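(* Planar Support admits a problem kernel with at most $2^{m}\cdot 2^{2^{2r(m\cdot(r^2+r+1))}\cdot 6^{2r^2}}$ vertices, which can be computed in linear time. Consequently, Planar Support is fixed-parameter tractable with respect to $m+r$.
   Context: Hypergraphs have no hyperedges of size at most one and no repeated hyperedges. A support for a hypergraph $\mathcal H=(\mathcal V,\mathcal E)$ is a graph on vertex set $\mathcal V$ in which every hyperedge induces a connected subgraph. A graph is $r$-outerplanar (has outerplanarity at most $r$) if it has a plane embedding whose layer decomposition (layer $L_1$ = vertices on the outer face, $L_i$ = vertices on the outer face after deleting $L_1,\dots,L_{i-1}$) has at most $r$ layers. Planar Support: given a hypergraph $\mathcal H$ with $n$ vertices and $m$ hyperedges and $r\in\mathbb N$, decide whether $\mathcal H$ has a planar support of outerplanarity at most $r$; the parameter is $m+r$. A problem kernel is a polynomial-time algorithm mapping an instance to an equivalent instance (yes iff yes) of the same problem whose size and parameter are bounded by a computable function of the original parameter. A parameterized problem is fixed-parameter tractable if it can be decided in $f(k)\cdot|I|^{O(1)}$ time for a computable $f$ of the parameter $k$. *)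

theory Defs
  imports "HOL-Analysis.Analysis" "Graph_Theory.Digraph_Component"
begin

section \<open>Random access machines\<close>

text \<open>
  Algorithms are programs of a random access machine with uniform cost measure. The machine has
  registers and a memory that is addressed through registers, both holding natural numbers;
  subtraction is truncated. There is deliberately no unit-cost multiplication, so polynomial time
  agrees with polynomial time on Turing machines. Control flow is structured; jumps are simulated
  with constant overhead by a single loop that dispatches on a program counter.
\<close>

type_synonym reg = nat

datatype com =
    Skip
  | Const reg nat
  | Add reg reg reg
  | Sub reg reg reg
  | Load reg reg   \<comment> \<open>\<open>Load d a\<close>: register \<open>d\<close> := memory cell whose address is in register \<open>a\<close>\<close>
  | Store reg reg  \<comment> \<open>\<open>Store a s\<close>: memory cell whose address is in register \<open>a\<close> := register \<open>s\<close>\<close>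
  | Seq com com
  | If_nz reg com com
  | While_nz reg com

type_synonym state = "(reg \<Rightarrow> nat) \<times> (nat \<Rightarrow> nat)"

text \<open>\<open>exec c s t s'\<close>: started in \<open>s\<close>, program \<open>c\<close> halts in \<open>s'\<close> after exactly \<open>t\<close> steps.\<close>

inductive exec :: "com \<Rightarrow> state \<Rightarrow> nat \<Rightarrow> state \<Rightarrow> bool" where
  Skip: "exec Skip s 1 s"
| Const: "exec (Const d k) (R, M) 1 (R(d := k), M)"
| Add: "exec (Add d a b) (R, M) 1 (R(d := R a + R b), M)"
| Sub: "exec (Sub d a b) (R, M) 1 (R(d := R a - R b), M)"
| Load: "exec (Load d a) (R, M) 1 (R(d := M (R a)), M)"
| Store: "exec (Store a b) (R, M) 1 (R, M(R a := R b))"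
| Seq: "exec c\<^sub>1 s t\<^sub>1 s' \<Longrightarrow> exec c\<^sub>2 s' t\<^sub>2 s'' \<Longrightarrow> exec (Seq c\<^sub>1 c\<^sub>2) s (t\<^sub>1 + t\<^sub>2) s''"
| If_true: "fst s a \<noteq> 0 \<Longrightarrow> exec c\<^sub>1 s t s' \<Longrightarrow> exec (If_nz a c\<^sub>1 c\<^sub>2) s (t + 1) s'"
| If_false: "fst s a = 0 \<Longrightarrow> exec c\<^sub>2 s t s' \<Longrightarrow> exec (If_nz a c\<^sub>1 c\<^sub>2) s (t + 1) s'"
| While_false: "fst s a = 0 \<Longrightarrow> exec (While_nz a c) s 1 s"
| While_true: "fst s a \<noteq> 0 \<Longrightarrow> exec c s t\<^sub>1 s' \<Longrightarrow> exec (While_nz a c) s' t\<^sub>2 s'' \<Longrightarrow>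
    exec (While_nz a c) s (t\<^sub>1 + t\<^sub>2 + 1) s''"

text \<open>Input and output words are stored in memory from address 1 on, their length at address 0.\<close>

definition initial_state :: "nat list \<Rightarrow> state" where
  "initial_state w =
    ((\<lambda>_. 0),
     (\<lambda>i. if i = 0 then length w else if i \<le> length w then w ! (i - 1) else 0))"

definition result_word :: "state \<Rightarrow> nat list" where
  "result_word s = map (\<lambda>i. snd s (Suc i)) [0..<snd s 0]"

definition run :: "com \<Rightarrow> nat list \<Rightarrow> nat \<Rightarrow> nat list \<Rightarrow> bool" where
  "run c w t w' \<longleftrightarrow> (\<exists>s. exec c (initial_state w) t s \<and> result_word s = w')"

definition computable :: "(nat \<Rightarrow> nat) \<Rightarrow> bool" where
  "computable f \<longleftrightarrow> (\<exists>c. \<forall>k. \<exists>t. run c [k] t [f k])"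

inductive_cases exec_SeqE: "exec (Seq c\<^sub>1 c\<^sub>2) s t s'"
inductive_cases exec_IfE: "exec (If_nz a c\<^sub>1 c\<^sub>2) s t s'"
inductive_cases exec_WhileE: "exec (While_nz a c) s t s'"

lemma exec_deterministic:
  "exec c s t s' \<Longrightarrow> exec c s u s'' \<Longrightarrow> t = u \<and> s' = s''"
proof (induction arbitrary: u s'' rule: exec.induct)
  case (Seq c\<^sub>1 s t\<^sub>1 s1 c\<^sub>2 t\<^sub>2 s2)
  from Seq.prems obtain u\<^sub>1 s1' u\<^sub>2
    where "u = u\<^sub>1 + u\<^sub>2" "exec c\<^sub>1 s u\<^sub>1 s1'" "exec c\<^sub>2 s1' u\<^sub>2 s''"
    by (rule exec_SeqE)
  with Seq.IH(1)[of u\<^sub>1 s1'] Seq.IH(2)[of u\<^sub>2 s''] show ?case by simp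
next
  case (If_true s a c\<^sub>1 t s1 c\<^sub>2)
  from If_true.prems obtain v where "u = Suc v" "exec c\<^sub>1 s v s''"
    by (rule exec_IfE) (use If_true.hyps(1) in simp_all)
  with If_true.IH[of v s''] show ?case by simp
next
  case (If_false s a c\<^sub>2 t s1 c\<^sub>1)
  from If_false.prems obtain v where "u = Suc v" "exec c\<^sub>2 s v s''"
    by (rule exec_IfE) (use If_false.hyps(1) in simp_all)
  with If_false.IH[of v s''] show ?case by simp
next
  case While_false
  from While_false.prems show ?case by (rule exec_WhileE) (use While_false.hyps in simp_all)
next
  case (While_true s a c t\<^sub>1 s1 t\<^sub>2 s2)
  from While_true.prems obtain u\<^sub>1 s1' u\<^sub>2
    where "u = u\<^sub>1 + u\<^sub>2 + 1" "exec c s u\<^sub>1 s1'" "exec (While_nz a c) s1' u\<^sub>2 s''"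
    by (rule exec_WhileE) (use While_true.hyps(1) in simp_all)
  with While_true.IH(1)[of u\<^sub>1 s1'] While_true.IH(2)[of u\<^sub>2 s''] show ?case by simp
qed (erule exec.cases; force)+


section \<open>Parameterized problems\<close>

text \<open>
  \<open>encodes Q w I\<close>: the word \<open>w\<close> is an admissible machine representation of the instance \<open>I\<close>;
  an instance may have several. Algorithms have to be correct on each of them.
\<close>

record 'i param_problem =
  instances :: "'i set"
  yes :: "'i \<Rightarrow> bool"
  encodes :: "nat list \<Rightarrow> 'i \<Rightarrow> bool"
  inst_size :: "'i \<Rightarrow> nat"
  param :: "'i \<Rightarrow> nat"

text \<open>
  A problem kernel computed within time \<open>T\<close>, as a function of the instance size, whose outputs
  additionally satisfy \<open>B\<close>. The general notion of a problem kernel is the case where \<open>T\<close> is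
  a polynomial and \<open>B\<close> is trivial.
\<close>

definition kernel_within ::
    "'i param_problem \<Rightarrow> (nat \<Rightarrow> nat) \<Rightarrow> ('i \<Rightarrow> 'i \<Rightarrow> bool) \<Rightarrow> bool" where
  "kernel_within Q T B \<longleftrightarrow>
    (\<exists>c g. computable g \<and>
      (\<forall>I \<in> instances Q. \<forall>w. encodes Q w I \<longrightarrow>
        (\<exists>t w' I'. run c w t w' \<and> t \<le> T (inst_size Q I) \<and>
          I' \<in> instances Q \<and> encodes Q w' I' \<and>
          (yes Q I' \<longleftrightarrow> yes Q I) \<and>
          inst_size Q I' \<le> g (param Q I) \<and> param Q I' \<le> g (param Q I) \<and>
          B I I')))"

definition fixed_parameter_tractable :: "'i param_problem \<Rightarrow> bool" where
  "fixed_parameter_tractable Q \<longleftrightarrow>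
    (\<exists>c f d. computable f \<and>
      (\<forall>I \<in> instances Q. \<forall>w. encodes Q w I \<longrightarrow>
        (\<exists>t. run c w t [if yes Q I then 1 else 0] \<and>
          t \<le> f (param Q I) * inst_size Q I ^ d)))"


section \<open>Plane embeddings and outerplanarity\<close>

text \<open>
  Finite simple undirected graphs are represented by \<open>pair_graph\<close>: an edge is a pair of opposite
  arcs. In an embedding, both are drawn by the same curve, traversed in opposite directions.
\<close>

definition plane_embedding ::
    "'a pair_pre_digraph \<Rightarrow> ('a \<Rightarrow> complex) \<Rightarrow> ('a \<times> 'a \<Rightarrow> real \<Rightarrow> complex) \<Rightarrow> bool" where
  "plane_embedding G p \<gamma> \<longleftrightarrow>
    inj_on p (pverts G) \<and>
    (\<forall>(u, v) \<in> parcs G.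
      arc (\<gamma> (u, v)) \<and> pathstart (\<gamma> (u, v)) = p u \<and> pathfinish (\<gamma> (u, v)) = p v \<and>
      \<gamma> (v, u) = reversepath (\<gamma> (u, v)) \<and>
      path_image (\<gamma> (u, v)) \<inter> p ` pverts G = {p u, p v}) \<and>
    (\<forall>(u, v) \<in> parcs G. \<forall>(x, y) \<in> parcs G. {u, v} \<noteq> {x, y} \<longrightarrow>
      path_image (\<gamma> (u, v)) \<inter> path_image (\<gamma> (x, y)) = p ` ({u, v} \<inter> {x, y}))"

definition drawing ::
    "('a, 'a \<times> 'a) pre_digraph \<Rightarrow> ('a \<Rightarrow> complex) \<Rightarrow> ('a \<times> 'a \<Rightarrow> real \<Rightarrow> complex) \<Rightarrow> complex set" where
  "drawing H p \<gamma> = p ` verts H \<union> (\<Union>a \<in> arcs H. path_image (\<gamma> a))"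

text \<open>
  The drawing of a finite graph is compact, so the outer face, the unbounded component of its
  complement, is the set \<open>outside\<close>.
\<close>

definition outer_vertices ::
    "('a, 'a \<times> 'a) pre_digraph \<Rightarrow> ('a \<Rightarrow> complex) \<Rightarrow> ('a \<times> 'a \<Rightarrow> real \<Rightarrow> complex) \<Rightarrow> 'a set" where
  "outer_vertices H p \<gamma> = {v \<in> verts H. p v \<in> frontier (outside (drawing H p \<gamma>))}"

fun remaining ::
    "'a pair_pre_digraph \<Rightarrow> ('a \<Rightarrow> complex) \<Rightarrow> ('a \<times> 'a \<Rightarrow> real \<Rightarrow> complex) \<Rightarrow> nat \<Rightarrow> 'a set" where
  "remaining G p \<gamma> 0 = pverts G"
| "remaining G p \<gamma> (Suc i) =
    remaining G p \<gamma> i - outer_vertices (with_proj G \<restriction> remaining G p \<gamma> i) p \<gamma>"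

definition layer ::
    "'a pair_pre_digraph \<Rightarrow> ('a \<Rightarrow> complex) \<Rightarrow> ('a \<times> 'a \<Rightarrow> real \<Rightarrow> complex) \<Rightarrow> nat \<Rightarrow> 'a set" where
  "layer G p \<gamma> i = outer_vertices (with_proj G \<restriction> remaining G p \<gamma> (i - 1)) p \<gamma>"

definition outerplanar :: "nat \<Rightarrow> 'a pair_pre_digraph \<Rightarrow> bool" where
  "outerplanar r G \<longleftrightarrow>
    (\<exists>p \<gamma>. plane_embedding G p \<gamma> \<and> pverts G = (\<Union>i \<in> {1..r}. layer G p \<gamma> i))"


section \<open>Planar Support\<close>

definition hypergraph :: "'a set \<Rightarrow> 'a set set \<Rightarrow> bool" where
  "hypergraph V E \<longleftrightarrow> finite V \<and> (\<forall>e \<in> E. e \<subseteq> V \<and> card e \<ge> 2)"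

definition support :: "'a pair_pre_digraph \<Rightarrow> 'a set \<Rightarrow> 'a set set \<Rightarrow> bool" where
  "support G V E \<longleftrightarrow>
    pair_graph G \<and> pverts G = V \<and>
    (\<forall>e \<in> E. Digraph_Component.connected (with_proj G \<restriction> e))"

text \<open>
  An instance consists of vertices \<open>{0, \<dots>, n - 1}\<close>, hyperedges and \<open>r\<close>. It is represented by
  \<open>n\<close>, \<open>m\<close>, \<open>r\<close>, followed by the hyperedges in any order, each as its size followed
  by its elements in any order.
\<close>

definition encodes_hypergraph :: "nat list \<Rightarrow> nat set \<times> nat set set \<times> nat \<Rightarrow> bool" where
  "encodes_hypergraph w = (\<lambda>(V, E, r).
    \<exists>es. distinct (map set es) \<and> (\<forall>e \<in> set es. distinct e) \<and> set ` set es = E \<and>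
      w = [card V, length es, r] @ concat (map (\<lambda>e. length e # e) es))"

definition Planar_Support :: "(nat set \<times> nat set set \<times> nat) param_problem" where
  "Planar_Support = \<lparr>
    instances = {(V, E, r). hypergraph V E \<and> (\<exists>n. V = {..<n})},
    yes = (\<lambda>(V, E, r). \<exists>G. support G V E \<and> outerplanar r G),
    encodes = encodes_hypergraph,
    inst_size = (\<lambda>(V, E, r). card V + (\<Sum>e \<in> E. card e) + 1),
    param = (\<lambda>(V, E, r). card E + r) \<rparr>"

end

theory Submission
  imports Defs
begin

text \<open>
  An \<open>r\<close>-outerplanar graph is the same as a plane rooted forest of depth at most \<open>r\<close> (every vertex is
  put below a vertex of an earlier layer on a common face) together with noncrossing chords between positions
  of its Euler tour. Such a structure is written as a term: \<open>Push\<close> and \<open>Pop\<close> walk along the tour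
  with the current root path as stack, and \<open>Arc t u\<close> draws a chord over the part of the tour described
  by \<open>t\<close>. An embedding is turned into a term by refining the plane into a fine labelled grid, whose tree
  of blocks gives the nesting of the chords; a term is drawn with parabolas.

  On a path of nested subterms, a subterm can be replaced by a deeper one that has the same interface,
  that is, the same connections between its at most \<open>2 * r\<close> visible vertices and the same classes of inner
  vertices, where the class of a vertex is the set of hyperedges containing it. So some support uses
  boundedly many vertices of each class, and further vertices of a class are attached as twins.
  Hence it is correct to keep a bounded number of vertices of each of the \<open>2 ^ m\<close> classes. The kernel is
  then solved by searching all coded tours.
\<close>

text \<open>All topology is confined to compactness: finitely many disjoint compact connected sets
  occupy disjoint connected sets of cells in every sufficiently fine grid. Inside the grid planarity
  is a matter of counting, and no Jordan curve theorem is invoked. A spanning tree has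
  \<open>N * N + 2 * N\<close> of the \<open>2 * N * (N + 1)\<close> edges, and a tree on the
  \<open>N * N\<close> blocks, hung from the outer face, crosses \<open>N * N\<close> others;
  together these are all edges, so running around the blocks is an Euler tour of the spanning tree.

  The constant 5 in the threshold counts what is compared along nested subterms: an interface
  consists of \<open>m + 1\<close> relations on \<open>2 * r\<close> slots, or
  \<open>4 * r\<^sup>2 * (m + 1)\<close> bits, and the number of inner classes takes at most
  \<open>m + 1\<close> more. The number can stand for the set of these classes because the set only
  shrinks inwards; recording the set would cost another exponential.

  The threshold is doubly exponential but has to be computed in linear time without multiplication.
  As no class exceeds \<open>n\<close> vertices, it may be cut off there.\<close>

datatype 'v tm = Done | Push 'v "'v tm" | Pop "'v tm" | Arc "'v tm" "'v tm"

fun out :: "'v list \<Rightarrow> 'v tm \<Rightarrow> 'v list" where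
  "out P Done = P"
| "out P (Push v t) = out (v # P) t"
| "out P (Pop t) = out (tl P) t"
| "out P (Arc t u) = out (out P t) u"

fun ok :: "nat \<Rightarrow> 'v list \<Rightarrow> 'v tm \<Rightarrow> bool" where
  "ok r P Done \<longleftrightarrow> True"
| "ok r P (Push v t) \<longleftrightarrow> length P < r \<and> ok r (v # P) t"
| "ok r P (Pop t) \<longleftrightarrow> P \<noteq> [] \<and> ok r (tl P) t"
| "ok r P (Arc t u) \<longleftrightarrow> ok r P t \<and> ok r (out P t) u"

text \<open>A chord end at an empty stack belongs to no vertex, and such a chord yields nothing.
  Both ends may have the same top, which gives a loop; loops do not affect connectedness and are
  discarded when a graph is built.\<close>

definition link :: "'v list \<Rightarrow> 'v list \<Rightarrow> ('v \<times> 'v) set" where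
  "link P Q = (if P = [] \<or> Q = [] then {} else {(hd P, hd Q), (hd Q, hd P)})"

fun links :: "'v list \<Rightarrow> 'v tm \<Rightarrow> ('v \<times> 'v) set" where
  "links P Done = {}"
| "links P (Push v t) = links (v # P) t"
| "links P (Pop t) = links (tl P) t"
| "links P (Arc t u) = link P (out P t) \<union> links P t \<union> links (out P t) u"

fun pushed :: "'v tm \<Rightarrow> 'v list" where
  "pushed Done = []"
| "pushed (Push v t) = v # pushed t"
| "pushed (Pop t) = pushed t"
| "pushed (Arc t u) = pushed t @ pushed u"

fun height :: "'v tm \<Rightarrow> nat" where
  "height Done = 0"
| "height (Push v t) = Suc (height t)"
| "height (Pop t) = Suc (height t)"
| "height (Arc t u) = Suc (max (height t) (height u))"

fun nodes :: "'v tm \<Rightarrow> nat" where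
  "nodes Done = 0"
| "nodes (Push v t) = Suc (nodes t)"
| "nodes (Pop t) = Suc (nodes t)"
| "nodes (Arc t u) = Suc (nodes t + nodes u)"

lemma link_sym: "sym (link P Q)"
  by (auto simp: link_def sym_def)

lemma links_sym: "sym (links P t)"
proof (induction t arbitrary: P)
  case (Arc t u)
  then show ?case using link_sym by (auto intro!: sym_Un)
qed (auto simp: sym_def)

lemma set_tl_subset: "set (tl P) \<subseteq> set P"
  by (cases P) auto

lemma set_out: "set (out P t) \<subseteq> set P \<union> set (pushed t)"
proof (induction t arbitrary: P)
  case (Push x1 t) then show ?case by fastforce
next
  case (Pop t) then show ?case using set_tl_subset[of P] by fastforce
next
  case (Arc t1 t2) then show ?case by fastforce
qed auto

lemma link_subset: "link P Q \<subseteq> (set P \<union> set Q) \<times> (set P \<union> set Q)"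
  by (auto simp: link_def)

lemma links_subset: "links P t \<subseteq> (set P \<union> set (pushed t)) \<times> (set P \<union> set (pushed t))"
proof (induction t arbitrary: P)
  case (Push x1 t) from Push[of "x1 # P"] show ?case by auto
next
  case (Pop t) then show ?case using set_tl_subset[of P] Pop[of "tl P"] by auto
next
  case (Arc t u)
  have "link P (out P t) \<subseteq> (set P \<union> set (pushed t)) \<times> (set P \<union> set (pushed t))"
    using link_subset[of P "out P t"] set_out[of P t] by blast
  moreover have "links (out P t) u \<subseteq> (set P \<union> set (pushed t) \<union> set (pushed u)) \<times> (set P \<union> set (pushed t) \<union> set (pushed u))"
    using Arc(2)[of "out P t"] set_out[of P t] by blast
  ultimately show ?case using Arc(1)[of P] by auto
qed auto

lemma length_out: "ok r P t \<Longrightarrow> length P \<le> r \<Longrightarrow> length (out P t) \<le> r"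
proof (induction t arbitrary: P)
  case (Push v t) from Push.IH[of "v # P"] Push.prems show ?case by simp
next
  case (Pop t) from Pop.IH[of "tl P"] Pop.prems show ?case by simp
next
  case (Arc t u)
  then show ?case by simp
qed auto

subsection \<open>Renaming\<close>

lemma out_map: "out (map f P) (map_tm f t) = map f (out P t)"
  by (induction t arbitrary: P) (auto simp flip: map_tl list.map(2))

lemma ok_map: "ok r (map f P) (map_tm f t) = ok r P t"
  by (induction t arbitrary: P) (auto simp: out_map simp flip: map_tl list.map(2))

lemma pushed_map: "pushed (map_tm f t) = map f (pushed t)"
  by (induction t) auto

lemma nodes_map: "nodes (map_tm f t) = nodes t"
  by (induction t) auto

lemma link_map: "link (map f P) (map f Q) = map_prod f f ` link P Q"
  by (auto simp: link_def hd_map)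

lemma links_map: "links (map f P) (map_tm f t) = map_prod f f ` links P t"
  by (induction t arbitrary: P) (auto simp: out_map link_map image_Un simp flip: map_tl list.map(2))

subsection \<open>Contexts\<close>

datatype 'v frame = FPush 'v | FPop | FArcL "'v tm" | FArcR "'v tm"

fun plug :: "'v frame list \<Rightarrow> 'v tm \<Rightarrow> 'v tm" where
  "plug [] s = s"
| "plug (FPush v # fs) s = Push v (plug fs s)"
| "plug (FPop # fs) s = Pop (plug fs s)"
| "plug (FArcL u # fs) s = Arc (plug fs s) u"
| "plug (FArcR t # fs) s = Arc t (plug fs s)"

fun hole_in :: "'v list \<Rightarrow> 'v frame list \<Rightarrow> 'v list" where
  "hole_in P [] = P"
| "hole_in P (FPush v # fs) = hole_in (v # P) fs"
| "hole_in P (FPop # fs) = hole_in (tl P) fs"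
| "hole_in P (FArcL u # fs) = hole_in P fs"
| "hole_in P (FArcR t # fs) = hole_in (out P t) fs"

fun hole_out :: "'v frame list \<Rightarrow> 'v list \<Rightarrow> 'v list" where
  "hole_out [] Q = Q"
| "hole_out (FPush v # fs) Q = hole_out fs Q"
| "hole_out (FPop # fs) Q = hole_out fs Q"
| "hole_out (FArcL u # fs) Q = out (hole_out fs Q) u"
| "hole_out (FArcR t # fs) Q = hole_out fs Q"

text \<open>A context sees the term in its hole only through the stack \<open>Q\<close> with which
  that term ends. This is what makes an exchange of the term possible.\<close>

fun ctx_links :: "'v list \<Rightarrow> 'v frame list \<Rightarrow> 'v list \<Rightarrow> ('v \<times> 'v) set" where
  "ctx_links P [] Q = {}"
| "ctx_links P (FPush v # fs) Q = ctx_links (v # P) fs Q"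
| "ctx_links P (FPop # fs) Q = ctx_links (tl P) fs Q"
| "ctx_links P (FArcL u # fs) Q =
     link P (hole_out fs Q) \<union> ctx_links P fs Q \<union> links (hole_out fs Q) u"
| "ctx_links P (FArcR t # fs) Q = link P (out P t) \<union> links P t \<union> ctx_links (out P t) fs Q"

fun ctx_ok :: "nat \<Rightarrow> 'v list \<Rightarrow> 'v frame list \<Rightarrow> 'v list \<Rightarrow> bool" where
  "ctx_ok r P [] Q = True"
| "ctx_ok r P (FPush v # fs) Q \<longleftrightarrow> length P < r \<and> ctx_ok r (v # P) fs Q"
| "ctx_ok r P (FPop # fs) Q \<longleftrightarrow> P \<noteq> [] \<and> ctx_ok r (tl P) fs Q"
| "ctx_ok r P (FArcL u # fs) Q \<longleftrightarrow> ctx_ok r P fs Q \<and> ok r (hole_out fs Q) u"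
| "ctx_ok r P (FArcR t # fs) Q \<longleftrightarrow> ok r P t \<and> ctx_ok r (out P t) fs Q"

fun ctx_pushed :: "'v frame list \<Rightarrow> 'v list" where
  "ctx_pushed [] = []"
| "ctx_pushed (FPush v # fs) = v # ctx_pushed fs"
| "ctx_pushed (FPop # fs) = ctx_pushed fs"
| "ctx_pushed (FArcL u # fs) = pushed u @ ctx_pushed fs"
| "ctx_pushed (FArcR t # fs) = pushed t @ ctx_pushed fs"

lemma out_plug: "out P (plug fs s) = hole_out fs (out (hole_in P fs) s)"
  by (induction P fs rule: hole_in.induct) auto

lemma links_plug: "links P (plug fs s) = ctx_links P fs (out (hole_in P fs) s) \<union> links (hole_in P fs) s"
  by (induction P fs rule: hole_in.induct) (auto simp: out_plug)

lemma ok_plug: "ok r P (plug fs s) \<longleftrightarrow> ctx_ok r P fs (out (hole_in P fs) s) \<and> ok r (hole_in P fs) s"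
  by (induction P fs rule: hole_in.induct) (auto simp: out_plug)

lemma pushed_plug: "mset (pushed (plug fs s)) = mset (ctx_pushed fs) + mset (pushed s)"
  by (induction fs rule: ctx_pushed.induct) auto

lemma nodes_plug: "nodes (plug fs s) \<ge> length fs + nodes s"
  by (induction fs rule: ctx_pushed.induct) auto

lemma nodes_plug_less: "nodes s < nodes s' \<Longrightarrow> nodes (plug fs s) < nodes (plug fs s')"
  by (induction fs rule: ctx_pushed.induct) auto

lemma plug_append: "plug (fs @ gs) s = plug fs (plug gs s)"
  by (induction fs rule: ctx_pushed.induct) auto

lemma hole_in_append: "hole_in P (fs @ gs) = hole_in (hole_in P fs) gs"
  by (induction P fs rule: hole_in.induct) auto

lemma set_hole_in: "set (hole_in P fs) \<subseteq> set P \<union> set (ctx_pushed fs)"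
proof (induction P fs rule: hole_in.induct)
  case (3 P fs) then show ?case using set_tl_subset[of P] by fastforce
next
  case (5 P t fs) then show ?case using set_out[of P t] by fastforce
qed auto

lemma set_hole_out: "set (hole_out fs Q) \<subseteq> set Q \<union> set (ctx_pushed fs)"
proof (induction fs Q rule: hole_out.induct)
  case (4 u fs Q) then show ?case using set_out[of "hole_out fs Q" u] by fastforce
qed auto

lemma ctx_links_subset:
  "ctx_links P fs Q \<subseteq> (set P \<union> set (ctx_pushed fs) \<union> set Q) \<times> (set P \<union> set (ctx_pushed fs) \<union> set Q)"
proof (induction P fs Q rule: ctx_links.induct)
  case (2 P v fs Q) then show ?case by fastforce
next
  case (3 P fs Q) then show ?case using set_tl_subset[of P] by fastforce
next
  case (4 P u fs Q)
  have "link P (hole_out fs Q) \<subseteq> (set P \<union> set (ctx_pushed fs) \<union> set Q) \<times> (set P \<union> set (ctx_pushed fs) \<union> set Q)"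
    using link_subset[of P "hole_out fs Q"] set_hole_out[of fs Q] by blast
  moreover have "links (hole_out fs Q) u \<subseteq> (set (pushed u) \<union> set (ctx_pushed fs) \<union> set Q) \<times> (set (pushed u) \<union> set (ctx_pushed fs) \<union> set Q)"
    using links_subset[of "hole_out fs Q" u] set_hole_out[of fs Q] by blast
  ultimately show ?case using 4 by auto
next
  case (5 P t fs Q)
  have "link P (out P t) \<subseteq> (set P \<union> set (pushed t)) \<times> (set P \<union> set (pushed t))"
    using link_subset[of P "out P t"] set_out[of P t] by blast
  moreover have "ctx_links (out P t) fs Q \<subseteq> (set P \<union> set (pushed t) \<union> set (ctx_pushed fs) \<union> set Q) \<times> (set P \<union> set (pushed t) \<union> set (ctx_pushed fs) \<union> set Q)"
    using 5 set_out[of P t] by blast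
  ultimately show ?case using links_subset[of P t] by auto
qed auto

lemma ctx_ok_length: "ctx_ok r P fs Q \<Longrightarrow> length P \<le> r \<Longrightarrow> length (hole_in P fs) \<le> r"
proof (induction P fs rule: hole_in.induct)
  case (5 P t fs) then show ?case using length_out by auto
qed auto

text \<open>At each \<open>Arc\<close> the path descends into the higher part. Subterms will be
  compared along this path.\<close>

lemma plug_height: "\<exists>fs s. t = plug fs s \<and> length fs = height t"
proof (induction t)
  case Done then show ?case by (intro exI[of _ "[]"]) auto
next
  case (Push v t) then obtain fs s where "t = plug fs s" "length fs = height t" by auto
  then show ?case by (intro exI[of _ "FPush v # fs"] exI[of _ s]) simp
next
  case (Pop t) then obtain fs s where "t = plug fs s" "length fs = height t" by auto
  then show ?case by (intro exI[of _ "FPop # fs"] exI[of _ s]) simp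
next
  case (Arc t u)
  then obtain fs s gs s' where *: "t = plug fs s" "length fs = height t" "u = plug gs s'" "length gs = height u" by auto
  show ?case
  proof (cases "height t \<ge> height u")
    case True
    with * show ?thesis by (intro exI[of _ "FArcL u # fs"] exI[of _ s]) simp
  next
    case False
    with * show ?thesis by (intro exI[of _ "FArcR t # gs"] exI[of _ s']) simp
  qed
qed

text \<open>Only \<open>Arc\<close> branches, so few vertices fit under a bounded height.\<close>

lemma pushed_height: "length (pushed t) < 2 ^ height t"
proof (induction t)
  case (Push v t)
  have "(1::nat) \<le> 2 ^ height t" by simp
  with Push show ?case by simp
next
  case (Arc t u)
  have "(2::nat) ^ height t \<le> 2 ^ max (height t) (height u)" "(2::nat) ^ height u \<le> 2 ^ max (height t) (height u)"
    by (auto intro: power_increasing)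
  with Arc show ?case by (simp del: power_increasing_iff)
qed auto

text \<open>The vertices that are pushed and popped again while the term runs: no other part of a term
  with distinct pushes can mention them.\<close>

definition inner_verts :: "'v list \<Rightarrow> 'v tm \<Rightarrow> 'v set" where
  "inner_verts P t = set (pushed t) - set (out P t)"

lemma distinct_pushed_plug:
  "distinct (pushed (plug fs s)) \<longleftrightarrow> distinct (ctx_pushed fs @ pushed s)"
  by (rule mset_eq_imp_distinct_iff) (simp add: pushed_plug)

lemma set_pushed_plug: "set (pushed (plug fs s)) = set (ctx_pushed fs) \<union> set (pushed s)"
  using mset_eq_setD[of "pushed (plug fs s)" "ctx_pushed fs @ pushed s"] by (simp add: pushed_plug)

lemma inner_verts_plug_subset:
  assumes "distinct (pushed (plug fs s))"
  shows "inner_verts (hole_in P fs) s \<subseteq> inner_verts P (plug fs s)"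
proof -
  have "set (ctx_pushed fs) \<inter> set (pushed s) = {}" using assms by (simp add: distinct_pushed_plug)
  then show ?thesis
    unfolding inner_verts_def out_plug using set_hole_out[of fs "out (hole_in P fs) s"] set_pushed_plug[of fs s]
    by blast
qed

subsection \<open>Realizations\<close>

definition members :: "('v \<Rightarrow> nat set) \<Rightarrow> nat \<Rightarrow> 'v set" where
  "members cl j = {x. j \<in> cl x}"

text \<open>Reflexive even outside \<open>e\<close>; it is read as connectedness between members of
  \<open>e\<close> only.\<close>

definition joined :: "('v \<times> 'v) set \<Rightarrow> 'v set \<Rightarrow> ('v \<times> 'v) set" where
  "joined F e = rtrancl (F \<inter> e \<times> e)"

text \<open>\<open>cl v\<close> is the set of (indices of) hyperedges that contain \<open>v\<close>.\<close>

definition realizes :: "nat \<Rightarrow> nat \<Rightarrow> ('v \<Rightarrow> nat set) \<Rightarrow> 'v set \<Rightarrow> 'v tm \<Rightarrow> bool" where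
  "realizes r m cl V t \<longleftrightarrow>
     ok r [] t \<and> out [] t = [] \<and> distinct (pushed t) \<and> set (pushed t) = V \<and>
     (\<forall>j<m. \<forall>x\<in>V \<inter> members cl j. \<forall>y\<in>V \<inter> members cl j. (x, y) \<in> joined (links [] t) (members cl j))"

lemma joined_mono: "F \<subseteq> F' \<Longrightarrow> joined F e \<subseteq> joined F' e"
  unfolding joined_def by (rule rtrancl_mono) auto

lemma joined_trans: "(x, y) \<in> joined F e \<Longrightarrow> (y, z) \<in> joined F e \<Longrightarrow> (x, z) \<in> joined F e"
  unfolding joined_def by (rule rtrancl_trans)

lemma joined_refl [simp]: "(x, x) \<in> joined F e"
  by (simp add: joined_def)

lemma joined_step: "(x, y) \<in> F \<Longrightarrow> x \<in> e \<Longrightarrow> y \<in> e \<Longrightarrow> (x, y) \<in> joined F e"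
  unfolding joined_def by auto

lemma joined_sym: "sym F \<Longrightarrow> (x, y) \<in> joined F e \<Longrightarrow> (y, x) \<in> joined F e"
  unfolding joined_def using sym_rtrancl[of "F \<inter> e \<times> e"] by (auto simp: sym_def)

lemma joined_induct [consumes 1, case_names refl step]:
  assumes "(x, y) \<in> joined F e" "Q x"
    "\<And>y z. (x, y) \<in> joined F e \<Longrightarrow> (y, z) \<in> F \<Longrightarrow> y \<in> e \<Longrightarrow> z \<in> e \<Longrightarrow> Q y \<Longrightarrow> Q z"
  shows "Q y"
  using assms(1)[unfolded joined_def]
  by (induction rule: rtrancl_induct) (use assms(2,3) in \<open>auto simp: joined_def\<close>)

lemma joined_map:
  assumes "(x, y) \<in> joined F e" "F \<subseteq> D \<times> D" "\<And>z. z \<in> D \<Longrightarrow> z \<in> e \<Longrightarrow> f z \<in> e'"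
  shows "(f x, f y) \<in> joined (map_prod f f ` F) e'"
  using assms(1)
proof (induction rule: joined_induct)
  case (step y z)
  then have "(f y, f z) \<in> map_prod f f ` F" "y \<in> D" "z \<in> D" using assms(2) by force+
  with step assms(3) show ?case by (meson joined_step joined_trans)
qed simp

subsection \<open>Pumping\<close>

text \<open>Here \<open>A\<close> stands for the links of the surrounding context, \<open>B1\<close>
  and \<open>B2\<close> for those of the outer and the inner subterm, \<open>S1\<close> and
  \<open>S2\<close> for their visible vertices, \<open>I1\<close> and \<open>I2\<close> for their
  inner ones. An inner vertex has links inside its subterm only. So an old path can be cut where it
  enters and leaves \<open>B1\<close>; each stretch in between runs from one visible vertex to
  another and is replaced by one inside the renamed \<open>B2\<close>.\<close>

lemma exchange_connected:
  fixes A B1 A2 B2 :: "('v \<times> 'v) set" and f :: "'v \<Rightarrow> 'v"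
  defines "N \<equiv> A \<union> map_prod f f ` B2"
  assumes A: "A \<subseteq> (- I1) \<times> (- I1)" "sym A" and B1: "B1 \<subseteq> (S1 \<union> I1) \<times> (S1 \<union> I1)"
    and A2: "A2 \<subseteq> (- I2) \<times> (- I2)" and B2: "B2 \<subseteq> (S2 \<union> I2) \<times> (S2 \<union> I2)" "sym B2"
    and eq: "A \<union> B1 = A2 \<union> B2"
    and f: "\<And>x. x \<in> S2 \<Longrightarrow> f x \<in> S1" "\<And>x. x \<in> I2 \<Longrightarrow> f x = x" "\<And>x. x \<in> S2 \<Longrightarrow> x \<in> e \<Longrightarrow> f x \<in> e"
    and S: "S1 \<inter> I1 = {}" "S2 \<inter> I2 = {}" "S1 \<subseteq> V" "I2 \<subseteq> I1" "I1 \<subseteq> V"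
    and slots: "\<And>x y. x \<in> S1 \<inter> e \<Longrightarrow> y \<in> S1 \<inter> e \<Longrightarrow> (x, y) \<in> joined B1 e \<Longrightarrow>
       (x, y) \<in> joined (map_prod f f ` B2) e"
    and old: "\<And>x y. x \<in> V \<inter> e \<Longrightarrow> y \<in> V \<inter> e \<Longrightarrow> (x, y) \<in> joined (A \<union> B1) e"
    and xy: "x \<in> (V - I1 \<union> I2) \<inter> e" "y \<in> (V - I1 \<union> I2) \<inter> e"
  shows "(x, y) \<in> joined N e"
proof -
  have "sym (map_prod f f ` B2)"
  proof (rule symI)
    fix a b assume "(a, b) \<in> map_prod f f ` B2"
    then obtain x y where "(x, y) \<in> B2" "a = f x" "b = f y" by auto
    then show "(b, a) \<in> map_prod f f ` B2" using symD[OF B2(2)] by (metis map_prod_imageI)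
  qed
  then have sN: "sym N" unfolding N_def using A(2) by (rule sym_Un[rotated])
  note nsym = joined_sym[OF sN]
  have outer: "(x, z) \<in> joined N e" if "x \<in> V \<inter> e" "z \<in> V \<inter> e" "x \<notin> I1" "z \<notin> I1" for x z
  proof -
    \<comment> \<open>While the old path is inside the subterm, the invariant remembers the visible
      vertex \<open>s\<close> through which it came in.\<close>
    have "(if z \<in> I1 then \<exists>s\<in>S1 \<inter> e. (x, s) \<in> joined N e \<and> (s, z) \<in> joined B1 e else (x, z) \<in> joined N e)"
      using old[OF that(1,2)]
    proof (induction rule: joined_induct)
      case refl then show ?case using that by simp
    next
      case (step y z)
      show ?case
      proof (cases "y \<in> I1")
        case True
        then obtain s where s: "s \<in> S1 \<inter> e" "(x, s) \<in> joined N e" "(s, y) \<in> joined B1 e" using step by auto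
        have yz: "(y, z) \<in> B1" using True step A by auto
        have sz: "(s, z) \<in> joined B1 e" using joined_trans[OF s(3) joined_step[OF yz step(3,4)]] .
        show ?thesis
        proof (cases "z \<in> I1")
          case True then show ?thesis using s sz by auto
        next
          case False
          then have "z \<in> S1 \<inter> e" using yz B1 step by auto
          then have "(s, z) \<in> joined N e" using slots[OF s(1) _ sz] joined_mono[of "map_prod f f ` B2" N e] N_def by auto
          then show ?thesis using False joined_trans[OF s(2)] by simp
        qed
      next
        case False
        then have xy: "(x, y) \<in> joined N e" using step by simp
        show ?thesis
        proof (cases "(y, z) \<in> A")
          case True
          then have "(y, z) \<in> joined N e" using step by (intro joined_step) (auto simp: N_def)
          moreover have "z \<notin> I1" using True A by auto
          ultimately show ?thesis using joined_trans[OF xy] by simp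
        next
          case F: False
          then have yz: "(y, z) \<in> B1" using step by auto
          then have y: "y \<in> S1 \<inter> e" using False B1 step by auto
          have yzw: "(y, z) \<in> joined B1 e" using joined_step[OF yz step(3,4)] .
          show ?thesis
          proof (cases "z \<in> I1")
            case True then show ?thesis using y xy yzw by auto
          next
            case False
            then have "z \<in> S1 \<inter> e" using yz B1 step by auto
            then have "(y, z) \<in> joined N e" using slots[OF y _ yzw] joined_mono[of "map_prod f f ` B2" N e] N_def by auto
            then show ?thesis using False joined_trans[OF xy] by simp
          qed
        qed
      qed
    qed
    then show ?thesis using that by simp
  qed
  have inner: "(v, z) \<in> joined N e \<or> (\<exists>s\<in>S1 \<inter> e. (v, s) \<in> joined N e)"
    if v: "v \<in> I2 \<inter> e" and z: "z \<in> V \<inter> e" for v z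
  proof -
    have img: "(v, f w) \<in> joined N e" if "(v, w) \<in> joined B2 e" for w
    proof -
      have "(f v, f w) \<in> joined (map_prod f f ` B2) e"
        by (rule joined_map[OF that B2(1)]) (use f in auto)
      then show ?thesis using joined_mono[of "map_prod f f ` B2" N e] N_def f(2) v by auto
    qed
    have "(v, z) \<in> joined (A \<union> B1) e" using old v z S by auto
    \<comment> \<open>From an inner vertex of the inner subterm an old path can only follow
      \<open>B2\<close> until it meets a visible vertex, unless it ends before that.\<close>
    then have "z \<in> I2 \<and> (v, z) \<in> joined B2 e \<or> (\<exists>s\<in>S2 \<inter> e. (v, s) \<in> joined B2 e)"
    proof (induction rule: joined_induct)
      case refl then show ?case using v by simp
    next
      case (step y z)
      show ?case
      proof (cases "\<exists>s\<in>S2 \<inter> e. (v, s) \<in> joined B2 e")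
        case False
        then have y: "y \<in> I2" "(v, y) \<in> joined B2 e" using step by auto
        then have yz: "(y, z) \<in> B2" using step eq A2 by auto
        have vz: "(v, z) \<in> joined B2 e" by (rule joined_trans[OF y(2) joined_step[OF yz step(3,4)]])
        have "z \<in> S2 \<union> I2" using yz B2 by auto
        then show ?thesis using vz step False by auto
      qed auto
    qed
    then show ?thesis
    proof
      assume "z \<in> I2 \<and> (v, z) \<in> joined B2 e"
      then show ?thesis using img[of z] f(2)[of z] by simp
    next
      assume "\<exists>s\<in>S2 \<inter> e. (v, s) \<in> joined B2 e"
      then obtain s where "s \<in> S2 \<inter> e" "(v, s) \<in> joined B2 e" by auto
      then show ?thesis using img[of s] f by auto
    qed
  qed
  have V: "x \<in> V \<inter> e" "y \<in> V \<inter> e" using xy S by auto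
  \<comment> \<open>Every surviving vertex is connected to the other endpoint or to some vertex
    outside \<open>I1\<close>; between vertices of the latter kind \<open>outer\<close>
    applies.\<close>
  have rep: "(x, y) \<in> joined N e \<or> (\<exists>s. s \<in> V \<inter> e \<and> s \<notin> I1 \<and> (x, s) \<in> joined N e)"
    if "x \<in> (V - I1 \<union> I2) \<inter> e" "y \<in> V \<inter> e" for x y
  proof (cases "x \<in> I2")
    case True
    then show ?thesis using inner[of x y] that S(1,3) by (metis IntD1 IntD2 IntI disjoint_iff subsetD)
  next
    case False
    then show ?thesis using that by (intro disjI2 exI[of _ x]) auto
  qed
  show ?thesis
  proof (cases "(x, y) \<in> joined N e")
    case False
    then have nyx: "(y, x) \<notin> joined N e" using nsym by blast
    obtain s where s: "s \<in> V \<inter> e" "s \<notin> I1" "(x, s) \<in> joined N e" using rep[OF xy(1) V(2)] False by auto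
    obtain s' where s': "s' \<in> V \<inter> e" "s' \<notin> I1" "(y, s') \<in> joined N e" using rep[OF xy(2) V(1)] nyx by auto
    have "(s, s') \<in> joined N e" using outer s s' by auto
    then show ?thesis using joined_trans[OF joined_trans[OF s(3)] nsym[OF s'(3)]] by simp
  qed
qed

definition slot :: "nat \<Rightarrow> 'v list \<Rightarrow> 'v list \<Rightarrow> nat \<Rightarrow> 'v option" where
  "slot r P Q k =
    (if k < r then (if k < length P then Some (rev P ! k) else None)
     else (if k - r < length Q then Some (rev Q ! (k - r)) else None))"

text \<open>The interface of a subterm running from \<open>P\<close> to \<open>Q\<close>: which slots hold the same
  vertex (index \<open>m\<close>) and which slots are connected inside hyperedge \<open>j < m\<close> by links
  of the subterm.\<close>

definition interface ::
    "nat \<Rightarrow> nat \<Rightarrow> ('v \<Rightarrow> nat set) \<Rightarrow> 'v list \<Rightarrow> 'v tm \<Rightarrow> nat \<Rightarrow> (nat \<times> nat) set" where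
  "interface r m cl P t = (\<lambda>j\<in>{..m}. {(k, l). k < 2 * r \<and> l < 2 * r \<and>
     (\<exists>x y. slot r P (out P t) k = Some x \<and> slot r P (out P t) l = Some y \<and>
        (if j = m then x = y
         else x \<in> members cl j \<and> y \<in> members cl j \<and> (x, y) \<in> joined (links P t) (members cl j)))})"

lemma interface_space:
  "interface r m cl P t \<in> {..m} \<rightarrow>\<^sub>E Pow ({..<2 * r} \<times> {..<2 * r})"
  by (auto simp: interface_def)

lemma slot_in: "slot r P Q k = Some x \<Longrightarrow> x \<in> set P \<union> set Q"
  using nth_mem[of k "rev P"] nth_mem[of "k - r" "rev Q"] by (auto simp: slot_def split: if_splits)

lemma in_slot:
  assumes "x \<in> set P \<union> set Q" "length P \<le> r" "length Q \<le> r"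
  shows "\<exists>k<2 * r. slot r P Q k = Some x"
  using assms(1)
proof
  assume "x \<in> set P"
  then obtain k where "k < length P" "rev P ! k = x" by (metis in_set_conv_nth length_rev set_rev)
  then show ?thesis using assms by (intro exI[of _ k]) (auto simp: slot_def)
next
  assume "x \<in> set Q"
  then obtain k where "k < length Q" "rev Q ! k = x" by (metis in_set_conv_nth length_rev set_rev)
  then show ?thesis using assms by (intro exI[of _ "r + k"]) (auto simp: slot_def)
qed

text \<open>Component \<open>m\<close> of the interface records which slots hold equal vertices and,
  by its diagonal, which slots are filled at all. Hence sending the vertex of each slot to the
  vertex in the same slot of the other subterm is well defined and injective, and the components
  below \<open>m\<close> become statements about this map.\<close>

lemma interface_rename:
  assumes eq: "interface r m cl P1 t1 = interface r m cl P2 t2"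
    and len: "length P1 \<le> r" "length (out P1 t1) \<le> r" "length P2 \<le> r" "length (out P2 t2) \<le> r"
  defines "S1 \<equiv> set P1 \<union> set (out P1 t1)" and "S2 \<equiv> set P2 \<union> set (out P2 t2)"
  obtains f where "map f P2 = P1" "map f (out P2 t2) = out P1 t1" "inj_on f S2" "\<And>x. x \<notin> S2 \<Longrightarrow> f x = x"
    "\<And>j x. j < m \<Longrightarrow> x \<in> S2 \<Longrightarrow> f x \<in> members cl j \<longleftrightarrow> x \<in> members cl j"
    "\<And>j x y. j < m \<Longrightarrow> x \<in> S2 \<Longrightarrow> y \<in> S2 \<Longrightarrow> f x \<in> members cl j \<Longrightarrow> f y \<in> members cl j \<Longrightarrow>
       (f x, f y) \<in> joined (links P1 t1) (members cl j) \<Longrightarrow> (x, y) \<in> joined (links P2 t2) (members cl j)"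
proof -
  define v1 where "v1 = slot r P1 (out P1 t1)"
  define v2 where "v2 = slot r P2 (out P2 t2)"
  have eqm: "(\<exists>x. v1 k = Some x \<and> v1 l = Some x) \<longleftrightarrow> (\<exists>x. v2 k = Some x \<and> v2 l = Some x)"
    if "k < 2 * r" "l < 2 * r" for k l
  proof -
    have "(k, l) \<in> interface r m cl P1 t1 m \<longleftrightarrow> (k, l) \<in> interface r m cl P2 t2 m" using eq by simp
    then show ?thesis using that unfolding interface_def v1_def[symmetric] v2_def[symmetric] by simp
  qed
  have eqj: "(\<exists>x y. v1 k = Some x \<and> v1 l = Some y \<and> x \<in> members cl j \<and> y \<in> members cl j \<and> (x, y) \<in> joined (links P1 t1) (members cl j))
     \<longleftrightarrow> (\<exists>x y. v2 k = Some x \<and> v2 l = Some y \<and> x \<in> members cl j \<and> y \<in> members cl j \<and> (x, y) \<in> joined (links P2 t2) (members cl j))"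
    if "k < 2 * r" "l < 2 * r" "j < m" for k l j
  proof -
    have "(k, l) \<in> interface r m cl P1 t1 j \<longleftrightarrow> (k, l) \<in> interface r m cl P2 t2 j" using eq by simp
    then show ?thesis using that unfolding interface_def v1_def[symmetric] v2_def[symmetric] by simp
  qed
  have dom: "v1 k = None \<longleftrightarrow> v2 k = None" if "k < 2 * r" for k
    using eqm[OF that that] by auto
  \<comment> \<open>At the length of the shorter stack exactly one of the two slots is
    empty.\<close>
  have lenP: "length P1 = length P2"
  proof (rule ccontr)
    assume "length P1 \<noteq> length P2"
    then consider "length P1 < length P2" | "length P2 < length P1" by linarith
    then show False
    proof cases
      case 1 then show ?thesis using dom[of "length P1"] len by (auto simp: v1_def v2_def slot_def)
    next
      case 2 then show ?thesis using dom[of "length P2"] len by (auto simp: v1_def v2_def slot_def)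
    qed
  qed
  have lenQ: "length (out P1 t1) = length (out P2 t2)"
  proof (rule ccontr)
    assume "length (out P1 t1) \<noteq> length (out P2 t2)"
    then consider "length (out P1 t1) < length (out P2 t2)" | "length (out P2 t2) < length (out P1 t1)" by linarith
    then show False
    proof cases
      case 1 then show ?thesis using dom[of "r + length (out P1 t1)"] len by (auto simp: v1_def v2_def slot_def)
    next
      case 2 then show ?thesis using dom[of "r + length (out P2 t2)"] len by (auto simp: v1_def v2_def slot_def)
    qed
  qed
  define f where "f = (\<lambda>x. if x \<in> S2 then the (v1 (SOME k. k < 2 * r \<and> v2 k = Some x)) else x)"
  have f: "v1 k = Some (f x)" if kx: "k < 2 * r" "v2 k = Some x" for k x
  proof -
    have "x \<in> S2" using that slot_in unfolding v2_def S2_def by metis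
    define l where "l = (SOME k. k < 2 * r \<and> v2 k = Some x)"
    have l: "l < 2 * r \<and> v2 l = Some x" unfolding l_def by (rule someI[of _ k]) (use that in simp)
    then obtain y where "v1 k = Some y" "v1 l = Some y" using eqm[OF kx(1) conjunct1[OF l]] kx(2) l by blast
    then show ?thesis using \<open>x \<in> S2\<close> by (simp add: f_def l_def)
  qed
  have sl: "\<exists>k<2 * r. v2 k = Some x" if "x \<in> S2" for x
    using in_slot[of x P2 "out P2 t2" r] that len unfolding S2_def v2_def by auto
  have mapP: "map f P2 = P1"
  proof -
    have "rev (map f P2) = rev P1"
    proof (rule nth_equalityI)
      fix i assume "i < length (rev (map f P2))"
      then have i: "i < length P2" by simp
      then have "v2 i = Some (rev P2 ! i)" "v1 i = Some (rev P1 ! i)"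
        using len lenP by (auto simp: v1_def v2_def slot_def)
      then show "rev (map f P2) ! i = rev P1 ! i" using f[of i "rev P2 ! i"] i len by (simp add: rev_map)
    qed (simp add: lenP)
    then show ?thesis by simp
  qed
  have mapQ: "map f (out P2 t2) = out P1 t1"
  proof -
    have "rev (map f (out P2 t2)) = rev (out P1 t1)"
    proof (rule nth_equalityI)
      fix i assume "i < length (rev (map f (out P2 t2)))"
      then have i: "i < length (out P2 t2)" by simp
      then have "v2 (r + i) = Some (rev (out P2 t2) ! i)" "v1 (r + i) = Some (rev (out P1 t1) ! i)"
        using len lenQ by (auto simp: v1_def v2_def slot_def)
      then show "rev (map f (out P2 t2)) ! i = rev (out P1 t1) ! i" using f[of "r + i" "rev (out P2 t2) ! i"] i len
        by (simp add: rev_map)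
    qed (simp add: lenQ)
    then show ?thesis by simp
  qed
  show thesis
  proof (rule that[OF mapP mapQ])
    show "inj_on f S2"
    proof (rule inj_onI)
      fix x y assume xy: "x \<in> S2" "y \<in> S2" "f x = f y"
      obtain k where k: "k < 2 * r" "v2 k = Some x" using sl xy(1) by blast
      obtain l where l: "l < 2 * r" "v2 l = Some y" using sl xy(2) by blast
      have "\<exists>z. v1 k = Some z \<and> v1 l = Some z" using f[OF k] f[OF l] xy(3) by simp
      then show "x = y" using eqm[OF k(1) l(1)] k l by simp
    qed
    show "\<And>x. x \<notin> S2 \<Longrightarrow> f x = x" by (simp add: f_def)
    fix j x assume j: "j < m" "x \<in> S2"
    then obtain k where k: "k < 2 * r" "v2 k = Some x" using sl by blast
    show "f x \<in> members cl j \<longleftrightarrow> x \<in> members cl j"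
      using eqj[OF k(1) k(1) j(1)] unfolding f[OF k] k(2) by simp
  next
    fix j x y assume *: "j < m" "x \<in> S2" "y \<in> S2" "f x \<in> members cl j" "f y \<in> members cl j"
       "(f x, f y) \<in> joined (links P1 t1) (members cl j)"
    obtain k where k: "k < 2 * r" "v2 k = Some x" using sl *(2) by blast
    obtain l where l: "l < 2 * r" "v2 l = Some y" using sl *(3) by blast
    show "(x, y) \<in> joined (links P2 t2) (members cl j)"
      using eqj[OF k(1) l(1) *(1)] *(4-6) unfolding f[OF k] f[OF l] k(2) l(2) by simp
  qed
qed

lemma ctx_links_sym: "sym (ctx_links P fs Q)"
  by (induction P fs Q rule: ctx_links.induct) (auto intro!: sym_Un link_sym links_sym simp: sym_def[of "{}"])

text \<open>The outer subterm is replaced by the inner one with its visible vertices renamed. What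
  disappears are the vertices that are inner for the outer subterm but not for the inner one; by
  \<open>cls\<close> their classes are still present, so they can come back as twins.\<close>

lemma pump:
  assumes R: "realizes r m cl V (plug fs1 (plug fs2 s))" and ne: "fs2 \<noteq> []"
  defines "P1 \<equiv> hole_in [] fs1" and "t1 \<equiv> plug fs2 s"
  defines "P2 \<equiv> hole_in P1 fs2"
  assumes eq: "interface r m cl P1 t1 = interface r m cl P2 s"
    and cls: "cl ` inner_verts P1 t1 = cl ` inner_verts P2 s"
  shows "\<exists>V' t'. realizes r m cl V' t' \<and> V' \<subseteq> V \<and> cl ` V' = cl ` V \<and> nodes t' < nodes (plug fs1 (plug fs2 s))"
proof -
  define Q1 where "Q1 = out P1 t1"
  define Q2 where "Q2 = out P2 s"
  define S1 where "S1 = set P1 \<union> set Q1"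
  define S2 where "S2 = set P2 \<union> set Q2"
  define I1 where "I1 = inner_verts P1 t1"
  define I2 where "I2 = inner_verts P2 s"
  from R have R: "ok r [] (plug fs1 t1)" "out [] (plug fs1 t1) = []" "distinct (pushed (plug fs1 t1))"
      "set (pushed (plug fs1 t1)) = V"
    and conn: "\<And>j x y. j < m \<Longrightarrow> x \<in> V \<inter> members cl j \<Longrightarrow> y \<in> V \<inter> members cl j \<Longrightarrow>
        (x, y) \<in> joined (links [] (plug fs1 t1)) (members cl j)"
    by (auto simp: realizes_def t1_def)
  have ok1: "ctx_ok r [] fs1 Q1" "ok r P1 t1" using R(1) by (auto simp: ok_plug P1_def Q1_def)
  have ok2: "ctx_ok r P1 fs2 Q2" "ok r P2 s" using ok1(2) by (auto simp: ok_plug P2_def Q2_def t1_def)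
  have lP1: "length P1 \<le> r" using ctx_ok_length[OF ok1(1)] by (simp add: P1_def)
  have lP2: "length P2 \<le> r" using ctx_ok_length[OF ok2(1) lP1] by (simp add: P2_def)
  have lQ: "length Q1 \<le> r" "length Q2 \<le> r" using length_out ok1 ok2 lP1 lP2 by (auto simp: Q1_def Q2_def)
  have d1: "distinct (ctx_pushed fs1 @ pushed t1)" using R(3) distinct_pushed_plug by blast
  have V1: "V = set (ctx_pushed fs1) \<union> set (pushed t1)" using R(4) set_pushed_plug by metis
  have p1: "set (pushed t1) = set (ctx_pushed fs2) \<union> set (pushed s)" unfolding t1_def set_pushed_plug ..
  have d2: "distinct (ctx_pushed fs2 @ pushed s)" using d1 distinct_pushed_plug unfolding t1_def by auto
  have dis: "set (ctx_pushed fs1) \<inter> set (pushed t1) = {}" "set (ctx_pushed fs2) \<inter> set (pushed s) = {}"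
    using d1 d2 by auto
  have P1s: "set P1 \<subseteq> set (ctx_pushed fs1)" using set_hole_in[of "[]" fs1] by (simp add: P1_def)
  have P2s: "set P2 \<subseteq> set P1 \<union> set (ctx_pushed fs2)" using set_hole_in[of P1 fs2] by (simp add: P2_def)
  have Q1s: "set Q1 \<subseteq> set P1 \<union> set (pushed t1)" unfolding Q1_def by (rule set_out)
  have Q2s: "set Q2 \<subseteq> set P2 \<union> set (pushed s)" unfolding Q2_def by (rule set_out)
  have I1: "I1 = set (pushed t1) - set Q1" and I2: "I2 = set (pushed s) - set Q2"
    by (auto simp: I1_def I2_def inner_verts_def Q1_def Q2_def)
  have I12: "I2 \<subseteq> I1" unfolding I1_def I2_def P2_def t1_def
    by (rule inner_verts_plug_subset) (use d1 in \<open>simp add: t1_def\<close>)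
  have S1V: "S1 \<subseteq> V" using P1s Q1s V1 by (auto simp: S1_def)
  have S1I1: "S1 \<inter> I1 = {}" using P1s dis unfolding S1_def I1 by blast
  have S2I2: "S2 \<inter> I2 = {}" using P1s P2s dis p1 unfolding S2_def I2 by blast
  have I1V: "I1 \<subseteq> V" using V1 I1 by auto
  have A: "ctx_links [] fs1 Q1 \<subseteq> (- I1) \<times> (- I1)"
    using ctx_links_subset[of "[]" fs1 Q1] dis unfolding I1 by auto
  have A2: "ctx_links [] fs1 Q1 \<union> ctx_links P1 fs2 Q2 \<subseteq> (- I2) \<times> (- I2)"
  proof -
    have "ctx_links P1 fs2 Q2 \<subseteq> (- I2) \<times> (- I2)"
      using ctx_links_subset[of P1 fs2 Q2] dis P1s p1 unfolding I2 by blast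
    then show ?thesis using A I12 by blast
  qed
  have B1: "links P1 t1 \<subseteq> (S1 \<union> I1) \<times> (S1 \<union> I1)"
    using links_subset[of P1 t1] unfolding S1_def I1 by blast
  have B2: "links P2 s \<subseteq> (S2 \<union> I2) \<times> (S2 \<union> I2)"
    using links_subset[of P2 s] unfolding S2_def I2 by blast
  have l1: "links [] (plug fs1 t1) = ctx_links [] fs1 Q1 \<union> links P1 t1"
    by (simp add: links_plug P1_def Q1_def)
  have l2: "links P1 t1 = ctx_links P1 fs2 Q2 \<union> links P2 s"
    by (simp add: links_plug P2_def Q2_def t1_def)
  obtain f where f: "map f P2 = P1" "map f Q2 = Q1" "inj_on f S2" "\<And>x. x \<notin> S2 \<Longrightarrow> f x = x"
    "\<And>j x. j < m \<Longrightarrow> x \<in> S2 \<Longrightarrow> f x \<in> members cl j \<longleftrightarrow> x \<in> members cl j"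
    "\<And>j x y. j < m \<Longrightarrow> x \<in> S2 \<Longrightarrow> y \<in> S2 \<Longrightarrow> f x \<in> members cl j \<Longrightarrow> f y \<in> members cl j \<Longrightarrow>
       (f x, f y) \<in> joined (links P1 t1) (members cl j) \<Longrightarrow> (x, y) \<in> joined (links P2 s) (members cl j)"
    using interface_rename[OF eq lP1 _ lP2] lQ unfolding Q1_def Q2_def S2_def by metis
  have fS: "f ` S2 = S1" using f(1,2) unfolding S1_def S2_def by (metis image_Un list.set_map)
  have fI: "f x = x" if "x \<in> I2" for x using f(4) S2I2 that by auto
  define t' where "t' = plug fs1 (map_tm f s)"
  have o': "out P1 (map_tm f s) = Q1" using out_map[of f P2 s] f(1,2) by (simp add: Q2_def)
  have l': "links [] t' = ctx_links [] fs1 Q1 \<union> map_prod f f ` links P2 s"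
    using links_map[of f P2 s] f(1) o' unfolding t'_def links_plug P1_def[symmetric] by simp
  define V' where "V' = V - I1 \<union> I2"
  have pS: "set (pushed s) \<subseteq> S2 \<union> I2" unfolding S2_def I2 by auto
  have injf: "inj_on f (S2 \<union> I2)"
  proof (rule inj_onI)
    fix x y assume "x \<in> S2 \<union> I2" "y \<in> S2 \<union> I2" "f x = f y"
    moreover have "f x \<in> S1" if "x \<in> S2" for x using fS that by auto
    moreover have "f x \<in> I1" if "x \<in> I2" for x using fI I12 that by auto
    ultimately show "x = y" using f(3) fI S1I1 by (metis Un_iff disjoint_iff inj_onD)
  qed
  have rn: "pushed (map_tm f s) = map f (pushed s)" by (rule pushed_map)
  have cp: "x \<in> set (ctx_pushed fs1) \<Longrightarrow> x \<notin> set (pushed t1)" for x using d1 by auto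
  \<comment> \<open>A vertex pushed by \<open>s\<close> that is not inner ends on the exit stack of
    \<open>s\<close>. Injectivity of \<open>f\<close> keeps its image off the entry stack, so the
    image was pushed inside the old subterm and not by the context.\<close>
  have fp: "f x \<in> set (pushed t1)" if x: "x \<in> set (pushed s)" for x
  proof (cases "x \<in> I2")
    case True then show ?thesis using fI I12 I1 by auto
  next
    case False
    then have xQ: "x \<in> set Q2" using x I2 by auto
    then have fQ: "f x \<in> set Q1" using f(2) by auto
    show ?thesis
    proof (rule ccontr)
      assume "f x \<notin> set (pushed t1)"
      then have "f x \<in> set P1" using fQ Q1s by auto
      then obtain y where y: "y \<in> set P2" "f y = f x" using f(1) by (metis image_iff list.set_map)
      then have "y = x" using f(3) xQ by (metis S2_def UnI1 UnI2 inj_onD)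
      moreover have "y \<notin> set (pushed s)" using y(1) P2s P1s dis p1 by blast
      ultimately show False using x by simp
    qed
  qed
  have "distinct (pushed t')"
  proof -
    have "distinct (map f (pushed s))" using d2 injf pS by (auto simp: distinct_map intro: inj_on_subset)
    then show ?thesis unfolding t'_def distinct_pushed_plug rn using d1 fp by auto
  qed
  moreover have setV: "set (pushed t') = V'"
  proof
    show "set (pushed t') \<subseteq> V'"
    proof
      fix x assume "x \<in> set (pushed t')"
      then consider "x \<in> set (ctx_pushed fs1)" | y where "y \<in> set (pushed s)" "x = f y"
        unfolding t'_def set_pushed_plug rn by auto
      then show "x \<in> V'"
      proof cases
        case 1 then show ?thesis using V1 d1 I1 by (auto simp: V'_def)
      next
        case 2
        show ?thesis
        proof (cases "y \<in> I2")
          case True then show ?thesis using 2 fI by (auto simp: V'_def)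
        next
          case False
          then have "y \<in> S2" using pS 2 by auto
          then have "x \<in> S1" using 2 fS by auto
          then show ?thesis using S1V S1I1 by (auto simp: V'_def)
        qed
      qed
    qed
    show "V' \<subseteq> set (pushed t')"
    proof
      fix x assume "x \<in> V'"
      then consider "x \<in> I2" | "x \<in> set (ctx_pushed fs1)" | "x \<in> set (pushed t1)" "x \<notin> I1" "x \<notin> set (ctx_pushed fs1)"
        using V1 by (auto simp: V'_def)
      then show "x \<in> set (pushed t')"
      proof cases
        case 1
        then have "x \<in> set (pushed s)" "f x = x" using I2 fI by auto
        then show ?thesis unfolding t'_def set_pushed_plug rn by force
      next
        case 2 then show ?thesis unfolding t'_def set_pushed_plug by simp
      next
        case 3
        then have "x \<in> set Q1" using I1 by auto
        then obtain y where y: "y \<in> set Q2" "x = f y" using f(2) by (metis image_iff list.set_map)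
        have "y \<notin> set P2"
        proof
          assume "y \<in> set P2"
          then have "x \<in> set P1" using f(1) y(2) by auto
          then show False using P1s 3 by auto
        qed
        then have "y \<in> set (pushed s)" using y Q2s by auto
        then show ?thesis unfolding t'_def set_pushed_plug rn using y by auto
      qed
    qed
  qed
  moreover have "ok r [] t'"
    using ok1 ok2 ok_map[of r f P2 s] f(1) o' unfolding t'_def ok_plug P1_def[symmetric] by simp
  moreover have "out [] t' = []"
    using R(2) o' unfolding t'_def out_plug P1_def[symmetric] Q1_def by simp
  moreover have "(x, y) \<in> joined (links [] t') (members cl j)"
    if "j < m" "x \<in> V' \<inter> members cl j" "y \<in> V' \<inter> members cl j" for j x y
    unfolding l'
  proof (rule exchange_connected[where A = "ctx_links [] fs1 Q1" and ?B1.0 = "links P1 t1" and ?B2.0 = "links P2 s"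
        and ?A2.0 = "ctx_links [] fs1 Q1 \<union> ctx_links P1 fs2 Q2" and ?I1.0 = I1 and ?I2.0 = I2 and ?S1.0 = S1 and ?S2.0 = S2 and V = V])
    show "(x, y) \<in> joined (ctx_links [] fs1 Q1 \<union> links P1 t1) (members cl j)"
      if "x \<in> V \<inter> members cl j" "y \<in> V \<inter> members cl j" for x y using conn[OF \<open>j < m\<close> that] by (simp add: l1)
    show "(x, y) \<in> joined (map_prod f f ` links P2 s) (members cl j)"
      if *: "x \<in> S1 \<inter> members cl j" "y \<in> S1 \<inter> members cl j" "(x, y) \<in> joined (links P1 t1) (members cl j)" for x y
    proof -
      obtain x' y' where x': "x' \<in> S2" "y' \<in> S2" "x = f x'" "y = f y'" using * fS by blast
      then have "(x', y') \<in> joined (links P2 s) (members cl j)" using f(6) * \<open>j < m\<close> by auto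
      moreover have "f z \<in> members cl j" if "z \<in> S2 \<union> I2" "z \<in> members cl j" for z
        using f(5)[OF \<open>j < m\<close>, of z] fI[of z] that by auto
      ultimately have "(f x', f y') \<in> joined (map_prod f f ` links P2 s) (members cl j)" using joined_map[OF _ B2] by blast
      then show ?thesis using x' by simp
    qed
    show "f x \<in> S1" if "x \<in> S2" for x using fS that by auto
    show "x \<in> (V - I1 \<union> I2) \<inter> members cl j" "y \<in> (V - I1 \<union> I2) \<inter> members cl j" using that by (auto simp: V'_def)
  qed (use A A2 B1 B2 l2 f fI S1I1 S2I2 S1V I12 I1V \<open>j < m\<close> in \<open>auto intro: ctx_links_sym links_sym\<close>)
  ultimately have "realizes r m cl V' t'" by (auto simp: realizes_def)
  moreover have "V' \<subseteq> V" using I12 I1V by (auto simp: V'_def)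
  moreover have "cl ` V' = cl ` V"
  proof
    show "cl ` V \<subseteq> cl ` V'"
    proof
      fix c assume "c \<in> cl ` V"
      then obtain v where "v \<in> V" "c = cl v" by auto
      then show "c \<in> cl ` V'" using cls unfolding V'_def I1_def[symmetric] I2_def[symmetric]
        by (cases "v \<in> I1") (auto simp: image_Un)
    qed
  qed (use \<open>V' \<subseteq> V\<close> in auto)
  moreover have "nodes t' < nodes (plug fs1 (plug fs2 s))"
    unfolding t'_def
    by (rule nodes_plug_less) (use nodes_plug[of fs2 s] ne in \<open>cases fs2; simp add: nodes_map\<close>)
  ultimately show ?thesis by blast
qed

text \<open>In a realization with the fewest nodes no two subterms on a longest path agree in the
  recorded data, since otherwise \<open>pump\<close> would give a smaller one. So the height is
  below the number of possible data.\<close>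

lemma small_realization:
  assumes R: "realizes r m cl V t" and r: "r \<ge> 1" and cl: "\<And>v. v \<in> V \<Longrightarrow> cl v \<subseteq> {..<m}"
  obtains V' t' where "realizes r m cl V' t'" "V' \<subseteq> V" "cl ` V' = cl ` V"
    "card V' \<le> 2 ^ (2 ^ (5 * r\<^sup>2 * (m + 1)))"
proof -
  define good where "good = (\<lambda>(V', t'). realizes r m cl V' t' \<and> V' \<subseteq> V \<and> cl ` V' = cl ` V)"
  define w where "w = arg_min (\<lambda>p. nodes (snd p)) good"
  have g0: "good (V, t)" using R by (simp add: good_def)
  have gw: "good w" and min: "\<And>p. good p \<Longrightarrow> nodes (snd w) \<le> nodes (snd p)"
    using arg_min_nat_lemma[where P = good and m = "\<lambda>p. nodes (snd p)", OF g0] by (auto simp: w_def)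
  obtain V' t' where w: "w = (V', t')" by (cases w)
  have g: "realizes r m cl V' t'" "V' \<subseteq> V" "cl ` V' = cl ` V" using gw by (auto simp: good_def w)
  obtain fs s where fs: "t' = plug fs s" "length fs = height t'" using plug_height by blast
  define sub where "sub = (\<lambda>i. plug (drop i fs) s)"
  define ins where "ins = (\<lambda>i. hole_in [] (take i fs))"
  \<comment> \<open>The number of inner classes is enough: the sets of inner vertices decrease along
    the path, so equal numbers mean equal sets of classes.\<close>
  define st where "st = (\<lambda>i. (interface r m cl (ins i) (sub i), card (cl ` inner_verts (ins i) (sub i))))"
  define X where "X = ({..m} \<rightarrow>\<^sub>E Pow ({..<2 * r} \<times> {..<2 * r})) \<times> {..(2::nat) ^ m}"
  have dist: "distinct (pushed t')" "set (pushed t') = V'" using g by (auto simp: realizes_def)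
  have split: "t' = plug (take i fs) (sub i)" for i unfolding sub_def fs(1) plug_append[symmetric] by simp
  have intV: "inner_verts (ins i) (sub i) \<subseteq> V" for i
    using set_pushed_plug[of "take i fs" "sub i"] split[of i] dist g(2) by (auto simp: inner_verts_def)
  have stX: "st i \<in> X" for i
  proof -
    have "cl ` inner_verts (ins i) (sub i) \<subseteq> Pow {..<m}" using intV[of i] cl by blast
    then have "card (cl ` inner_verts (ins i) (sub i)) \<le> card (Pow {..<m})" by (intro card_mono) auto
    then show ?thesis unfolding st_def X_def using interface_space[of r m cl "ins i" "sub i"] by (simp add: card_Pow)
  qed
  have finX: "finite X" unfolding X_def by (intro finite_cartesian_product finite_PiE) auto
  have inj: "inj_on st {..length fs}"
  proof (rule ccontr)
    assume "\<not> inj_on st {..length fs}"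
    then obtain i j where ij: "i < j" "j \<le> length fs" "st i = st j"
      unfolding inj_on_def by (metis atMost_iff linorder_neqE_nat)
    define fs2 where "fs2 = take (j - i) (drop i fs)"
    have take: "take i fs @ fs2 = take j fs" unfolding fs2_def using ij by (metis le_add_diff_inverse less_imp_le take_add)
    have sub: "sub i = plug fs2 (sub j)"
    proof -
      have "drop i fs = fs2 @ drop j fs" unfolding fs2_def using ij
        by (metis append_take_drop_id drop_drop le_add_diff_inverse2 less_imp_le)
      then show ?thesis by (simp add: sub_def plug_append)
    qed
    have ins: "ins j = hole_in (ins i) fs2" unfolding ins_def take[symmetric] hole_in_append ..
    have insi: "hole_in [] (take i fs) = ins i" by (simp add: ins_def)
    have sp: "t' = plug (take i fs) (plug fs2 (sub j))" using split[of i] sub by simp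
    have d: "distinct (pushed (plug fs2 (sub j)))"
      using dist(1) split[of i] sub distinct_pushed_plug by (metis distinct_append)
    have "inner_verts (ins j) (sub j) \<subseteq> inner_verts (ins i) (sub i)"
      unfolding ins sub by (rule inner_verts_plug_subset[OF d])
    moreover have "finite (inner_verts (ins i) (sub i))" by (auto simp: inner_verts_def)
    ultimately have "cl ` inner_verts (ins i) (sub i) = cl ` inner_verts (ins j) (sub j)"
      using ij(3) by (intro card_subset_eq[symmetric]) (auto simp: st_def)
    then have "cl ` inner_verts (hole_in [] (take i fs)) (plug fs2 (sub j)) =
        cl ` inner_verts (hole_in (hole_in [] (take i fs)) fs2) (sub j)"
      unfolding insi ins[symmetric] sub[symmetric] .
    moreover have "interface r m cl (hole_in [] (take i fs)) (plug fs2 (sub j)) =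
        interface r m cl (hole_in (hole_in [] (take i fs)) fs2) (sub j)"
      unfolding insi ins[symmetric] sub[symmetric] using ij(3) by (simp add: st_def)
    moreover have "fs2 \<noteq> []" using ij by (simp add: fs2_def)
    moreover have "realizes r m cl V' (plug (take i fs) (plug fs2 (sub j)))" using g(1) sp by simp
    ultimately obtain V'' t'' where "realizes r m cl V'' t''" "V'' \<subseteq> V'" "cl ` V'' = cl ` V'" "nodes t'' < nodes t'"
      using pump[of r m cl V' "take i fs" fs2 "sub j"] unfolding sp[symmetric] by auto
    moreover from this have "good (V'', t'')" using g by (auto simp: good_def)
    ultimately show False using min[of "(V'', t'')"] by (auto simp: w)
  qed
  have "card {..length fs} \<le> card X"
    using card_inj_on_le[OF inj _ finX] stX by auto
  then have "height t' < card X" using fs(2) by simp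
  also have "card X = (2 ^ (2 * r * (2 * r))) ^ (m + 1) * (2 ^ m + 1)"
    unfolding X_def by (simp add: card_cartesian_product card_PiE card_Pow)
  also have "\<dots> \<le> 2 ^ (4 * r\<^sup>2 * (m + 1)) * 2 ^ (m + 1)"
  proof -
    have "2 * r * (2 * r) * (m + 1) = 4 * r\<^sup>2 * (m + 1)" by (simp add: power2_eq_square)
    moreover have "(2::nat) ^ m + 1 \<le> 2 ^ (m + 1)" by simp
    ultimately show ?thesis unfolding power_mult[symmetric] by (metis mult_le_mono2)
  qed
  also have "\<dots> = 2 ^ ((4 * r\<^sup>2 + 1) * (m + 1))"
    unfolding power_add[symmetric] by (simp add: algebra_simps)
  \<comment> \<open>As \<open>r \<ge> 1\<close>, the summand 1 is absorbed by
    \<open>r\<^sup>2\<close>.\<close>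
  also have "\<dots> \<le> 2 ^ (5 * r\<^sup>2 * (m + 1))"
    using r by (intro power_increasing mult_right_mono) (auto simp: power2_eq_square)
  finally have h: "height t' \<le> 2 ^ (5 * r\<^sup>2 * (m + 1))" by simp
  have "card V' = length (pushed t')" using dist distinct_card by metis
  also have "\<dots> \<le> 2 ^ height t'" using pushed_height[of t'] by simp
  also have "\<dots> \<le> 2 ^ (2 ^ (5 * r\<^sup>2 * (m + 1)))" using h by (intro power_increasing) auto
  finally show thesis using that g by blast
qed

subsection \<open>Twins\<close>

text \<open>The twin is visited just before \<open>v\<close>, as a leaf below the same parent, and
  the \<open>Arc\<close> over \<open>Pop (Push v Done)\<close> is the chord between the two. The
  stack gets no higher than it is at \<open>v\<close>, so the depth bound survives.\<close>

fun add_twin :: "'v \<Rightarrow> 'v \<Rightarrow> 'v tm \<Rightarrow> 'v tm" where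
  "add_twin v v' Done = Done"
| "add_twin v v' (Push x t) =
    (if x = v then Push v' (Arc (Pop (Push v Done)) (add_twin v v' t)) else Push x (add_twin v v' t))"
| "add_twin v v' (Pop t) = Pop (add_twin v v' t)"
| "add_twin v v' (Arc t u) = Arc (add_twin v v' t) (add_twin v v' u)"

lemma out_add_twin: "out P (add_twin v v' t) = out P t"
  by (induction t arbitrary: P) auto

lemma ok_add_twin: "ok r P t \<Longrightarrow> ok r P (add_twin v v' t)"
  by (induction t arbitrary: P) (auto simp: out_add_twin)

lemma pushed_add_twin: "v \<notin> set (pushed t) \<Longrightarrow> pushed (add_twin v v' t) = pushed t"
  by (induction t) auto

lemma mset_pushed_add_twin:
  "v \<in> set (pushed t) \<Longrightarrow> distinct (pushed t) \<Longrightarrow> mset (pushed (add_twin v v' t)) = add_mset v' (mset (pushed t))"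
proof (induction t)
  case (Arc t u)
  then show ?case using pushed_add_twin[of v t v'] pushed_add_twin[of v u v']
    by (cases "v \<in> set (pushed t)"; cases "v \<in> set (pushed u)") auto
qed (auto simp: pushed_add_twin)

lemma links_add_twin:
  "links P t \<subseteq> links P (add_twin v v' t) \<and> (v \<in> set (pushed t) \<longrightarrow> {(v, v'), (v', v)} \<subseteq> links P (add_twin v v' t))"
proof (induction t arbitrary: P)
  case (Arc t u)
  then show ?case using out_add_twin[of P v v' t] by auto
qed (auto simp: link_def)

text \<open>The twin lies in the same hyperedges as \<open>v\<close>, so its single link serves all
  of them.\<close>

lemma realizes_add_twin:
  assumes R: "realizes r m cl V t" and v: "v \<in> V" "v' \<notin> V" "cl v' = cl v"
  shows "realizes r m cl (insert v' V) (add_twin v v' t)"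
proof -
  let ?t = "add_twin v v' t"
  have p: "distinct (pushed t)" "set (pushed t) = V" using R by (auto simp: realizes_def)
  have ms: "mset (pushed ?t) = mset (v' # pushed t)" using mset_pushed_add_twin[of v t v'] p v by simp
  have st: "set (pushed ?t) = insert v' V" using mset_eq_setD[OF ms] p by simp
  have d: "distinct (pushed ?t)" using mset_eq_imp_distinct_iff[OF ms] p v by simp
  have l: "links [] t \<subseteq> links [] ?t" "(v, v') \<in> links [] ?t" "(v', v) \<in> links [] ?t"
    using links_add_twin[of "[]" t v v'] p v by auto
  have old: "(x, y) \<in> joined (links [] ?t) (members cl j)"
    if "j < m" "x \<in> V \<inter> members cl j" "y \<in> V \<inter> members cl j" for x y j
    using R that joined_mono[OF l(1)] unfolding realizes_def by blast
  have "(x, y) \<in> joined (links [] ?t) (members cl j)"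
    if j: "j < m" and xy: "x \<in> insert v' V \<inter> members cl j" "y \<in> insert v' V \<inter> members cl j" for x y j
  proof -
    have e: "\<exists>x'\<in>V \<inter> members cl j. (x, x') \<in> joined (links [] ?t) (members cl j) \<and> (x', x) \<in> joined (links [] ?t) (members cl j)"
      if "x \<in> insert v' V \<inter> members cl j" for x
    proof (cases "x = v'")
      case True
      then show ?thesis using that v l by (intro bexI[of _ v]) (auto simp: members_def intro: joined_step)
    next
      case False
      then show ?thesis using that by (intro bexI[of _ x]) auto
    qed
    show ?thesis using e[OF xy(1)] e[OF xy(2)] old[OF j] joined_trans by metis
  qed
  then show ?thesis using R st d by (auto simp: realizes_def out_add_twin ok_add_twin)
qed

lemma realizes_rename:
  assumes R: "realizes r m cl V t" and f: "inj_on f V" "\<And>v. v \<in> V \<Longrightarrow> cl' (f v) = cl v"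
  shows "realizes r m cl' (f ` V) (map_tm f t)"
proof -
  have p: "distinct (pushed t)" "set (pushed t) = V" using R by (auto simp: realizes_def)
  have "(f x, f y) \<in> joined (links [] (map_tm f t)) (members cl' j)"
    if "j < m" "x \<in> V" "f x \<in> members cl' j" "y \<in> V" "f y \<in> members cl' j" for x y j
  proof -
    have "(x, y) \<in> joined (links [] t) (members cl j)"
      using R that f by (auto simp: realizes_def members_def)
    from joined_map[OF this, of V f "members cl' j"] show ?thesis
      using links_subset[of "[]" t] p f links_map[of f "[]" t] by (auto simp: members_def)
  qed
  then show ?thesis
    using R f p ok_map[of r f "[]" t] out_map[of f "[]" t]
    by (auto simp: realizes_def pushed_map distinct_map)
qed

lemma realizes_twins:
  assumes "finite V2" "realizes r m cl V1 t" "V1 \<subseteq> V2" "cl ` V2 \<subseteq> cl ` V1"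
  shows "\<exists>t'. realizes r m cl V2 t'"
proof -
  have "\<exists>t'. realizes r m cl (V1 \<union> D) t'" if "finite D" "D \<subseteq> V2" for D
    using that
  proof (induction D rule: finite_induct)
    case empty then show ?case using assms by auto
  next
    case (insert x D)
    then obtain t' where t': "realizes r m cl (V1 \<union> D) t'" by auto
    show ?case
    proof (cases "x \<in> V1")
      case True then show ?thesis using t' by (auto simp: insert_absorb)
    next
      case False
      have "cl x \<in> cl ` V1" using assms(4) insert.prems by blast
      then obtain v where "v \<in> V1" "cl x = cl v" by blast
      then show ?thesis using realizes_add_twin[OF t', of v x] insert False by auto
    qed
  qed
  from this[of V2] show ?thesis using assms by (simp add: Un_absorb1)
qed

subsection \<open>Grids\<close>

type_synonym cell = "int \<times> int"

definition adj :: "cell \<Rightarrow> cell \<Rightarrow> bool" where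
  "adj c d \<longleftrightarrow> \<bar>fst c - fst d\<bar> + \<bar>snd c - snd d\<bar> = 1"

text \<open>The corners of a block \<open>(x, y)\<close> are numbered counterclockwise from \<open>(x, y)\<close>; side \<open>k\<close>
  leads from corner \<open>k\<close> to corner \<open>k + 1\<close>, indices modulo 4. The edge \<open>(x, y, True)\<close> is the one from
  \<open>(x, y)\<close> to the right, \<open>(x, y, False)\<close> the one upwards.\<close>

definition corner :: "cell \<Rightarrow> nat \<Rightarrow> cell" where
  "corner b k = (let x = fst b; y = snd b; i = k mod 4 in
     if i = 0 then (x, y) else if i = 1 then (x + 1, y) else if i = 2 then (x + 1, y + 1) else (x, y + 1))"

definition side :: "cell \<Rightarrow> nat \<Rightarrow> int \<times> int \<times> bool" where
  "side b k = (let x = fst b; y = snd b; i = k mod 4 in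
     if i = 0 then (x, y, True) else if i = 1 then (x + 1, y, False)
     else if i = 2 then (x, y + 1, True) else (x, y, False))"

definition across :: "cell \<Rightarrow> nat \<Rightarrow> cell" where
  "across b k = (let x = fst b; y = snd b; i = k mod 4 in
     if i = 0 then (x, y - 1) else if i = 1 then (x + 1, y) else if i = 2 then (x, y + 1) else (x - 1, y))"

definition edge_between :: "cell \<Rightarrow> cell \<Rightarrow> int \<times> int \<times> bool" where
  "edge_between c d = (min (fst c) (fst d), min (snd c) (snd d), snd c = snd d)"

lemma adj_sym: "adj c d \<Longrightarrow> adj d c"
  by (auto simp: adj_def abs_minus_commute)

lemma edge_between_commute: "edge_between c d = edge_between d c"
  by (auto simp: edge_between_def min.commute)

lemma adj_cases:
  assumes "adj c d"
  obtains "d = (fst c + 1, snd c)" | "d = (fst c - 1, snd c)" | "d = (fst c, snd c + 1)" | "d = (fst c, snd c - 1)"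
proof -
  have "\<bar>fst c - fst d\<bar> + \<bar>snd c - snd d\<bar> = 1" using assms by (simp add: adj_def)
  then have "fst d = fst c + 1 \<and> snd d = snd c \<or> fst d = fst c - 1 \<and> snd d = snd c \<or>
     fst d = fst c \<and> snd d = snd c + 1 \<or> fst d = fst c \<and> snd d = snd c - 1" by arith
  then show thesis using that by (metis prod.collapse)
qed

lemma edge_between_eqD:
  assumes "adj c d" "adj c' d'" "edge_between c d = edge_between c' d'"
  shows "c = c' \<and> d = d' \<or> c = d' \<and> d = c'"
  using assms(1,2)
  by (cases rule: adj_cases; cases rule: adj_cases[OF assms(2)])
     (use assms(3) in \<open>auto simp: edge_between_def min_def prod_eq_iff split: if_splits\<close>)

lemma mod4_cases:
  fixes k :: nat
  obtains "k mod 4 = 0" | "k mod 4 = 1" | "k mod 4 = 2" | "k mod 4 = 3"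
proof -
  have "k mod 4 < 4" by simp
  then have "k mod 4 = 0 \<or> k mod 4 = 1 \<or> k mod 4 = 2 \<or> k mod 4 = 3" by linarith
  then show thesis by (elim disjE) (fact that)+
qed

lemmas block_defs = corner_def side_def across_def edge_between_def Let_def

lemma corner_adj: "adj (corner b k) (corner b (Suc k))"
  by (rule mod4_cases[of k]) (auto simp: block_defs adj_def mod_Suc)

lemma side_edge: "side b k = edge_between (corner b k) (corner b (Suc k))"
  by (rule mod4_cases[of k]) (auto simp: block_defs adj_def mod_Suc)

lemma side_inj: "side b k = side b l \<Longrightarrow> k mod 4 = l mod 4"
  by (rule mod4_cases[of k]; rule mod4_cases[of l]) (auto simp: block_defs)

lemma side_eq_across: "side b k = side b' l \<Longrightarrow> b \<noteq> b' \<Longrightarrow> across b k = b' \<and> across b' l = b \<and> l mod 4 = (k + 2) mod 4"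
  by (rule mod4_cases[of k]; rule mod4_cases[of l]) (auto simp: block_defs prod_eq_iff mod_Suc)

lemma side_across: "side (across b k) (k + 2) = side b k" "across (across b k) (k + 2) = b"
  by (rule mod4_cases[of k]; auto simp: block_defs mod_Suc)+

lemma corner_across: "corner (across b k) (k + 2) = corner b (Suc k)" "corner (across b k) (Suc (k + 2)) = corner b k"
  by (rule mod4_cases[of k]; auto simp: block_defs mod_Suc)+

lemma corner_mod: "corner b (k mod 4) = corner b k" "side b (k mod 4) = side b k" "across b (k mod 4) = across b k"
  by (simp_all add: block_defs)

lemma corner_cong: "k mod 4 = l mod 4 \<Longrightarrow> corner b k = corner b l"
  by (metis corner_mod(1))

lemma dart_block_unique:
  "corner b k = corner b' l \<Longrightarrow> corner b (Suc k) = corner b' (Suc l) \<Longrightarrow> b = b' \<and> k mod 4 = l mod 4"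
  by (rule mod4_cases[of k]; rule mod4_cases[of l]) (auto simp: block_defs prod_eq_iff mod_Suc)

text \<open>The block to the left of the step from \<open>c\<close> to \<open>d\<close>, that is,
  the one whose counterclockwise boundary contains this step.\<close>

definition dart_block :: "cell \<Rightarrow> cell \<Rightarrow> cell" where
  "dart_block c d = (if d = (fst c + 1, snd c) then c else if d = (fst c, snd c + 1) then (fst c - 1, snd c)
     else if d = (fst c - 1, snd c) then (fst c - 1, snd c - 1) else (fst c, snd c - 1))"

lemma dart_block:
  assumes "adj c d"
  shows "\<exists>k<4. corner (dart_block c d) k = c \<and> corner (dart_block c d) (Suc k) = d"
  using assms
proof (cases rule: adj_cases)
  case 1 then show ?thesis by (intro exI[of _ 0]) (auto simp: dart_block_def block_defs)
next
  case 2 then show ?thesis by (intro exI[of _ 2]) (auto simp: dart_block_def block_defs)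
next
  case 3 then show ?thesis by (intro exI[of _ 1]) (auto simp: dart_block_def block_defs)
next
  case 4 then show ?thesis by (intro exI[of _ 3]) (auto simp: dart_block_def block_defs)
qed

section \<open>Spanning trees of the grid and walks around them\<close>

lemma bfs_tree:
  assumes "\<And>x. x \<in> X \<Longrightarrow> \<exists>a\<in>A. (a, x) \<in> rtrancl R"
  obtains par and rk :: "'a \<Rightarrow> nat" where
    "\<And>x. x \<in> X \<Longrightarrow> x \<notin> A \<Longrightarrow> (par x, x) \<in> R \<and> rk (par x) < rk x \<and> (\<exists>a\<in>A. (a, par x) \<in> rtrancl R)"
    "\<And>x. x \<in> A \<Longrightarrow> rk x = 0"
proof -
  define rk where "rk = (\<lambda>x. LEAST n. \<exists>a\<in>A. (a, x) \<in> R ^^ n)"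
  have ex: "\<exists>p. (p, x) \<in> R \<and> rk p < rk x \<and> (\<exists>a\<in>A. (a, p) \<in> rtrancl R)" if "x \<in> X" "x \<notin> A" for x
  proof -
    have e: "\<exists>n. \<exists>a\<in>A. (a, x) \<in> R ^^ n" using assms[OF that(1)] by (auto simp: rtrancl_power)
    then obtain a where a: "a \<in> A" "(a, x) \<in> R ^^ rk x" unfolding rk_def using LeastI_ex[OF e] by blast
    have "rk x \<noteq> 0"
    proof
      assume "rk x = 0"
      with a(2) have "a = x" by simp
      with a(1) that show False by simp
    qed
    then obtain n where n: "rk x = Suc n" by (cases "rk x") auto
    then obtain p where p: "(a, p) \<in> R ^^ n" "(p, x) \<in> R" using a by auto
    have "rk p \<le> n" unfolding rk_def by (rule Least_le) (use p a in auto)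
    moreover have "(a, p) \<in> rtrancl R" using p(1) rtrancl_power by metis
    ultimately show ?thesis using p(2) a(1) n by (intro exI[of _ p]) auto
  qed
  define par where "par = (\<lambda>x. SOME p. (p, x) \<in> R \<and> rk p < rk x \<and> (\<exists>a\<in>A. (a, p) \<in> rtrancl R))"
  show thesis
  proof (rule that[of par rk])
    show "(par x, x) \<in> R \<and> rk (par x) < rk x \<and> (\<exists>a\<in>A. (a, par x) \<in> rtrancl R)" if "x \<in> X" "x \<notin> A" for x
      unfolding par_def by (rule someI_ex[OF ex[OF that]])
    show "rk x = 0" if "x \<in> A" for x
    proof -
      have "rk x \<le> 0" unfolding rk_def by (rule Least_le) (use that in auto)
      then show ?thesis by simp
    qed
  qed
qed

text \<open>Parity at a grid point: of the four edges around it an even number separates a given set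
  of blocks from the rest, so one such edge forces a second.\<close>

lemma exists_other_of_four:
  "p \<in> {a, b, c, d} \<Longrightarrow> distinct [a, b, c, d] \<Longrightarrow> Q p \<Longrightarrow> (Q a \<noteq> Q b) = (Q c \<noteq> Q d) \<Longrightarrow>
     \<exists>e\<in>{a, b, c, d}. e \<noteq> p \<and> Q e"
  by auto

text \<open>\<open>par\<close> is a spanning tree of the grid points rooted in
  \<open>(0, 0)\<close>, and \<open>St c\<close> is the stack in force at \<open>c\<close>, which
  grows exactly on the steps from \<open>par c\<close> to a point \<open>c\<close> of
  \<open>U\<close>. The prescribed boundary paths contain every boundary edge except
  \<open>(N - 1, N, True)\<close>; this gap is the only passage to the outer face.\<close>

locale grid_tree =
  fixes N :: int and par :: "cell \<Rightarrow> cell" and rk :: "cell \<Rightarrow> nat" and St :: "cell \<Rightarrow> 'v list" and U :: "cell set" and r :: nat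
  assumes N: "N \<ge> 1"
    and par: "\<And>c. c \<in> {0..N} \<times> {0..N} \<Longrightarrow> c \<noteq> (0, 0) \<Longrightarrow> par c \<in> {0..N} \<times> {0..N} \<and> adj c (par c) \<and> rk (par c) < rk c"
    and bottom: "\<And>x. 0 < x \<Longrightarrow> x \<le> N \<Longrightarrow> par (x, 0) = (x - 1, 0)"
    and left: "\<And>y. 0 < y \<Longrightarrow> y \<le> N \<Longrightarrow> par (0, y) = (0, y - 1)"
    and right: "\<And>y. 0 < y \<Longrightarrow> y \<le> N \<Longrightarrow> par (N, y) = (N, y - 1)"
    and top: "\<And>x. 0 < x \<Longrightarrow> x < N \<Longrightarrow> par (x, N) = (x - 1, N)"
    and U: "U \<subseteq> {0<..<N} \<times> {0<..<N}"
    and push: "\<And>c. c \<in> U \<Longrightarrow> \<exists>v. St c = v # St (par c)"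
    and nopush: "\<And>c. c \<in> {0..N} \<times> {0..N} \<Longrightarrow> c \<noteq> (0, 0) \<Longrightarrow> c \<notin> U \<Longrightarrow> St c = St (par c)"
    and rootSt: "St (0, 0) = []"
    and lenSt: "\<And>c. length (St c) \<le> r"
    and injU: "inj_on (\<lambda>c. hd (St c)) U"
begin

definition "cells = {0..N} \<times> {0..N}"
definition "blocks = {0..<N} \<times> {0..<N}"
definition "edges = (\<lambda>(x, y). (x, y, True)) ` ({0..<N} \<times> {0..N}) \<union> (\<lambda>(x, y). (x, y, False)) ` ({0..N} \<times> {0..<N})"
definition "par_edge c = edge_between c (par c)"
definition "tset = par_edge ` (cells - {(0, 0)})"

lemma card_edges: "card edges = nat (2 * N * (N + 1))"
proof -
  have "card edges = nat N * nat (N + 1) + nat (N + 1) * nat N"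
    unfolding edges_def by (subst card_Un_disjoint) (auto simp: card_image inj_on_def)
  also have "\<dots> = nat (2 * N * (N + 1))" using N by (simp add: algebra_simps flip: nat_mult_distrib nat_add_distrib)
  finally show ?thesis .
qed

lemma edge_in_edges: "c \<in> cells \<Longrightarrow> d \<in> cells \<Longrightarrow> adj c d \<Longrightarrow> edge_between c d \<in> edges"
  by (erule adj_cases) (auto simp: edges_def cells_def edge_between_def image_iff)

lemma par_edge_inj: "inj_on par_edge (cells - {(0, 0)})"
proof (rule inj_onI)
  fix c d assume "c \<in> cells - {(0, 0)}" "d \<in> cells - {(0, 0)}" "par_edge c = par_edge d"
  then show "c = d" using edge_between_eqD[of c "par c" d "par d"] par[of c] par[of d]
    unfolding par_edge_def cells_def by (metis Diff_iff insertI1 less_asym)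
qed

lemma tree_edges: "tset \<subseteq> edges"
proof
  fix e assume "e \<in> tset"
  then obtain c where c: "c \<in> cells" "c \<noteq> (0, 0)" "e = edge_between c (par c)" by (auto simp: tset_def par_edge_def)
  show "e \<in> edges" unfolding c(3) using c par[of c] by (intro edge_in_edges) (auto simp: cells_def)
qed

lemma card_tree: "card tset = nat (N * N + 2 * N)"
proof -
  have "card tset = card cells - 1" unfolding tset_def using N
    by (subst card_image[OF par_edge_inj]) (simp add: cells_def card_Diff_singleton)
  also have "card cells = nat ((N + 1) * (N + 1))" unfolding cells_def using N by (simp add: nat_mult_distrib)
  finally show ?thesis using N by (simp add: algebra_simps nat_diff_distrib)
qed

lemma treeD:
  assumes "edge_between c d \<in> tset" "adj c d"
  shows "c \<in> cells \<and> d \<in> cells \<and> (c \<noteq> (0, 0) \<and> par c = d \<or> d \<noteq> (0, 0) \<and> par d = c)"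
proof -
  obtain a where a: "a \<in> cells" "a \<noteq> (0, 0)" "edge_between c d = edge_between a (par a)"
    using assms(1) by (auto simp: tset_def par_edge_def)
  then show ?thesis using edge_between_eqD[OF assms(2) _ a(3)] par[of a] by (auto simp: cells_def)
qed

lemma par_in_tree: "c \<in> cells \<Longrightarrow> c \<noteq> (0, 0) \<Longrightarrow> edge_between c (par c) \<in> tset"
  by (auto simp: tset_def par_edge_def)

lemma boundary_tree:
  assumes b: "b \<in> blocks" and a: "across b k \<notin> blocks" and ne: "side b k \<noteq> (N - 1, N, True)"
  shows "side b k \<in> tset"
proof -
  obtain x y where xy: "b = (x, y)" "0 \<le> x" "x < N" "0 \<le> y" "y < N" using b by (auto simp: blocks_def)
  have *: "edge_between (par c) c \<in> tset" if "c \<in> cells" "c \<noteq> (0, 0)" for c using par_in_tree[OF that] edge_between_commute by metis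
  show ?thesis
  proof (rule mod4_cases[of k])
    assume k: "k mod 4 = 0"
    then have "y = 0" using a xy by (auto simp: across_def blocks_def)
    then show ?thesis using *[of "(x + 1, 0)"] bottom[of "x + 1"] xy k by (simp add: side_def cells_def edge_between_def)
  next
    assume k: "k mod 4 = 1"
    then have "x + 1 = N" using a xy by (auto simp: across_def blocks_def)
    then show ?thesis using *[of "(N, y + 1)"] right[of "y + 1"] xy k by (simp add: side_def cells_def edge_between_def)
  next
    assume k: "k mod 4 = 2"
    then have "y + 1 = N" "x + 1 < N" using a xy ne by (auto simp: across_def blocks_def side_def Let_def)
    then show ?thesis using *[of "(x + 1, N)"] top[of "x + 1"] xy k by (simp add: side_def cells_def edge_between_def)
  next
    assume k: "k mod 4 = 3"
    then have "x = 0" using a xy by (auto simp: across_def blocks_def)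
    then show ?thesis using *[of "(0, y + 1)"] left[of "y + 1"] xy k by (simp add: side_def cells_def edge_between_def)
  qed
qed

lemma top_not_tree: "(N - 1, N, True) \<notin> tset"
proof
  assume "(N - 1, N, True) \<in> tset"
  moreover have "(N - 1, N, True) = edge_between (N - 1, N) (N, N)" by (simp add: edge_between_def)
  ultimately have "edge_between (N - 1, N) (N, N) \<in> tset" by simp
  from treeD[OF this] have "par (N - 1, N) = (N, N) \<or> par (N, N) = (N - 1, N)" by (auto simp: adj_def)
  then show False using right[of N] N left[of N] top[of "N - 1"] by (cases "N = 1") auto
qed

definition "dual = {(b, b'). b \<in> blocks \<and> b' \<in> blocks \<and> (\<exists>k<4. b' = across b k \<and> side b k \<notin> tset)}"

text \<open>If the blocks that cannot be reached formed a nonempty set \<open>S\<close>, all edges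
  separating \<open>S\<close> from the rest would be tree edges, and every grid point would have an
  even number of them. But a finite nonempty set of edges of a forest has a point of degree one;
  here it is the deepest cell whose edge to its parent separates.\<close>

lemma dual_connected:
  assumes "b \<in> blocks"
  shows "((N - 1, N - 1), b) \<in> rtrancl dual"
proof (rule ccontr)
  assume nb: "((N - 1, N - 1), b) \<notin> rtrancl dual"
  define S where "S = {b \<in> blocks. ((N - 1, N - 1), b) \<notin> rtrancl dual}"
  define sep where "sep = (\<lambda>(x, y, h). ((x, y) \<in> S) \<noteq> (((if h then (x, y - 1) else (x - 1, y)) \<in> S)))"
  have SB: "S \<subseteq> blocks" by (auto simp: S_def)
  have closed: "side b k \<in> tset" if "b \<in> S" "across b k \<notin> S" for b k
  proof (rule ccontr)
    assume nt: "side b k \<notin> tset"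
    have bB: "b \<in> blocks" using that SB by auto
    show False
    proof (cases "across b k \<in> blocks")
      case True
      then have r: "((N - 1, N - 1), across b k) \<in> rtrancl dual" using that by (auto simp: S_def)
      have "(across b k, b) \<in> dual" unfolding dual_def using True bB nt side_across[of b k] corner_mod[of "across b k" "k + 2"]
        by (auto intro!: exI[of _ "(k + 2) mod 4"])
      with r have "((N - 1, N - 1), b) \<in> rtrancl dual" by auto
      then show False using that by (simp add: S_def)
    next
      case False
      then have e: "side b k = (N - 1, N, True)" using boundary_tree bB nt by blast
      have "b = (N - 1, N - 1)"
      proof (rule mod4_cases[of k])
        assume "k mod 4 = 0"
        then show ?thesis using e bB False by (auto simp: side_def blocks_def Let_def)
      qed (use e in \<open>auto simp: side_def Let_def prod_eq_iff\<close>)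
      then show False using that by (simp add: S_def)
    qed
  qed
  have sep_tree: "e \<in> tset" if se: "sep e" for e
  proof -
    obtain x y h where e: "e = (x, y, h)" by (cases e)
    show ?thesis
    proof (cases h)
      case True
      then consider "(x, y) \<in> S" "(x, y - 1) \<notin> S" | "(x, y - 1) \<in> S" "(x, y) \<notin> S" using se e by (auto simp: sep_def)
      then show ?thesis
      proof cases
        case 1 then show ?thesis using closed[of "(x, y)" 0] True e by (simp add: across_def side_def)
      next
        case 2 then show ?thesis using closed[of "(x, y - 1)" 2] True e by (simp add: across_def side_def)
      qed
    next
      case False
      then consider "(x, y) \<in> S" "(x - 1, y) \<notin> S" | "(x - 1, y) \<in> S" "(x, y) \<notin> S" using se e by (auto simp: sep_def)
      then show ?thesis
      proof cases
        case 1 then show ?thesis using closed[of "(x, y)" 3] False e by (simp add: across_def side_def)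
      next
        case 2 then show ?thesis using closed[of "(x - 1, y)" 1] False e by (simp add: across_def side_def)
      qed
    qed
  qed
  define X where "X = {c \<in> cells - {(0, 0)}. sep (par_edge c)}"
  have finX: "finite X" by (simp add: X_def cells_def)
  \<comment> \<open>The right side of a block of \<open>S\<close> in the last occupied column is a
    separating edge.\<close>
  have "X \<noteq> {}"
  proof -
    have finS: "finite S" using SB by (rule finite_subset) (simp add: blocks_def)
    have "b \<in> S" using assms nb by (simp add: S_def)
    define x where "x = Max (fst ` S)"
    have "x \<in> fst ` S" unfolding x_def using finS \<open>b \<in> S\<close> by (intro Max_in) auto
    then obtain y where y: "(x, y) \<in> S" by force
    have "(x + 1, y) \<notin> S"
    proof
      assume "(x + 1, y) \<in> S"
      then have "x + 1 \<in> fst ` S" by force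
      then have "x + 1 \<le> x" unfolding x_def using finS by (intro Max_ge) auto
      then show False by simp
    qed
    then have "sep (x + 1, y, False)" using y by (simp add: sep_def)
    then have "(x + 1, y, False) \<in> tset" by (rule sep_tree)
    then show ?thesis using \<open>sep (x + 1, y, False)\<close> by (force simp: tset_def X_def)
  qed
  then have "Max (rk ` X) \<in> rk ` X" using finX by (intro Max_in) auto
  then obtain c where c0: "c \<in> X" "rk c = Max (rk ` X)" by (metis imageE)
  have c: "c \<in> X" "\<And>d. d \<in> X \<Longrightarrow> rk d \<le> rk c" using c0 finX by auto
  have cc: "c \<in> cells" "c \<noteq> (0, 0)" "sep (par_edge c)" using c by (auto simp: X_def)
  obtain x y where xy: "c = (x, y)" by (cases c)
  define star where "star = {(x, y, True), (x, y, False), (x - 1, y, True), (x, y - 1, False)}"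
  have "adj c (par c)" using par cc by (simp add: cells_def)
  then have pstar: "par_edge c \<in> star"
    by (cases rule: adj_cases) (auto simp: par_edge_def edge_between_def star_def xy)
  \<comment> \<open>By parity \<open>c\<close> has a second separating edge. It is not the one to
    the parent of \<open>c\<close>, so it leads to a child, which has greater rank.\<close>
  obtain e where e: "e \<in> star" "e \<noteq> par_edge c" "sep e"
  proof -
    have "sep (x, y, True) \<noteq> sep (x, y, False) \<longleftrightarrow> sep (x - 1, y, True) \<noteq> sep (x, y - 1, False)"
      by (auto simp: sep_def)
    from exists_other_of_four[OF pstar[unfolded star_def] _ cc(3) this] show thesis using that unfolding star_def by auto
  qed
  have "e \<in> tset" using sep_tree e by blast
  then obtain d where d: "d \<in> cells" "d \<noteq> (0, 0)" "e = par_edge d" by (auto simp: tset_def)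
  obtain c' where c': "adj c c'" "e = edge_between c c'"
  proof -
    have "\<exists>c'. adj c c' \<and> e = edge_between c c'"
      using e(1) unfolding star_def xy
      by (elim insertE emptyE; intro exI[of _ "(if e = (x, y, True) then (x + 1, y) else if e = (x, y, False) then (x, y + 1) else if e = (x - 1, y, True) then (x - 1, y) else (x, y - 1))"]) (auto simp: adj_def edge_between_def)
    then show thesis using that by blast
  qed
  have "c = d \<or> c = par d"
    using edge_between_eqD[OF c'(1), of d "par d"] par[of d] d c'(2) by (auto simp: par_edge_def cells_def)
  then have "c = par d" using d e by auto
  then have "rk c < rk d" using par d by (simp add: cells_def)
  moreover have "d \<in> X" using d e by (simp add: X_def)
  ultimately show False using c(2) by fastforce
qed

lemma boundary_St: "c \<in> cells \<Longrightarrow> c \<notin> {0<..<N} \<times> {0<..<N} \<Longrightarrow> St c = []"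
proof (induction "rk c" arbitrary: c rule: less_induct)
  case less
  show ?case
  proof (cases "c = (0, 0)")
    case True then show ?thesis by (simp add: rootSt)
  next
    case False
    obtain x y where xy: "c = (x, y)" by (cases c)
    have c: "c \<notin> U" using less.prems U by auto
    have p: "par c \<in> cells" "rk (par c) < rk c" using par[of c] less.prems False by (auto simp: cells_def)
    have "par c \<notin> {0<..<N} \<times> {0<..<N}"
      using less.prems(1,2) False bottom[of x] left[of y] right[of y] top[of x] unfolding xy cells_def
      by (cases "y = 0"; cases "x = 0"; cases "x = N"; cases "y = N") auto
    then have "St (par c) = []" using less.hyps[OF p(2) p(1)] by blast
    moreover have "St c = St (par c)" using nopush[of c] less.prems(1) c False unfolding cells_def by blast
    ultimately show ?thesis by simp
  qed
qed

lemma tree_side: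
  assumes "side b k \<in> tset"
  shows "\<exists>s. ok r (St (corner b k)) s \<and> out (St (corner b k)) s = St (corner b (Suc k)) \<and>
    pushed s = (if corner b (Suc k) \<in> U \<and> par (corner b (Suc k)) = corner b k then [hd (St (corner b (Suc k)))] else [])"
proof -
  define c where "c = corner b k"
  define d where "d = corner b (Suc k)"
  have U0: "(0, 0) \<notin> U" using U by auto
  have "c \<in> cells \<and> d \<in> cells \<and> (c \<noteq> (0, 0) \<and> par c = d \<or> d \<noteq> (0, 0) \<and> par d = c)"
    unfolding c_def d_def using treeD assms corner_adj side_edge by metis
  then consider "c \<in> cells" "d \<in> cells" "c \<noteq> (0, 0)" "par c = d" | "c \<in> cells" "d \<in> cells" "d \<noteq> (0, 0)" "par d = c" by blast
  then show ?thesis unfolding c_def[symmetric] d_def[symmetric]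
  proof cases
    case 1
    then have "rk d < rk c" using par by (auto simp: cells_def)
    then have n: "\<not> (d \<in> U \<and> par d = c)" using par[of d] 1 U0 unfolding cells_def by (metis less_asym)
    show "\<exists>s. ok r (St c) s \<and> out (St c) s = St d \<and> pushed s = (if d \<in> U \<and> par d = c then [hd (St d)] else [])"
    proof (cases "c \<in> U")
      case True
      then obtain v where "St c = v # St d" using push 1 by blast
      then show ?thesis using n by (intro exI[of _ "Pop Done"]) auto
    next
      case False
      then have "St c = St d" using nopush 1 by (auto simp: cells_def)
      then show ?thesis using n by (intro exI[of _ Done]) auto
    qed
  next
    case 2
    show "\<exists>s. ok r (St c) s \<and> out (St c) s = St d \<and> pushed s = (if d \<in> U \<and> par d = c then [hd (St d)] else [])"
    proof (cases "d \<in> U")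
      case True
      then obtain v where "St d = v # St c" using push 2 by blast
      then show ?thesis using True 2 lenSt[of d] by (intro exI[of _ "Push v Done"]) auto
    next
      case False
      then have "St d = St c" using nopush 2 by (auto simp: cells_def)
      then show ?thesis using False by (intro exI[of _ Done]) auto
    qed
  qed
qed

text \<open>Each block is entered across its side \<open>pk b\<close> and run through
  counterclockwise, from corner \<open>pk b + 1\<close> back to corner \<open>pk b\<close>. Each of
  its three other sides is either a tree edge, which is walked, or the entrance of a child in the
  dual tree, which is run through in its place; an \<open>Arc\<close> over every such side draws the
  chord between its two ends. The numbers of edges leave no third case.\<close>

theorem grid_term:
  "\<exists>t. ok r [] t \<and> out [] t = [] \<and> distinct (pushed t) \<and> set (pushed t) = (\<lambda>c. hd (St c)) ` U \<and>
     (\<forall>c\<in>cells. \<forall>d\<in>cells. adj c d \<longrightarrow> link (St c) (St d) \<subseteq> links [] t)"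
proof -
  define b0 where "b0 = (N - 1, N - 1)"
  have b0: "b0 \<in> blocks" using N by (simp add: b0_def blocks_def)
  have finB: "finite blocks" by (simp add: blocks_def)
  obtain bp and bk :: "cell \<Rightarrow> nat" where bp: "\<And>b. b \<in> blocks \<Longrightarrow> b \<notin> {b0} \<Longrightarrow>
      (bp b, b) \<in> dual \<and> bk (bp b) < bk b \<and> (\<exists>a\<in>{b0}. (a, bp b) \<in> rtrancl dual)"
    using bfs_tree[of blocks "{b0}" dual] dual_connected unfolding b0_def by (metis singletonI)
  \<comment> \<open>The root block is entered from the outer face, through the gap in the boundary,
    which is its upper side.\<close>
  have "\<exists>k<4. side b k \<notin> tset \<and> (if b = b0 then k = 2 else across b k = bp b)" if "b \<in> blocks" for b
  proof (cases "b = b0")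
    case True
    then show ?thesis using top_not_tree by (intro exI[of _ 2]) (simp add: b0_def side_def)
  next
    case False
    then have "(bp b, b) \<in> dual" using bp[of b] that by simp
    then obtain k where "b = across (bp b) k" "side (bp b) k \<notin> tset" by (auto simp: dual_def)
    then show ?thesis using side_across[of "bp b" k] False corner_mod[of b "k + 2"]
      by (intro exI[of _ "(k + 2) mod 4"]) auto
  qed
  then obtain pk where pk: "\<And>b. b \<in> blocks \<Longrightarrow> pk b < 4 \<and> side b (pk b) \<notin> tset \<and> (if b = b0 then pk b = 2 else across b (pk b) = bp b)"
    by metis
  define pe where "pe = (\<lambda>b. side b (pk b))"
  have shared: "b \<noteq> b0 \<and> bp b = b'" if "b \<in> blocks" "b' \<in> blocks" "b \<noteq> b'" "pe b = side b' l" for b b' l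
  proof -
    have a: "across b (pk b) = b'" using side_eq_across[of b "pk b" b' l] that by (simp add: pe_def)
    have "b \<noteq> b0"
    proof
      assume "b = b0"
      then have "b' = (N - 1, N)" using a pk[OF that(1)] by (simp add: across_def b0_def)
      then show False using that by (simp add: blocks_def)
    qed
    then show ?thesis using a pk[OF that(1)] by simp
  qed
  have pe_inj: "inj_on pe blocks"
  proof (rule inj_onI, rule ccontr)
    fix b b' assume *: "b \<in> blocks" "b' \<in> blocks" "pe b = pe b'" "b \<noteq> b'"
    have "b \<noteq> b0 \<and> bp b = b'" using shared[of b b' "pk b'"] * by (simp add: pe_def)
    moreover have "b' \<noteq> b0 \<and> bp b' = b" using shared[of b' b "pk b"] * by (simp add: pe_def)
    ultimately show False using bp[of b] bp[of b'] * by auto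
  qed
  have side_edges: "side b k \<in> edges" if "b \<in> blocks" for b k
    using that by (rule_tac mod4_cases[of k]) (auto simp: blocks_def side_def edges_def Let_def image_iff)
  \<comment> \<open>Tree edges and entrances are disjoint, and their numbers add up to the number of
    all edges.\<close>
  have all: "edges = tset \<union> pe ` blocks"
  proof (rule sym, rule card_seteq)
    show "finite edges" by (simp add: edges_def)
    show "tset \<union> pe ` blocks \<subseteq> edges" using tree_edges side_edges by (auto simp: pe_def)
    have "tset \<inter> pe ` blocks = {}" using pk by (auto simp: pe_def)
    moreover have "finite tset" using tree_edges finite_subset \<open>finite edges\<close> by blast
    ultimately have "card (tset \<union> pe ` blocks) = nat (N * N + 2 * N) + nat N * nat N"
      using finB card_image[OF pe_inj] by (subst card_Un_disjoint) (auto simp: card_tree blocks_def)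
    also have "\<dots> = card edges" unfolding card_edges using N by (simp add: algebra_simps flip: nat_mult_distrib nat_add_distrib)
    finally show "card edges \<le> card (tset \<union> pe ` blocks)" by simp
  qed
  have child: "across b k \<in> blocks \<and> across b k \<noteq> b0 \<and> bp (across b k) = b \<and> pk (across b k) = (k + 2) mod 4 \<and> bk b < bk (across b k)"
    if b: "b \<in> blocks" and k: "k mod 4 \<noteq> pk b" and nt: "side b k \<notin> tset" for b k
  proof -
    obtain b' where b': "b' \<in> blocks" "side b k = pe b'" using all side_edges[OF b, of k] nt by auto
    have "b' \<noteq> b" using b'(2) side_inj[of b k "pk b"] k pk[OF b] by (auto simp: pe_def)
    then have s: "b' \<noteq> b0 \<and> bp b' = b" using shared[of b' b k] b b' by simp
    have "across b k = b' \<and> pk b' mod 4 = (k + 2) mod 4" using side_eq_across[of b k b' "pk b'"] b' \<open>b' \<noteq> b\<close> by (auto simp: pe_def)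
    then show ?thesis using s b' pk[OF b'(1)] bp[OF b'(1)] by auto
  qed
  \<comment> \<open>\<open>C\<close> is the relation from parent to child in the dual tree, and
    \<open>W b\<close> consists of the blocks run through on behalf of \<open>b\<close>, itself
    included.\<close>
  define C where "C = {(b, b'). b' \<in> blocks \<and> b' \<noteq> b0 \<and> bp b' = b}"
  define W where "W = (\<lambda>b. {b'. (b, b') \<in> rtrancl C})"
  have Cbk: "bk b \<le> bk b'" if "(b, b') \<in> rtrancl C" for b b'
    using that by (induction rule: rtrancl_induct) (use bp in \<open>force simp: C_def\<close>)+
  have svC: "single_valued (converse C)" by (auto simp: single_valued_def C_def)
  have Wdisj: "W b1 \<inter> W b2 = {}" if "(b, b1) \<in> C" "(b, b2) \<in> C" "b1 \<noteq> b2" for b b1 b2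
  proof -
    have no: "(x, y) \<notin> rtrancl C" if xy: "(b, x) \<in> C" "(b, y) \<in> C" "x \<noteq> y" for x y
    proof
      assume "(x, y) \<in> rtrancl C"
      then obtain z where z: "(x, z) \<in> rtrancl C" "(z, y) \<in> C" using xy(3) by (metis rtranclE)
      then have "z = b" using that(2) by (simp add: C_def)
      then have "bk x \<le> bk b" using Cbk z by blast
      moreover have "bk b < bk x" using that(1) bp[of x] by (auto simp: C_def)
      ultimately show False by simp
    qed
    show ?thesis
    proof (rule ccontr)
      assume "W b1 \<inter> W b2 \<noteq> {}"
      then obtain x where "(b1, x) \<in> rtrancl C" "(b2, x) \<in> rtrancl C" by (auto simp: W_def)
      then have "(x, b1) \<in> rtrancl (converse C)" "(x, b2) \<in> rtrancl (converse C)" by (simp_all add: rtrancl_converse)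
      from single_valued_confluent[OF svC this] have "(b2, b1) \<in> rtrancl C \<or> (b1, b2) \<in> rtrancl C"
        by (auto simp: rtrancl_converse)
      then show False using no that by blast
    qed
  qed
  \<comment> \<open>The block whose walk contains the step from \<open>par c\<close> to
    \<open>c\<close>, and hence the place where the vertex of \<open>c\<close> is pushed.\<close>
  define db where "db = (\<lambda>c. dart_block (par c) c)"
  have Ucell: "c \<in> cells" "c \<noteq> (0, 0)" if "c \<in> U" for c using U that by (auto simp: cells_def)
  have db: "\<exists>k<4. corner (db c) k = par c \<and> corner (db c) (Suc k) = c" if "c \<in> U" for c
    unfolding db_def using dart_block par[of c] Ucell[OF that] adj_sym by (auto simp: cells_def)
  have db_eq: "db c = b \<and> side b k \<in> tset" if "c \<in> U" "par c = corner b k" "c = corner b (Suc k)" for b k c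
  proof
    show "db c = b" using db[OF that(1)] dart_block_unique[of "db c" _ b k] that by metis
    show "side b k \<in> tset" using par_in_tree[OF Ucell[OF that(1)]] that(2,3) side_edge[of b k] edge_between_commute by metis
  qed
  have dbB: "db c \<in> blocks" if "c \<in> U" for c
  proof -
    have c: "0 < fst c" "fst c < N" "0 < snd c" "snd c < N" using U that by auto
    have "adj (par c) c" using par[of c] Ucell[OF that] adj_sym by (auto simp: cells_def)
    then show ?thesis
      by (cases rule: adj_cases) (use c in \<open>auto simp: db_def dart_block_def blocks_def prod_eq_iff mem_Times_iff\<close>)
  qed
  define goal where "goal = (\<lambda>b t. ok r (St (corner b (pk b + 1))) t \<and>
     out (St (corner b (pk b + 1))) t = St (corner b (pk b)) \<and> distinct (pushed t) \<and>
     set (pushed t) = (\<lambda>c. hd (St c)) ` {c \<in> U. db c \<in> W b} \<and>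
     (\<forall>b'\<in>W b. \<forall>k<4. k \<noteq> pk b' \<longrightarrow> link (St (corner b' k)) (St (corner b' (Suc k))) \<subseteq> links (St (corner b (pk b + 1))) t))"
  \<comment> \<open>Ranks grow away from the root, so \<open>M - bk b\<close> serves for an
    induction from the leaves of the dual tree.\<close>
  define M where "M = Max (bk ` blocks)"
  have "\<exists>t. goal b t" if "b \<in> blocks" for b
    using that
  proof (induction "M - bk b" arbitrary: b rule: less_induct)
    case less
    note b = less.prems
    define A where "A = (\<lambda>k. if side b k \<in> tset then {c \<in> U. par c = corner b k \<and> c = corner b (Suc k)}
       else {c \<in> U. db c \<in> W (across b k)})"
    have AU: "A k \<subseteq> U" for k by (auto simp: A_def)
    define good where "good = (\<lambda>k s. ok r (St (corner b k)) s \<and> out (St (corner b k)) s = St (corner b (Suc k)) \<and> distinct (pushed s) \<and>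
        set (pushed s) = (\<lambda>c. hd (St c)) ` A k \<and>
        (side b k \<notin> tset \<longrightarrow> (\<forall>b'\<in>W (across b k). \<forall>l<4. l \<noteq> pk b' \<longrightarrow>
           link (St (corner b' l)) (St (corner b' (Suc l))) \<subseteq> links (St (corner b k)) s)))"
    have ex: "\<exists>s. good k s"
      if k: "k mod 4 \<noteq> pk b" for k
    proof (cases "side b k \<in> tset")
      case True
      obtain s where s: "ok r (St (corner b k)) s" "out (St (corner b k)) s = St (corner b (Suc k))"
        "pushed s = (if corner b (Suc k) \<in> U \<and> par (corner b (Suc k)) = corner b k then [hd (St (corner b (Suc k)))] else [])"
        using tree_side[OF True] by blast
      have "A k = (if corner b (Suc k) \<in> U \<and> par (corner b (Suc k)) = corner b k then {corner b (Suc k)} else {})"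
        using True by (auto simp: A_def)
      then show ?thesis using s True unfolding good_def by (intro exI[of _ s]) simp
    next
      case False
      let ?b = "across b k"
      have ch: "?b \<in> blocks" "pk ?b = (k + 2) mod 4" "bk b < bk ?b" using child[OF b k False] by auto
      have "bk ?b \<le> M" unfolding M_def using ch(1) finB by auto
      then have "M - bk ?b < M - bk b" using ch(3) by simp
      then obtain s where s: "goal ?b s" using less.hyps ch(1) by blast
      have "(pk ?b + 1) mod 4 = Suc (k + 2) mod 4" unfolding ch(2) by (simp add: mod_simps)
      then have c1: "corner ?b (pk ?b + 1) = corner b k" using corner_cong corner_across(2) by metis
      have c2: "corner ?b (pk ?b) = corner b (Suc k)"
        unfolding ch(2) corner_mod(1) by (rule corner_across(1))
      have "A k = {c \<in> U. db c \<in> W ?b}" using False by (simp add: A_def)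
      then show ?thesis using s[unfolded goal_def c1 c2] unfolding good_def by (intro exI[of _ s]) simp
    qed
    \<comment> \<open>The three sides other than the entrance in counterclockwise order, with
      indices modulo 4.\<close>
    define k1 where "k1 = pk b + 1" define k2 where "k2 = pk b + 2" define k3 where "k3 = pk b + 3"
    have p4: "pk b < 4" using pk[OF b] by simp
    have p4': "pk b = 0 \<or> pk b = 1 \<or> pk b = 2 \<or> pk b = 3" using p4 by linarith
    have ks: "k1 mod 4 \<noteq> pk b" "k2 mod 4 \<noteq> pk b" "k3 mod 4 \<noteq> pk b" "k1 mod 4 \<noteq> k2 mod 4" "k1 mod 4 \<noteq> k3 mod 4" "k2 mod 4 \<noteq> k3 mod 4"
      using p4' unfolding k1_def k2_def k3_def by (elim disjE; simp)+
    have kall: "k mod 4 = k1 mod 4 \<or> k mod 4 = k2 mod 4 \<or> k mod 4 = k3 mod 4" if kk: "k mod 4 \<noteq> pk b" for k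
      unfolding k1_def k2_def k3_def by (rule mod4_cases[of k]; insert p4' kk; elim disjE; simp)
    have kS: "Suc k1 = k2" "Suc k2 = k3" "corner b (Suc k3) = corner b (pk b)"
      unfolding k1_def k2_def k3_def by (auto intro: corner_cong)
    obtain s1 where g1: "good k1 s1" using ex[OF ks(1)] by blast
    have s1: "ok r (St (corner b k1)) s1" "out (St (corner b k1)) s1 = St (corner b k2)" "distinct (pushed s1)"
        "set (pushed s1) = (\<lambda>c. hd (St c)) ` A k1"
        "side b k1 \<notin> tset \<longrightarrow> (\<forall>b'\<in>W (across b k1). \<forall>l<4. l \<noteq> pk b' \<longrightarrow>
           link (St (corner b' l)) (St (corner b' (Suc l))) \<subseteq> links (St (corner b k1)) s1)"
      using g1 unfolding good_def kS by simp_all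
    obtain s2 where g2: "good k2 s2" using ex[OF ks(2)] by blast
    have s2: "ok r (St (corner b k2)) s2" "out (St (corner b k2)) s2 = St (corner b k3)" "distinct (pushed s2)"
        "set (pushed s2) = (\<lambda>c. hd (St c)) ` A k2"
        "side b k2 \<notin> tset \<longrightarrow> (\<forall>b'\<in>W (across b k2). \<forall>l<4. l \<noteq> pk b' \<longrightarrow>
           link (St (corner b' l)) (St (corner b' (Suc l))) \<subseteq> links (St (corner b k2)) s2)"
      using g2 unfolding good_def kS by simp_all
    obtain s3 where g3: "good k3 s3" using ex[OF ks(3)] by blast
    have s3: "ok r (St (corner b k3)) s3" "out (St (corner b k3)) s3 = St (corner b (pk b))" "distinct (pushed s3)"
        "set (pushed s3) = (\<lambda>c. hd (St c)) ` A k3"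
        "side b k3 \<notin> tset \<longrightarrow> (\<forall>b'\<in>W (across b k3). \<forall>l<4. l \<noteq> pk b' \<longrightarrow>
           link (St (corner b' l)) (St (corner b' (Suc l))) \<subseteq> links (St (corner b k3)) s3)"
      using g3 unfolding good_def kS by simp_all
    define t where "t = Arc s1 (Arc s2 (Arc s3 Done))"
    have childC: "(b, across b k) \<in> C" if "k mod 4 \<noteq> pk b" "side b k \<notin> tset" for k
      using child[OF b that] by (auto simp: C_def)
    have Adisj: "A k \<inter> A l = {}" if kl: "k mod 4 \<noteq> pk b" "l mod 4 \<noteq> pk b" "k mod 4 \<noteq> l mod 4" for k l
    proof -
      have tn: "A k \<inter> A l = {}" if "side b k \<in> tset" "side b l \<notin> tset" "l mod 4 \<noteq> pk b" for k l
      proof -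
        have dbb: "db c = b" if "c \<in> A k" for c using that db_eq[of c b k] \<open>side b k \<in> tset\<close> by (auto simp: A_def)
        have nb: "b \<notin> W (across b l)"
        proof
          assume "b \<in> W (across b l)"
          then have "bk (across b l) \<le> bk b" using Cbk by (simp add: W_def)
          then show False using child[OF b that(3,2)] by simp
        qed
        have "db c \<in> W (across b l)" if "c \<in> A l" for c using that \<open>side b l \<notin> tset\<close> by (simp add: A_def)
        then show ?thesis using dbb nb by (metis Int_iff equals0I)
      qed
      consider "side b k \<in> tset" "side b l \<in> tset" | "side b k \<in> tset" "side b l \<notin> tset" | "side b k \<notin> tset" "side b l \<in> tset"
        | "side b k \<notin> tset" "side b l \<notin> tset" by blast
      then show ?thesis
      proof cases
        case 1
        have "k mod 4 = l mod 4" if "c \<in> A k" "c \<in> A l" for c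
        proof -
          have "par c = corner b k \<and> c = corner b (Suc k)" "par c = corner b l \<and> c = corner b (Suc l)"
            using that 1 by (auto simp: A_def)
          then show ?thesis using dart_block_unique[of b k b l] by metis
        qed
        then show ?thesis using kl(3) by blast
      next
        case 2 then show ?thesis using tn kl by blast
      next
        case 3 then show ?thesis using tn[of l k] kl by blast
      next
        case 4
        have "across b k \<noteq> across b l"
          using child[OF b kl(1) 4(1)] child[OF b kl(2) 4(2)] kl(3)
          by (rule_tac mod4_cases[of k]; rule_tac mod4_cases[of l]) (auto simp: mod_Suc)
        then have "W (across b k) \<inter> W (across b l) = {}" using Wdisj childC kl 4 by blast
        moreover have "A k = {c \<in> U. db c \<in> W (across b k)}" "A l = {c \<in> U. db c \<in> W (across b l)}"
          using 4 by (simp_all add: A_def)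
        ultimately show ?thesis by blast
      qed
    qed
    have Wsplit: "x = b \<or> (\<exists>k. k mod 4 \<noteq> pk b \<and> side b k \<notin> tset \<and> x \<in> W (across b k))" if "x \<in> W b" for x
    proof (cases "x = b")
      case False
      then obtain b' where b': "(b, b') \<in> C" "(b', x) \<in> rtrancl C"
        using \<open>x \<in> W b\<close> converse_rtranclE[of b x C] unfolding W_def by (metis mem_Collect_eq)
      then have bb: "b' \<in> blocks" "b' \<noteq> b0" "bp b' = b" by (auto simp: C_def)
      then have a: "across b' (pk b') = b" "side b' (pk b') \<notin> tset" using pk by (metis, metis)
      have sa: "side b (pk b' + 2) = pe b'" "across b (pk b' + 2) = b'" using side_across[of b' "pk b'"] a by (auto simp: pe_def)
      have "b \<noteq> b'" using bp[of b'] bb by auto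
      then have "pe b \<noteq> pe b'" using pe_inj b bb(1) by (metis inj_onD)
      then have "(pk b' + 2) mod 4 \<noteq> pk b" using sa corner_mod(2)[of b "pk b' + 2"] by (auto simp: pe_def)
      then show ?thesis using sa a b' by (auto simp: W_def pe_def intro!: exI[of _ "pk b' + 2"])
    qed simp
    have Acong: "A k = A l" if "k mod 4 = l mod 4" for k l
    proof -
      have "Suc k mod 4 = Suc l mod 4" using that by (metis mod_Suc_eq)
      then have "corner b k = corner b l" "corner b (Suc k) = corner b (Suc l)" using that by (auto intro: corner_cong)
      moreover have "side b k = side b l" "across b k = across b l" using that corner_mod(2,3) by metis+
      ultimately show ?thesis by (simp add: A_def)
    qed
    have Aall: "{c \<in> U. db c \<in> W b} = A k1 \<union> A k2 \<union> A k3"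
    proof
      show "A k1 \<union> A k2 \<union> A k3 \<subseteq> {c \<in> U. db c \<in> W b}"
      proof -
        have "A k \<subseteq> {c \<in> U. db c \<in> W b}" if k: "k mod 4 \<noteq> pk b" for k
        proof (cases "side b k \<in> tset")
          case True
          then show ?thesis using db_eq[of _ b k] by (auto simp: A_def W_def)
        next
          case False
          then have "(b, across b k) \<in> C" using childC k by blast
          then show ?thesis using False by (auto simp: A_def W_def intro: converse_rtrancl_into_rtrancl)
        qed
        then show ?thesis using ks by blast
      qed
      show "{c \<in> U. db c \<in> W b} \<subseteq> A k1 \<union> A k2 \<union> A k3"
      proof
        fix c assume c: "c \<in> {c \<in> U. db c \<in> W b}"
        have "\<exists>k. k mod 4 \<noteq> pk b \<and> c \<in> A k"
        proof (cases "db c = b")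
          case True
          have cU: "c \<in> U" using c by blast
          obtain k where k0: "corner (db c) k = par c" "corner (db c) (Suc k) = c" using db[OF cU] by blast
          note k = k0[unfolded True]
          have t: "side b k \<in> tset" using db_eq[OF cU k(1)[symmetric] k(2)[symmetric]] by blast
          have "k mod 4 \<noteq> pk b"
          proof
            assume "k mod 4 = pk b"
            then have "side b (pk b) = side b k" using corner_mod(2)[of b k] by simp
            then show False using pk[OF b] t by simp
          qed
          moreover have "c \<in> A k" by (simp add: A_def t k cU)
          ultimately show ?thesis by blast
        next
          case False
          have cU: "c \<in> U" "db c \<in> W b" using c by blast+
          obtain k where k: "k mod 4 \<noteq> pk b" "side b k \<notin> tset" "db c \<in> W (across b k)" using Wsplit[OF cU(2)] False by blast
          then have "c \<in> A k" by (simp add: A_def cU)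
          then show ?thesis using k(1) by blast
        qed
        then obtain k where "k mod 4 \<noteq> pk b" "c \<in> A k" by blast
        then show "c \<in> A k1 \<union> A k2 \<union> A k3" using kall[of k] Acong[of k] by blast
      qed
    qed
    have lt: "links (St (corner b k1)) t = link (St (corner b k1)) (St (corner b k2)) \<union> links (St (corner b k1)) s1 \<union>
       (link (St (corner b k2)) (St (corner b k3)) \<union> links (St (corner b k2)) s2 \<union>
        (link (St (corner b k3)) (St (corner b (pk b))) \<union> links (St (corner b k3)) s3))"
      unfolding t_def by (simp add: s1 s2 s3)
    have lk: "link (St (corner b k)) (St (corner b (Suc k))) \<subseteq> links (St (corner b k1)) t" if "k mod 4 \<noteq> pk b" for k
    proof -
      have e: "link (St (corner b k)) (St (corner b (Suc k))) = link (St (corner b l)) (St (corner b (Suc l)))" if "k mod 4 = l mod 4" for l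
      proof -
        have "Suc k mod 4 = Suc l mod 4" using that by (metis mod_Suc_eq)
        then show ?thesis using corner_cong[of k l b] corner_cong[of "Suc k" "Suc l" b] that by simp
      qed
      have "link (St (corner b k1)) (St (corner b (Suc k1))) \<subseteq> links (St (corner b k1)) t"
        "link (St (corner b k2)) (St (corner b (Suc k2))) \<subseteq> links (St (corner b k1)) t"
        "link (St (corner b k3)) (St (corner b (Suc k3))) \<subseteq> links (St (corner b k1)) t"
        unfolding lt kS by blast+
      then show ?thesis using kall[OF that] e by metis
    qed
    have "goal b t"
      unfolding goal_def
    proof (intro conjI ballI allI impI)
      show "ok r (St (corner b (pk b + 1))) t" unfolding k1_def[symmetric] t_def by (simp add: s1 s2 s3)
      show "out (St (corner b (pk b + 1))) t = St (corner b (pk b))" unfolding k1_def[symmetric] t_def by (simp add: s1 s2 s3)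
      have im: "(\<lambda>c. hd (St c)) ` A k \<inter> (\<lambda>c. hd (St c)) ` A l = {}" if "A k \<inter> A l = {}" for k l
        using that inj_on_image_Int[OF injU AU[of k] AU[of l]] by simp
      show "distinct (pushed t)" unfolding t_def using s1(3,4) s2(3,4) s3(3,4) im[OF Adisj[OF ks(1,2,4)]] im[OF Adisj[OF ks(1,3,5)]] im[OF Adisj[OF ks(2,3,6)]]
        by (simp add: Int_Un_distrib)
      show "set (pushed t) = (\<lambda>c. hd (St c)) ` {c \<in> U. db c \<in> W b}" unfolding t_def Aall by (auto simp: s1 s2 s3)
      fix b' l assume bl: "b' \<in> W b" "l < 4" "l \<noteq> pk b'"
      show "link (St (corner b' l)) (St (corner b' (Suc l))) \<subseteq> links (St (corner b (pk b + 1))) t"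
        unfolding k1_def[symmetric]
      proof (cases "b' = b")
        case True
        then show "link (St (corner b' l)) (St (corner b' (Suc l))) \<subseteq> links (St (corner b k1)) t" using lk[of l] bl by simp
      next
        case False
        then obtain k where k: "k mod 4 \<noteq> pk b" "side b k \<notin> tset" "b' \<in> W (across b k)" using Wsplit bl by blast
        have mc: "side b k = side b l" "across b k = across b l" if "k mod 4 = l mod 4" for l using corner_mod that by metis+
        show "link (St (corner b' l)) (St (corner b' (Suc l))) \<subseteq> links (St (corner b k1)) t"
          using kall[OF k(1)]
        proof (elim disjE)
          assume "k mod 4 = k1 mod 4" from mc[OF this] k(2,3)
          have "side b k1 \<notin> tset" "b' \<in> W (across b k1)" by simp_all
          then have "link (St (corner b' l)) (St (corner b' (Suc l))) \<subseteq> links (St (corner b k1)) s1" using s1(5) bl(2,3) by blast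
          then show ?thesis unfolding lt by blast
        next
          assume "k mod 4 = k2 mod 4" from mc[OF this] k(2,3)
          have "side b k2 \<notin> tset" "b' \<in> W (across b k2)" by simp_all
          then have "link (St (corner b' l)) (St (corner b' (Suc l))) \<subseteq> links (St (corner b k2)) s2" using s2(5) bl(2,3) by blast
          then show ?thesis unfolding lt by blast
        next
          assume "k mod 4 = k3 mod 4" from mc[OF this] k(2,3)
          have "side b k3 \<notin> tset" "b' \<in> W (across b k3)" by simp_all
          then have "link (St (corner b' l)) (St (corner b' (Suc l))) \<subseteq> links (St (corner b k3)) s3" using s3(5) bl(2,3) by blast
          then show ?thesis unfolding lt by blast
        qed
      qed
    qed
    then show ?case by blast
  qed
  then obtain t where t: "goal b0 t" using b0 by blast
  have p0: "pk b0 = 2" using pk[OF b0] by simp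
  have W0: "b \<in> W b0" if "b \<in> blocks" for b
    using that
  proof (induction "bk b" arbitrary: b rule: less_induct)
    case less
    show ?case
    proof (cases "b = b0")
      case True then show ?thesis by (simp add: W_def)
    next
      case False
      then have "bk (bp b) < bk b" "bp b \<in> blocks" using bp[of b] less.prems by (auto simp: dual_def)
      then have "bp b \<in> W b0" using less.hyps by blast
      moreover have "(bp b, b) \<in> C" using False less.prems by (simp add: C_def)
      ultimately show ?thesis by (auto simp: W_def)
    qed
  qed
  have e1: "St (corner b0 (pk b0 + 1)) = []" "St (corner b0 (pk b0)) = []"
    using N unfolding p0 by (auto intro!: boundary_St simp: corner_def b0_def cells_def)
  have tp: "ok r [] t" "out [] t = []" "distinct (pushed t)" "set (pushed t) = (\<lambda>c. hd (St c)) ` {c \<in> U. db c \<in> W b0}"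
    and tl: "\<forall>b'\<in>W b0. \<forall>k<4. k \<noteq> pk b' \<longrightarrow> link (St (corner b' k)) (St (corner b' (Suc k))) \<subseteq> links [] t"
  proof -
    note T = t[unfolded goal_def e1]
    show "ok r [] t" "out [] t = []" "distinct (pushed t)" "set (pushed t) = (\<lambda>c. hd (St c)) ` {c \<in> U. db c \<in> W b0}"
      "\<forall>b'\<in>W b0. \<forall>k<4. k \<noteq> pk b' \<longrightarrow> link (St (corner b' k)) (St (corner b' (Suc k))) \<subseteq> links [] t"
      by (rule T[THEN conjunct1] T[THEN conjunct2, THEN conjunct1] T[THEN conjunct2, THEN conjunct2, THEN conjunct1]
        T[THEN conjunct2, THEN conjunct2, THEN conjunct2, THEN conjunct1] T[THEN conjunct2, THEN conjunct2, THEN conjunct2, THEN conjunct2])+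
  qed
  have lks: "link (St c) (St d) \<subseteq> links [] t" if cd: "c \<in> cells" "d \<in> cells" "adj c d" for c d
  proof (cases "St c = [] \<or> St d = []")
    case True then show ?thesis by (auto simp: link_def)
  next
    case False
    \<comment> \<open>A point with a nonempty stack is not on the boundary, so the edge has a block
      on either side. It is the entrance of at most one of them, and the other one draws the
      chord.\<close>
    have cint: "c \<in> {0<..<N} \<times> {0<..<N}" using boundary_St cd(1) False by blast
    have lsym: "link P Q = link Q P" for P Q :: "'v list" by (auto simp: link_def)
    have inB: "dart_block c d \<in> blocks" "dart_block d c \<in> blocks"
      using cd(3) cint by (cases rule: adj_cases; auto simp: dart_block_def blocks_def mem_Times_iff prod_eq_iff)+
    obtain k where k: "k < 4" "corner (dart_block c d) k = c" "corner (dart_block c d) (Suc k) = d" using dart_block[OF cd(3)] by blast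
    obtain l where l: "l < 4" "corner (dart_block d c) l = d" "corner (dart_block d c) (Suc l) = c"
      using dart_block[OF adj_sym[OF cd(3)]] by blast
    have ne: "dart_block c d \<noteq> dart_block d c"
      using cd(3) by (cases rule: adj_cases) (auto simp: dart_block_def prod_eq_iff)
    have se: "side (dart_block c d) k = side (dart_block d c) l" using side_edge k l edge_between_commute by metis
    have "k \<noteq> pk (dart_block c d) \<or> l \<noteq> pk (dart_block d c)"
    proof (rule ccontr)
      assume "\<not> ?thesis"
      then have kl: "k = pk (dart_block c d)" "l = pk (dart_block d c)" by blast+
      have "pe (dart_block c d) = pe (dart_block d c)" unfolding pe_def using se[unfolded kl] .
      then show False using pe_inj inB ne by (metis inj_onD)
    qed
    then show ?thesis
    proof
      assume "k \<noteq> pk (dart_block c d)"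
      then have "link (St (corner (dart_block c d) k)) (St (corner (dart_block c d) (Suc k))) \<subseteq> links [] t"
        by (rule tl[rule_format, OF W0[OF inB(1)] k(1)])
      then show ?thesis by (simp only: k(2,3))
    next
      assume "l \<noteq> pk (dart_block d c)"
      then have "link (St (corner (dart_block d c) l)) (St (corner (dart_block d c) (Suc l))) \<subseteq> links [] t"
        by (rule tl[rule_format, OF W0[OF inB(2)] l(1)])
      then show ?thesis using lsym[of "St c" "St d"] by (simp only: l(2,3))
    qed
  qed
  have inW: "\<And>c. c \<in> U \<Longrightarrow> db c \<in> W b0" by (rule W0[OF dbB])
  have Ueq: "{c \<in> U. db c \<in> W b0} = U"
  proof (rule equalityI; rule subsetI)
    fix c assume "c \<in> U"
    then show "c \<in> {c \<in> U. db c \<in> W b0}" using inW[of c] by (simp only: mem_Collect_eq)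
  qed (erule CollectE, erule conjunct1)
  note sp = tp(4)[unfolded Ueq]
  show ?thesis
  proof (intro exI[of _ t] conjI ballI impI)
    show "ok r [] t" "out [] t = []" "distinct (pushed t)" by (rule tp)+
    show "set (pushed t) = (\<lambda>c. hd (St c)) ` U" by (rule sp)
    show "link (St c) (St d) \<subseteq> links [] t" if "c \<in> cells" "d \<in> cells" "adj c d" for c d
      by (rule lks[OF that])
  qed
qed

end

section \<open>Labelled grids\<close>

fun level :: "('v \<Rightarrow> nat) \<Rightarrow> 'v option \<Rightarrow> nat" where
  "level lev None = 0"
| "level lev (Some v) = lev v"

text \<open>The root path of a label, with the number of steps as fuel. By
  \<open>stack_of_fuel\<close> the level of the label is fuel enough.\<close>

fun stack_of :: "('v \<Rightarrow> 'v option) \<Rightarrow> nat \<Rightarrow> 'v option \<Rightarrow> 'v list" where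
  "stack_of pl n None = []"
| "stack_of pl 0 (Some v) = []"
| "stack_of pl (Suc n) (Some v) = v # stack_of pl n (pl v)"

lemma stack_of_fuel:
  assumes "\<And>v. v \<in> V \<Longrightarrow> level lev (pl v) < lev v \<and> set_option (pl v) \<subseteq> V"
  shows "set_option l \<subseteq> V \<Longrightarrow> level lev l \<le> n \<Longrightarrow> level lev l \<le> m \<Longrightarrow> stack_of pl n l = stack_of pl m l"
proof (induction n arbitrary: l m)
  case 0
  then show ?case using assms by (cases l) fastforce+
next
  case (Suc n)
  show ?case
  proof (cases l)
    case (Some v)
    then have a: "level lev (pl v) < lev v" "set_option (pl v) \<subseteq> V" using assms[of v] Suc.prems by auto
    then obtain k where "m = Suc k" using Suc.prems Some by (cases m) auto
    then show ?thesis using Suc.IH[of "pl v" k] a Suc.prems Some by simp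
  qed simp
qed

lemma length_stack_of: "length (stack_of pl n l) \<le> n"
  by (induction pl n l rule: stack_of.induct) auto

definition boundary_par :: "int \<Rightarrow> cell \<Rightarrow> cell" where
  "boundary_par N c = (if snd c = 0 then (fst c - 1, 0) else if fst c = 0 \<or> fst c = N then (fst c, snd c - 1)
     else (fst c - 1, snd c))"

text \<open>Every vertex \<open>v\<close> chooses a cell \<open>rc v\<close> of its region next to a
  cell \<open>rp v\<close> of lower level; the label of \<open>rp v\<close>, if there is one,
  becomes the parent of \<open>v\<close> in the forest. Breadth-first trees inside the regions
  together with these steps form the spanning tree required by \<open>grid_tree\<close>, and the
  walk pushes \<open>v\<close> when it enters the region through \<open>rc v\<close>.\<close>

lemma labels_to_term:
  fixes lab :: "cell \<Rightarrow> 'v option" and N :: int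
  defines "C \<equiv> {0..N} \<times> {0..N}" and "I \<equiv> {0<..<N} \<times> {0<..<N}"
  assumes N: "N \<ge> 1"
    and bd: "\<And>c. c \<in> C \<Longrightarrow> c \<notin> I \<Longrightarrow> lab c = None"
    and labV: "\<And>c v. c \<in> C \<Longrightarrow> lab c = Some v \<Longrightarrow> v \<in> V"
    and conn: "\<And>c d. c \<in> C \<Longrightarrow> d \<in> C \<Longrightarrow> lab c \<noteq> None \<Longrightarrow> lab c = lab d \<Longrightarrow>
        (c, d) \<in> rtrancl {(a, b). a \<in> C \<and> b \<in> C \<and> adj a b \<and> lab a = lab b}"
    and zero: "\<And>c. c \<in> C \<Longrightarrow> lab c = None \<Longrightarrow>
        \<exists>a. a \<in> C \<and> a \<notin> I \<and> (a, c) \<in> rtrancl {(a, b). a \<in> C \<and> b \<in> C \<and> adj a b \<and> lab a = lab b}"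
    and lev: "\<And>v. v \<in> V \<Longrightarrow> lev v \<le> r \<and> (\<exists>c d. c \<in> C \<and> d \<in> C \<and> adj c d \<and> lab c = Some v \<and> level lev (lab d) < lev v)"
  shows "\<exists>t. ok r [] t \<and> out [] t = [] \<and> distinct (pushed t) \<and> set (pushed t) = V \<and>
     (\<forall>c\<in>C. \<forall>d\<in>C. \<forall>u w. adj c d \<longrightarrow> lab c = Some u \<longrightarrow> lab d = Some w \<longrightarrow> (u, w) \<in> links [] t)"
proof -
  define R where "R = {(a, b). a \<in> C \<and> b \<in> C \<and> adj a b \<and> lab a = lab b}"
  have "\<exists>c d. c \<in> C \<and> d \<in> C \<and> adj c d \<and> lab c = Some v \<and> level lev (lab d) < lev v" if "v \<in> V" for v
    using lev[OF that] by blast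
  then obtain rc rp where rt: "\<And>v. v \<in> V \<Longrightarrow> rc v \<in> C \<and> rp v \<in> C \<and> adj (rc v) (rp v) \<and> lab (rc v) = Some v \<and> level lev (lab (rp v)) < lev v"
    by metis
  define A where "A = (C - I) \<union> rc ` V"
  have reach: "\<exists>a\<in>A. (a, c) \<in> rtrancl R" if c: "c \<in> C" for c
  proof (cases "lab c")
    case None
    then obtain a where "a \<in> C" "a \<notin> I" "(a, c) \<in> rtrancl R" using zero[OF c] unfolding R_def by blast
    then show ?thesis unfolding A_def by blast
  next
    case (Some v)
    then have v: "v \<in> V" using labV c by blast
    then have "(rc v, c) \<in> rtrancl R" unfolding R_def using rt[OF v] Some by (intro conn) (simp_all add: c)
    then show ?thesis unfolding A_def using v by blast
  qed
  obtain par0 and rk0 :: "cell \<Rightarrow> nat" where bfs: "\<And>x. x \<in> C \<Longrightarrow> x \<notin> A \<Longrightarrow> (par0 x, x) \<in> R \<and> rk0 (par0 x) < rk0 x \<and> (\<exists>a\<in>A. (a, par0 x) \<in> rtrancl R)"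
    "\<And>x. x \<in> A \<Longrightarrow> rk0 x = 0"
    using bfs_tree[of C A R] reach by metis
  define par where "par = (\<lambda>c. if c \<notin> I then boundary_par N c else if c \<in> rc ` V then rp (the (lab c)) else par0 c)"
  define M where "M = Max (rk0 ` C)"
  have M: "rk0 c \<le> M" if "c \<in> C" for c unfolding M_def using that by (intro Max_ge) (auto simp: C_def)
  define n2 where "n2 = nat (2 * N)"
  \<comment> \<open>A lexicographic order: first the level, then boundary before interior, then the
    breadth-first distance. The offset \<open>n2 + 1\<close> of interior cells exceeds all ranks on
    the boundary, where the level is 0.\<close>
  define rk where "rk = (\<lambda>c. level lev (lab c) * (M + 1 + n2) + (if c \<notin> I then nat (fst c + snd c) else n2 + 1 + rk0 c))"
  define pl where "pl = (\<lambda>v. lab (rp v))"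
  \<comment> \<open>The empty stack outside the grid is a default value, as \<open>grid_tree\<close>
    bounds the stack of every cell.\<close>
  define St where "St = (\<lambda>c. if c \<in> C then stack_of pl (level lev (lab c)) (lab c) else [])"
  have rcI: "rc v \<in> I" if "v \<in> V" for v using bd rt[OF that] by (metis option.discI)
  have pl: "level lev (pl v) < lev v \<and> set_option (pl v) \<subseteq> V" if "v \<in> V" for v
  proof -
    have "set_option (lab (rp v)) \<subseteq> V" using labV[of "rp v"] rt[OF that] by (cases "lab (rp v)") auto
    then show ?thesis using rt[OF that] by (simp add: pl_def)
  qed
  have bp: "boundary_par N c \<in> C \<and> boundary_par N c \<notin> I \<and> adj c (boundary_par N c) \<and>
      nat (fst (boundary_par N c) + snd (boundary_par N c)) < nat (fst c + snd c)" if "c \<in> C" "c \<notin> I" "c \<noteq> (0, 0)" for c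
  proof -
    obtain x y where xy: "c = (x, y)" by (cases c)
    have b: "0 \<le> x" "x \<le> N" "0 \<le> y" "y \<le> N" "x = 0 \<or> y = 0 \<or> x = N \<or> y = N" "x \<noteq> 0 \<or> y \<noteq> 0"
      using that by (auto simp: C_def I_def xy)
    show ?thesis
    proof (cases "y = 0")
      case True then show ?thesis using b by (auto simp: boundary_par_def xy C_def I_def adj_def)
    next
      case y: False
      show ?thesis
      proof (cases "x = 0 \<or> x = N")
        case True then show ?thesis using b y by (auto simp: boundary_par_def xy C_def I_def adj_def)
      next
        case False
        then have "y = N" using b y by auto
        then show ?thesis using b y False by (auto simp: boundary_par_def xy C_def I_def adj_def)
      qed
    qed
  qed
  have low: "rk c < level lev (lab c) * (M + 1 + n2) + (M + 1 + n2) + n2 + 1" if "c \<in> C" for c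
  proof (cases "c \<in> I")
    case True then show ?thesis using M[OF that] by (simp add: rk_def)
  next
    case False
    have "fst c + snd c \<le> 2 * N" using that by (auto simp: C_def)
    then have "nat (fst c + snd c) \<le> n2" unfolding n2_def by (rule nat_mono)
    then show ?thesis using False by (simp add: rk_def)
  qed
  have step: "par c \<in> C \<and> adj c (par c) \<and> rk (par c) < rk c \<and> (c \<in> rc ` V \<or> lab (par c) = lab c)"
    if c: "c \<in> C" "c \<noteq> (0, 0)" for c
  proof (cases "c \<in> I")
    case False
    then show ?thesis using bp[OF c(1) False c(2)] bd c by (simp add: par_def rk_def)
  next
    case I: True
    show ?thesis
    proof (cases "c \<in> rc ` V")
      case True
      then obtain v where v: "v \<in> V" "c = rc v" by blast
      have p: "par c = rp v" using I True v rt[OF v(1)] by (simp add: par_def)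
      have "rk (rp v) < level lev (lab (rp v)) * (M + 1 + n2) + (M + 1 + n2) + n2 + 1" using low rt[OF v(1)] by blast
      also have "\<dots> = Suc (level lev (lab (rp v))) * (M + 1 + n2) + n2 + 1" by simp
      also have "\<dots> \<le> lev v * (M + 1 + n2) + n2 + 1"
        using rt[OF v(1)] by (intro add_mono mult_right_mono) auto
      also have "\<dots> \<le> rk c" using I v rt[OF v(1)] by (simp add: rk_def)
      finally show ?thesis using p rt[OF v(1)] v True by auto
    next
      case False
      then have nA: "c \<notin> A" using I by (auto simp: A_def)
      have p: "par c = par0 c" using I False by (simp add: par_def)
      have b: "par0 c \<in> C" "adj (par0 c) c" "lab (par0 c) = lab c" "rk0 (par0 c) < rk0 c"
        using bfs(1)[OF c(1) nA] by (auto simp: R_def)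
      have "rk (par0 c) < rk c"
      proof (cases "par0 c \<in> I")
        case True then show ?thesis using b I by (simp add: rk_def)
      next
        case F: False
        have "fst (par0 c) + snd (par0 c) \<le> 2 * N" using b(1) by (auto simp: C_def)
        then have "nat (fst (par0 c) + snd (par0 c)) \<le> n2" unfolding n2_def by (rule nat_mono)
        then show ?thesis using F I b by (simp add: rk_def)
      qed
      then show ?thesis using b p adj_sym by auto
    qed
  qed
  have hdSt: "St (rc v) = v # St (par (rc v))" if v: "v \<in> V" for v
  proof -
    have p: "par (rc v) = rp v" using rcI[OF v] v rt[OF v] by (simp add: par_def)
    have lv: "lev v \<noteq> 0" using rt[OF v] by (metis not_less_zero)
    then obtain k where k: "lev v = Suc k" by (cases "lev v") auto
    have "stack_of pl k (pl v) = stack_of pl (level lev (pl v)) (pl v)"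
      using pl[OF v] k by (intro stack_of_fuel[of V lev]) (use pl in auto)
    then show ?thesis using rt[OF v] k p by (simp add: St_def pl_def)
  qed
  interpret grid_tree N par rk St "rc ` V" r
  proof
    show "N \<ge> 1" by (rule N)
    show "par c \<in> {0..N} \<times> {0..N} \<and> adj c (par c) \<and> rk (par c) < rk c" if "c \<in> {0..N} \<times> {0..N}" "c \<noteq> (0, 0)" for c
      using step[of c] that unfolding C_def by blast
    show "par (x, 0) = (x - 1, 0)" if "0 < x" "x \<le> N" for x by (simp add: par_def I_def boundary_par_def)
    show "par (0, y) = (0, y - 1)" if "0 < y" "y \<le> N" for y using that by (simp add: par_def I_def boundary_par_def)
    show "par (N, y) = (N, y - 1)" if "0 < y" "y \<le> N" for y using that by (simp add: par_def I_def boundary_par_def)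
    show "par (x, N) = (x - 1, N)" if "0 < x" "x < N" for x using that N by (simp add: par_def I_def boundary_par_def)
    show "rc ` V \<subseteq> {0<..<N} \<times> {0<..<N}" using rcI unfolding I_def by blast
    show "\<exists>v. St c = v # St (par c)" if "c \<in> rc ` V" for c using hdSt that by blast
    show "St c = St (par c)" if "c \<in> {0..N} \<times> {0..N}" "c \<noteq> (0, 0)" "c \<notin> rc ` V" for c
      using step[of c] that unfolding St_def C_def by simp
    show "St (0, 0) = []" using bd[of "(0, 0)"] N by (simp add: St_def C_def I_def)
    show "length (St c) \<le> r" for c
    proof (cases "c \<in> C")
      case True
      have "level lev (lab c) \<le> r" using labV[OF True] lev by (cases "lab c") auto
      then show ?thesis using length_stack_of[of pl "level lev (lab c)" "lab c"] True by (simp add: St_def)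
    qed (simp add: St_def)
    show "inj_on (\<lambda>c. hd (St c)) (rc ` V)"
    proof (rule inj_onI)
      fix c d assume "c \<in> rc ` V" "d \<in> rc ` V" and e: "hd (St c) = hd (St d)"
      then obtain v w where v: "v \<in> V" "c = rc v" and w: "w \<in> V" "d = rc w" by blast
      show "c = d" using e hdSt[OF v(1)] hdSt[OF w(1)] v(2) w(2) by simp
    qed
  qed
  have cC: "cells = C" by (simp add: cells_def C_def)
  have img: "(\<lambda>c. hd (St c)) ` rc ` V = V" using hdSt by (auto simp: image_image)
  obtain t where t: "ok r [] t" "out [] t = []" "distinct (pushed t)" "set (pushed t) = (\<lambda>c. hd (St c)) ` rc ` V"
    "\<forall>c\<in>cells. \<forall>d\<in>cells. adj c d \<longrightarrow> link (St c) (St d) \<subseteq> links [] t"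
    using grid_term by blast
  have hd: "St c \<noteq> [] \<and> hd (St c) = u" if "c \<in> C" "lab c = Some u" for c u
  proof -
    have "u \<in> V" using labV that by blast
    then have "lev u \<noteq> 0" using rt by (metis not_less_zero)
    then show ?thesis using that by (cases "lev u") (auto simp: St_def)
  qed
  have "(u, w) \<in> links [] t" if "c \<in> C" "d \<in> C" "adj c d" "lab c = Some u" "lab d = Some w" for c d u w
  proof -
    have "(u, w) \<in> link (St c) (St d)" using hd[of c u] hd[of d w] that by (simp add: link_def)
    then show ?thesis using t(5) that cC by blast
  qed
  then show ?thesis using t(1-4) unfolding img by (intro exI[of _ t]) simp
qed

text \<open>Cells outside all regions need labels as well: every connected component of free cells
  receives a lowest label found around it. Then each region touches a lower level, because the
  escape path of \<open>v\<close> avoids all other regions of level at least \<open>lev v\<close>;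
  the first cell with which it leaves \<open>R v\<close> and the free components next to it
  therefore has a lower level.\<close>

lemma regions_to_term:
  fixes R :: "'v \<Rightarrow> cell set" and N :: int and esc :: "'v \<Rightarrow> cell set"
  defines "C \<equiv> {0..N} \<times> {0..N}" and "I \<equiv> {0<..<N} \<times> {0<..<N}"
  assumes N: "N \<ge> 1" and RI: "\<And>v. v \<in> V \<Longrightarrow> R v \<subseteq> I"
    and conn: "\<And>v c d. v \<in> V \<Longrightarrow> c \<in> R v \<Longrightarrow> d \<in> R v \<Longrightarrow> (c, d) \<in> rtrancl {(a, b). a \<in> R v \<and> b \<in> R v \<and> adj a b}"
    and disj: "\<And>u v. u \<in> V \<Longrightarrow> v \<in> V \<Longrightarrow> u \<noteq> v \<Longrightarrow> R u \<inter> R v = {}"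
    and lev: "\<And>v. v \<in> V \<Longrightarrow> 1 \<le> lev v \<and> lev v \<le> r"
    and esc: "\<And>v. v \<in> V \<Longrightarrow> \<exists>c\<in>esc v. \<exists>d\<in>esc v. c \<in> R v \<and> d \<notin> C \<and> (c, d) \<in> rtrancl {(a, b). a \<in> esc v \<and> b \<in> esc v \<and> adj a b}"
    and avoid: "\<And>u v. u \<in> V \<Longrightarrow> v \<in> V \<Longrightarrow> u \<noteq> v \<Longrightarrow> lev v \<le> lev u \<Longrightarrow> esc v \<inter> R u = {}"
  shows "\<exists>t. ok r [] t \<and> out [] t = [] \<and> distinct (pushed t) \<and> set (pushed t) = V \<and>
     (\<forall>u\<in>V. \<forall>w\<in>V. (\<exists>c\<in>R u. \<exists>d\<in>R w. adj c d) \<longrightarrow> (u, w) \<in> links [] t)"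
proof -
  define free where "free = {c \<in> I. \<forall>v\<in>V. c \<notin> R v}"
  \<comment> \<open>For free cells the description denotes nothing, but there \<open>lab\<close>
    does not consult \<open>own\<close>.\<close>
  define own where "own = (\<lambda>c. if c \<in> I then Some (THE v. v \<in> V \<and> c \<in> R v) else None)"
  define F where "F = {(a, b). a \<in> free \<and> b \<in> free \<and> adj a b}"
  \<comment> \<open>The labels around the free component of \<open>c\<close>. Cells on the border of
    the grid contribute \<open>None\<close>, which has level 0.\<close>
  define nb where "nb = (\<lambda>c. {own x |d x. (c, d) \<in> rtrancl F \<and> x \<in> C \<and> x \<notin> free \<and> adj d x})"
  define ml where "ml = (\<lambda>S. SOME l. l \<in> S \<and> (\<forall>k\<in>S. level lev l \<le> level lev k))"
  define lab where "lab = (\<lambda>c. if c \<in> free then ml (nb c) else own c)"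
  have IC: "I \<subseteq> C" by (auto simp: I_def C_def)
  have freeI: "free \<subseteq> I" by (auto simp: free_def)
  have ownR: "own c = Some v" if "v \<in> V" "c \<in> R v" for c v
  proof -
    have "(THE v. v \<in> V \<and> c \<in> R v) = v" using that disj by (intro the_equality) blast+
    then show ?thesis using RI that by (auto simp: own_def)
  qed
  have nfree: "\<exists>v\<in>V. c \<in> R v" if "c \<in> I" "c \<notin> free" for c using that by (auto simp: free_def)
  have Rfree: "c \<notin> free" if "v \<in> V" "c \<in> R v" for c v using that by (auto simp: free_def)
  have own_out: "own c = None" if "c \<notin> I" for c using that by (simp add: own_def)
  have Fsym: "sym (rtrancl F)" by (rule sym_rtrancl) (auto simp: F_def sym_def adj_sym)
  have nb_eq: "nb c = nb d" if "(c, d) \<in> rtrancl F" for c d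
  proof -
    have "(d, c) \<in> rtrancl F" using that Fsym by (rule symD[rotated])
    then show ?thesis unfolding nb_def using that by (blast intro: rtrancl_trans)
  qed
  \<comment> \<open>A walk to the right from a free cell has to leave the free cells before it
    leaves the grid.\<close>
  have nb_ne: "nb c \<noteq> {}" if "c \<in> free" for c
  proof (rule ccontr)
    assume e: "\<not> nb c \<noteq> {}"
    have "(fst c + int k, snd c) \<in> free \<and> (c, (fst c + int k, snd c)) \<in> rtrancl F" for k
    proof (induction k)
      case 0 then show ?case using that by simp
    next
      case (Suc k)
      let ?d = "(fst c + int k, snd c)" and ?x = "(fst c + int (Suc k), snd c)"
      have a: "adj ?d ?x" by (simp add: adj_def)
      have "?d \<in> I" using Suc freeI by blast
      then have "?x \<in> C" by (auto simp: I_def C_def)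
      have "?x \<in> free"
      proof (rule ccontr)
        assume "?x \<notin> free"
        then have "own ?x \<in> nb c" unfolding nb_def using Suc \<open>?x \<in> C\<close> a by blast
        then show False using e by blast
      qed
      moreover have "(?d, ?x) \<in> F" using Suc calculation a by (simp add: F_def)
      ultimately show ?case using Suc by (meson rtrancl.rtrancl_into_rtrancl)
    qed
    then have "(fst c + int (nat N), snd c) \<in> I" using freeI by blast
    moreover have "fst c > 0" using that freeI by (auto simp: I_def)
    ultimately show False using N by (auto simp: I_def)
  qed
  have ml: "ml S \<in> S \<and> (\<forall>k\<in>S. level lev (ml S) \<le> level lev k)" if ne: "S \<noteq> {}" for S
  proof -
    obtain l where "l \<in> S \<and> (\<forall>k\<in>S. level lev l \<le> level lev k)"
      using ne ex_has_least_nat[of "\<lambda>l. l \<in> S" _ "level lev"] by (metis all_not_in_conv)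
    then show ?thesis unfolding ml_def by (rule someI)
  qed
  have labF: "lab c = lab d" if "(c, d) \<in> rtrancl F" for c d
  proof (cases "c = d")
    case False
    then have "c \<in> free" "d \<in> free" using that by (auto simp: F_def elim: converse_rtranclE rtranclE)
    then show ?thesis using nb_eq[OF that] by (simp add: lab_def)
  qed simp
  have labR: "lab c = Some v" if "v \<in> V" "c \<in> R v" for c v using ownR[OF that] Rfree[OF that] by (simp add: lab_def)
  have nb_lab: "\<exists>d x. (c, d) \<in> rtrancl F \<and> d \<in> free \<and> x \<in> C \<and> x \<notin> free \<and> adj d x \<and> lab x = lab c" if c: "c \<in> free" for c
  proof -
    have "lab c \<in> nb c" using ml[OF nb_ne[OF c]] c by (simp add: lab_def)
    then obtain d x where dx: "lab c = own x" "(c, d) \<in> rtrancl F" "x \<in> C" "x \<notin> free" "adj d x" by (auto simp: nb_def)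
    moreover have "d \<in> free" using dx(2) c by (cases rule: rtranclE) (auto simp: F_def)
    ultimately show ?thesis by (intro exI[of _ d] exI[of _ x]) (simp add: lab_def)
  qed
  define RR where "RR = {(a, b). a \<in> C \<and> b \<in> C \<and> adj a b \<and> lab a = lab b}"
  have F_RR: "(c, d) \<in> rtrancl RR" if "(c, d) \<in> rtrancl F" for c d
  proof -
    have "F \<subseteq> RR"
    proof
      fix p assume p: "p \<in> F"
      then obtain a b where ab: "p = (a, b)" "a \<in> free" "b \<in> free" "adj a b" by (auto simp: F_def)
      have "lab a = lab b" using labF[of a b] p ab by auto
      then show "p \<in> RR" using ab freeI IC by (auto simp: RR_def)
    qed
    then show ?thesis using that rtrancl_mono by blast
  qed
  have RRsym: "(d, c) \<in> rtrancl RR" if "(c, d) \<in> rtrancl RR" for c d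
  proof -
    have "sym RR" by (auto simp: RR_def sym_def adj_sym)
    then show ?thesis using symD[OF sym_rtrancl that] by blast
  qed
  have anchor: "\<exists>x\<in>C. x \<notin> free \<and> lab x = lab c \<and> (c, x) \<in> rtrancl RR" if "c \<in> C" for c
  proof (cases "c \<in> free")
    case True
    obtain d x where dx: "(c, d) \<in> rtrancl F" "d \<in> free" "x \<in> C" "x \<notin> free" "adj d x" "lab x = lab c" using nb_lab[OF True] by blast
    have "(d, x) \<in> RR" using dx labF[OF dx(1)] freeI IC by (auto simp: RR_def)
    then have "(c, x) \<in> rtrancl RR" using F_RR[OF dx(1)] by (rule rtrancl.rtrancl_into_rtrancl[rotated])
    then show ?thesis using dx by blast
  next
    case False then show ?thesis using that by blast
  qed
  have own_some: "\<exists>v\<in>V. x \<in> R v \<and> lab x = Some v" if "x \<in> C" "x \<notin> free" "lab x \<noteq> None" for x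
  proof -
    have "x \<in> I"
    proof (rule ccontr)
      assume "x \<notin> I"
      then show False using own_out that(2,3) by (simp add: lab_def)
    qed
    then show ?thesis using nfree that labR by blast
  qed
  have "\<exists>t. ok r [] t \<and> out [] t = [] \<and> distinct (pushed t) \<and> set (pushed t) = V \<and>
     (\<forall>c\<in>C. \<forall>d\<in>C. \<forall>u w. adj c d \<longrightarrow> lab c = Some u \<longrightarrow> lab d = Some w \<longrightarrow> (u, w) \<in> links [] t)"
    unfolding C_def
  proof (rule labels_to_term[where lev = lev], unfold C_def[symmetric] I_def[symmetric] RR_def[symmetric])
    show "N \<ge> 1" by (rule N)
    show "lab c = None" if "c \<in> C" "c \<notin> I" for c using that own_out freeI by (auto simp: lab_def)
    show "v \<in> V" if c: "c \<in> C" "lab c = Some v" for c v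
    proof -
      obtain x where "x \<in> C" "x \<notin> free" "lab x = lab c" using anchor[OF c(1)] by blast
      then show ?thesis using own_some[of x] c by auto
    qed
    show "(c, d) \<in> rtrancl RR" if cd: "c \<in> C" "d \<in> C" "lab c \<noteq> None" "lab c = lab d" for c d
    proof -
      obtain x where x: "x \<in> C" "x \<notin> free" "lab x = lab c" "(c, x) \<in> rtrancl RR" using anchor[OF cd(1)] by blast
      obtain y where y: "y \<in> C" "y \<notin> free" "lab y = lab d" "(d, y) \<in> rtrancl RR" using anchor[OF cd(2)] by blast
      obtain v where v: "v \<in> V" "x \<in> R v" "lab x = Some v" using own_some[OF x(1,2)] x(3) cd(3) by auto
      obtain w where w: "w \<in> V" "y \<in> R w" "lab y = Some w" using own_some[OF y(1,2)] y(3) cd(3,4) by auto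
      have "v = w" using v(3) w(3) x(3) y(3) cd(4) by simp
      then have "(x, y) \<in> rtrancl {(a, b). a \<in> R v \<and> b \<in> R v \<and> adj a b}" using conn v w by simp
      moreover have "{(a, b). a \<in> R v \<and> b \<in> R v \<and> adj a b} \<subseteq> RR"
        using labR[OF v(1)] RI[OF v(1)] IC by (auto simp: RR_def)
      ultimately have "(x, y) \<in> rtrancl RR" using rtrancl_mono by blast
      then show ?thesis using x(4) RRsym[OF y(4)] by (meson rtrancl_trans)
    qed
    show "\<exists>a. a \<in> C \<and> a \<notin> I \<and> (a, c) \<in> rtrancl RR" if c: "c \<in> C" "lab c = None" for c
    proof -
      obtain x where x: "x \<in> C" "x \<notin> free" "lab x = lab c" "(c, x) \<in> rtrancl RR" using anchor[OF c(1)] by blast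
      have "x \<notin> I" using nfree[of x] labR x c(2) by fastforce
      then show ?thesis using x RRsym by blast
    qed
    show "lev v \<le> r \<and> (\<exists>c d. c \<in> C \<and> d \<in> C \<and> adj c d \<and> lab c = Some v \<and> level lev (lab d) < lev v)" if v: "v \<in> V" for v
    proof (rule conjI)
      show "lev v \<le> r" using lev[OF v] by simp
      show "\<exists>c d. c \<in> C \<and> d \<in> C \<and> adj c d \<and> lab c = Some v \<and> level lev (lab d) < lev v"
      proof (rule ccontr)
        assume no: "\<not> (\<exists>c d. c \<in> C \<and> d \<in> C \<and> adj c d \<and> lab c = Some v \<and> level lev (lab d) < lev v)"
        obtain s e where se: "s \<in> esc v" "e \<in> esc v" "s \<in> R v" "e \<notin> C" "(s, e) \<in> rtrancl {(a, b). a \<in> esc v \<and> b \<in> esc v \<and> adj a b}"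
          using esc[OF v] by blast
        \<comment> \<open>A free component that touches both \<open>R v\<close> and something lower
          carries a lower label itself, and then \<open>R v\<close> touches that label.\<close>
        have exit: False if x: "x \<in> R v \<or> x \<in> free \<and> Some v \<in> nb x" and y: "y \<in> C" "y \<notin> free" "adj x y" "level lev (own y) < lev v" for x y
        proof (cases "x \<in> R v")
          case True
          then show False using no y labR[OF v True] RI[OF v] IC by (metis lab_def subsetD)
        next
          case False
          then have xf: "x \<in> free" "Some v \<in> nb x" using x by auto
          then obtain d z where dz: "Some v = own z" "(x, d) \<in> rtrancl F" "z \<in> C" "z \<notin> free" "adj d z" by (auto simp: nb_def)
          have "own y \<in> nb x" unfolding nb_def using y by blast
          then have "level lev (ml (nb x)) < lev v" using ml[OF nb_ne[OF xf(1)]] y(4) by (meson le_less_trans)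
          then have "level lev (lab d) < lev v" using labF[OF dz(2)] xf by (simp add: lab_def)
          moreover have "d \<in> C" using dz(2) xf(1) freeI IC by (cases rule: rtranclE) (auto simp: F_def)
          moreover have "lab z = Some v" using dz by (simp add: lab_def)
          ultimately show False using no dz adj_sym by blast
        qed
        have "e \<in> I \<and> (e \<in> R v \<or> e \<in> free \<and> Some v \<in> nb e)"
          using se(5)
        proof (induction rule: rtrancl_induct)
          case base then show ?case using se RI v by blast
        next
          case (step x y)
          have xy: "x \<in> esc v" "y \<in> esc v" "adj x y" using step.hyps(2) by auto
          have xI: "x \<in> I" and xc: "x \<in> R v \<or> x \<in> free \<and> Some v \<in> nb x" using step.IH by auto
          have yC: "y \<in> C" using xy(3) xI by (cases rule: adj_cases) (auto simp: I_def C_def)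
          have yI: "y \<in> I"
          proof (rule ccontr)
            assume y: "y \<notin> I"
            then have "y \<notin> free" "level lev (own y) < lev v" using freeI own_out lev[OF v] by auto
            then show False using exit[OF xc yC _ xy(3)] by blast
          qed
          show ?case
          proof (cases "y \<in> free")
            case True
            have "Some v \<in> nb y"
            proof (cases "x \<in> R v")
              case R: True
              have "own x \<in> nb y" unfolding nb_def using xI IC Rfree[OF v R] adj_sym[OF xy(3)] by blast
              then show ?thesis using ownR[OF v R] by simp
            next
              case False
              then have "(x, y) \<in> F" using xc True xy by (simp add: F_def)
              then show ?thesis using nb_eq[of x y] xc False by auto
            qed
            then show ?thesis using yI True by blast
          next
            case False
            then obtain u where u: "u \<in> V" "y \<in> R u" using nfree yI by blast
            have "u = v"
            proof (rule ccontr)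
              assume "u \<noteq> v"
              then have "lev u < lev v" using avoid[of u v] u v xy(2) by (meson disjoint_iff not_le)
              then show False using exit[OF xc yC False xy(3)] ownR[OF u] by simp
            qed
            then show ?thesis using u yI by blast
          qed
        qed
        then show False using se(4) IC by blast
      qed
    qed
  qed
  then obtain t where t: "ok r [] t \<and> out [] t = [] \<and> distinct (pushed t) \<and> set (pushed t) = V"
     "\<forall>c\<in>C. \<forall>d\<in>C. \<forall>u w. adj c d \<longrightarrow> lab c = Some u \<longrightarrow> lab d = Some w \<longrightarrow> (u, w) \<in> links [] t" by blast
  have "(u, w) \<in> links [] t" if "u \<in> V" "w \<in> V" "c \<in> R u" "d \<in> R w" "adj c d" for u w c d
    using t(2)[rule_format, of c d u w] that labR RI IC by (meson subsetD)
  then show ?thesis using t(1) by blast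
qed

subsection \<open>Discretization\<close>

text \<open>The width of a cell when the square of half-width \<open>\<rho>\<close> around the
  origin is divided into \<open>n\<close> rows and \<open>n\<close> columns.\<close>

definition mesh :: "real \<Rightarrow> nat \<Rightarrow> real" where
  "mesh \<rho> n = 2 * \<rho> / real n"

lemma mesh_pos: "\<rho> > 0 \<Longrightarrow> n > 0 \<Longrightarrow> mesh \<rho> n > 0"
  by (simp add: mesh_def)

definition square :: "real \<Rightarrow> nat \<Rightarrow> cell \<Rightarrow> complex set" where
  "square \<rho> n c = {z. - \<rho> + of_int (fst c) * mesh \<rho> n \<le> Re z \<and> Re z \<le> - \<rho> + (of_int (fst c) + 1) * mesh \<rho> n \<and>
     - \<rho> + of_int (snd c) * mesh \<rho> n \<le> Im z \<and> Im z \<le> - \<rho> + (of_int (snd c) + 1) * mesh \<rho> n}"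

definition touched :: "real \<Rightarrow> nat \<Rightarrow> complex set \<Rightarrow> cell set" where
  "touched \<rho> n K = {c. square \<rho> n c \<inter> K \<noteq> {}}"

lemma closed_square: "closed (square \<rho> n c)"
proof -
  have "square \<rho> n c = {z. - \<rho> + of_int (fst c) * mesh \<rho> n \<le> Re z} \<inter> {z. Re z \<le> - \<rho> + (of_int (fst c) + 1) * mesh \<rho> n} \<inter>
     {z. - \<rho> + of_int (snd c) * mesh \<rho> n \<le> Im z} \<inter> {z. Im z \<le> - \<rho> + (of_int (snd c) + 1) * mesh \<rho> n}"
    by (auto simp: square_def)
  moreover have "closed {z. a \<le> Re z}" "closed {z. Re z \<le> a}" "closed {z. a \<le> Im z}" "closed {z. Im z \<le> a}" for a
    by (intro closed_Collect_le continuous_intros)+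
  ultimately show ?thesis by (simp only: closed_Int)
qed

lemma floor_slot:
  fixes d x \<rho> :: real
  assumes "d > 0"
  shows "- \<rho> + of_int \<lfloor>(x + \<rho>) / d\<rfloor> * d \<le> x" "x \<le> - \<rho> + (of_int \<lfloor>(x + \<rho>) / d\<rfloor> + 1) * d"
proof -
  have "of_int \<lfloor>(x + \<rho>) / d\<rfloor> \<le> (x + \<rho>) / d" by (rule of_int_floor_le)
  then have "of_int \<lfloor>(x + \<rho>) / d\<rfloor> * d \<le> x + \<rho>" using assms by (simp only: pos_le_divide_eq)
  then show "- \<rho> + of_int \<lfloor>(x + \<rho>) / d\<rfloor> * d \<le> x" by simp
  have "(x + \<rho>) / d \<le> of_int \<lfloor>(x + \<rho>) / d\<rfloor> + 1" by linarith
  then have "x + \<rho> \<le> (of_int \<lfloor>(x + \<rho>) / d\<rfloor> + 1) * d" using assms by (simp only: pos_divide_le_eq)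
  then show "x \<le> - \<rho> + (of_int \<lfloor>(x + \<rho>) / d\<rfloor> + 1) * d" by simp
qed

lemma in_some_square:
  assumes "\<rho> > 0" "n > 0"
  shows "\<exists>c. z \<in> square \<rho> n c"
proof -
  have d: "mesh \<rho> n > 0" using assms by (rule mesh_pos)
  show ?thesis
    unfolding square_def mem_Collect_eq
    by (rule exI[of _ "(\<lfloor>(Re z + \<rho>) / mesh \<rho> n\<rfloor>, \<lfloor>(Im z + \<rho>) / mesh \<rho> n\<rfloor>)"], unfold fst_conv snd_conv, intro conjI floor_slot[OF d])
qed

lemma square_near:
  assumes "z \<in> square \<rho> n c" "w \<in> square \<rho> n c"
  shows "dist z w \<le> 4 * \<rho> / n"
proof -
  have "\<bar>Re (z - w)\<bar> \<le> mesh \<rho> n" "\<bar>Im (z - w)\<bar> \<le> mesh \<rho> n"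
    using assms by (auto simp: square_def abs_le_iff algebra_simps)
  then have "dist z w \<le> 2 * mesh \<rho> n" using cmod_le[of "z - w"] by (simp add: dist_norm)
  then show ?thesis by (simp add: mesh_def)
qed

lemma square_index_close:
  fixes d a :: real and i j :: int
  assumes "d > 0" "a + of_int i * d \<le> x" "x \<le> a + (of_int i + 1) * d" "a + of_int j * d \<le> x" "x \<le> a + (of_int j + 1) * d"
  shows "\<bar>i - j\<bar> \<le> 1"
proof -
  have "of_int i * d \<le> (of_int j + 1) * d" "of_int j * d \<le> (of_int i + 1) * d" using assms by linarith+
  then have "of_int i \<le> (of_int j + 1 :: real)" "of_int j \<le> (of_int i + 1 :: real)" using assms(1) by (auto simp: mult_le_cancel_right)
  then have "i \<le> j + 1" "j \<le> i + 1" by linarith+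
  then show ?thesis by simp
qed

lemma finite_touched:
  assumes "\<rho> > 0" "n > 0" "bounded K"
  shows "finite (touched \<rho> n K)"
proof -
  define d where "d = mesh \<rho> n"
  have d: "d > 0" using assms by (simp add: d_def mesh_pos)
  obtain B where B: "\<And>z. z \<in> K \<Longrightarrow> norm z \<le> B" using assms(3) by (auto simp: bounded_iff)
  define m where "m = \<lceil>(B + \<rho>) / d\<rceil> + 1"
  have m: "(B + \<rho>) / d \<le> of_int m - 1" by (simp add: m_def)
  have idx: "- m \<le> i \<and> i \<le> m" if "- \<rho> + of_int i * d \<le> x" "x \<le> - \<rho> + (of_int i + 1) * d" "\<bar>x\<bar> \<le> B" for i x
  proof -
    have "of_int i * d \<le> B + \<rho>" using that by linarith
    then have "of_int i \<le> (B + \<rho>) / d" using d by (simp add: pos_le_divide_eq)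
    then have 1: "of_int i \<le> (of_int m :: real)" using m by linarith
    have "- (B + \<rho>) \<le> (of_int i + 1) * d" using that assms(1) by linarith
    then have "- ((B + \<rho>) / d) \<le> of_int i + 1" using d by (simp add: pos_le_divide_eq minus_divide_left pos_divide_le_eq)
    then have "- (of_int m :: real) \<le> of_int i" using m by linarith
    then have "of_int (- m) \<le> (of_int i :: real)" by simp
    then show ?thesis using 1 by (simp only: of_int_le_iff)
  qed
  have "touched \<rho> n K \<subseteq> {- m..m} \<times> {- m..m}"
  proof
    fix c assume "c \<in> touched \<rho> n K"
    then obtain z where z: "z \<in> square \<rho> n c" "z \<in> K" by (auto simp: touched_def)
    have "\<bar>Re z\<bar> \<le> B" "\<bar>Im z\<bar> \<le> B" using B[OF z(2)] abs_Re_le_cmod[of z] abs_Im_le_cmod[of z] by linarith+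
    then show "c \<in> {- m..m} \<times> {- m..m}"
      using idx[of "fst c" "Re z"] idx[of "snd c" "Im z"] z(1) by (simp add: square_def d_def mem_Times_iff)
  qed
  then show ?thesis by (rule finite_subset) simp
qed

text \<open>Touched cells of different components have no point of \<open>K\<close> in common, since
  a touched cell next to both would join them. So several components would split \<open>K\<close>
  into two nonempty closed parts.\<close>

lemma touched_connected:
  assumes "\<rho> > 0" "n > 0" "topological_space_class.connected K" "compact K" "c \<in> touched \<rho> n K" "d \<in> touched \<rho> n K"
  shows "(c, d) \<in> rtrancl {(a, b). a \<in> touched \<rho> n K \<and> b \<in> touched \<rho> n K \<and> adj a b}"
proof (rule ccontr)
  define T where "T = touched \<rho> n K"
  define F where "F = {(a, b). a \<in> T \<and> b \<in> T \<and> adj a b}"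
  define A where "A = {a \<in> T. (c, a) \<in> rtrancl F}"
  assume "(c, d) \<notin> rtrancl {(a, b). a \<in> touched \<rho> n K \<and> b \<in> touched \<rho> n K \<and> adj a b}"
  then have dA: "d \<in> T - A" using assms(6) by (auto simp: A_def F_def T_def)
  have cA: "c \<in> A" using assms(5) by (simp add: A_def T_def)
  have fin: "finite T" unfolding T_def by (rule finite_touched[OF assms(1,2) compact_imp_bounded[OF assms(4)]])
  define X where "X = (\<Union>a\<in>A. square \<rho> n a)"
  define Y where "Y = (\<Union>a\<in>T - A. square \<rho> n a)"
  have clo: "closed X" "closed Y" unfolding X_def Y_def using fin by (auto intro!: closed_UN closed_square simp: A_def)
  have cover: "K \<subseteq> X \<union> Y"
  proof
    fix z assume "z \<in> K"
    moreover obtain a where "z \<in> square \<rho> n a" using in_some_square assms(1,2) by blast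
    ultimately have "a \<in> T" "z \<in> square \<rho> n a" by (auto simp: T_def touched_def)
    then show "z \<in> X \<union> Y" by (auto simp: X_def Y_def)
  qed
  have "X \<inter> Y \<inter> K = {}"
  proof (rule ccontr)
    assume "X \<inter> Y \<inter> K \<noteq> {}"
    then obtain z where z0: "z \<in> K" "z \<in> X" "z \<in> Y" by blast
    obtain a where a: "a \<in> A" "z \<in> square \<rho> n a" using z0(2) unfolding X_def by blast
    obtain b where b: "b \<in> T - A" "z \<in> square \<rho> n b" using z0(3) unfolding Y_def by blast
    note z = z0(1) a(1) b(1) a(2) b(2)
    \<comment> \<open>the square with the column of \<open>a\<close> and the row of \<open>b\<close> contains \<open>z\<close> as well and is next to both\<close>
    define m where "m = (fst a, snd b)"
    have zm: "z \<in> square \<rho> n m" using z(4,5) by (simp add: square_def m_def)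
    then have mT: "m \<in> T" using z(1) by (auto simp: T_def touched_def)
    have dpos: "mesh \<rho> n > 0" using assms(1,2) by (rule mesh_pos)
    have close: "\<bar>fst a - fst b\<bar> \<le> 1" "\<bar>snd a - snd b\<bar> \<le> 1"
      using square_index_close[OF dpos, of "- \<rho>" "fst a" "Re z" "fst b"] square_index_close[OF dpos, of "- \<rho>" "snd a" "Im z" "snd b"] z(4,5)
      by (simp_all add: square_def)
    have ext: "y \<in> A" if "x \<in> A" "y \<in> T" "x = y \<or> adj x y" for x y
      using that by (auto simp: A_def F_def intro: rtrancl.rtrancl_into_rtrancl)
    have "a = m \<or> adj a m" "m = b \<or> adj m b" using close by (auto simp: m_def adj_def prod_eq_iff)
    then have "b \<in> A" using ext z(2,3) mT by blast
    then show False using z(3) by blast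
  qed
  moreover have "X \<inter> K \<noteq> {}" using cA assms(5) by (auto simp: X_def touched_def)
  moreover have "Y \<inter> K \<noteq> {}" using dA assms(6) by (auto simp: Y_def touched_def)
  ultimately show False using assms(3) clo cover unfolding connected_closed by blast
qed

text \<open>Disjoint compact sets have positive distance, and the diameter of a cell eventually
  falls below it.\<close>

lemma touched_separate:
  assumes "\<rho> > 0" "compact K" "compact L" "K \<inter> L = {}"
  shows "\<forall>\<^sub>F n in sequentially. touched \<rho> n K \<inter> touched \<rho> n L = {}"
proof -
  obtain e where e: "e > 0" "\<And>x y. x \<in> K \<Longrightarrow> y \<in> L \<Longrightarrow> e \<le> dist x y"
    using separate_compact_closed[OF assms(2) compact_imp_closed[OF assms(3)] assms(4)] by blast
  have "(\<lambda>n. 4 * \<rho> / real n) \<longlonglongrightarrow> 0"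
    using lim_const_over_n[of "4 * \<rho>"] by simp
  then have "\<forall>\<^sub>F n in sequentially. 4 * \<rho> / real n < e" using e(1) by (rule order_tendstoD)
  then show ?thesis
  proof (rule eventually_mono)
    fix n assume n: "4 * \<rho> / real n < e"
    show "touched \<rho> n K \<inter> touched \<rho> n L = {}"
    proof (rule ccontr)
      assume "touched \<rho> n K \<inter> touched \<rho> n L \<noteq> {}"
      then obtain c x y where "x \<in> square \<rho> n c" "y \<in> square \<rho> n c" "x \<in> K" "y \<in> L" by (auto simp: touched_def)
      then show False using square_near[of x \<rho> n c y] e(2)[of x y] n by simp
    qed
  qed
qed

lemma touched_inside:
  assumes "\<rho> > 0" "n \<ge> 8" "K \<subseteq> ball 0 (\<rho> / 2)"
  shows "touched \<rho> n K \<subseteq> {0<..<int n - 1} \<times> {0<..<int n - 1}"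
proof
  fix c assume "c \<in> touched \<rho> n K"
  then obtain z where z: "z \<in> square \<rho> n c" "z \<in> K" by (auto simp: touched_def)
  define d where "d = mesh \<rho> n"
  have d: "d > 0" "real n * d = 2 * \<rho>" using assms by (auto simp: d_def mesh_def)
  have "norm z < \<rho> / 2" using z(2) assms(3) by auto
  then have b: "\<bar>Re z\<bar> < \<rho> / 2" "\<bar>Im z\<bar> < \<rho> / 2" using abs_Re_le_cmod[of z] abs_Im_le_cmod[of z] by linarith+
  have idx: "0 < i \<and> i < int n - 1" if "- \<rho> + of_int i * d \<le> x" "x \<le> - \<rho> + (of_int i + 1) * d" "\<bar>x\<bar> < \<rho> / 2" for i x
  proof -
    have "of_int i * d < (3 / 4 * real n) * d" using that d(2) by linarith
    then have 1: "of_int i < 3 / 4 * real n" using d(1) by (simp add: mult_less_cancel_right)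
    have "(1 / 4 * real n) * d < (of_int i + 1) * d" using that d(2) by linarith
    then have "1 / 4 * real n < of_int i + 1" using d(1) by (simp add: mult_less_cancel_right)
    then have "(0::real) < of_int i" using assms(2) by linarith
    moreover have "of_int i < (of_int (int n - 1) :: real)" using 1 assms(2) by simp
    ultimately show ?thesis by (simp only: of_int_0_less_iff of_int_less_iff)
  qed
  show "c \<in> {0<..<int n - 1} \<times> {0<..<int n - 1}"
    using idx[of "fst c" "Re z"] idx[of "snd c" "Im z"] z(1) b by (simp add: square_def d_def mem_Times_iff)
qed

text \<open>The factor 4 is on the safe side: points of the square have norm at most
  \<open>2 * \<rho>\<close>.\<close>

lemma touched_outside:
  assumes "\<rho> > 0" "n > 0" "z \<in> K" "norm z \<ge> 4 * \<rho>"
  shows "\<exists>c\<in>touched \<rho> n K. c \<notin> {0..int n - 1} \<times> {0..int n - 1}"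
proof -
  obtain c where c: "z \<in> square \<rho> n c" using in_some_square assms by blast
  define d where "d = mesh \<rho> n"
  have d: "d > 0" "real n * d = 2 * \<rho>" using assms by (auto simp: d_def mesh_def)
  have idx: "\<bar>x\<bar> \<le> \<rho>" if "- \<rho> + of_int i * d \<le> x" "x \<le> - \<rho> + (of_int i + 1) * d" "i \<in> {0..int n - 1}" for i x
  proof -
    have "0 \<le> (of_int i :: real)" "of_int i + 1 \<le> (of_int (int n) :: real)" using that(3) by auto
    then have "0 \<le> of_int i * d" "(of_int i + 1) * d \<le> real n * d" using d(1) by (auto intro: mult_right_mono)
    then show ?thesis using that d(2) by linarith
  qed
  have "c \<notin> {0..int n - 1} \<times> {0..int n - 1}"
  proof
    assume "c \<in> {0..int n - 1} \<times> {0..int n - 1}"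
    then have "\<bar>Re z\<bar> \<le> \<rho>" "\<bar>Im z\<bar> \<le> \<rho>" using idx[of "fst c" "Re z"] idx[of "snd c" "Im z"] c
      by (auto simp: square_def d_def mem_Times_iff)
    then show False using cmod_le[of z] assms(1,4) by linarith
  qed
  moreover have "c \<in> touched \<rho> n K" using c assms(3) by (auto simp: touched_def)
  ultimately show ?thesis by blast
qed

text \<open>\<open>K v\<close> is a part of the drawing near the vertex \<open>v\<close>,
  \<open>A e\<close> a middle part of the edge \<open>e\<close>, and \<open>X v\<close> an escape
  from \<open>v\<close> to far away. The cells of \<open>A e\<close> are given to the first vertex
  of \<open>e\<close> until they meet \<open>K (snd e)\<close>, so that adjacent vertices get
  adjacent regions. This is why \<open>XA\<close> compares \<open>lev v\<close> with the level of
  \<open>fst e\<close> only.\<close>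

lemma compact_regions_to_term:
  fixes K :: "'v \<Rightarrow> complex set" and A :: "'v \<times> 'v \<Rightarrow> complex set" and X :: "'v \<Rightarrow> complex set"
  assumes fin: "finite V" "E \<subseteq> V \<times> V" and \<rho>: "\<rho> > 0" and irr: "\<And>u. (u, u) \<notin> E"
    and K: "\<And>v. v \<in> V \<Longrightarrow> compact (K v) \<and> topological_space_class.connected (K v) \<and> K v \<subseteq> ball 0 (\<rho> / 2)"
    and A: "\<And>e. e \<in> E \<Longrightarrow> compact (A e) \<and> topological_space_class.connected (A e) \<and> A e \<subseteq> ball 0 (\<rho> / 2) \<and> A e \<inter> K (fst e) \<noteq> {} \<and> A e \<inter> K (snd e) \<noteq> {}"
    and KK: "\<And>u v. u \<in> V \<Longrightarrow> v \<in> V \<Longrightarrow> u \<noteq> v \<Longrightarrow> K u \<inter> K v = {}"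
    and AA: "\<And>e f. e \<in> E \<Longrightarrow> f \<in> E \<Longrightarrow> e \<noteq> f \<Longrightarrow> A e \<inter> A f = {}"
    and AK: "\<And>e v. e \<in> E \<Longrightarrow> v \<in> V \<Longrightarrow> v \<noteq> fst e \<Longrightarrow> v \<noteq> snd e \<Longrightarrow> A e \<inter> K v = {}"
    and X: "\<And>v. v \<in> V \<Longrightarrow> compact (X v) \<and> topological_space_class.connected (X v) \<and> X v \<inter> K v \<noteq> {} \<and> (\<exists>z\<in>X v. norm z \<ge> 4 * \<rho>)"
    and XK: "\<And>u v. u \<in> V \<Longrightarrow> v \<in> V \<Longrightarrow> u \<noteq> v \<Longrightarrow> lev v \<le> lev u \<Longrightarrow> X v \<inter> K u = {}"
    and XA: "\<And>e v. e \<in> E \<Longrightarrow> v \<in> V \<Longrightarrow> fst e \<noteq> v \<Longrightarrow> lev v \<le> lev (fst e) \<Longrightarrow> X v \<inter> A e = {}"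
    and lev: "\<And>v. v \<in> V \<Longrightarrow> 1 \<le> lev v \<and> lev v \<le> r"
  shows "\<exists>t. ok r [] t \<and> out [] t = [] \<and> distinct (pushed t) \<and> set (pushed t) = V \<and> E \<subseteq> links [] t"
proof -
  have finE: "finite E" using fin finite_subset by blast
  have sep: "\<forall>\<^sub>F n in sequentially. Q \<longrightarrow> touched \<rho> n S \<inter> touched \<rho> n T = {}"
    if "Q \<Longrightarrow> compact S \<and> compact T \<and> S \<inter> T = {}" for Q S T
  proof (cases Q)
    case True
    then show ?thesis using touched_separate[OF \<rho>, of S T] that by simp
  qed simp
  have s1: "\<forall>\<^sub>F n in sequentially. \<forall>u\<in>V. \<forall>v\<in>V. u \<noteq> v \<longrightarrow> touched \<rho> n (K u) \<inter> touched \<rho> n (K v) = {}"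
    by (intro eventually_ball_finite ballI fin(1) sep) (use K KK in blast)
  have s2: "\<forall>\<^sub>F n in sequentially. \<forall>e\<in>E. \<forall>f\<in>E. e \<noteq> f \<longrightarrow> touched \<rho> n (A e) \<inter> touched \<rho> n (A f) = {}"
    by (intro eventually_ball_finite ballI finE sep) (use A AA in blast)
  have s3: "\<forall>\<^sub>F n in sequentially. \<forall>e\<in>E. \<forall>v\<in>V. v \<noteq> fst e \<and> v \<noteq> snd e \<longrightarrow> touched \<rho> n (A e) \<inter> touched \<rho> n (K v) = {}"
    by (intro eventually_ball_finite ballI finE fin(1) sep) (use A K AK in blast)
  have s4: "\<forall>\<^sub>F n in sequentially. \<forall>u\<in>V. \<forall>v\<in>V. u \<noteq> v \<and> lev v \<le> lev u \<longrightarrow> touched \<rho> n (X v) \<inter> touched \<rho> n (K u) = {}"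
    by (intro eventually_ball_finite ballI fin(1) sep) (use X K XK in blast)
  have s5: "\<forall>\<^sub>F n in sequentially. \<forall>e\<in>E. \<forall>v\<in>V. fst e \<noteq> v \<and> lev v \<le> lev (fst e) \<longrightarrow> touched \<rho> n (X v) \<inter> touched \<rho> n (A e) = {}"
    by (intro eventually_ball_finite ballI finE fin(1) sep) (use X A XA in blast)
  \<comment> \<open>Only finitely many pairs of sets have to be separated, so one \<open>n\<close>
    serves them all.\<close>
  obtain n where nn: "\<forall>u\<in>V. \<forall>v\<in>V. u \<noteq> v \<longrightarrow> touched \<rho> n (K u) \<inter> touched \<rho> n (K v) = {}"
     "\<forall>e\<in>E. \<forall>f\<in>E. e \<noteq> f \<longrightarrow> touched \<rho> n (A e) \<inter> touched \<rho> n (A f) = {}"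
     "\<forall>e\<in>E. \<forall>v\<in>V. v \<noteq> fst e \<and> v \<noteq> snd e \<longrightarrow> touched \<rho> n (A e) \<inter> touched \<rho> n (K v) = {}"
     "\<forall>u\<in>V. \<forall>v\<in>V. u \<noteq> v \<and> lev v \<le> lev u \<longrightarrow> touched \<rho> n (X v) \<inter> touched \<rho> n (K u) = {}"
     "\<forall>e\<in>E. \<forall>v\<in>V. fst e \<noteq> v \<and> lev v \<le> lev (fst e) \<longrightarrow> touched \<rho> n (X v) \<inter> touched \<rho> n (A e) = {}"
     and n8: "n \<ge> 8"
    using eventually_happens'[OF sequentially_bot eventually_conj[OF s1 eventually_conj[OF s2 eventually_conj[OF s3
       eventually_conj[OF s4 eventually_conj[OF s5 eventually_ge_at_top[of "8::nat"]]]]]]]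
    by (elim exE conjE) (rule_tac that, assumption+)
  have na: "\<And>u v. u \<in> V \<Longrightarrow> v \<in> V \<Longrightarrow> u \<noteq> v \<Longrightarrow> touched \<rho> n (K u) \<inter> touched \<rho> n (K v) = {}" using nn(1) by simp
  have nb: "\<And>e f. e \<in> E \<Longrightarrow> f \<in> E \<Longrightarrow> e \<noteq> f \<Longrightarrow> touched \<rho> n (A e) \<inter> touched \<rho> n (A f) = {}" using nn(2) by simp
  have nc: "\<And>e v. e \<in> E \<Longrightarrow> v \<in> V \<Longrightarrow> v \<noteq> fst e \<Longrightarrow> v \<noteq> snd e \<Longrightarrow> touched \<rho> n (A e) \<inter> touched \<rho> n (K v) = {}" using nn(3) by simp
  have nd: "\<And>u v. u \<in> V \<Longrightarrow> v \<in> V \<Longrightarrow> u \<noteq> v \<Longrightarrow> lev v \<le> lev u \<Longrightarrow> touched \<rho> n (X v) \<inter> touched \<rho> n (K u) = {}" using nn(4) by simp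
  have ne: "\<And>e v. e \<in> E \<Longrightarrow> v \<in> V \<Longrightarrow> fst e \<noteq> v \<Longrightarrow> lev v \<le> lev (fst e) \<Longrightarrow> touched \<rho> n (X v) \<inter> touched \<rho> n (A e) = {}" using nn(5) by simp
  note n = na nb nc nd ne
  have n0: "n > 0" using n8 by simp
  define k where "k = (\<lambda>v. touched \<rho> n (K v))"
  define a where "a = (\<lambda>e. touched \<rho> n (A e))"
  define x where "x = (\<lambda>v. touched \<rho> n (X v))"
  note tc = touched_connected[OF \<rho> n0]
  have hit: "touched \<rho> n S \<inter> touched \<rho> n T \<noteq> {}" if ST: "S \<inter> T \<noteq> {}" for S T
  proof -
    obtain z where z: "z \<in> S" "z \<in> T" using ST by blast
    obtain c where "z \<in> square \<rho> n c" using in_some_square \<rho> n0 by blast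
    then show ?thesis using z by (auto simp: touched_def)
  qed
  define G where "G = (\<lambda>e. {(p, q). p \<in> a e - k (snd e) \<and> q \<in> a e - k (snd e) \<and> adj p q})"
  \<comment> \<open>The part of \<open>A e\<close> that can be reached from \<open>K (fst e)\<close>
    without touching \<open>K (snd e)\<close>. Stopping there keeps the regions disjoint, and
    growing from \<open>K (fst e)\<close> keeps them connected.\<close>
  define Q where "Q = (\<lambda>e. {q. \<exists>s\<in>a e \<inter> k (fst e). (s, q) \<in> rtrancl (G e)})"
  define R where "R = (\<lambda>u. k u \<union> (\<Union>e\<in>{e\<in>E. fst e = u}. Q e))"
  have eV: "fst e \<in> V" "snd e \<in> V" "fst e \<noteq> snd e" if "e \<in> E" for e
    using fin(2) irr[of "fst e"] that by (cases e; auto)+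
  have Qa: "q \<in> a e - k (snd e)" if e: "e \<in> E" and q: "q \<in> Q e" for e q
  proof -
    obtain s where s: "s \<in> a e \<inter> k (fst e)" "(s, q) \<in> rtrancl (G e)" using q by (auto simp: Q_def)
    have "s \<in> a e - k (snd e)" using s(1) n(1)[of "fst e" "snd e"] eV[OF e] by (auto simp: k_def)
    with s(2) show ?thesis by (cases rule: rtranclE) (auto simp: G_def)
  qed
  have kR: "k u \<subseteq> R u" for u by (auto simp: R_def)
  have QR: "Q e \<subseteq> R (fst e)" if "e \<in> E" for e using that by (auto simp: R_def)
  have cross: "\<exists>c\<in>R (fst e). \<exists>d\<in>R (snd e). adj c d" if e: "e \<in> E" for e
  proof (rule ccontr)
    assume no: "\<not> (\<exists>c\<in>R (fst e). \<exists>d\<in>R (snd e). adj c d)"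
    obtain s where s: "s \<in> a e \<inter> k (fst e)" using hit[of "A e" "K (fst e)"] A[OF e] by (auto simp: a_def k_def)
    obtain s' where s': "s' \<in> a e \<inter> k (snd e)" using hit[of "A e" "K (snd e)"] A[OF e] by (auto simp: a_def k_def)
    have "(s, s') \<in> rtrancl {(p, q). p \<in> a e \<and> q \<in> a e \<and> adj p q}"
      unfolding a_def by (rule tc) (use A[OF e] s s' in \<open>auto simp: a_def\<close>)
    then have "s' \<in> Q e"
    proof (induction rule: rtrancl_induct)
      case base then show ?case using s by (auto simp: Q_def)
    next
      case (step p q)
      have pq: "q \<in> a e" "adj p q" using step.hyps by auto
      have "q \<notin> k (snd e)" using no step.IH QR[OF e] kR[of "snd e"] pq by blast
      then have "(p, q) \<in> G e" using pq Qa[OF e step.IH] by (auto simp: G_def)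
      then show ?case using step.IH by (auto simp: Q_def intro: rtrancl.rtrancl_into_rtrancl)
    qed
    then show False using Qa[OF e] s' by blast
  qed
  have "\<exists>t. ok r [] t \<and> out [] t = [] \<and> distinct (pushed t) \<and> set (pushed t) = V \<and>
     (\<forall>u\<in>V. \<forall>w\<in>V. (\<exists>c\<in>R u. \<exists>d\<in>R w. adj c d) \<longrightarrow> (u, w) \<in> links [] t)"
  proof (rule regions_to_term[where N = "int n - 1" and esc = x and lev = lev])
    show "1 \<le> int n - 1" using n8 by simp
    show "R v \<subseteq> {0<..<int n - 1} \<times> {0<..<int n - 1}" if v: "v \<in> V" for v
    proof -
      have "k v \<subseteq> {0<..<int n - 1} \<times> {0<..<int n - 1}" unfolding k_def by (rule touched_inside[OF \<rho> n8]) (use K v in blast)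
      moreover have "Q e \<subseteq> {0<..<int n - 1} \<times> {0<..<int n - 1}" if e: "e \<in> E" for e
      proof -
        have "a e \<subseteq> {0<..<int n - 1} \<times> {0<..<int n - 1}" unfolding a_def by (rule touched_inside[OF \<rho> n8]) (use A e in blast)
        then show ?thesis using Qa[OF e] by blast
      qed
      ultimately show ?thesis unfolding R_def by blast
    qed
    show "(c, d) \<in> rtrancl {(p, q). p \<in> R v \<and> q \<in> R v \<and> adj p q}" if v: "v \<in> V" and cd: "c \<in> R v" "d \<in> R v" for v c d
    proof -
      let ?F = "{(p, q). p \<in> R v \<and> q \<in> R v \<and> adj p q}"
      have symF: "(q, p) \<in> rtrancl ?F" if "(p, q) \<in> rtrancl ?F" for p q
      proof -
        have "sym ?F" by (auto simp: sym_def adj_sym)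
        then show ?thesis using symD[OF sym_rtrancl that] by blast
      qed
      have to_k: "\<exists>s\<in>k v. (s, c) \<in> rtrancl ?F" if cR: "c \<in> R v" for c
      proof (cases "c \<in> k v")
        case True then show ?thesis by blast
      next
        case False
        then obtain e where e: "e \<in> E" "fst e = v" "c \<in> Q e" using cR unfolding R_def by blast
        then obtain s where s: "s \<in> a e \<inter> k v" "(s, c) \<in> rtrancl (G e)" by (auto simp: Q_def)
        have "(s, c) \<in> rtrancl ?F \<and> c \<in> Q e" using s(2)
        proof (induction rule: rtrancl_induct)
          case base then show ?case using s(1) e(2) by (auto simp: Q_def)
        next
          case (step p q)
          then have "q \<in> Q e" "adj p q" by (auto simp: Q_def G_def intro: rtrancl.rtrancl_into_rtrancl)
          then have "(p, q) \<in> ?F" using QR[OF e(1)] e(2) step.IH by auto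
          then show ?case using step.IH \<open>q \<in> Q e\<close> by (meson rtrancl.rtrancl_into_rtrancl)
        qed
        then show ?thesis using s by blast
      qed
      obtain s where s: "s \<in> k v" "(s, c) \<in> rtrancl ?F" using to_k cd by blast
      obtain s' where s': "s' \<in> k v" "(s', d) \<in> rtrancl ?F" using to_k cd by blast
      have "(s, s') \<in> rtrancl {(p, q). p \<in> k v \<and> q \<in> k v \<and> adj p q}"
        unfolding k_def by (rule tc) (use K[OF v] s s' in \<open>auto simp: k_def\<close>)
      moreover have "{(p, q). p \<in> k v \<and> q \<in> k v \<and> adj p q} \<subseteq> ?F" using kR[of v] by auto
      ultimately have "(s, s') \<in> rtrancl ?F" using rtrancl_mono by blast
      then show ?thesis using symF[OF s(2)] s'(2) by (meson rtrancl_trans)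
    qed
    show "R u \<inter> R v = {}" if uv: "u \<in> V" "v \<in> V" "u \<noteq> v" for u v
    proof -
      have kk: "k u \<inter> k v = {}" using n(1) uv by (simp add: k_def)
      have kq: "k u \<inter> Q e = {}" if "e \<in> E" "fst e = v" "u \<in> V" "u \<noteq> v" for e u v
      proof (cases "u = snd e")
        case True then show ?thesis using Qa[OF that(1)] by blast
      next
        case False
        then have "a e \<inter> k u = {}" using n(3)[of e u] that by (simp add: a_def k_def)
        then show ?thesis using Qa[OF that(1)] by blast
      qed
      have qq: "Q e \<inter> Q f = {}" if "e \<in> E" "f \<in> E" "fst e = u" "fst f = v" for e f
      proof -
        have "a e \<inter> a f = {}" using n(2)[of e f] that uv by (auto simp: a_def)
        then show ?thesis using Qa[OF that(1)] Qa[OF that(2)] by blast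
      qed
      show ?thesis unfolding R_def using kk kq[of _ v u] kq[of _ u v] qq uv by blast
    qed
    show "1 \<le> lev v \<and> lev v \<le> r" if "v \<in> V" for v using lev that .
    show "\<exists>c\<in>x v. \<exists>d\<in>x v. c \<in> R v \<and> d \<notin> {0..int n - 1} \<times> {0..int n - 1} \<and>
        (c, d) \<in> rtrancl {(p, q). p \<in> x v \<and> q \<in> x v \<and> adj p q}" if v: "v \<in> V" for v
    proof -
      obtain c where c: "c \<in> x v" "c \<in> k v" using hit[of "X v" "K v"] X[OF v] by (auto simp: x_def k_def)
      obtain z where z: "z \<in> X v" "norm z \<ge> 4 * \<rho>" using X[OF v] by blast
      obtain d where d: "d \<in> x v" "d \<notin> {0..int n - 1} \<times> {0..int n - 1}"
        using touched_outside[OF \<rho> n0 z] unfolding x_def by blast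
      have "(c, d) \<in> rtrancl {(p, q). p \<in> x v \<and> q \<in> x v \<and> adj p q}"
        unfolding x_def by (rule tc) (use X[OF v] c d in \<open>auto simp: x_def\<close>)
      then show ?thesis using c d kR[of v] by blast
    qed
    show "x v \<inter> R u = {}" if uv: "u \<in> V" "v \<in> V" "u \<noteq> v" "lev v \<le> lev u" for u v
    proof -
      have "x v \<inter> k u = {}" using n(4) uv by (simp add: x_def k_def)
      moreover have "x v \<inter> Q e = {}" if "e \<in> E" "fst e = u" for e
        using n(5)[of e v] Qa[OF that(1)] uv that unfolding x_def a_def by blast
      ultimately show ?thesis unfolding R_def by blast
    qed
  qed
  then obtain t where t: "ok r [] t" "out [] t = []" "distinct (pushed t)" "set (pushed t) = V"
     "\<forall>u\<in>V. \<forall>w\<in>V. (\<exists>c\<in>R u. \<exists>d\<in>R w. adj c d) \<longrightarrow> (u, w) \<in> links [] t" by (elim exE conjE) (rule_tac that, assumption+)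
  have "E \<subseteq> links [] t"
  proof
    fix e assume e: "e \<in> E"
    have "(fst e, snd e) \<in> links [] t" using t(5) eV[OF e] cross[OF e] by blast
    then show "e \<in> links [] t" by simp
  qed
  then show ?thesis using t(1-4) by blast
qed

subsection \<open>From embeddings to terms\<close>

lemma outside_escape:
  fixes D :: "complex set"
  assumes "compact D" "q \<in> outside D"
  obtains g z where "path g" "pathstart g = q" "norm z \<ge> M" "pathfinish g = z" "path_image g \<inter> D = {}"
proof -
  let ?S = "connected_component_set (- D) q"
  have "q \<notin> D" "\<not> bounded ?S" using assms(2) by (auto simp: outside_def)
  have "open ?S" using assms(1) by (simp add: compact_imp_closed open_Compl open_connected_component)
  moreover have "topological_space_class.connected ?S" by simp
  ultimately have pc: "path_connected ?S" by (simp add: connected_open_path_connected)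
  obtain z where z: "z \<in> ?S" "norm z > M" using \<open>\<not> bounded ?S\<close> by (auto simp: bounded_iff not_le)
  have "q \<in> ?S" using \<open>q \<notin> D\<close> by simp
  then obtain g where "path g" "path_image g \<subseteq> ?S" "pathstart g = q" "pathfinish g = z"
    using pc z(1) unfolding path_connected_def by blast
  moreover have "?S \<subseteq> - D" by (rule connected_component_subset)
  ultimately show thesis using that[of g z] z(2) by auto
qed

lemma initial_piece_avoids:
  fixes g :: "real \<Rightarrow> complex"
  assumes "path g" "closed S" "pathstart g \<notin> S"
  shows "\<exists>b>0. b \<le> 1 / 3 \<and> g ` {0..b} \<inter> S = {}"
proof -
  have c: "continuous_on {0..1} g" using assms(1) by (simp add: path_def)
  have "open (- S)" "g 0 \<in> - S" using assms by (auto simp: pathstart_def)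
  then obtain d where d: "d > 0" "\<And>t. t \<in> {0..1} \<Longrightarrow> dist t 0 < d \<Longrightarrow> g t \<in> - S"
    using c[unfolded continuous_on_topological, rule_format, of 0 "- S"]
    by (metis (no_types, lifting) atLeastAtMost_iff dist_commute open_dist order_refl zero_le_one)
  show ?thesis
    by (rule exI[of _ "min (1 / 3) (d / 2)"]) (use d in \<open>auto simp: dist_real_def\<close>)
qed

locale embedded_graph =
  fixes G :: "nat pair_pre_digraph" and p :: "nat \<Rightarrow> complex" and \<gamma> :: "nat \<times> nat \<Rightarrow> real \<Rightarrow> complex" and r :: nat
  assumes graph: "pair_graph G" and emb: "plane_embedding G p \<gamma>"
    and layers: "pverts G = (\<Union>i \<in> {1..r}. layer G p \<gamma> i)"
begin

definition "V = pverts G"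
definition "E = parcs G"
definition "rem i = remaining G p \<gamma> i"
definition "D i = drawing (with_proj G \<restriction> rem i) p \<gamma>"
text \<open>The number of the layer of \<open>v\<close>, counted from 1: \<open>rem i\<close> is
  what remains after \<open>i\<close> layers have been removed.\<close>

definition "lev v = (LEAST i. v \<notin> rem i)"

interpretation pg: pair_graph G by (rule graph)

lemma finV: "finite V" and finE: "finite E"
  by (simp_all add: V_def E_def pg.pair_finite_verts pg.pair_finite_arcs)

lemma E_sym: "(u, w) \<in> E \<Longrightarrow> (w, u) \<in> E"
  unfolding E_def by (rule pg.arcs_symmetric)

lemma E_V: "(u, w) \<in> E \<Longrightarrow> u \<in> V \<and> w \<in> V \<and> u \<noteq> w"
  using pg.in_arcsD1 pg.in_arcsD2 pg.pair_no_loops unfolding E_def V_def by fastforce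

lemma injp: "inj_on p V" using emb by (simp add: plane_embedding_def V_def)

lemma edge:
  assumes "(u, w) \<in> E"
  shows "arc (\<gamma> (u, w))" "\<gamma> (u, w) 0 = p u" "\<gamma> (u, w) 1 = p w" "\<gamma> (w, u) t = \<gamma> (u, w) (1 - t)"
    "path_image (\<gamma> (u, w)) \<inter> p ` V = {p u, p w}"
proof -
  have "arc (\<gamma> (u, w)) \<and> pathstart (\<gamma> (u, w)) = p u \<and> pathfinish (\<gamma> (u, w)) = p w \<and>
      \<gamma> (w, u) = reversepath (\<gamma> (u, w)) \<and> path_image (\<gamma> (u, w)) \<inter> p ` pverts G = {p u, p w}"
    using emb assms unfolding plane_embedding_def E_def by blast
  then show "arc (\<gamma> (u, w))" "\<gamma> (u, w) 0 = p u" "\<gamma> (u, w) 1 = p w" "\<gamma> (w, u) t = \<gamma> (u, w) (1 - t)"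
    "path_image (\<gamma> (u, w)) \<inter> p ` V = {p u, p w}"
    by (auto simp: pathstart_def pathfinish_def reversepath_def V_def)
qed

lemma edge_path: "(u, w) \<in> E \<Longrightarrow> path (\<gamma> (u, w))"
  using edge(1) by (simp add: arc_def)

lemma edge_inj: "(u, w) \<in> E \<Longrightarrow> s \<in> {0..1} \<Longrightarrow> t \<in> {0..1} \<Longrightarrow> \<gamma> (u, w) s = \<gamma> (u, w) t \<Longrightarrow> s = t"
  using edge(1) by (auto simp: arc_def inj_on_def)

lemma edge_vertex:
  assumes "(u, w) \<in> E" "s \<in> {0..1}" "\<gamma> (u, w) s = p x" "x \<in> V"
  shows "x = u \<and> s = 0 \<or> x = w \<and> s = 1"
proof -
  have "\<gamma> (u, w) s \<in> path_image (\<gamma> (u, w))" unfolding path_image_def using assms(2) by (rule imageI)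
  then have "p x \<in> path_image (\<gamma> (u, w)) \<inter> p ` V" using assms(3,4) by simp
  then have "p x = p u \<or> p x = p w" using edge(5)[OF assms(1)] by blast
  then have "x = u \<or> x = w" using injp assms(4) E_V[OF assms(1)] by (auto dest: inj_onD)
  then show ?thesis
  proof
    assume "x = u"
    then have "s = 0" using edge_inj[OF assms(1,2), of 0] edge(2)[OF assms(1)] assms(3) by simp
    then show ?thesis using \<open>x = u\<close> by simp
  next
    assume "x = w"
    then have "s = 1" using edge_inj[OF assms(1,2), of 1] edge(3)[OF assms(1)] assms(3) by simp
    then show ?thesis using \<open>x = w\<close> by simp
  qed
qed

lemma edge_cross:
  assumes "(u, w) \<in> E" "(x, y) \<in> E" "s \<in> {0..1}" "t \<in> {0..1}" "\<gamma> (u, w) s = \<gamma> (x, y) t" "{u, w} \<noteq> {x, y}"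
  shows "(s = 0 \<or> s = 1) \<and> (t = 0 \<or> t = 1) \<and> (s = 0 \<longrightarrow> t = 0 \<longrightarrow> u = x)"
proof -
  have "\<gamma> (u, w) s \<in> path_image (\<gamma> (u, w))" unfolding path_image_def using assms(3) by (rule imageI)
  moreover have "\<gamma> (x, y) t \<in> path_image (\<gamma> (x, y))" unfolding path_image_def using assms(4) by (rule imageI)
  ultimately have "\<gamma> (u, w) s \<in> path_image (\<gamma> (u, w)) \<inter> path_image (\<gamma> (x, y))" using assms(5) by simp
  also have "\<dots> = p ` ({u, w} \<inter> {x, y})" using emb assms(1,2,6) unfolding plane_embedding_def E_def by blast
  finally obtain z where z: "\<gamma> (u, w) s = p z" "z \<in> {u, w}" "z \<in> {x, y}" by blast
  have zV: "z \<in> V" using z(2) E_V[OF assms(1)] by auto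
  have "z = u \<and> s = 0 \<or> z = w \<and> s = 1" "z = x \<and> t = 0 \<or> z = y \<and> t = 1"
    using edge_vertex[OF assms(1,3) z(1) zV] edge_vertex[OF assms(2,4) _ zV] z(1) assms(5) by auto
  then show ?thesis by auto
qed

lemma rem_antimono: "i \<le> j \<Longrightarrow> rem j \<subseteq> rem i"
  by (induction rule: dec_induct) (auto simp: rem_def)

lemma rem_0: "rem 0 = V" by (simp add: rem_def V_def)

lemma lev:
  assumes "v \<in> V"
  shows "1 \<le> lev v" "lev v \<le> r" "v \<in> rem (lev v - 1)" "p v \<in> frontier (outside (D (lev v - 1)))"
proof -
  obtain i where i: "i \<in> {1..r}" "v \<in> layer G p \<gamma> i" using assms layers by (auto simp: V_def)
  have "v \<notin> rem i" using i by (cases i) (auto simp: rem_def layer_def)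
  then have ex: "v \<notin> rem (lev v)" "lev v \<le> i" unfolding lev_def by (rule LeastI, rule Least_le)
  show "lev v \<le> r" using ex i by simp
  show 1: "1 \<le> lev v" using ex(1) assms rem_0 by (cases "lev v") auto
  show 2: "v \<in> rem (lev v - 1)" using not_less_Least[of "lev v - 1" "\<lambda>i. v \<notin> rem i"] 1 unfolding lev_def by fastforce
  obtain k where k: "lev v = Suc k" using 1 by (cases "lev v") auto
  then show "p v \<in> frontier (outside (D (lev v - 1)))"
    using ex(1) 2 by (auto simp: rem_def outer_vertices_def D_def)
qed

lemma in_rem: "x \<in> V \<Longrightarrow> i < lev x \<Longrightarrow> x \<in> rem i"
  using not_less_Least[of i "\<lambda>i. x \<notin> rem i"] unfolding lev_def by blast

lemma D_eq: "D i = p ` rem i \<union> (\<Union>e\<in>{e \<in> E. fst e \<in> rem i \<and> snd e \<in> rem i}. path_image (\<gamma> e))"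
  by (auto simp: D_def drawing_def E_def induce_subgraph_def)

lemma rem_V: "rem i \<subseteq> V" using rem_antimono[of 0 i] rem_0 by simp

lemma compact_D: "compact (D i)"
proof -
  have "finite (rem i)" using rem_V finV finite_subset by blast
  moreover have "compact (path_image (\<gamma> e))" if "e \<in> E" for e using edge_path[of "fst e" "snd e"] that by (simp add: compact_path_image)
  ultimately show ?thesis unfolding D_eq using finE by (intro compact_Un compact_UN finite_imp_compact[OF finite_imageI]) auto
qed

text \<open>The escape of \<open>v\<close> starts in a small disc around \<open>p v\<close> and then
  stays off the drawing of the vertices of level at least \<open>lev v\<close>. It may still cross
  an edge that leads from such a vertex to a lower level. Therefore only a very short piece of an
  edge between different levels is given to the vertex of higher level, and the rest to the one of
  lower level, whose region the escape is allowed to cross.\<close>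

lemma embedded_graph_term:
  "\<exists>t. ok r [] t \<and> out [] t = [] \<and> distinct (pushed t) \<and> set (pushed t) = V \<and> E \<subseteq> links [] t"
proof -
  \<comment> \<open>All of the drawing except \<open>p v\<close> and the first thirds of the edges
    at \<open>v\<close>.\<close>
  define Z where "Z = (\<lambda>v. p ` (V - {v}) \<union> (\<Union>e\<in>{e \<in> E. fst e \<noteq> v \<and> snd e \<noteq> v}. path_image (\<gamma> e)) \<union>
     (\<Union>e\<in>{e \<in> E. fst e = v}. \<gamma> e ` {1/3..1}))"
  have piece: "compact (\<gamma> (u, w) ` {a..b}) \<and> topological_space_class.connected (\<gamma> (u, w) ` {a..b})" if "(u, w) \<in> E" "0 \<le> a" "b \<le> 1" for u w a b
  proof -
    have "continuous_on {a..b} (\<gamma> (u, w))" by (rule continuous_on_subset[OF edge_path[OF that(1), unfolded path_def]]) (use that in auto)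
    then show ?thesis by (simp add: compact_continuous_image connected_continuous_image)
  qed
  have "closed (Z v)" for v
  proof -
    have "compact (path_image (\<gamma> e))" if "e \<in> E" for e using edge_path[of "fst e" "snd e"] that by (simp add: compact_path_image)
    moreover have "compact (\<gamma> e ` {1/3..1})" if "e \<in> E" for e using piece[of "fst e" "snd e" "1/3" 1] that by simp
    ultimately have "compact (Z v)" unfolding Z_def using finE finV by (intro compact_Un compact_UN) (auto intro: finite_imp_compact)
    then show ?thesis by (rule compact_imp_closed)
  qed
  moreover have pZ: "p v \<notin> Z v" if v: "v \<in> V" for v
  proof
    assume "p v \<in> Z v"
    then consider x where "x \<in> V" "x \<noteq> v" "p v = p x" | u w where "(u, w) \<in> E" "u \<noteq> v" "w \<noteq> v" "p v \<in> path_image (\<gamma> (u, w))"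
      | w t where "(v, w) \<in> E" "t \<in> {1/3..1}" "p v = \<gamma> (v, w) t" unfolding Z_def by fastforce
    then show False
    proof cases
      case 1 then show ?thesis using injp v by (auto dest: inj_onD)
    next
      case 2
      then obtain s where s: "s \<in> {0..1}" "\<gamma> (u, w) s = p v" by (auto simp: path_image_def)
      from edge_vertex[OF 2(1) s v] show ?thesis using 2 by blast
    next
      case 3
      have "t \<in> {0..1}" using 3(2) by simp
      from edge_vertex[OF 3(1) this 3(3)[symmetric] v] show ?thesis using 3 E_V[OF 3(1)] by auto
    qed
  qed
  ultimately have "\<exists>\<epsilon>>0. ball (p v) \<epsilon> \<subseteq> - Z v" if "v \<in> V" for v
    using that open_contains_ball[of "- Z v"] by (simp add: open_Compl)
  then obtain \<epsilon> where \<epsilon>: "\<And>v. v \<in> V \<Longrightarrow> \<epsilon> v > 0 \<and> ball (p v) (\<epsilon> v) \<subseteq> - Z v" by metis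
  obtain \<rho> where \<rho>: "\<rho> > 0" "D 0 \<subseteq> ball 0 (\<rho> / 2)"
  proof -
    obtain B where "B > 0" "\<And>x. x \<in> D 0 \<Longrightarrow> norm x \<le> B" using compact_imp_bounded[OF compact_D[of 0]] bounded_pos by blast
    then show thesis using that[of "4 * B"] by force
  qed
  have ex_esc: "\<exists>q g z. q \<in> ball (p v) (\<epsilon> v) \<and> path g \<and> pathstart g = q \<and> norm z \<ge> 4 * \<rho> \<and> pathfinish g = z \<and> path_image g \<inter> D (lev v - 1) = {}"
    if v: "v \<in> V" for v
  proof -
    have "p v \<in> closure (outside (D (lev v - 1)))" using lev(4)[OF v] by (simp add: frontier_def)
    then obtain q where q: "q \<in> outside (D (lev v - 1))" "dist q (p v) < \<epsilon> v" using \<epsilon>[OF v] closure_approachable by blast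
    obtain g z where "path g" "pathstart g = q" "norm z \<ge> 4 * \<rho>" "pathfinish g = z" "path_image g \<inter> D (lev v - 1) = {}"
      using outside_escape[OF compact_D q(1), where M = "4 * \<rho>"] by metis
    then show ?thesis using q(2) by (intro exI[of _ q] exI[of _ g] exI[of _ z]) (simp add: dist_commute)
  qed
  obtain q g z where esc: "\<And>v. v \<in> V \<Longrightarrow> q v \<in> ball (p v) (\<epsilon> v) \<and> path (g v) \<and> pathstart (g v) = q v \<and> norm (z v) \<ge> 4 * \<rho> \<and>
      pathfinish (g v) = z v \<and> path_image (g v) \<inter> D (lev v - 1) = {}"
  proof -
    define P where "P = (\<lambda>v h. fst h \<in> ball (p v) (\<epsilon> v) \<and> path (fst (snd h)) \<and> pathstart (fst (snd h)) = fst h \<and> norm (snd (snd h)) \<ge> 4 * \<rho> \<and>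
      pathfinish (fst (snd h)) = snd (snd h) \<and> path_image (fst (snd h)) \<inter> D (lev v - 1) = {})"
    have "\<forall>v\<in>V. \<exists>h. P v h"
    proof
      fix v assume "v \<in> V"
      then obtain q g z where "q \<in> ball (p v) (\<epsilon> v) \<and> path g \<and> pathstart g = q \<and> norm z \<ge> 4 * \<rho> \<and> pathfinish g = z \<and> path_image g \<inter> D (lev v - 1) = {}"
        using ex_esc by blast
      then show "\<exists>h. P v h" by (intro exI[of _ "(q, g, z)"]) (simp add: P_def)
    qed
    then obtain h where h: "\<forall>v\<in>V. P v (h v)" using bchoice[of V P] by blast
    show thesis
      by (rule that[of "\<lambda>v. fst (h v)" "\<lambda>v. fst (snd (h v))" "\<lambda>v. snd (snd (h v))"]) (use h in \<open>simp only: P_def\<close>)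
  qed
  \<comment> \<open>Edges that the escape of \<open>v\<close> may cross although \<open>x\<close> is
    on no lower level than \<open>v\<close>: because of \<open>y\<close> the edge is absent from
    \<open>D (lev v - 1)\<close>. But \<open>p x\<close> is still in that set, so some initial piece
    of the edge is missed by the escape.\<close>
  define bad where "bad = {(v, x, y). v \<in> V \<and> (x, y) \<in> E \<and> lev y < lev v \<and> lev v \<le> lev x}"
  have "\<exists>b>0. b \<le> 1 / 3 \<and> \<gamma> (x, y) ` {0..b} \<inter> path_image (g v) = {}" if "(v, x, y) \<in> bad" for v x y
  proof -
    have b: "v \<in> V" "(x, y) \<in> E" "lev v \<le> lev x" using that by (auto simp: bad_def)
    have "x \<in> rem (lev v - 1)" using in_rem[of x "lev v - 1"] E_V[OF b(2)] b(3) lev(1)[OF b(1)] by simp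
    then have "p x \<in> D (lev v - 1)" by (auto simp: D_eq)
    then have "pathstart (\<gamma> (x, y)) \<notin> path_image (g v)" using esc[OF b(1)] edge(2)[OF b(2)] by (auto simp: pathstart_def)
    then show ?thesis using initial_piece_avoids[OF edge_path[OF b(2)], of "path_image (g v)"] esc[OF b(1)]
      by (simp add: closed_path_image)
  qed
  then obtain b where b: "\<And>v x y. (v, x, y) \<in> bad \<Longrightarrow> b v x y > 0 \<and> b v x y \<le> 1 / 3 \<and> \<gamma> (x, y) ` {0..b v x y} \<inter> path_image (g v) = {}"
    by metis
  have finbad: "finite bad"
    by (rule finite_subset[of _ "V \<times> E"]) (auto simp: bad_def finV finE)
  define \<beta> where "\<beta> = Min (insert (1 / 3) ((\<lambda>(v, x, y). b v x y) ` bad))"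
  have \<beta>0: "\<beta> > 0" unfolding \<beta>_def using finbad b by (subst Min_gr_iff) auto
  have \<beta>3: "\<beta> \<le> 1 / 3" unfolding \<beta>_def using finbad by (intro Min_le) auto
  have \<beta>b: "\<beta> \<le> b v x y" if "(v, x, y) \<in> bad" for v x y
    unfolding \<beta>_def using finbad that by (intro Min_le) (auto intro!: rev_image_eqI[OF that])
  \<comment> \<open>How far the edge from \<open>u\<close> to \<open>w\<close> belongs to
    \<open>u\<close>. Thirds at both ends of an edge are disjoint, and \<open>\<beta>\<close> is
    short enough for all escapes counted in \<open>bad\<close>.\<close>
  define s where "s = (\<lambda>u w. if lev u \<le> lev w then 1 / 3 else \<beta>)"
  have s: "0 < s u w" "s u w \<le> 1 / 3" for u w using \<beta>0 \<beta>3 by (auto simp: s_def)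
  define K where "K = (\<lambda>u. insert (p u) (\<Union>w\<in>{w. (u, w) \<in> E}. \<gamma> (u, w) ` {0..s u w}))"
  \<comment> \<open>Each edge once, directed away from its end of lower level, which is to receive
    the middle part; ties are broken by the names of the vertices.\<close>
  define F where "F = {(u, w) \<in> E. lev u < lev w \<or> lev u = lev w \<and> u < w}"
  define A where "A = (\<lambda>(u, w). \<gamma> (u, w) ` {1/3..1 - s w u})"
  define X where "X = (\<lambda>v. closed_segment (p v) (q v) \<union> path_image (g v))"
  have inD: "\<gamma> (u, w) t \<in> D i" if "(u, w) \<in> E" "t \<in> {0..1}" "u \<in> rem i" "w \<in> rem i" for u w t i
    using that unfolding D_eq path_image_def by force
  have inZ1: "\<gamma> (u, w) t \<in> Z v" if "(u, w) \<in> E" "t \<in> {0..1}" "u \<noteq> v" "w \<noteq> v" for u w t v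
    using that unfolding Z_def path_image_def by force
  have inZ2: "\<gamma> (u, v) t \<in> Z v" if "(u, v) \<in> E" "t \<in> {0..2/3}" for u t v
  proof -
    have "\<gamma> (u, v) t = \<gamma> (v, u) (1 - t)" using edge(4)[OF E_sym[OF that(1)]] by simp
    then show ?thesis unfolding Z_def using E_sym[OF that(1)] that(2) by force
  qed
  have seg: "closed_segment (p v) (q v) \<inter> Z v = {}" if "v \<in> V" for v
  proof -
    have "closed_segment (p v) (q v) \<subseteq> ball (p v) (\<epsilon> v)"
      using esc[OF that] \<epsilon>[OF that] by (intro closed_segment_subset) auto
    then show ?thesis using \<epsilon>[OF that] by blast
  qed
  have FE: "(u, w) \<in> E" "u \<in> V" "w \<in> V" "u \<noteq> w" "lev u \<le> lev w" "s u w = 1 / 3" if "(u, w) \<in> F" for u w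
    using that E_V[of u w] by (auto simp: F_def s_def)
  have finU: "finite {w. (u, w) \<in> E}" for u
    by (rule finite_subset[of _ "snd ` E"]) (force simp: finE)+
  have "\<exists>t. ok r [] t \<and> out [] t = [] \<and> distinct (pushed t) \<and> set (pushed t) = V \<and> F \<subseteq> links [] t"
  proof (rule compact_regions_to_term[where K = K and A = A and X = X and lev = lev and \<rho> = \<rho>])
    show "finite V" by (rule finV)
    show "F \<subseteq> V \<times> V" using FE by auto
    show "\<rho> > 0" by (rule \<rho>(1))
    show "(u, u) \<notin> F" for u using FE by blast
    show "1 \<le> lev v \<and> lev v \<le> r" if "v \<in> V" for v using lev that by blast
    show "compact (K v) \<and> topological_space_class.connected (K v) \<and> K v \<subseteq> ball 0 (\<rho> / 2)" if v: "v \<in> V" for v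
    proof (intro conjI)
      have pc: "compact (\<gamma> (v, w) ` {0..s v w}) \<and> topological_space_class.connected (\<gamma> (v, w) ` {0..s v w})" if "(v, w) \<in> E" for w
        using piece[OF that, of 0 "s v w"] s[of v w] by simp
      show "compact (K v)" unfolding K_def using finU pc by (intro compact_insert compact_UN) auto
      have Keq: "K v = \<Union> (insert {p v} ((\<lambda>w. \<gamma> (v, w) ` {0..s v w}) ` {w. (v, w) \<in> E}))" by (auto simp: K_def)
      have pin: "p v \<in> \<gamma> (v, w) ` {0..s v w}" if "(v, w) \<in> E" for w
        by (rule image_eqI[of _ _ 0]) (use edge(2)[OF that] s[of v w] in auto)
      show "topological_space_class.connected (K v)"
        unfolding Keq by (rule connected_Union) (use pc pin in auto)
      have "K v \<subseteq> D 0"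
      proof -
        have "\<gamma> (v, w) t \<in> D 0" if "(v, w) \<in> E" "t \<in> {0..s v w}" for w t
          using inD[OF that(1), of t 0] that(2) s[of v w] rem_0 E_V[OF that(1)] by simp
        moreover have "p v \<in> D 0" using v rem_0 by (auto simp: D_eq)
        ultimately show ?thesis unfolding K_def by auto
      qed
      then show "K v \<subseteq> ball 0 (\<rho> / 2)" using \<rho>(2) by blast
    qed
    show "compact (A e) \<and> topological_space_class.connected (A e) \<and> A e \<subseteq> ball 0 (\<rho> / 2) \<and> A e \<inter> K (fst e) \<noteq> {} \<and> A e \<inter> K (snd e) \<noteq> {}"
      if "e \<in> F" for e
    proof -
      obtain u w where e: "e = (u, w)" by (cases e)
      note f = FE[OF that[unfolded e]]
      have Ae: "A e = \<gamma> (u, w) ` {1/3..1 - s w u}" by (simp add: A_def e)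
      have 1: "compact (A e) \<and> topological_space_class.connected (A e)" unfolding Ae using piece[OF f(1), of "1/3" "1 - s w u"] s[of w u] by simp
      have "A e \<subseteq> D 0" unfolding Ae using inD[OF f(1), of _ 0] rem_0 f(2,3) s[of w u] by auto
      then have 2: "A e \<subseteq> ball 0 (\<rho> / 2)" using \<rho>(2) by blast
      have "\<gamma> (u, w) (1/3) \<in> A e" unfolding Ae using s(2)[of w u] by (intro imageI) auto
      moreover have "\<gamma> (u, w) (1/3) \<in> K u" unfolding K_def using f(1,6) by force
      ultimately have 3: "A e \<inter> K u \<noteq> {}" by blast
      have "\<gamma> (u, w) (1 - s w u) \<in> A e" unfolding Ae using s(2)[of w u] by (intro imageI) auto
      moreover have "\<gamma> (u, w) (1 - s w u) \<in> K w"
      proof -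
        have "\<gamma> (u, w) (1 - s w u) = \<gamma> (w, u) (s w u)" using edge(4)[OF f(1)] by simp
        then show ?thesis unfolding K_def using E_sym[OF f(1)] s(1)[of w u] by force
      qed
      ultimately have "A e \<inter> K w \<noteq> {}" by blast
      then show ?thesis using 1 2 3 by (simp add: e)
    qed
    have Kcases: "x = p u \<or> (\<exists>w t. (u, w) \<in> E \<and> x = \<gamma> (u, w) t \<and> 0 \<le> t \<and> t \<le> s u w)" if "x \<in> K u" for x u
      using that unfolding K_def by auto
    show "K u \<inter> K v = {}" if uv: "u \<in> V" "v \<in> V" "u \<noteq> v" for u v
    proof (rule ccontr)
      assume "K u \<inter> K v \<noteq> {}"
      then obtain x where x: "x \<in> K u" "x \<in> K v" by blast
      have pe: False if "u \<in> V" "v \<in> V" "u \<noteq> v" "x = p u" "x \<in> K v" for u v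
        using Kcases[OF that(5)]
      proof
        assume "x = p v" then show False using that injp by (auto dest: inj_onD)
      next
        assume "\<exists>w t. (v, w) \<in> E \<and> x = \<gamma> (v, w) t \<and> 0 \<le> t \<and> t \<le> s v w"
        then obtain w t where wt: "(v, w) \<in> E" "x = \<gamma> (v, w) t" "0 \<le> t" "t \<le> s v w" by blast
        have "t \<in> {0..1}" using wt s(2)[of v w] by auto
        from edge_vertex[OF wt(1) this _ that(1)] show False using wt that s(2)[of v w] by auto
      qed
      show False
      proof (cases "x = p u \<or> x = p v")
        case True then show False using pe x uv by metis
      next
        case False
        then obtain w t y t' where wt: "(u, w) \<in> E" "x = \<gamma> (u, w) t" "0 \<le> t" "t \<le> s u w"
           "(v, y) \<in> E" "x = \<gamma> (v, y) t'" "0 \<le> t'" "t' \<le> s v y" using Kcases[OF x(1)] Kcases[OF x(2)] by blast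
        have tt: "t \<in> {0..1}" "t' \<in> {0..1}" "t + t' < 1" using wt s(2)[of u w] s(2)[of v y] by auto
        show False
        proof (cases "{u, w} = {v, y}")
          case True
          then have "u = y" "w = v" using uv(3) by (auto simp: doubleton_eq_iff)
          then have "\<gamma> (u, w) t = \<gamma> (u, w) (1 - t')" using wt edge(4)[OF wt(1)] by simp
          then have "t = 1 - t'" using edge_inj[OF wt(1) tt(1), of "1 - t'"] tt(2) by simp
          then show False using tt(3) by simp
        next
          case False
          have "\<gamma> (u, w) t = \<gamma> (v, y) t'" using wt by simp
          from edge_cross[OF wt(1,5) tt(1,2) this False] show False using uv wt(3,4,7,8) s(2)[of u w] s(2)[of v y] by auto
        qed
      qed
    qed
    show "A e \<inter> A f = {}" if ef: "e \<in> F" "f \<in> F" "e \<noteq> f" for e f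
    proof (rule ccontr)
      assume "A e \<inter> A f \<noteq> {}"
      obtain u w x y where e: "e = (u, w)" "f = (x, y)" by (metis prod.exhaust)
      note a = FE[OF ef(1)[unfolded e]] and c = FE[OF ef(2)[unfolded e]]
      obtain t t' where t: "\<gamma> (u, w) t = \<gamma> (x, y) t'" "t \<in> {1/3..1 - s w u}" "t' \<in> {1/3..1 - s y x}"
        using \<open>A e \<inter> A f \<noteq> {}\<close> unfolding A_def e split_conv by blast
      have "{u, w} \<noteq> {x, y}" using ef e by (auto simp: F_def doubleton_eq_iff)
      moreover have "t \<in> {0..1}" "t' \<in> {0..1}" "t \<noteq> 0" "t \<noteq> 1" using t s(1)[of w u] s(1)[of y x] by auto
      ultimately show False using edge_cross[OF a(1) c(1)] t by blast
    qed
    show "A e \<inter> K v = {}" if ev: "e \<in> F" "v \<in> V" "v \<noteq> fst e" "v \<noteq> snd e" for e v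
    proof (rule ccontr)
      assume "A e \<inter> K v \<noteq> {}"
      obtain u w where e: "e = (u, w)" by (cases e)
      note f = FE[OF ev(1)[unfolded e]]
      obtain t where t: "\<gamma> (u, w) t \<in> K v" "t \<in> {1/3..1 - s w u}"
        using \<open>A e \<inter> K v \<noteq> {}\<close> unfolding A_def e split_conv by blast
      have t01: "t \<in> {0..1}" "t \<noteq> 0" "t \<noteq> 1" using t s(1)[of w u] by auto
      show False using Kcases[OF t(1)]
      proof
        assume "\<gamma> (u, w) t = p v" then show False using edge_vertex[OF f(1) t01(1) _ ev(2)] t01 by auto
      next
        assume "\<exists>y t'. (v, y) \<in> E \<and> \<gamma> (u, w) t = \<gamma> (v, y) t' \<and> 0 \<le> t' \<and> t' \<le> s v y"
        then obtain y t' where y: "(v, y) \<in> E" "\<gamma> (u, w) t = \<gamma> (v, y) t'" "0 \<le> t'" "t' \<le> s v y" by blast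
        have "t' \<in> {0..1}" using y s(2)[of v y] by auto
        moreover have "{u, w} \<noteq> {v, y}" using ev e by auto
        ultimately show False using edge_cross[OF f(1) y(1) t01(1) _ y(2)] t01 by blast
      qed
    qed
    show "compact (X v) \<and> topological_space_class.connected (X v) \<and> X v \<inter> K v \<noteq> {} \<and> (\<exists>z\<in>X v. norm z \<ge> 4 * \<rho>)" if v: "v \<in> V" for v
    proof (intro conjI)
      have gv: "path (g v)" "pathstart (g v) = q v" using esc[OF v] by auto
      show "compact (X v)" unfolding X_def using gv by (intro compact_Un) (auto simp: compact_path_image)
      have "q v \<in> closed_segment (p v) (q v) \<inter> path_image (g v)" using gv(2) pathstart_in_path_image[of "g v"] by auto
      then show "topological_space_class.connected (X v)" unfolding X_def using gv by (intro connected_Un) (auto simp: connected_path_image)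
      show "X v \<inter> K v \<noteq> {}" by (auto simp: X_def K_def)
      have "z v \<in> path_image (g v)" using esc[OF v] pathfinish_in_path_image[of "g v"] by simp
      then show "\<exists>z\<in>X v. norm z \<ge> 4 * \<rho>" using esc[OF v] by (auto simp: X_def)
    qed
    show "X v \<inter> K u = {}" if uv: "u \<in> V" "v \<in> V" "u \<noteq> v" "lev v \<le> lev u" for u v
    proof (rule ccontr)
      assume "X v \<inter> K u \<noteq> {}"
      then obtain x where x: "x \<in> X v" "x \<in> K u" by blast
      have ur: "u \<in> rem (lev v - 1)" using in_rem[OF uv(1), of "lev v - 1"] uv(4) lev(1)[OF uv(2)] by simp
      consider "x = p u" | w t where "(u, w) \<in> E" "x = \<gamma> (u, w) t" "0 \<le> t" "t \<le> s u w" using Kcases[OF x(2)] by blast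
      then show False
      proof cases
        case 1
        then have "x \<in> Z v" "x \<in> D (lev v - 1)" using uv ur by (auto simp: Z_def D_eq)
        then show False using x(1) seg[OF uv(2)] esc[OF uv(2)] by (auto simp: X_def)
      next
        case 2
        have t: "t \<in> {0..1}" "t \<in> {0..2/3}" using 2 s(2)[of u w] by auto
        have "x \<in> Z v"
        proof (cases "w = v")
          case True then show ?thesis using inZ2[of u v t] 2 t by simp
        next
          case False then show ?thesis using inZ1[OF 2(1) t(1) uv(3) False] 2 by simp
        qed
        then have xg: "x \<in> path_image (g v)" using x(1) seg[OF uv(2)] by (auto simp: X_def)
        show False
        proof (cases "lev v \<le> lev w")
          case True
          then have "w \<in> rem (lev v - 1)" using in_rem[of w "lev v - 1"] E_V[OF 2(1)] lev(1)[OF uv(2)] by simp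
          then have "x \<in> D (lev v - 1)" using inD[OF 2(1) t(1) ur] 2 by simp
          then show False using xg esc[OF uv(2)] by blast
        next
          case False
          \<comment> \<open>The edge goes down below the level of \<open>v\<close>, and it is the
            small length \<open>\<beta>\<close> that keeps the piece at \<open>u\<close> away from
            the escape.\<close>
          then have bd: "(v, u, w) \<in> bad" using uv 2 by (auto simp: bad_def)
          have "s u w = \<beta>" using False uv by (simp add: s_def)
          then have "t \<in> {0..b v u w}" using 2 \<beta>b[OF bd] by auto
          then show False using b[OF bd] xg 2 by blast
        qed
      qed
    qed
    show "X v \<inter> A e = {}" if ev: "e \<in> F" "v \<in> V" "fst e \<noteq> v" "lev v \<le> lev (fst e)" for e v
    proof (rule ccontr)
      assume "X v \<inter> A e \<noteq> {}"
      obtain u w where e: "e = (u, w)" by (cases e)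
      note f = FE[OF ev(1)[unfolded e]]
      obtain t where t: "\<gamma> (u, w) t \<in> X v" "t \<in> {1/3..1 - s w u}"
        using \<open>X v \<inter> A e \<noteq> {}\<close> unfolding A_def e split_conv by blast
      have t01: "t \<in> {0..1}" using t s(1)[of w u] by auto
      have lv: "lev v \<le> lev u" "lev v \<le> lev w" "u \<noteq> v" using ev f(5) e by auto
      have "u \<in> rem (lev v - 1)" "w \<in> rem (lev v - 1)" using in_rem[of _ "lev v - 1"] f lv lev(1)[OF ev(2)] by simp_all
      then have "\<gamma> (u, w) t \<in> D (lev v - 1)" using inD[OF f(1) t01] by blast
      then have sg: "\<gamma> (u, w) t \<in> closed_segment (p v) (q v)" using t(1) esc[OF ev(2)] by (auto simp: X_def)
      have "\<gamma> (u, w) t \<in> Z v"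
      proof (cases "w = v")
        case True
        \<comment> \<open>An edge of \<open>F\<close> that ends in \<open>v\<close> joins two
          vertices of the same level here, so a full third at \<open>v\<close> does not belong to
          \<open>A e\<close>.\<close>
        then have "lev w \<le> lev u" using lv by simp
        then have "s w u = 1 / 3" by (simp add: s_def)
        then show ?thesis using inZ2[of u v t] f(1) True t(2) by simp
      next
        case False then show ?thesis using inZ1[OF f(1) t01 lv(3) False] by simp
      qed
      then show False using sg seg[OF ev(2)] by blast
    qed
  qed
  then obtain t where t: "ok r [] t" "out [] t = []" "distinct (pushed t)" "set (pushed t) = V" "F \<subseteq> links [] t" by blast
  have "(u, w) \<in> links [] t" if "(u, w) \<in> E" for u w
  proof -
    have "(u, w) \<in> F \<or> (w, u) \<in> F" using that E_sym[OF that] E_V[OF that] by (auto simp: F_def)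
    then show ?thesis using t(5) links_sym[of "[]" t] by (auto dest: symD)
  qed
  then show ?thesis using t(1-4) by (intro exI[of _ t]) auto
qed

end

lemma outerplanar_imp_term:
  fixes G :: "nat pair_pre_digraph"
  assumes "pair_graph G" "outerplanar r G"
  shows "\<exists>t. ok r [] t \<and> out [] t = [] \<and> distinct (pushed t) \<and> set (pushed t) = pverts G \<and> parcs G \<subseteq> links [] t"
proof -
  obtain p \<gamma> where "plane_embedding G p \<gamma>" "pverts G = (\<Union>i \<in> {1..r}. layer G p \<gamma> i)"
    using assms(2) by (auto simp: outerplanar_def)
  then interpret embedded_graph G p \<gamma> r using assms(1) by (intro embedded_graph.intro)
  show ?thesis using embedded_graph_term by (simp add: V_def E_def)
qed

subsection \<open>Drawing a tour\<close>

text \<open>A tour is the sequence of stacks of a closed term; position \<open>i\<close> belongs to the vertex on top of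
  the \<open>i\<close>-th stack. The drawing puts position \<open>i\<close> near \<open>(i, 0)\<close>, chords become parabolas in the
  upper half plane, and each vertex sits in the lower half plane, exponentially
  deeper the lower its level, and is joined to its positions by straight spokes.\<close>

locale tour =
  fixes S :: "nat \<Rightarrow> nat list" and L r :: nat and C :: "(nat \<times> nat) set"
  assumes S0: "S 0 = []"
    and step: "\<And>k. k < L \<Longrightarrow> (\<exists>v. S (Suc k) = v # S k) \<or> S k \<noteq> [] \<and> S (Suc k) = tl (S k)"
    and len: "\<And>k. k \<le> L \<Longrightarrow> length (S k) \<le> r"
    and once: "\<And>k l v. k < L \<Longrightarrow> l < L \<Longrightarrow> S (Suc k) = v # S k \<Longrightarrow> S (Suc l) = v # S l \<Longrightarrow> k = l"
    and C: "\<And>a b. (a, b) \<in> C \<Longrightarrow> a \<le> b \<and> b \<le> L"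
    and nocross: "\<And>a b c d. (a, b) \<in> C \<Longrightarrow> (c, d) \<in> C \<Longrightarrow> \<not> (a < c \<and> c < b \<and> b < d)"
begin

definition "V = {v. \<exists>k<L. S (Suc k) = v # S k}"
definition "pos v = Suc (THE k. k < L \<and> S (Suc k) = v # S k)"
definition "depth v = length (S (pos v))"
definition "tip i = hd (S i)"

lemma pos:
  assumes "v \<in> V"
  shows "1 \<le> pos v" "pos v \<le> L" "S (pos v) = v # S (pos v - 1)"
proof -
  obtain k where k: "k < L" "S (Suc k) = v # S k" using assms by (auto simp: V_def)
  have "(THE k. k < L \<and> S (Suc k) = v # S k) = k" using k once by (intro the_equality) blast+
  then show "1 \<le> pos v" "pos v \<le> L" "S (pos v) = v # S (pos v - 1)" using k by (auto simp: pos_def)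
qed

lemma pos_eq: "k < L \<Longrightarrow> S (Suc k) = v # S k \<Longrightarrow> v \<in> V \<and> pos v = Suc k"
proof -
  assume k: "k < L" "S (Suc k) = v # S k"
  have "(THE k. k < L \<and> S (Suc k) = v # S k) = k" using k once by (intro the_equality) blast+
  then show ?thesis using k by (auto simp: pos_def V_def)
qed

text \<open>As long as \<open>v\<close> is not popped, the stack of the moment of its push persists
  as a suffix; and after it is popped it cannot come back, because it is pushed only once.\<close>

lemma on_stack:
  "i \<le> L \<Longrightarrow> v \<in> set (S i) \<Longrightarrow> v \<in> V \<and> pos v \<le> i \<and> (\<forall>j. pos v \<le> j \<longrightarrow> j \<le> i \<longrightarrow> (\<exists>xs. S j = xs @ S (pos v)))"
proof (induction i rule: less_induct)
  case (less i)
  show ?case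
  proof (cases i)
    case 0 then show ?thesis using less.prems S0 by simp
  next
    case (Suc k)
    then have k: "k < L" "k < i" using less.prems by auto
    show ?thesis
    proof (cases "v \<in> set (S k)")
      case True
      then have IH: "v \<in> V" "pos v \<le> k" "\<And>j. pos v \<le> j \<Longrightarrow> j \<le> k \<Longrightarrow> \<exists>xs. S j = xs @ S (pos v)"
        using less.IH[OF k(2)] k by auto
      obtain xs where xs: "S k = xs @ S (pos v)" using IH by blast
      have "\<exists>xs. S (Suc k) = xs @ S (pos v)"
      proof -
        consider w where "S (Suc k) = w # S k" | "S k \<noteq> []" "S (Suc k) = tl (S k)" using step[OF k(1)] by blast
        then show ?thesis
        proof cases
          case 1 then show ?thesis using xs by auto
        next
          case 2
          show ?thesis
          proof (cases xs)
            case Nil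
            then have "S (Suc k) = S (pos v - 1)" using 2 xs pos(3)[OF IH(1)] by simp
            then have "v \<in> set (S (pos v - 1))" using less.prems Suc by simp
            moreover have "pos v - 1 < i" using IH(2) k by simp
            ultimately have "pos v \<le> pos v - 1" using less.IH[of "pos v - 1"] pos[OF IH(1)] by simp
            then show ?thesis using pos(1)[OF IH(1)] by simp
          next
            case (Cons y ys)
            then show ?thesis using 2 xs by auto
          qed
        qed
      qed
      then have "\<exists>xs. S j = xs @ S (pos v)" if "pos v \<le> j" "j \<le> i" for j
        using that IH(3)[of j] Suc by (cases "j = Suc k") auto
      then show ?thesis using IH Suc by auto
    next
      case False
      then obtain w where w: "S (Suc k) = w # S k"
        using step[OF k(1)] less.prems Suc set_tl_subset[of "S k"] by auto
      then have "w = v" using False less.prems Suc by auto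
      then have "v \<in> V" "pos v = i" using pos_eq[OF k(1)] w Suc by auto
      then show ?thesis by auto
    qed
  qed
qed

lemma distinct_stack: "i \<le> L \<Longrightarrow> distinct (S i)"
proof (induction i)
  case 0 then show ?case by (simp add: S0)
next
  case (Suc k)
  then have k: "k < L" "distinct (S k)" by auto
  consider w where "S (Suc k) = w # S k" | "S (Suc k) = tl (S k)" using step[OF k(1)] by blast
  then show ?case
  proof cases
    case 1
    have "w \<notin> set (S k)" using on_stack[of k w] pos_eq[OF k(1) 1] k(1) by auto
    then show ?thesis using 1 k by simp
  next
    case 2 then show ?thesis using k by (simp add: distinct_tl)
  qed
qed

lemma tip_in: "i \<le> L \<Longrightarrow> S i \<noteq> [] \<Longrightarrow> tip i \<in> V \<and> pos (tip i) \<le> i \<and> S i = S (pos (tip i))"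
proof -
  assume i: "i \<le> L" "S i \<noteq> []"
  have m: "tip i \<in> set (S i)" using i by (simp add: tip_def)
  from on_stack[OF i(1) m] obtain xs where xs: "tip i \<in> V" "pos (tip i) \<le> i" "S i = xs @ S (pos (tip i))" by blast
  have "xs = []"
  proof (rule ccontr)
    assume "xs \<noteq> []"
    then have "tip i \<in> set xs" using xs(3) by (metis hd_append2 list.set_sel(1) tip_def)
    moreover have "tip i \<in> set (S (pos (tip i)))" using pos(3)[OF xs(1)] by (metis list.set_intros(1))
    ultimately show False using distinct_stack[OF i(1)] xs(3) by (metis disjoint_iff distinct_append)
  qed
  then show ?thesis using xs by simp
qed

lemma tip_V: "i \<le> L \<Longrightarrow> S i \<noteq> [] \<Longrightarrow> tip i \<in> V"
  and tip_pos: "i \<le> L \<Longrightarrow> S i \<noteq> [] \<Longrightarrow> pos (tip i) \<le> i"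
  using tip_in by blast+

lemma depth_bounds: "v \<in> V \<Longrightarrow> 1 \<le> depth v \<and> depth v \<le> r"
  using pos[of v] len[of "pos v"] by (simp add: depth_def)

text \<open>At time \<open>i\<close> the stack is the one that existed when \<open>tip i\<close> was
  pushed, so whatever was pushed in between has been popped for good. This nesting of subtrees is
  what the drawing relies on.\<close>

lemma nested:
  assumes i: "i \<le> L" "S i \<noteq> []" and w: "w \<in> V" "pos (tip i) < pos w" "pos w \<le> i"
  shows "depth (tip i) < depth w" "pos w < i" "\<And>j. j \<le> L \<Longrightarrow> S j \<noteq> [] \<Longrightarrow> tip j = w \<Longrightarrow> j < i"
proof -
  define u where "u = tip i"
  have u: "u \<in> V" "pos u \<le> i" "S i = S (pos u)" using tip_in[OF i] by (auto simp: u_def)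
  have "u \<in> set (S i)" using i by (simp add: u_def tip_def)
  then have "\<forall>j. pos u \<le> j \<longrightarrow> j \<le> i \<longrightarrow> (\<exists>xs. S j = xs @ S (pos u))" using on_stack[OF i(1), of u] by blast
  then obtain xs where xs: "S (pos w) = xs @ S (pos u)" using w(2,3) unfolding u_def[symmetric] by (meson less_imp_le)
  have ne: "u \<noteq> w" using w by (auto simp: u_def)
  have "xs \<noteq> []" using xs pos(3)[OF w(1)] pos(3)[OF u(1)] ne by auto
  then show 1: "depth (tip i) < depth w" using xs by (simp add: depth_def u_def)
  have nw: "w \<notin> set (S i)"
  proof
    assume "w \<in> set (S i)"
    then obtain ys where "S i = ys @ S (pos w)" using on_stack[OF i(1), of w] w(3) by blast
    then have "length (S i) \<ge> depth w" by (simp add: depth_def)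
    then show False using 1 u(3) by (simp add: depth_def u_def)
  qed
  then show "pos w < i" using w(3) pos(3)[OF w(1)] by (metis le_neq_implies_less list.set_intros(1))
  fix j assume j: "j \<le> L" "S j \<noteq> []" "tip j = w"
  show "j < i"
  proof (rule ccontr)
    assume "\<not> j < i"
    moreover have "w \<in> set (S j)" using j by (auto simp: tip_def)
    ultimately obtain ys where "S i = ys @ S (pos w)" using on_stack[OF j(1), of w] w(3) by (meson not_less)
    then show False using nw pos(3)[OF w(1)] by simp
  qed
qed

text \<open>The shifts separate chord ends that share a position. Chords at position
  \<open>i\<close> start between \<open>i + 1/4\<close> and \<open>i + 1/2\<close> and end between
  \<open>i - 1/4\<close> and \<open>i\<close>. Among chords with a common start, the longer one
  starts further left; among chords with a common end, the longer one ends further right. So nested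
  chords occupy strictly nested intervals.\<close>

definition "\<eta> = 1 / (4 * (real L + 1))"
definition "lx c = real (fst c) + 1 / 2 - \<eta> * real (snd c)"
definition "rx c = real (snd c) - \<eta> * real (fst c)"
text \<open>With this ratio between consecutive levels, a spoke that is at least a quarter away from
  its upper end in horizontal direction is below all vertices of greater depth: it spans less than
  \<open>L + 2\<close>, and \<open>H / 4 = L + 2\<close>.\<close>

definition "H = 4 * (real L + 2)"
definition "hgt v = H ^ (r + 1 - depth v)"
text \<open>Half a unit before the first position of \<open>v\<close>, hence to the left of all
  chord ends that belong to \<open>v\<close>.\<close>

definition "vx v = real (pos v) - 1 / 2"
definition "P v = Complex (vx v) (- hgt v)"

lemma eta: "0 < \<eta>" "a \<le> L \<Longrightarrow> \<eta> * real a < 1 / 4"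
proof -
  show "0 < \<eta>" by (simp add: \<eta>_def)
  assume "a \<le> L"
  then have "real a < real L + 1" by simp
  then show "\<eta> * real a < 1 / 4" by (simp add: \<eta>_def field_simps)
qed

lemma endpoint_bounds:
  assumes "(a, b) \<in> C" "a < b"
  shows "real a + 1 / 4 < lx (a, b)" "lx (a, b) < real a + 1 / 2" "real b - 1 / 4 < rx (a, b)" "rx (a, b) \<le> real b"
    "lx (a, b) < rx (a, b)"
proof -
  have L: "a \<le> L" "b \<le> L" using C[OF assms(1)] by auto
  show 1: "real a + 1 / 4 < lx (a, b)" using eta(2)[OF L(2)] by (simp add: lx_def)
  have "0 < \<eta> * real b" using eta(1) assms(2) by simp
  then show 2: "lx (a, b) < real a + 1 / 2" by (simp add: lx_def)
  show 3: "real b - 1 / 4 < rx (a, b)" using eta(2)[OF L(1)] by (simp add: rx_def)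
  show "rx (a, b) \<le> real b" using eta(1) by (simp add: rx_def)
  show "lx (a, b) < rx (a, b)" using 2 3 assms(2) by simp
qed

text \<open>The use of \<open>nocross\<close>: the intervals of two chords are disjoint or strictly
  nested, even if the chords share positions.\<close>

lemma chords_separate_aux:
  assumes "(a, b) \<in> C" "(c, d) \<in> C" "a < b" "c < d" "a < c \<or> a = c \<and> d < b"
  shows "rx (a, b) < lx (c, d) \<or> lx (a, b) < lx (c, d) \<and> rx (c, d) < rx (a, b)"
proof -
  note e = endpoint_bounds[OF assms(1,3)] and f = endpoint_bounds[OF assms(2,4)]
  have nc: "\<not> (a < c \<and> c < b \<and> b < d)" using nocross assms by blast
  show ?thesis
  proof (cases "a < c")
    case True
    show ?thesis
    proof (cases "b \<le> c")
      case True then show ?thesis using e f by linarith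
    next
      case False
      then have db: "d \<le> b" using nc True by simp
      have "real a + 1 \<le> real c" using True by simp
      then have l: "lx (a, b) < lx (c, d)" using e f by linarith
      have "rx (c, d) < rx (a, b)"
      proof (cases "d = b")
        case d: True
        have "\<eta> * real a < \<eta> * real c" using eta(1) True by simp
        then show ?thesis using d by (simp add: rx_def)
      next
        case False
        then have "real d + 1 \<le> real b" using db by simp
        then show ?thesis using e f by linarith
      qed
      then show ?thesis using l by simp
    qed
  next
    case False
    then have ac: "a = c" "d < b" using assms(5) by auto
    have "\<eta> * real d < \<eta> * real b" using eta(1) ac by simp
    then have "lx (a, b) < lx (c, d)" using ac by (simp add: lx_def)
    moreover have "real d + 1 \<le> real b" using ac by simp
    ultimately show ?thesis using e f by linarith
  qed
qed

lemma chords_separate: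
  assumes "c \<in> C" "d \<in> C" "fst c < snd c" "fst d < snd d" "c \<noteq> d"
  shows "rx c < lx d \<or> rx d < lx c \<or> lx c < lx d \<and> rx d < rx c \<or> lx d < lx c \<and> rx c < rx d"
proof -
  obtain a b a' b' where *: "c = (a, b)" "d = (a', b')" by (metis prod.exhaust)
  then consider "a < a' \<or> a = a' \<and> b' < b" | "a' < a \<or> a' = a \<and> b < b'" using assms(5) by force
  then show ?thesis
  proof cases
    case 1 then show ?thesis using chords_separate_aux[of a b a' b'] assms * by auto
  next
    case 2 then show ?thesis using chords_separate_aux[of a' b' a b] assms * by auto
  qed
qed

lemma hgt_pos: "hgt v > 0" by (simp add: hgt_def H_def)

lemma hgt_mono: "w \<in> V \<Longrightarrow> depth u < depth w \<Longrightarrow> H * hgt w \<le> hgt u"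
proof -
  assume a: "w \<in> V" "depth u < depth w"
  have H1: "H \<ge> 1" by (simp add: H_def)
  have "H * hgt w = H ^ Suc (r + 1 - depth w)" by (simp add: hgt_def)
  also have "\<dots> \<le> H ^ (r + 1 - depth u)" using H1 depth_bounds[OF a(1)] a(2) by (intro power_increasing) auto
  finally show ?thesis by (simp add: hgt_def)
qed

definition "spoke u x = closed_segment (P u) (Complex x 0)"

lemma spoke_point:
  assumes "z \<in> spoke u x" "vx u < x"
  shows "vx u \<le> Re z" "Re z \<le> x" "Im z * (x - vx u) = - hgt u * (x - Re z)" "Im z \<le> 0" "- hgt u \<le> Im z"
    "Im z = 0 \<Longrightarrow> Re z = x" "Re z = vx u \<Longrightarrow> z = P u"
proof -
  obtain t where t: "0 \<le> t" "t \<le> 1" "z = (1 - t) *\<^sub>R P u + t *\<^sub>R Complex x 0"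
    using assms(1) by (auto simp: spoke_def in_segment)
  have re: "Re z = vx u + t * (x - vx u)" and im: "Im z = - (1 - t) * hgt u" by (simp_all add: t P_def algebra_simps)
  have tx: "0 \<le> t * (x - vx u)" "t * (x - vx u) \<le> x - vx u" using t assms(2) by (auto simp: mult_left_le_one_le)
  show "vx u \<le> Re z" "Re z \<le> x" using re tx by linarith+
  show "Im z * (x - vx u) = - hgt u * (x - Re z)" by (simp add: re im algebra_simps)
  have "0 \<le> (1 - t) * hgt u" using t hgt_pos[of u] by simp
  then show "Im z \<le> 0" using im by (simp add: algebra_simps)
  have "(1 - t) * hgt u \<le> hgt u" using t hgt_pos[of u] by (simp add: mult_left_le_one_le)
  then show "- hgt u \<le> Im z" using im by (simp add: algebra_simps)
  show "Re z = x" if "Im z = 0"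
  proof -
    have "t = 1" using that im hgt_pos[of u] by simp
    then show ?thesis using re by simp
  qed
  show "z = P u" if "Re z = vx u"
  proof -
    have "t = 0" using that re assms(2) by simp
    then show ?thesis using t by simp
  qed
qed

lemma spokes_same:
  assumes "z \<in> spoke u x" "z \<in> spoke u x'" "vx u < x" "vx u < x'" "x \<noteq> x'"
  shows "z = P u"
proof -
  have a: "Im z * (x - vx u) = - hgt u * (x - Re z)" "Im z * (x' - vx u) = - hgt u * (x' - Re z)"
    using spoke_point(3) assms by blast+
  have "Im z * (x - x') = - hgt u * (x - x')" using a by (simp add: algebra_simps)
  then have "(Im z + hgt u) * (x - x') = 0" by (simp add: algebra_simps)
  then have "Im z = - hgt u" using assms(5) by simp
  then have "- hgt u * (x - vx u) = - hgt u * (x - Re z)" using a by simp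
  then have "Re z = vx u" using hgt_pos[of u] by simp
  then show ?thesis using spoke_point(7) assms by blast
qed

text \<open>\<open>at_pos i x\<close>: \<open>x\<close> can be the end of a chord at position \<open>i\<close>.\<close>

definition "at_pos i x \<longleftrightarrow> i \<le> L \<and> S i \<noteq> [] \<and> real i - 1 / 4 < x \<and> x < real i + 1 / 2"

lemma at_pos_vx: "at_pos i x \<Longrightarrow> vx (tip i) < x"
proof -
  assume a: "at_pos i x"
  then have "pos (tip i) \<le> i" using tip_pos by (simp add: at_pos_def)
  then have "real (pos (tip i)) \<le> real i" by simp
  then show ?thesis using a unfolding at_pos_def vx_def by linarith
qed

text \<open>If the spoke reaches the column of a vertex \<open>w\<close> that was pushed after
  \<open>tip i\<close>, then \<open>w\<close> was pushed before time \<open>i\<close> as well. So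
  \<open>w\<close> has greater depth, and the spoke is steep enough to pass below
  \<open>P w\<close>.\<close>

lemma spoke_below:
  assumes "at_pos i x" "w \<in> V" "pos (tip i) < pos w" "z \<in> spoke (tip i) x" "vx w \<le> Re z"
  shows "depth (tip i) < depth w" "pos w < i" "Re z \<le> x - 1 / 4 \<Longrightarrow> Im z < - hgt w"
proof -
  have i: "i \<le> L" "S i \<noteq> []" "x < real i + 1 / 2" "real i - 1 / 4 < x" using assms(1) by (auto simp: at_pos_def)
  note sp = spoke_point[OF assms(4) at_pos_vx[OF assms(1)]]
  have "real (pos w) < real i + 1" using sp(2) assms(5) i(3) by (simp add: vx_def)
  then have "pos w \<le> i" by simp
  then show d: "depth (tip i) < depth w" and "pos w < i" using nested[OF i(1,2) assms(2,3)] by auto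
  assume far: "Re z \<le> x - 1 / 4"
  have u: "tip i \<in> V" by (rule tip_V[OF i(1,2)])
  have span: "0 < x - vx (tip i)" "x - vx (tip i) \<le> real L + 1"
    using at_pos_vx[OF assms(1)] i(1,3) pos(1)[OF u] by (auto simp: vx_def)
  have "hgt (tip i) * (1 / 4) \<le> hgt (tip i) * (x - Re z)" using far hgt_pos[of "tip i"] by (intro mult_left_mono) auto
  moreover have "H * hgt w \<le> hgt (tip i)" by (rule hgt_mono[OF assms(2) d])
  moreover have "H * hgt w = 4 * (hgt w * (real L + 2))" by (simp add: H_def)
  ultimately have "hgt w * (real L + 2) \<le> hgt (tip i) * (x - Re z)" by linarith
  moreover have "hgt w * (x - vx (tip i)) < hgt w * (real L + 2)" using span hgt_pos[of w] by (intro mult_strict_left_mono) auto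
  ultimately have "hgt w * (x - vx (tip i)) < - (Im z * (x - vx (tip i)))" using sp(3) by linarith
  then have "(hgt w + Im z) * (x - vx (tip i)) < 0" by (simp add: algebra_simps)
  then have "hgt w + Im z < 0" using span(1) by (simp add: mult_less_0_iff)
  then show "Im z < - hgt w" by simp
qed

lemma pos_inj:
  assumes "u \<in> V" "w \<in> V" "pos u = pos w"
  shows "u = w"
proof -
  have "hd (S (pos u)) = u" "hd (S (pos w)) = w" using pos(3) assms(1,2) by (metis list.sel(1))+
  then show ?thesis using assms(3) by metis
qed

text \<open>In the columns of the spoke of the vertex pushed later, the spoke of the other vertex is
  already below that vertex, which is the lowest point of its own spoke.\<close>

lemma spokes_disjoint:
  assumes "at_pos i x" "at_pos j y" "tip i \<noteq> tip j" "z \<in> spoke (tip i) x" "z \<in> spoke (tip j) y"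
  shows False
proof -
  have *: False if "at_pos i x" "at_pos j y" "pos (tip i) < pos (tip j)" "z \<in> spoke (tip i) x" "z \<in> spoke (tip j) y" for i x j y
  proof -
    have j: "j \<le> L" "S j \<noteq> []" using that(2) by (auto simp: at_pos_def)
    have i: "i \<le> L" "S i \<noteq> []" using that(1) by (auto simp: at_pos_def)
    have w: "tip j \<in> V" by (rule tip_V[OF j])
    note sp = spoke_point[OF that(5) at_pos_vx[OF that(2)]]
    have "pos (tip j) < i" by (rule spoke_below(2)[OF that(1) w that(3,4) sp(1)])
    then have "j < i" using nested(3)[OF i w that(3) _ j] by simp
    then have "real j + 1 \<le> real i" by simp
    then have "Re z \<le> x - 1 / 4" using sp(2) that(1,2) unfolding at_pos_def by linarith
    then have "Im z < - hgt (tip j)" by (rule spoke_below(3)[OF that(1) w that(3,4) sp(1)])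
    then show False using sp(5) by simp
  qed
  have "tip i \<in> V" "tip j \<in> V" by (rule tip_V; use assms(1,2) in \<open>simp add: at_pos_def\<close>)+
  then have "pos (tip i) \<noteq> pos (tip j)" using pos_inj[of "tip i" "tip j"] assms(3) by metis
  then consider "pos (tip i) < pos (tip j)" | "pos (tip j) < pos (tip i)" by linarith
  then show False
  proof cases
    case 1 show False by (rule *[OF assms(1,2) 1 assms(4,5)])
  next
    case 2 show False by (rule *[OF assms(2,1) 2 assms(5,4)])
  qed
qed

lemma vertex_on_spoke:
  assumes "at_pos i x" "v \<in> V" "P v \<in> spoke (tip i) x"
  shows "v = tip i"
proof (rule ccontr)
  assume ne: "v \<noteq> tip i"
  have u: "tip i \<in> V" by (rule tip_V; use assms(1) in \<open>simp add: at_pos_def\<close>)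
  have re: "Re (P v) = vx v" "Im (P v) = - hgt v" by (simp_all add: P_def)
  have "vx (tip i) \<le> vx v" using spoke_point(1)[OF assms(3) at_pos_vx[OF assms(1)]] re by simp
  then have "pos (tip i) \<le> pos v" by (simp add: vx_def)
  moreover have "pos (tip i) \<noteq> pos v" using pos_inj[OF u assms(2)] ne by metis
  ultimately have lt: "pos (tip i) < pos v" by (rule le_neq_implies_less)
  have "pos v < i" by (rule spoke_below(2)[OF assms(1,2) lt assms(3)]) (simp add: re)
  then have "real (pos v) + 1 \<le> real i" by simp
  then have "Re (P v) \<le> x - 1 / 4" using assms(1) unfolding re vx_def at_pos_def by linarith
  then have "Im (P v) < - hgt v" by (rule spoke_below(3)[OF assms(1,2) lt assms(3), rotated]) (simp add: re)
  then show False using re by simp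
qed

text \<open>A parabola, the graph of \<open>(x - lx c) * (rx c - x)\<close>. All arches have the
  same leading coefficient, so strictly nested intervals give disjoint arches.\<close>

definition "arch c t = Complex (lx c + t * (rx c - lx c)) ((rx c - lx c)\<^sup>2 * (t * (1 - t)))"

lemma arch_point:
  assumes "z \<in> path_image (arch c)" "lx c < rx c"
  shows "lx c \<le> Re z" "Re z \<le> rx c" "Im z = (Re z - lx c) * (rx c - Re z)" "Im z \<ge> 0"
    "Im z = 0 \<Longrightarrow> z = Complex (lx c) 0 \<or> z = Complex (rx c) 0"
proof -
  obtain t where t: "0 \<le> t" "t \<le> 1" "z = arch c t" using assms(1) by (auto simp: path_image_def)
  have "0 \<le> t * (rx c - lx c)" "t * (rx c - lx c) \<le> rx c - lx c" using t assms(2) by (auto simp: mult_left_le_one_le)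
  then show 1: "lx c \<le> Re z" "Re z \<le> rx c" using t by (auto simp: arch_def)
  show 2: "Im z = (Re z - lx c) * (rx c - Re z)" using t by (simp add: arch_def power2_eq_square algebra_simps)
  show "Im z \<ge> 0" using 1 2 by simp
  show "z = Complex (lx c) 0 \<or> z = Complex (rx c) 0" if "Im z = 0"
  proof -
    have "Re z = lx c \<or> Re z = rx c" using that 2 by auto
    then show ?thesis using that by (auto simp: complex_eq_iff)
  qed
qed

lemma arc_arch: "lx c < rx c \<Longrightarrow> arc (arch c)"
proof -
  assume l: "lx c < rx c"
  have "continuous_on {0..1} (arch c)" unfolding arch_def Complex_eq by (intro continuous_intros)
  moreover have "inj_on (arch c) {0..1}" using l by (intro inj_onI) (simp add: arch_def)
  ultimately show ?thesis by (simp add: arc_def path_def)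
qed

lemma arches_disjoint:
  assumes "c \<in> C" "d \<in> C" "fst c < snd c" "fst d < snd d" "c \<noteq> d" "z \<in> path_image (arch c)" "z \<in> path_image (arch d)"
  shows False
proof -
  have l: "lx c < rx c" "lx d < rx d" using endpoint_bounds(5)[of "fst c" "snd c"] endpoint_bounds(5)[of "fst d" "snd d"] assms by auto
  note p = arch_point[OF assms(6) l(1)] and q = arch_point[OF assms(7) l(2)]
  have nest: False if "lx c < lx d" "rx d < rx c" "z \<in> path_image (arch c)" "z \<in> path_image (arch d)" "lx c < rx c" "lx d < rx d" for c d
  proof -
    note p = arch_point[OF that(3,5)] and q = arch_point[OF that(4,6)]
    have "(Re z - lx d) * (rx d - Re z) \<le> (Re z - lx d) * (rx c - Re z)" using that q(1) by (intro mult_left_mono) auto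
    also have "\<dots> < (Re z - lx c) * (rx c - Re z)" using that q(2) by (intro mult_strict_right_mono) auto
    finally show False using p(3) q(3) by simp
  qed
  from chords_separate[OF assms(1-5)] show False
    using p q nest[of c d] nest[of d c] assms(6,7) l by (elim disjE) auto
qed

definition "curve c = linepath (P (tip (fst c))) (Complex (lx c) 0) +++ arch c +++ linepath (Complex (rx c) 0) (P (tip (snd c)))"

definition "good c \<longleftrightarrow> c \<in> C \<and> S (fst c) \<noteq> [] \<and> S (snd c) \<noteq> [] \<and> tip (fst c) \<noteq> tip (snd c)"

lemma good:
  assumes "good c"
  shows "fst c < snd c" "at_pos (fst c) (lx c)" "at_pos (snd c) (rx c)" "lx c < rx c" "tip (fst c) \<in> V" "tip (snd c) \<in> V"
proof -
  have c: "(fst c, snd c) \<in> C" using assms by (simp add: good_def)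
  show l: "fst c < snd c" using C[OF c] assms by (auto simp: good_def order_le_less)
  note e = endpoint_bounds[OF c l]
  show "at_pos (fst c) (lx c)" "at_pos (snd c) (rx c)" using e C[OF c] assms by (auto simp: at_pos_def good_def)
  show "lx c < rx c" using e by simp
  show "tip (fst c) \<in> V" "tip (snd c) \<in> V" using C[OF c] assms by (auto simp: good_def intro!: tip_V)
qed

lemma curve_image:
  assumes "good c"
  shows "path_image (curve c) = spoke (tip (fst c)) (lx c) \<union> path_image (arch c) \<union> spoke (tip (snd c)) (rx c)"
proof -
  have "pathfinish (arch c) = Complex (rx c) 0" "pathstart (arch c) = Complex (lx c) 0" by (simp_all add: arch_def pathfinish_def pathstart_def)
  then show ?thesis by (simp add: curve_def path_image_join spoke_def closed_segment_commute Un_assoc)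
qed

lemma spoke_arch:
  assumes "at_pos i x" "lx c < rx c" "z \<in> spoke (tip i) x" "z \<in> path_image (arch c)"
  shows "z = Complex x 0 \<and> (x = lx c \<or> x = rx c)"
proof -
  note s = spoke_point[OF assms(3) at_pos_vx[OF assms(1)]] and a = arch_point[OF assms(4,2)]
  have "Im z = 0" using s(4) a(4) by simp
  then show ?thesis using s(6) a(5) by (auto simp: complex_eq_iff)
qed

lemma arc_curve:
  assumes "good c"
  shows "arc (curve c)" "pathstart (curve c) = P (tip (fst c))" "pathfinish (curve c) = P (tip (snd c))"
proof -
  note g = good[OF assms]
  have fs: "pathfinish (arch c) = Complex (rx c) 0" "pathstart (arch c) = Complex (lx c) 0" by (simp_all add: arch_def pathfinish_def pathstart_def)
  have ne: "P u \<noteq> Complex x 0" for u x using hgt_pos[of u] by (simp add: P_def)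
  have a2: "arc (arch c +++ linepath (Complex (rx c) 0) (P (tip (snd c))))"
  proof (rule arc_join)
    show "arc (arch c)" by (rule arc_arch[OF g(4)])
    show "arc (linepath (Complex (rx c) 0) (P (tip (snd c))))" using ne[of "tip (snd c)" "rx c"] by (intro arc_linepath) metis
    show "path_image (arch c) \<inter> path_image (linepath (Complex (rx c) 0) (P (tip (snd c)))) \<subseteq> {pathstart (linepath (Complex (rx c) 0) (P (tip (snd c))))}"
      using spoke_arch[OF g(3,4)] by (auto simp: spoke_def closed_segment_commute)
  qed (simp add: fs)
  have "arc (linepath (P (tip (fst c))) (Complex (lx c) 0) +++ (arch c +++ linepath (Complex (rx c) 0) (P (tip (snd c)))))"
  proof (rule arc_join)
    show "arc (linepath (P (tip (fst c))) (Complex (lx c) 0))" using ne by (intro arc_linepath)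
    show "path_image (linepath (P (tip (fst c))) (Complex (lx c) 0)) \<inter> path_image (arch c +++ linepath (Complex (rx c) 0) (P (tip (snd c))))
       \<subseteq> {pathstart (arch c +++ linepath (Complex (rx c) 0) (P (tip (snd c))))}"
    proof
      fix z assume z: "z \<in> path_image (linepath (P (tip (fst c))) (Complex (lx c) 0)) \<inter> path_image (arch c +++ linepath (Complex (rx c) 0) (P (tip (snd c))))"
      then have zs: "z \<in> spoke (tip (fst c)) (lx c)" by (simp add: spoke_def)
      have "z \<in> path_image (arch c) \<or> z \<in> spoke (tip (snd c)) (rx c)"
        using z by (simp add: path_image_join fs spoke_def closed_segment_commute)
      then have "z = Complex (lx c) 0"
        using spoke_arch[OF g(2,4) zs] spokes_disjoint[OF g(2,3) _ zs] assms by (auto simp: good_def)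
      then show "z \<in> {pathstart (arch c +++ linepath (Complex (rx c) 0) (P (tip (snd c))))}" by (simp add: fs)
    qed
  qed (simp_all add: a2 fs)
  then show "arc (curve c)" by (simp add: curve_def)
  show "pathstart (curve c) = P (tip (fst c))" "pathfinish (curve c) = P (tip (snd c))" by (simp_all add: curve_def)
qed

lemma curve_vertices:
  assumes "good c" "v \<in> V" "P v \<in> path_image (curve c)"
  shows "v = tip (fst c) \<or> v = tip (snd c)"
proof -
  note g = good[OF assms(1)]
  have "P v \<notin> path_image (arch c)" using arch_point(4)[of "P v" c] g(4) hgt_pos[of v] by (auto simp: P_def)
  then show ?thesis using assms vertex_on_spoke[OF g(2) assms(2)] vertex_on_spoke[OF g(3) assms(2)]
    unfolding curve_image[OF assms(1)] by blast
qed

lemma curves_meet: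
  assumes "good c" "good d" "c \<noteq> d" "z \<in> path_image (curve c)" "z \<in> path_image (curve d)"
  shows "\<exists>v\<in>{tip (fst c), tip (snd c)} \<inter> {tip (fst d), tip (snd d)}. z = P v"
proof -
  note g = good[OF assms(1)] and h = good[OF assms(2)]
  have sep: "lx c \<noteq> lx d" "lx c \<noteq> rx d" "rx c \<noteq> lx d" "rx c \<noteq> rx d"
    using chords_separate[of c d] assms(1-3) g(1,4) h(1,4) unfolding good_def by linarith+
  have ss: "\<exists>v\<in>{tip i} \<inter> {tip j}. z = P v" if "at_pos i x" "at_pos j y" "x \<noteq> y" "z \<in> spoke (tip i) x" "z \<in> spoke (tip j) y" for i j x y
  proof -
    have e: "tip i = tip j" using spokes_disjoint[OF that(1,2) _ that(4,5)] by blast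
    have "z = P (tip i)"
      by (rule spokes_same[OF that(4) that(5)[folded e] at_pos_vx[OF that(1)] at_pos_vx[OF that(2), folded e] that(3)])
    then show ?thesis using e by simp
  qed
  define sp where "sp = (\<lambda>c. \<exists>i x. at_pos i x \<and> (x = lx c \<or> x = rx c) \<and> (i = fst c \<or> i = snd c) \<and> z \<in> spoke (tip i) x)"
  have cases: "z \<in> path_image (arch c) \<or> sp c" if "good c" "z \<in> path_image (curve c)" for c
  proof -
    have "z \<in> path_image (arch c) \<or> z \<in> spoke (tip (fst c)) (lx c) \<or> z \<in> spoke (tip (snd c)) (rx c)"
      using that(2) unfolding curve_image[OF that(1)] by blast
    then show ?thesis unfolding sp_def using good(2,3)[OF that(1)] by blast
  qed
  have sa: False if spc: "sp c" and hyps: "z \<in> path_image (arch d)" "lx d < rx d" "lx c \<noteq> lx d" "lx c \<noteq> rx d" "rx c \<noteq> lx d" "rx c \<noteq> rx d" for c d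
  proof -
    obtain i x where ix: "at_pos i x" "x = lx c \<or> x = rx c" "z \<in> spoke (tip i) x" using spc unfolding sp_def by blast
    show False using spoke_arch[OF ix(1) hyps(2) ix(3) hyps(1)] ix(2) hyps(3-6) by auto
  qed
  have aa: "\<not> (z \<in> path_image (arch c) \<and> z \<in> path_image (arch d))"
    using arches_disjoint[of c d z] assms(1-3) g(1) h(1) unfolding good_def by metis
  have "sp c" using cases[OF assms(1,4)] cases[OF assms(2,5)] aa sa[of d c] g(4) sep by metis
  moreover have "sp d" using cases[OF assms(1,4)] cases[OF assms(2,5)] aa sa[of c d] h(4) sep by metis
  ultimately obtain i x j y where 4: "at_pos i x" "x = lx c \<or> x = rx c" "i = fst c \<or> i = snd c" "z \<in> spoke (tip i) x"
     "at_pos j y" "y = lx d \<or> y = rx d" "j = fst d \<or> j = snd d" "z \<in> spoke (tip j) y" unfolding sp_def by blast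
  have "x \<noteq> y" using 4(2,6) sep by metis
  from ss[OF 4(1,5) this 4(4,8)] have "tip i = tip j" "z = P (tip i)" by auto
  moreover have "tip i \<in> {tip (fst c), tip (snd c)}" "tip j \<in> {tip (fst d), tip (snd d)}" using 4(3,7) by auto
  ultimately show ?thesis by auto
qed

section \<open>The plane graph of a tour\<close>

definition "joins u w c \<longleftrightarrow> good c \<and> {tip (fst c), tip (snd c)} = {u, w}"
definition "graph_of = \<lparr> pverts = V, parcs = {(u, w). \<exists>c. joins u w c} \<rparr>"
text \<open>Several chords may join the same two vertices. The choice depends on \<open>min\<close>
  and \<open>max\<close> only, so that both arcs of an edge get the same curve.\<close>

definition "chord u w = (SOME c. joins (min u w) (max u w) c)"
definition "edge_curve = (\<lambda>(u, w). if tip (fst (chord u w)) = u then curve (chord u w) else reversepath (curve (chord u w)))"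

lemma joins_sym: "joins u w c = joins w u c" by (auto simp: joins_def insert_commute)

lemma chord: "(u, w) \<in> parcs graph_of \<Longrightarrow> joins u w (chord u w)"
proof -
  assume "(u, w) \<in> parcs graph_of"
  then obtain c where "joins u w c" by (auto simp: graph_of_def)
  then have "joins (min u w) (max u w) c" using joins_sym[of u w c] by (simp add: min_def max_def)
  then have "joins (min u w) (max u w) (chord u w)" unfolding chord_def by (rule someI)
  then show ?thesis using joins_sym[of u w "chord u w"] by (simp add: min_def max_def split: if_splits)
qed

lemma chord_commute: "chord u w = chord w u" by (simp add: chord_def min.commute max.commute)

lemma joins_V: "joins u w c \<Longrightarrow> u \<in> V \<and> w \<in> V \<and> u \<noteq> w"
  using good[of c] by (auto simp: joins_def doubleton_eq_iff good_def)

lemma finite_V: "finite V"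
proof -
  have "V \<subseteq> (\<lambda>k. hd (S (Suc k))) ` {..<L}" by (force simp: V_def)
  then show ?thesis by (rule finite_subset) simp
qed

lemma pair_graph_graph_of: "pair_graph graph_of"
proof
  show "finite (pverts graph_of)" by (simp add: graph_of_def finite_V)
  have "parcs graph_of \<subseteq> V \<times> V" using joins_V by (auto simp: graph_of_def)
  then show "finite (parcs graph_of)" by (rule finite_subset) (simp add: finite_V)
  show "fst e \<in> pverts graph_of" "snd e \<in> pverts graph_of" "fst e \<noteq> snd e" if "e \<in> parcs graph_of" for e
    using that joins_V by (cases e; force simp: graph_of_def)+
  show "symmetric (with_proj graph_of)"
    using joins_sym by (auto simp: symmetric_def sym_def arcs_ends_def arc_to_ends_def graph_of_def image_iff)
qed

lemma edge_curve_image: "path_image (edge_curve (u, w)) = path_image (curve (chord u w))"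
  by (simp add: edge_curve_def)

lemma P_inj: "inj_on P V"
proof (rule inj_onI)
  fix u w assume uw: "u \<in> V" "w \<in> V" "P u = P w"
  then have "pos u = pos w" by (simp add: P_def vx_def)
  then show "u = w" using pos_inj uw by blast
qed

lemma plane_embedding_graph_of: "plane_embedding graph_of P edge_curve"
proof -
  have single: "arc (edge_curve (u, w)) \<and> pathstart (edge_curve (u, w)) = P u \<and> pathfinish (edge_curve (u, w)) = P w \<and>
      edge_curve (w, u) = reversepath (edge_curve (u, w)) \<and> path_image (edge_curve (u, w)) \<inter> P ` V = {P u, P w}"
    if e: "(u, w) \<in> parcs graph_of" for u w
  proof -
    define c where "c = chord u w"
    have j: "joins u w c" using chord[OF e] by (simp add: c_def)
    then have g: "good c" and t: "{tip (fst c), tip (snd c)} = {u, w}" by (auto simp: joins_def)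
    have ne: "u \<noteq> w" "u \<in> V" "w \<in> V" using joins_V[OF j] by auto
    note a = arc_curve[OF g]
    have cw: "chord w u = c" by (simp add: c_def chord_commute)
    have im: "path_image (curve c) \<inter> P ` V = {P u, P w}"
    proof
      show "path_image (curve c) \<inter> P ` V \<subseteq> {P u, P w}"
      proof
        fix z assume "z \<in> path_image (curve c) \<inter> P ` V"
        then obtain v where v: "v \<in> V" "z = P v" "P v \<in> path_image (curve c)" by blast
        have "v \<in> {tip (fst c), tip (snd c)}" using curve_vertices[OF g v(1,3)] by simp
        then show "z \<in> {P u, P w}" unfolding t v(2) by auto
      qed
      have "P (tip (fst c)) \<in> path_image (curve c)" "P (tip (snd c)) \<in> path_image (curve c)"
        using a(2,3) pathstart_in_path_image[of "curve c"] pathfinish_in_path_image[of "curve c"] by simp_all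
      then have "P ` {u, w} \<subseteq> path_image (curve c)" unfolding t[symmetric] by simp
      then show "{P u, P w} \<subseteq> path_image (curve c) \<inter> P ` V" using ne by simp
    qed
    consider "tip (fst c) = u" "tip (snd c) = w" | "tip (fst c) = w" "tip (snd c) = u" using t by (auto simp: doubleton_eq_iff)
    then show ?thesis
    proof cases
      case 1
      then have "edge_curve (u, w) = curve c" "edge_curve (w, u) = reversepath (curve c)"
        using ne by (simp_all add: edge_curve_def cw flip: c_def)
      then show ?thesis using a 1 im by simp
    next
      case 2
      then have "edge_curve (u, w) = reversepath (curve c)" "edge_curve (w, u) = curve c"
        using ne by (simp_all add: edge_curve_def cw flip: c_def)
      then show ?thesis using a 2 im by (simp add: arc_reversepath)
    qed
  qed
  have cross: "path_image (edge_curve (u, w)) \<inter> path_image (edge_curve (x, y)) = P ` ({u, w} \<inter> {x, y})"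
    if e: "(u, w) \<in> parcs graph_of" "(x, y) \<in> parcs graph_of" and ne: "{u, w} \<noteq> {x, y}" for u w x y
  proof
    have j: "joins u w (chord u w)" "joins x y (chord x y)" using chord e by blast+
    have t: "{tip (fst (chord u w)), tip (snd (chord u w))} = {u, w}" "{tip (fst (chord x y)), tip (snd (chord x y))} = {x, y}"
      and gg: "good (chord u w)" "good (chord x y)" using j by (auto simp: joins_def)
    have nc: "chord u w \<noteq> chord x y"
    proof
      assume "chord u w = chord x y"
      then show False using t ne by simp
    qed
    show "path_image (edge_curve (u, w)) \<inter> path_image (edge_curve (x, y)) \<subseteq> P ` ({u, w} \<inter> {x, y})"
    proof
      fix z assume "z \<in> path_image (edge_curve (u, w)) \<inter> path_image (edge_curve (x, y))"
      then have "z \<in> path_image (curve (chord u w))" "z \<in> path_image (curve (chord x y))" by (simp_all add: edge_curve_image)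
      from curves_meet[OF gg nc this] show "z \<in> P ` ({u, w} \<inter> {x, y})" unfolding t by (elim bexE) simp
    qed
    show "P ` ({u, w} \<inter> {x, y}) \<subseteq> path_image (edge_curve (u, w)) \<inter> path_image (edge_curve (x, y))"
    proof
      fix z assume "z \<in> P ` ({u, w} \<inter> {x, y})"
      then have "z \<in> {P u, P w}" "z \<in> {P x, P y}" by auto
      moreover have "{P u, P w} \<subseteq> path_image (edge_curve (u, w))" "{P x, P y} \<subseteq> path_image (edge_curve (x, y))"
        using single[OF e(1)] single[OF e(2)] by (metis Int_lower1)+
      ultimately show "z \<in> path_image (edge_curve (u, w)) \<inter> path_image (edge_curve (x, y))" by blast
    qed
  qed
  have Vv: "pverts graph_of = V" by (simp add: graph_of_def)
  show ?thesis unfolding plane_embedding_def Vv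
  proof (intro conjI ballI)
    show "inj_on P V" by (rule P_inj)
    fix e assume e: "e \<in> parcs graph_of"
    obtain u w where uw: "e = (u, w)" by (cases e)
    show "case e of (u, v) \<Rightarrow> arc (edge_curve (u, v)) \<and> pathstart (edge_curve (u, v)) = P u \<and> pathfinish (edge_curve (u, v)) = P v \<and>
        edge_curve (v, u) = reversepath (edge_curve (u, v)) \<and> path_image (edge_curve (u, v)) \<inter> P ` V = {P u, P v}"
      using single[of u w] e unfolding uw split_conv .
    show "case e of (u, v) \<Rightarrow> \<forall>(x, y)\<in>parcs graph_of. {u, v} \<noteq> {x, y} \<longrightarrow>
        path_image (edge_curve (u, v)) \<inter> path_image (edge_curve (x, y)) = P ` ({u, v} \<inter> {x, y})"
      using cross[of u w] e unfolding uw split_conv by blast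
  qed
qed

text \<open>The vertical ray downwards from \<open>P v\<close> misses the drawing: a spoke of
  another vertex that meets it would belong to a vertex of smaller depth, and the arches lie in the
  upper half plane.\<close>

lemma outer_if_lowest:
  assumes W: "W \<subseteq> V" "v \<in> W" "\<And>u. u \<in> W \<Longrightarrow> depth v \<le> depth u"
  shows "v \<in> outer_vertices (with_proj graph_of \<restriction> W) P edge_curve"
proof -
  define D where "D = drawing (with_proj graph_of \<restriction> W) P edge_curve"
  define ray where "ray = {z. Re z = vx v \<and> Im z < - hgt v}"
  have vV: "v \<in> V" using W by auto
  have noray: "z \<notin> spoke (tip i) x" if "z \<in> ray" "at_pos i x" "tip i \<in> W" for z i x
  proof
    assume zs: "z \<in> spoke (tip i) x"
    note sp = spoke_point[OF zs at_pos_vx[OF that(2)]]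
    have re: "Re z = vx v" "Im z < - hgt v" using that(1) by (auto simp: ray_def)
    have u: "tip i \<in> V" using that W by auto
    show False
    proof (cases "tip i = v")
      case True then show False using sp(5) re by simp
    next
      case False
      have "vx (tip i) \<le> vx v" using sp(1) re by simp
      then have "pos (tip i) \<le> pos v" by (simp add: vx_def)
      moreover have "pos (tip i) \<noteq> pos v" using pos_inj[OF u vV] False by metis
      ultimately have lt: "pos (tip i) < pos v" by (rule le_neq_implies_less)
      have "depth (tip i) < depth v" by (rule spoke_below(1)[OF that(2) vV lt zs]) (simp add: re)
      then show False using W(3)[OF that(3)] by simp
    qed
  qed
  have Dim: "D = P ` W \<union> (\<Union>e\<in>{e \<in> parcs graph_of. fst e \<in> W \<and> snd e \<in> W}. path_image (edge_curve e))"
    by (auto simp: D_def drawing_def induce_subgraph_def)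
  have rayD: "ray \<inter> D = {}"
  proof (rule ccontr)
    assume "ray \<inter> D \<noteq> {}"
    then obtain z where z: "z \<in> ray" "z \<in> D" by blast
    then consider u where "u \<in> W" "z = P u" | u w where "(u, w) \<in> parcs graph_of" "u \<in> W" "w \<in> W" "z \<in> path_image (edge_curve (u, w))"
      unfolding Dim by force
    then show False
    proof cases
      case 1
      then have "pos u = pos v" "Im z < - hgt v" using z(1) by (auto simp: ray_def P_def vx_def)
      then have "u = v" using pos_inj 1 W vV by blast
      then show False using 1 z(1) by (simp add: ray_def P_def)
    next
      case 2
      define c where "c = chord u w"
      have j: "good c" "{tip (fst c), tip (snd c)} = {u, w}" using chord[OF 2(1)] by (auto simp: joins_def c_def)
      note g = good[OF j(1)]
      have tW: "tip (fst c) \<in> W" "tip (snd c) \<in> W" using j(2) 2 by (auto simp: doubleton_eq_iff)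
      have "z \<notin> path_image (arch c)" using arch_point(4)[of z c] g(4) z(1) hgt_pos[of v] by (auto simp: ray_def)
      then show False using 2(4) noray[OF z(1) g(2) tW(1)] noray[OF z(1) g(3) tW(2)]
        unfolding edge_curve_image c_def[symmetric] curve_image[OF j(1)] by blast
    qed
  qed
  have conv: "convex ray"
  proof -
    have "ray = {z. Re z \<le> vx v} \<inter> {z. Re z \<ge> vx v} \<inter> {z. Im z < - hgt v}" by (auto simp: ray_def)
    then show ?thesis by (simp only: convex_Int convex_halfspace_Im_lt convex_halfspace_Re_le convex_halfspace_Re_ge)
  qed
  have unb: "\<not> bounded ray"
  proof
    assume "bounded ray"
    then obtain B where B: "\<And>z. z \<in> ray \<Longrightarrow> norm z \<le> B" by (auto simp: bounded_iff)
    have "Complex (vx v) (- hgt v - \<bar>B\<bar> - 1) \<in> ray" by (simp add: ray_def)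
    from B[OF this] have "\<bar>- hgt v - \<bar>B\<bar> - 1\<bar> \<le> B" using abs_Im_le_cmod[of "Complex (vx v) (- hgt v - \<bar>B\<bar> - 1)"] by simp
    then show False using hgt_pos[of v] by simp
  qed
  have out: "ray \<subseteq> outside D"
  proof
    fix z assume z: "z \<in> ray"
    have "ray \<subseteq> connected_component_set (- D) z"
      using z rayD convex_connected[OF conv] by (intro connected_component_maximal) auto
    then have "\<not> bounded (connected_component_set (- D) z)" using unb bounded_subset by blast
    then show "z \<in> outside D" using z rayD by (auto simp: outside_def)
  qed
  have "P v \<in> closure (outside D)"
  proof (rule closure_approachable[THEN iffD2], intro allI impI)
    fix e :: real assume e: "e > 0"
    have "Complex (vx v) (- hgt v - e / 2) \<in> outside D" using out e by (auto simp: ray_def)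
    moreover have "dist (Complex (vx v) (- hgt v - e / 2)) (P v) < e" using e by (simp add: dist_norm P_def cmod_def)
    ultimately show "\<exists>y\<in>outside D. dist y (P v) < e" by blast
  qed
  moreover have "P v \<in> D" using W by (auto simp: Dim)
  then have "P v \<notin> interior (outside D)" using interior_subset outside_no_overlap by blast
  ultimately have "P v \<in> frontier (outside D)" by (simp add: frontier_def)
  then show ?thesis using W by (simp add: outer_vertices_def D_def)
qed

text \<open>After \<open>i\<close> rounds at least the vertices of depth up to \<open>i\<close> are
  gone; vertices that become outer earlier do no harm.\<close>

lemma outerplanar_graph_of: "outerplanar r graph_of"
proof -
  let ?rem = "remaining graph_of P edge_curve"
  have remV: "?rem i \<subseteq> V" for i by (induction i) (auto simp: graph_of_def)
  have rem: "\<forall>v\<in>?rem i. i < depth v" for i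
  proof (induction i)
    case 0
    show ?case
    proof
      fix v assume "v \<in> ?rem 0"
      then have "v \<in> V" by (simp add: graph_of_def)
      then show "0 < depth v" using depth_bounds[of v] by simp
    qed
  next
    case (Suc i)
    show ?case
    proof
      fix v assume v: "v \<in> ?rem (Suc i)"
      then have vi: "v \<in> ?rem i" and nout: "v \<notin> outer_vertices (with_proj graph_of \<restriction> ?rem i) P edge_curve" by auto
      have "depth v \<noteq> Suc i"
      proof
        assume d: "depth v = Suc i"
        have "depth v \<le> depth u" if "u \<in> ?rem i" for u using bspec[OF Suc.IH that] d by simp
        from outer_if_lowest[OF remV vi this] show False using nout by blast
      qed
      then show "Suc i < depth v" using bspec[OF Suc.IH vi] by simp
    qed
  qed
  have empty: "?rem r = {}"
  proof (rule equals0I)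
    fix v assume v: "v \<in> ?rem r"
    then have "v \<in> V" using remV by blast
    then show False using bspec[OF rem v] depth_bounds[of v] by simp
  qed
  have "V = (\<Union>i \<in> {1..r}. layer graph_of P edge_curve i)"
  proof
    show "(\<Union>i \<in> {1..r}. layer graph_of P edge_curve i) \<subseteq> V"
      using remV by (auto simp: layer_def outer_vertices_def)
    show "V \<subseteq> (\<Union>i \<in> {1..r}. layer graph_of P edge_curve i)"
    proof
      fix v assume v: "v \<in> V"
      have "v \<in> ?rem i \<or> (\<exists>j\<in>{1..i}. v \<in> layer graph_of P edge_curve j)" for i
      proof (induction i)
        case 0 then show ?case using v by (simp add: graph_of_def)
      next
        case (Suc i)
        show ?case
        proof (cases "\<exists>j\<in>{1..i}. v \<in> layer graph_of P edge_curve j")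
          case True
          then obtain j where "j \<in> {1..i}" "v \<in> layer graph_of P edge_curve j" by blast
          moreover from this have "j \<in> {1..Suc i}" by simp
          ultimately show ?thesis by blast
        next
          case False
          then have vi: "v \<in> ?rem i" using Suc.IH by blast
          show ?thesis
          proof (cases "v \<in> layer graph_of P edge_curve (Suc i)")
            case True
            then show ?thesis by (intro disjI2 bexI[of _ "Suc i"]) auto
          next
            case False
            then have "v \<in> ?rem (Suc i)" using vi by (simp add: layer_def)
            then show ?thesis by blast
          qed
        qed
      qed
      from this[of r] show "v \<in> (\<Union>i \<in> {1..r}. layer graph_of P edge_curve i)" using empty by blast
    qed
  qed
  then show ?thesis unfolding outerplanar_def using plane_embedding_graph_of by (auto simp: graph_of_def)
qed

end

section \<open>From terms to tours\<close>

fun steps :: "'v tm \<Rightarrow> nat" where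
  "steps Done = 0"
| "steps (Push v t) = Suc (steps t)"
| "steps (Pop t) = Suc (steps t)"
| "steps (Arc t u) = steps t + steps u"

fun stack_at :: "'v list \<Rightarrow> 'v tm \<Rightarrow> nat \<Rightarrow> 'v list" where
  "stack_at P Done k = P"
| "stack_at P (Push v t) k = (case k of 0 \<Rightarrow> P | Suc l \<Rightarrow> stack_at (v # P) t l)"
| "stack_at P (Pop t) k = (case k of 0 \<Rightarrow> P | Suc l \<Rightarrow> stack_at (tl P) t l)"
| "stack_at P (Arc t u) k = (if k < steps t then stack_at P t k else stack_at (out P t) u (k - steps t))"

definition shift :: "nat \<Rightarrow> (nat \<times> nat) set \<Rightarrow> (nat \<times> nat) set" where
  "shift n C = (\<lambda>(a, b). (a + n, b + n)) ` C"

fun chords :: "'v tm \<Rightarrow> (nat \<times> nat) set" where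
  "chords Done = {}"
| "chords (Push v t) = shift 1 (chords t)"
| "chords (Pop t) = shift 1 (chords t)"
| "chords (Arc t u) = insert (0, steps t) (chords t \<union> shift (steps t) (chords u))"

lemma stack_at_end: "stack_at P t (steps t) = out P t"
  by (induction t arbitrary: P) auto

lemma stack_at_0: "stack_at P t 0 = P"
proof (induction t arbitrary: P)
  case (Arc t u)
  have "out P t = P" if "steps t = 0" using stack_at_end[of P t] Arc(1)[of P] that by simp
  then show ?case using Arc by auto
qed auto

lemma stack_at_Arc: "k \<le> steps t \<Longrightarrow> stack_at P (Arc t u) k = stack_at P t k"
  by (auto simp: stack_at_end stack_at_0 order_le_less)

lemma stack_at_step:
  "ok r P t \<Longrightarrow> k < steps t \<Longrightarrow>
     (\<exists>v. stack_at P t (Suc k) = v # stack_at P t k) \<or> stack_at P t k \<noteq> [] \<and> stack_at P t (Suc k) = tl (stack_at P t k)"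
proof (induction t arbitrary: P k)
  case (Push v t) then show ?case by (cases k) (auto simp: stack_at_0)
next
  case (Pop t) then show ?case by (cases k) (auto simp: stack_at_0)
next
  case (Arc t u)
  show ?case
  proof (cases "k < steps t")
    case True
    then show ?thesis using Arc.IH(1)[of P k] Arc.prems stack_at_Arc[of "Suc k" t P u] by simp
  next
    case False
    then have "k - steps t < steps u" "Suc k - steps t = Suc (k - steps t)" using Arc.prems by auto
    then show ?thesis using Arc.IH(2)[of "out P t" "k - steps t"] Arc.prems False by simp
  qed
qed simp

lemma stack_at_length: "ok r P t \<Longrightarrow> length P \<le> r \<Longrightarrow> k \<le> steps t \<Longrightarrow> length (stack_at P t k) \<le> r"
proof (induction t arbitrary: P k)
  case (Arc t u)
  then show ?case using length_out[of r P t] by auto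
qed (auto split: nat.split)

text \<open>Recovers the pushes from the stacks alone, as the moments at which the stack grows. This
  turns distinctness of the pushes into the assumption \<open>once\<close> of
  \<open>tour\<close>.\<close>

lemma pushed_stack_at:
  "ok r P t \<Longrightarrow> pushed t = map (\<lambda>k. hd (stack_at P t (Suc k)))
     (filter (\<lambda>k. length (stack_at P t k) < length (stack_at P t (Suc k))) [0..<steps t])"
proof (induction t arbitrary: P)
  case (Push v t)
  have "[0..<Suc (steps t)] = 0 # map Suc [0..<steps t]" by (metis map_Suc_upt upt_conv_Cons zero_less_Suc)
  then show ?case using Push.IH[of "v # P"] Push.prems
    by (simp add: stack_at_0 filter_map comp_def del: upt_Suc)
next
  case (Pop t)
  have "[0..<Suc (steps t)] = 0 # map Suc [0..<steps t]" by (metis map_Suc_upt upt_conv_Cons zero_less_Suc)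
  then show ?case using Pop.IH[of "tl P"] Pop.prems
    by (simp add: stack_at_0 filter_map comp_def del: upt_Suc)
next
  case (Arc t u)
  have "[0..<steps t + steps u] = [0..<steps t] @ map (\<lambda>k. k + steps t) [0..<steps u]"
  proof -
    have "map (\<lambda>k. k + steps t) [0..<steps u] = [steps t..<steps t + steps u]" using map_add_upt[of "steps t" "steps u"] by (simp only: add.commute)
    then show ?thesis using upt_add_eq_append[of 0 "steps t" "steps u"] by simp
  qed
  moreover have "filter (\<lambda>k. length (stack_at P (Arc t u) k) < length (stack_at P (Arc t u) (Suc k))) [0..<steps t] =
     filter (\<lambda>k. length (stack_at P t k) < length (stack_at P t (Suc k))) [0..<steps t]"
    by (intro filter_cong) (simp_all add: stack_at_Arc del: stack_at.simps)
  moreover have "map (\<lambda>k. hd (stack_at P (Arc t u) (Suc k))) (filter (\<lambda>k. length (stack_at P t k) < length (stack_at P t (Suc k))) [0..<steps t])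
     = map (\<lambda>k. hd (stack_at P t (Suc k))) (filter (\<lambda>k. length (stack_at P t k) < length (stack_at P t (Suc k))) [0..<steps t])"
    by (intro map_cong) (simp_all add: stack_at_Arc del: stack_at.simps)
  moreover have "stack_at P (Arc t u) (k + steps t) = stack_at (out P t) u k" "stack_at P (Arc t u) (Suc (k + steps t)) = stack_at (out P t) u (Suc k)" for k
    by (simp_all add: Suc_diff_le)
  ultimately show ?case using Arc.IH(1)[of P] Arc.IH(2)[of "out P t"] Arc.prems
    by (simp add: filter_map comp_def del: stack_at.simps)
qed simp

lemma in_shift: "(a, b) \<in> C \<Longrightarrow> (a + n, b + n) \<in> shift n C"
  by (force simp: shift_def)

lemma shiftE: "p \<in> shift n C \<Longrightarrow> (\<And>a b. (a, b) \<in> C \<Longrightarrow> p = (a + n, b + n) \<Longrightarrow> Q) \<Longrightarrow> Q"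
  by (auto simp: shift_def)

lemma chords_ArcE:
  assumes "(a, b) \<in> chords (Arc t u)"
  obtains "a = 0" "b = steps t" | "(a, b) \<in> chords t" | a' b' where "(a', b') \<in> chords u" "a = a' + steps t" "b = b' + steps t"
  using assms by (auto elim: shiftE)

lemma chords_bounds: "(a, b) \<in> chords t \<Longrightarrow> a \<le> b \<and> b \<le> steps t"
proof (induction t arbitrary: a b)
  case (Push v t) then show ?case by (auto elim!: shiftE)
next
  case (Pop t) then show ?case by (auto elim!: shiftE)
next
  case (Arc t u)
  from Arc.prems show ?case
  proof (cases rule: chords_ArcE)
    case 1 then show ?thesis by simp
  next
    case 2 then show ?thesis using Arc.IH(1)[of a b] by simp
  next
    case (3 a' b') then show ?thesis using Arc.IH(2)[of a' b'] by simp
  qed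
qed simp

lemma chords_nocross: "(a, b) \<in> chords t \<Longrightarrow> (c, d) \<in> chords t \<Longrightarrow> \<not> (a < c \<and> c < b \<and> b < d)"
proof (induction t arbitrary: a b c d)
  case (Push v t) then show ?case by (auto elim!: shiftE)
next
  case (Pop t) then show ?case by (auto elim!: shiftE)
next
  case (Arc t u)
  from Arc.prems(1) show ?case
  proof (cases rule: chords_ArcE)
    case 1
    from Arc.prems(2) show ?thesis
    proof (cases rule: chords_ArcE)
      case 2 then show ?thesis using 1 chords_bounds[of c d t] by simp
    qed (use 1 in simp_all)
  next
    case ab: 2
    from Arc.prems(2) show ?thesis
    proof (cases rule: chords_ArcE)
      case 2 then show ?thesis using ab Arc.IH(1)[of a b c d] by simp
    next
      case (3 a' b') then show ?thesis using chords_bounds[OF ab] by simp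
    qed simp
  next
    case ab: (3 a' b')
    from Arc.prems(2) show ?thesis
    proof (cases rule: chords_ArcE)
      case 2 then show ?thesis using ab chords_bounds[of c d t] by simp
    next
      case (3 c' d') then show ?thesis using ab Arc.IH(2)[of a' b' c' d'] by simp
    qed simp
  qed
qed simp

lemma links_chords: "(x, y) \<in> links P t \<Longrightarrow> \<exists>(a, b)\<in>chords t. (x, y) \<in> link (stack_at P t a) (stack_at P t b)"
proof (induction t arbitrary: P)
  case (Push v t)
  then obtain a b where "(a, b) \<in> chords t" "(x, y) \<in> link (stack_at (v # P) t a) (stack_at (v # P) t b)" by fastforce
  then show ?case using in_shift[of a b "chords t" 1] by (intro bexI[of _ "(Suc a, Suc b)"]) simp_all
next
  case (Pop t)
  then obtain a b where "(a, b) \<in> chords t" "(x, y) \<in> link (stack_at (tl P) t a) (stack_at (tl P) t b)" by fastforce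
  then show ?case using in_shift[of a b "chords t" 1] by (intro bexI[of _ "(Suc a, Suc b)"]) simp_all
next
  case (Arc t u)
  then consider "(x, y) \<in> link P (out P t)" | "(x, y) \<in> links P t" | "(x, y) \<in> links (out P t) u" by auto
  then show ?case
  proof cases
    case 1
    have "stack_at P (Arc t u) 0 = P" "stack_at P (Arc t u) (steps t) = out P t" using stack_at_0[of P "Arc t u"] stack_at_0[of "out P t" u] by simp_all
    then show ?thesis using 1 by (intro bexI[of _ "(0, steps t)"]) (simp_all del: stack_at.simps)
  next
    case 2
    then obtain a b where ab: "(a, b) \<in> chords t" "(x, y) \<in> link (stack_at P t a) (stack_at P t b)" using Arc.IH(1) by fastforce
    have "a \<le> steps t" "b \<le> steps t" using chords_bounds[OF ab(1)] by auto
    then show ?thesis using ab stack_at_Arc[of a t P u] stack_at_Arc[of b t P u]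
      by (intro bexI[of _ "(a, b)"]) (simp_all del: stack_at.simps)
  next
    case 3
    then obtain a b where "(a, b) \<in> chords u" "(x, y) \<in> link (stack_at (out P t) u a) (stack_at (out P t) u b)" using Arc.IH(2) by fastforce
    then show ?thesis using in_shift[of a b "chords u" "steps t"] by (intro bexI[of _ "(a + steps t, b + steps t)"]) simp_all
  qed
qed simp

lemma term_tour:
  fixes t :: "nat tm"
  assumes "ok r [] t" "distinct (pushed t)"
  shows "tour (stack_at [] t) (steps t) r (chords t)" "tour.V (stack_at [] t) (steps t) = set (pushed t)"
proof -
  let ?S = "stack_at [] t"
  let ?ks = "filter (\<lambda>k. length (?S k) < length (?S (Suc k))) [0..<steps t]"
  have p: "pushed t = map (\<lambda>k. hd (?S (Suc k))) ?ks" by (rule pushed_stack_at[OF assms(1)])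
  have inj: "inj_on (\<lambda>k. hd (?S (Suc k))) (set ?ks)" using assms(2) p by (simp only: distinct_map)
  show tr: "tour ?S (steps t) r (chords t)"
  proof
    show "?S 0 = []" by (rule stack_at_0)
    show "(\<exists>v. ?S (Suc k) = v # ?S k) \<or> ?S k \<noteq> [] \<and> ?S (Suc k) = tl (?S k)" if "k < steps t" for k
      by (rule stack_at_step[OF assms(1) that])
    show "length (?S k) \<le> r" if "k \<le> steps t" for k by (rule stack_at_length[OF assms(1) _ that]) simp
    show "k = l" if "k < steps t" "l < steps t" "?S (Suc k) = v # ?S k" "?S (Suc l) = v # ?S l" for k l v
      using inj_onD[OF inj, of k l] that by simp
    show "a \<le> b \<and> b \<le> steps t" if "(a, b) \<in> chords t" for a b by (rule chords_bounds[OF that])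
    show "\<not> (a < c \<and> c < b \<and> b < d)" if "(a, b) \<in> chords t" "(c, d) \<in> chords t" for a b c d by (rule chords_nocross[OF that])
  qed
  have push: "(\<exists>v. ?S (Suc k) = v # ?S k) \<longleftrightarrow> length (?S k) < length (?S (Suc k))" if "k < steps t" for k
  proof -
    have "length (?S (Suc k)) = Suc (length (?S k))" if "?S (Suc k) = v # ?S k" for v using that by simp
    moreover have "length (?S (Suc k)) \<le> length (?S k)" if "?S (Suc k) = tl (?S k)" using that by simp
    ultimately show ?thesis using stack_at_step[OF assms(1) that] by (metis lessI not_le)
  qed
  show "tour.V ?S (steps t) = set (pushed t)"
  proof
    show "tour.V ?S (steps t) \<subseteq> set (pushed t)"
    proof
      fix v assume "v \<in> tour.V ?S (steps t)"
      then obtain k where k: "k < steps t" "?S (Suc k) = v # ?S k" unfolding tour.V_def[OF tr] by blast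
      then have "k \<in> set ?ks" "v = hd (?S (Suc k))" by simp_all
      then show "v \<in> set (pushed t)" unfolding p by (simp only: set_map image_eqI)
    qed
    show "set (pushed t) \<subseteq> tour.V ?S (steps t)"
    proof
      fix v assume "v \<in> set (pushed t)"
      then obtain k where k: "k < steps t" "length (?S k) < length (?S (Suc k))" "v = hd (?S (Suc k))" unfolding p by auto
      then obtain w where "?S (Suc k) = w # ?S k" using push by blast
      then show "v \<in> tour.V ?S (steps t)" unfolding tour.V_def[OF tr] using k by auto
    qed
  qed
qed

lemma (in tour) tour_graph:
  "\<exists>G. pair_graph G \<and> pverts G = V \<and> outerplanar r G \<and>
     (\<forall>(a, b)\<in>C. \<forall>(u, w)\<in>link (S a) (S b). u \<noteq> w \<longrightarrow> (u, w) \<in> parcs G)"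
proof (intro exI[of _ graph_of] conjI ballI)
  show "pair_graph graph_of" by (rule pair_graph_graph_of)
  show "pverts graph_of = V" by (simp add: graph_of_def)
  show "outerplanar r graph_of" by (rule outerplanar_graph_of)
  fix p assume pC: "p \<in> C"
  obtain a b where p: "p = (a, b)" by (cases p)
  have j: "joins u w (a, b)" if "(u, w) \<in> link (S a) (S b)" "u \<noteq> w" for u w
    using that pC by (auto simp: p joins_def good_def link_def tip_def split: if_splits)
  have g: "(u, w) \<in> parcs graph_of" if "joins u w c" for u w c using that unfolding graph_of_def by (cases c) auto
  show "case p of (a, b) \<Rightarrow> \<forall>(u, w)\<in>link (S a) (S b). u \<noteq> w \<longrightarrow> (u, w) \<in> parcs graph_of"
    unfolding p split_conv
  proof (rule ballI)
    fix q assume q: "q \<in> link (S a) (S b)"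
    obtain u w where uw: "q = (u, w)" by (cases q)
    show "case q of (u, w) \<Rightarrow> u \<noteq> w \<longrightarrow> (u, w) \<in> parcs graph_of"
      unfolding uw split_conv using g[OF j[of u w]] q[unfolded uw] by iprover
  qed
qed

subsection \<open>Supports and realizations\<close>

text \<open>\<open>Digraph_Component.connected\<close> symmetrizes the subgraph and requires it to
  be nonempty. The arcs of a \<open>pair_graph\<close> are symmetric already, so the symmetrization
  changes nothing.\<close>

lemma connected_induced:
  fixes G :: "nat pair_pre_digraph"
  assumes "pair_graph G"
  shows "Digraph_Component.connected (with_proj G \<restriction> e) \<longleftrightarrow> e \<noteq> {} \<and> (\<forall>x\<in>e. \<forall>y\<in>e. (x, y) \<in> joined (parcs G) e)"
proof -
  interpret pair_graph G by (rule assms)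
  define R where "R = parcs G \<inter> e \<times> e"
  have ends: "arcs_ends (with_proj (mk_symmetric (with_proj G \<restriction> e))) = R"
  proof -
    have "arcs_ends (with_proj (mk_symmetric (with_proj G \<restriction> e))) = R \<union> converse R"
    proof -
      have "arcs_ends (with_proj X) = parcs X" for X :: "nat pair_pre_digraph"
        by (simp add: arcs_ends_def arc_to_ends_def)
      moreover have "arcs (with_proj G \<restriction> e) = R" by (auto simp: induce_subgraph_def R_def)
      then have "parcs (mk_symmetric (with_proj G \<restriction> e)) = (\<Union>a\<in>R. {(fst a, snd a), (snd a, fst a)})"
        unfolding mk_symmetric_def by (simp add: induce_subgraph_def)
      moreover have "(\<Union>a\<in>R. {(fst a, snd a), (snd a, fst a)}) = R \<union> converse R"
      proof
        show "(\<Union>a\<in>R. {(fst a, snd a), (snd a, fst a)}) \<subseteq> R \<union> converse R"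
        proof (rule UN_least)
          fix a assume "a \<in> R"
          then show "{(fst a, snd a), (snd a, fst a)} \<subseteq> R \<union> converse R" by (cases a) simp
        qed
        show "R \<union> converse R \<subseteq> (\<Union>a\<in>R. {(fst a, snd a), (snd a, fst a)})"
        proof
          fix p assume "p \<in> R \<union> converse R"
          moreover obtain x y where p: "p = (x, y)" by (cases p)
          ultimately consider "(x, y) \<in> R" | "(y, x) \<in> R" by auto
          then show "p \<in> (\<Union>a\<in>R. {(fst a, snd a), (snd a, fst a)})"
            by cases (rule UN_I, assumption, simp add: p)+
        qed
      qed
      ultimately show ?thesis by simp
    qed
    moreover have "converse R = R"
    proof (rule set_eqI)
      fix p :: "nat \<times> nat"
      obtain x y where p: "p = (x, y)" by (cases p)
      show "p \<in> converse R \<longleftrightarrow> p \<in> R" unfolding p using arcs_symmetric[of x y] arcs_symmetric[of y x] by (auto simp: R_def)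
    qed
    ultimately show ?thesis by simp
  qed
  have v: "verts (with_proj (mk_symmetric (with_proj G \<restriction> e))) = e" by (simp add: mk_symmetric_def induce_subgraph_def)
  have on: "(x, y) \<in> rtrancl_on e R \<longleftrightarrow> (x, y) \<in> rtrancl R" if "x \<in> e" for x y
  proof
    assume "(x, y) \<in> rtrancl_on e R" then show "(x, y) \<in> rtrancl R" by (rule rtrancl_on_rtranclI)
  next
    assume "(x, y) \<in> rtrancl R" then show "(x, y) \<in> rtrancl_on e R"
    proof (induction rule: rtrancl_induct)
      case base then show ?case using that by (rule rtrancl_on_refl)
    next
      case (step y z)
      show ?case by (rule rtrancl_on_into_rtrancl_on[OF step.IH step.hyps(2)]) (use step.hyps(2) in \<open>simp add: R_def\<close>)
    qed
  qed
  have "(\<forall>x\<in>e. \<forall>y\<in>e. (x, y) \<in> rtrancl_on e R) \<longleftrightarrow> (\<forall>x\<in>e. \<forall>y\<in>e. (x, y) \<in> rtrancl R)" by (simp add: on)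
  then show ?thesis
    unfolding Digraph_Component.connected_def strongly_connected_def reachable_def ends v joined_def R_def[symmetric] by simp
qed

definition class_of :: "nat set list \<Rightarrow> nat \<Rightarrow> nat set" where
  "class_of es v = {j. j < length es \<and> v \<in> es ! j}"

lemma members_class_of: "j < length es \<Longrightarrow> members (class_of es) j = es ! j"
  by (auto simp: members_def class_of_def)

text \<open>A term obtained from an embedding may have more links than the graph has edges, and a
  graph drawn from a term may have edges besides the links. Neither matters, since further edges
  never disconnect a hyperedge.\<close>

lemma support_iff_realizes:
  assumes h: "hypergraph V (set es)"
  shows "(\<exists>G. support G V (set es) \<and> outerplanar r G) \<longleftrightarrow> (\<exists>t. realizes r (length es) (class_of es) V t)"
proof
  assume "\<exists>G. support G V (set es) \<and> outerplanar r G"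
  then obtain G where G: "pair_graph G" "pverts G = V" "\<And>e. e \<in> set es \<Longrightarrow> Digraph_Component.connected (with_proj G \<restriction> e)" "outerplanar r G"
    by (auto simp: support_def)
  obtain t where t: "ok r [] t" "out [] t = []" "distinct (pushed t)" "set (pushed t) = V" "parcs G \<subseteq> links [] t"
    using outerplanar_imp_term[OF G(1,4)] G(2) by blast
  have "(x, y) \<in> joined (links [] t) (members (class_of es) j)" if "j < length es" "x \<in> members (class_of es) j" "y \<in> members (class_of es) j" for x y j
  proof -
    have "Digraph_Component.connected (with_proj G \<restriction> (es ! j))" by (rule G(3)) (simp add: that(1))
    then have "(x, y) \<in> joined (parcs G) (es ! j)" using that unfolding connected_induced[OF G(1)] members_class_of[OF that(1)] by blast
    then show ?thesis using joined_mono[OF t(5)] unfolding members_class_of[OF that(1)] by blast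
  qed
  then show "\<exists>t. realizes r (length es) (class_of es) V t" using t(1-4) unfolding realizes_def by blast
next
  assume "\<exists>t. realizes r (length es) (class_of es) V t"
  then obtain t where t: "ok r [] t" "distinct (pushed t)" "set (pushed t) = V"
    and conn: "\<And>j x y. j < length es \<Longrightarrow> x \<in> V \<inter> es ! j \<Longrightarrow> y \<in> V \<inter> es ! j \<Longrightarrow> (x, y) \<in> joined (links [] t) (es ! j)"
    by (auto simp: realizes_def members_class_of)
  interpret tour "stack_at [] t" "steps t" r "chords t" by (rule term_tour(1)[OF t(1,2)])
  obtain G where G: "pair_graph G" "pverts G = V" "outerplanar r G"
     "\<forall>(a, b)\<in>chords t. \<forall>(u, w)\<in>link (stack_at [] t a) (stack_at [] t b). u \<noteq> w \<longrightarrow> (u, w) \<in> parcs G"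
    using tour_graph unfolding term_tour(2)[OF t(1,2)] t(3) by blast
  have lk: "(u, w) \<in> parcs G" if uw: "(u, w) \<in> links [] t" "u \<noteq> w" for u w
  proof -
    obtain a b where "(a, b) \<in> chords t" "(u, w) \<in> link (stack_at [] t a) (stack_at [] t b)" using links_chords[OF uw(1)] by blast
    from bspec[OF bspec[OF G(4) this(1), unfolded split_conv] this(2)] uw(2) show ?thesis by simp
  qed
  have "Digraph_Component.connected (with_proj G \<restriction> e)" if e: "e \<in> set es" for e
  proof -
    have eV: "e \<subseteq> V" "e \<noteq> {}" using h e by (auto simp: hypergraph_def)
    obtain j where j: "j < length es" "es ! j = e" using e by (auto simp: in_set_conv_nth)
    have "(x, y) \<in> joined (parcs G) e" if "(x, y) \<in> joined (links [] t) e" for x y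
      using that
    proof (induction rule: joined_induct)
      case (step y z)
      show ?case
      proof (cases "y = z")
        case False
        then have "(y, z) \<in> joined (parcs G) e" using lk step by (intro joined_step) auto
        then show ?thesis using step joined_trans by metis
      qed (use step in simp)
    qed simp
    then show ?thesis unfolding connected_induced[OF G(1)] using conn[of j] j eV by blast
  qed
  then show "\<exists>G. support G V (set es) \<and> outerplanar r G" using G by (auto simp: support_def)
qed

lemma ok_0_pushed: "ok 0 P t \<Longrightarrow> pushed t = []"
  by (induction t arbitrary: P) auto

text \<open>A small realization uses no more vertices of a class than are kept, so its vertices can
  be exchanged for kept ones class by class, and the remaining kept vertices are attached as twins.
  Conversely every dropped vertex is a twin of a kept one.\<close>

lemma truncation:
  fixes cl :: "'v \<Rightarrow> nat set"
  assumes V: "finite V" "V' \<subseteq> V" "cl ` V' = cl ` V" and cl: "\<And>v. v \<in> V \<Longrightarrow> cl v \<subseteq> {..<m}"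
    and big: "\<And>c. card {v \<in> V'. cl v = c} \<ge> min (card {v \<in> V. cl v = c}) (2 ^ (2 ^ (5 * r\<^sup>2 * (m + 1))))"
  shows "(\<exists>t. realizes r m cl V t) \<longleftrightarrow> (\<exists>t. realizes r m cl V' t)"
proof
  assume "\<exists>t. realizes r m cl V' t"
  then obtain t where "realizes r m cl V' t" by blast
  from realizes_twins[OF V(1) this V(2)] show "\<exists>t. realizes r m cl V t" using V(3) by simp
next
  assume "\<exists>t. realizes r m cl V t"
  then obtain t where t: "realizes r m cl V t" by blast
  show "\<exists>t. realizes r m cl V' t"
  proof (cases "r = 0")
    case True
    \<comment> \<open>The case is separate because \<open>small_realization\<close> asks for
      \<open>r \<ge> 1\<close>. Without levels nothing can be pushed.\<close>
    note rz = t[unfolded realizes_def True]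
    have "set (pushed t) = V" by (rule rz[THEN conjunct2, THEN conjunct2, THEN conjunct2, THEN conjunct1])
    then have "V = {}" unfolding ok_0_pushed[OF rz[THEN conjunct1]] by simp
    then have "V' = V" using V(2) by blast
    then show ?thesis using t by blast
  next
    case False
    then have r1: "1 \<le> r" by simp
    obtain W s where W: "realizes r m cl W s" "W \<subseteq> V" "cl ` W = cl ` V" "card W \<le> 2 ^ (2 ^ (5 * r\<^sup>2 * (m + 1)))"
      using small_realization[OF t r1 cl] by blast
    have finW: "finite W" using W(2) V(1) finite_subset by blast
    have ex: "\<exists>f. f ` {v \<in> W. cl v = c} \<subseteq> {v \<in> V'. cl v = c} \<and> inj_on f {v \<in> W. cl v = c}" for c
    proof -
      have "card {v \<in> W. cl v = c} \<le> card {v \<in> V. cl v = c}" by (rule card_mono) (use W(2) V(1) in auto)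
      moreover have "card {v \<in> W. cl v = c} \<le> 2 ^ (2 ^ (5 * r\<^sup>2 * (m + 1)))"
        by (rule order_trans[OF card_mono W(4)]) (use finW in auto)
      ultimately have "card {v \<in> W. cl v = c} \<le> card {v \<in> V'. cl v = c}" by (rule order_trans[OF min.boundedI big])
      moreover have "finite {v \<in> W. cl v = c}" "finite {v \<in> V'. cl v = c}" using finW finite_subset[OF V(2,1)] by simp_all
      ultimately show ?thesis by (intro card_le_inj)
    qed
    from choice[OF allI[OF ex]] obtain f where
      f0: "\<forall>c. f c ` {v \<in> W. cl v = c} \<subseteq> {v \<in> V'. cl v = c} \<and> inj_on (f c) {v \<in> W. cl v = c}" ..
    note f = spec[OF f0]
    define g where "g = (\<lambda>v. f (cl v) v)"
    have g: "g v \<in> V' \<and> cl (g v) = cl v" if "v \<in> W" for v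
    proof -
      have "f (cl v) v \<in> f (cl v) ` {w \<in> W. cl w = cl v}" by (rule imageI) (use that in simp)
      then have "f (cl v) v \<in> {w \<in> V'. cl w = cl v}" using conjunct1[OF f[of "cl v"]] by blast
      then show ?thesis by (simp add: g_def)
    qed
    have inj: "inj_on g W"
    proof (rule inj_onI)
      fix v w assume vw: "v \<in> W" "w \<in> W" "g v = g w"
      have "cl v = cl w" using g[OF vw(1)] g[OF vw(2)] vw(3) by simp
      then have e: "f (cl v) v = f (cl v) w" using vw(3) by (simp add: g_def)
      show "v = w" by (rule inj_onD[OF conjunct2[OF f[of "cl v"]] e]) (use vw \<open>cl v = cl w\<close> in simp_all)
    qed
    have "realizes r m cl (g ` W) (map_tm g s)" by (rule realizes_rename[OF W(1) inj]) (rule conjunct2[OF g])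
    moreover have "g ` W \<subseteq> V'" using g by blast
    moreover have "cl ` V' \<subseteq> cl ` g ` W"
    proof -
      have "(\<lambda>x. cl (g x)) ` W = cl ` W" by (rule image_cong[OF refl conjunct2[OF g]])
      then have "cl ` g ` W = cl ` W" by (simp add: image_image)
      then show ?thesis using W(3) V(3) by simp
    qed
    ultimately show ?thesis by (rule realizes_twins[OF finite_subset[OF V(2,1)]])
  qed
qed

subsection \<open>Running programs\<close>

definition reach :: "com \<Rightarrow> state \<Rightarrow> (state \<Rightarrow> bool) \<Rightarrow> nat \<Rightarrow> bool" where
  "reach c s Q b \<longleftrightarrow> (\<exists>t s'. exec c s t s' \<and> t \<le> b \<and> Q s')"

lemma reach_mono: "reach c s Q b \<Longrightarrow> (\<And>s'. Q s' \<Longrightarrow> Q' s') \<Longrightarrow> b \<le> b' \<Longrightarrow> reach c s Q' b'"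
  unfolding reach_def by (meson order_trans)

lemma reach_Seq:
  assumes "reach c s P b" "\<And>s'. P s' \<Longrightarrow> reach c' s' Q b'"
  shows "reach (Seq c c') s Q (b + b')"
proof -
  obtain t s1 where 1: "exec c s t s1" "t \<le> b" "P s1" using assms(1) unfolding reach_def by blast
  obtain t' s2 where 2: "exec c' s1 t' s2" "t' \<le> b'" "Q s2" using assms(2)[OF 1(3)] unfolding reach_def by blast
  have "exec (Seq c c') s (t + t') s2" by (rule exec.Seq[OF 1(1) 2(1)])
  then show ?thesis unfolding reach_def using 1(2) 2(2,3) by (meson add_mono)
qed

fun straight :: "com \<Rightarrow> bool" where
  "straight (Seq c d) \<longleftrightarrow> straight c \<and> straight d"
| "straight (If_nz a c d) \<longleftrightarrow> straight c \<and> straight d"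
| "straight (While_nz a c) \<longleftrightarrow> False"
| "straight _ \<longleftrightarrow> True"

fun sem :: "com \<Rightarrow> state \<Rightarrow> state" where
  "sem Skip s = s"
| "sem (Const d k) (R, M) = (R(d := k), M)"
| "sem (Add d a b) (R, M) = (R(d := R a + R b), M)"
| "sem (Sub d a b) (R, M) = (R(d := R a - R b), M)"
| "sem (Load d a) (R, M) = (R(d := M (R a)), M)"
| "sem (Store a b) (R, M) = (R, M(R a := R b))"
| "sem (Seq c d) s = sem d (sem c s)"
| "sem (If_nz a c d) s = (if fst s a \<noteq> 0 then sem c s else sem d s)"
| "sem (While_nz a c) s = s"

text \<open>An upper bound that charges both branches of a conditional and is therefore a constant
  of the program.\<close>

fun cost :: "com \<Rightarrow> nat" where
  "cost (Seq c d) = cost c + cost d"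
| "cost (If_nz a c d) = cost c + cost d + 1"
| "cost _ = 1"

lemma exec_straight: "straight c \<Longrightarrow> \<exists>t\<le>cost c. exec c s t (sem c s)"
proof (induction c arbitrary: s)
  case (Seq c d)
  obtain t t' where "t \<le> cost c" "exec c s t (sem c s)" "t' \<le> cost d" "exec d (sem c s) t' (sem d (sem c s))"
    using Seq.IH(1)[of s] Seq.IH(2)[of "sem c s"] Seq.prems by auto
  then show ?case using exec.Seq by (intro exI[of _ "t + t'"]) auto
next
  case (If_nz a c d)
  obtain t t' where *: "t \<le> cost c" "exec c s t (sem c s)" "t' \<le> cost d" "exec d s t' (sem d s)"
    using If_nz.IH(1)[of s] If_nz.IH(2)[of s] If_nz.prems by auto
  show ?case
  proof (cases "fst s a = 0")
    case True
    then show ?thesis using * exec.If_false[of s a d t' "sem d s" c] by (intro exI[of _ "t' + 1"]) auto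
  next
    case False
    then show ?thesis using * exec.If_true[of s a c t "sem c s" d] by (intro exI[of _ "t + 1"]) auto
  qed
next
  case Skip then show ?case using exec.Skip[of s] by auto
next
  case (Const d k) then show ?case using exec.Const by (cases s) auto
next
  case (Add d a b) then show ?case using exec.Add by (cases s) auto
next
  case (Sub d a b) then show ?case using exec.Sub by (cases s) auto
next
  case (Load d a) then show ?case using exec.Load by (cases s) auto
next
  case (Store a b) then show ?case using exec.Store by (cases s) auto
qed simp

lemma reach_straight: "straight c \<Longrightarrow> Q (sem c s) \<Longrightarrow> cost c \<le> b \<Longrightarrow> reach c s Q b"
  using exec_straight[of c s] unfolding reach_def by (meson order_trans)

text \<open>For counting loops: register \<open>a\<close> holds the number of rounds that are
  left.\<close>

lemma reach_While:
  assumes "Inv 0 s" "\<And>i s. Inv i s \<Longrightarrow> fst s a = N - i"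
    and "\<And>i s. i < N \<Longrightarrow> Inv i s \<Longrightarrow> reach c s (Inv (Suc i)) d"
  shows "reach (While_nz a c) s (Inv N) ((d + 1) * N + 1)"
proof -
  have "reach (While_nz a c) s (Inv N) ((d + 1) * (N - i) + 1)" if "i \<le> N" "Inv i s" for i s
    using that
  proof (induction "N - i" arbitrary: i s)
    case 0
    then have "i = N" "fst s a = 0" using assms(2) by auto
    then show ?case using 0 exec.While_false[of s a c] unfolding reach_def by (metis le_add2)
  next
    case (Suc k)
    then have i: "i < N" "fst s a \<noteq> 0" using assms(2)[OF Suc.prems(2)] by auto
    obtain t s' where 1: "exec c s t s'" "t \<le> d" "Inv (Suc i) s'" using assms(3)[OF i(1) Suc.prems(2)] unfolding reach_def by blast
    have "reach (While_nz a c) s' (Inv N) ((d + 1) * (N - Suc i) + 1)" by (rule Suc.hyps(1)) (use Suc.hyps(2) i 1 in auto)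
    then obtain t' s'' where 2: "exec (While_nz a c) s' t' s''" "t' \<le> (d + 1) * (N - Suc i) + 1" "Inv N s''" unfolding reach_def by blast
    have "N - i = Suc (N - Suc i)" using i by simp
    then have "t + t' + 1 \<le> (d + 1) * (N - i) + 1" using 1 2 by simp
    then show ?case using exec.While_true[OF i(2) 1(1) 2(1)] 2(3) unfolding reach_def by blast
  qed
  from this[of 0 s] assms(1) show ?thesis by simp
qed

fun block :: "com list \<Rightarrow> com" where
  "block [] = Skip"
| "block [c] = c"
| "block (c # cs) = Seq c (block cs)"

subsection \<open>Expressions\<close>

text \<open>Recursion with a number of rounds fixed in advance suffices for an exhaustive search,
  guarantees termination and permits a bound on the running time by induction on expressions.
  \<open>Ren\<close> renames variables when the expression is compiled and costs nothing at run
  time.\<close>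

datatype ex = Num nat | Var nat | Mem ex | Plus ex ex | Monus ex ex | Bind ex ex | Ren "nat \<Rightarrow> nat" ex | Rec ex ex ex

definition cell_of :: "nat list \<Rightarrow> nat \<Rightarrow> nat" where
  "cell_of w a = (if a = 0 then length w else if a \<le> length w then w ! (a - 1) else 0)"

definition scons :: "'a \<Rightarrow> (nat \<Rightarrow> 'a) \<Rightarrow> nat \<Rightarrow> 'a" where
  "scons x E i = (case i of 0 \<Rightarrow> x | Suc j \<Rightarrow> E j)"

lemma scons_simps [simp]: "scons x E 0 = x" "scons x E (Suc i) = E i" "(\<lambda>i. scons x E (Suc i)) = E"
  by (simp_all add: scons_def)

text \<open>Variables are de Bruijn indices. The step of \<open>Rec b n s\<close> finds the value so far in variable 0 and
  the number of the round in variable 1.\<close>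

primrec ev :: "ex \<Rightarrow> nat list \<Rightarrow> (nat \<Rightarrow> nat) \<Rightarrow> nat" where
  "ev (Num c) w E = c"
| "ev (Var i) w E = E i"
| "ev (Mem a) w E = cell_of w (ev a w E)"
| "ev (Plus a b) w E = ev a w E + ev b w E"
| "ev (Monus a b) w E = ev a w E - ev b w E"
| "ev (Bind a e) w E = ev e w (scons (ev a w E) E)"
| "ev (Ren f e) w E = ev e w (\<lambda>i. E (f i))"
| "ev (Rec b n s) w E = rec_nat (ev b w E) (\<lambda>i x. ev s w (scons x (scons i E))) (ev n w E)"

primrec etime :: "ex \<Rightarrow> nat list \<Rightarrow> (nat \<Rightarrow> nat) \<Rightarrow> nat" where
  "etime (Num c) w E = 1"
| "etime (Var i) w E = 2"
| "etime (Mem a) w E = etime a w E + 6"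
| "etime (Plus a b) w E = etime a w E + etime b w E + 1"
| "etime (Monus a b) w E = etime a w E + etime b w E + 1"
| "etime (Bind a e) w E = etime a w E + etime e w (scons (ev a w E) E) + 2"
| "etime (Ren f e) w E = etime e w (\<lambda>i. E (f i))"
| "etime (Rec b n s) w E = etime b w E + etime n w E + 2 +
     (\<Sum>i<ev n w E. etime s w (scons (ev (Rec b (Num i) s) w E) (scons i E)) + 7)"

text \<open>The result is left in register \<open>k\<close>; variable \<open>i\<close> is expected in register \<open>\<rho> i\<close>, which has to be
  below \<open>k\<close>. Cells behind the input word may hold garbage, so addresses are compared with its length.\<close>

primrec compile :: "ex \<Rightarrow> (nat \<Rightarrow> reg) \<Rightarrow> reg \<Rightarrow> com" where
  "compile (Num c) \<rho> k = Const k c"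
| "compile (Var i) \<rho> k = Seq (Const k 0) (Add k k (\<rho> i))"
| "compile (Mem a) \<rho> k = Seq (compile a \<rho> k)
     (block [Const (k + 1) 0, Load (k + 1) (k + 1), Sub (k + 1) k (k + 1), If_nz (k + 1) (Const k 0) (Load k k)])"
| "compile (Plus a b) \<rho> k = Seq (compile a \<rho> k) (Seq (compile b \<rho> (k + 1)) (Add k k (k + 1)))"
| "compile (Monus a b) \<rho> k = Seq (compile a \<rho> k) (Seq (compile b \<rho> (k + 1)) (Sub k k (k + 1)))"
| "compile (Bind a e) \<rho> k = Seq (compile a \<rho> k) (Seq (compile e (scons k \<rho>) (k + 1)) (Seq (Const k 0) (Add k k (k + 1))))"
| "compile (Ren f e) \<rho> k = compile e (\<lambda>i. \<rho> (f i)) k"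
| "compile (Rec b n s) \<rho> k = Seq (compile b \<rho> k) (Seq (compile n \<rho> (k + 2)) (Seq (Const (k + 1) 0)
     (While_nz (k + 2) (Seq (compile s (scons k (scons (k + 1) \<rho>)) (k + 3))
        (block [Const k 0, Add k k (k + 3), Const (k + 3) 1, Add (k + 1) (k + 1) (k + 3), Sub (k + 2) (k + 2) (k + 3)])))))"

definition stores :: "(nat \<Rightarrow> nat) \<Rightarrow> nat list \<Rightarrow> bool" where
  "stores M w \<longleftrightarrow> M 0 = length w \<and> (\<forall>i<length w. M (Suc i) = w ! i)"

lemma stores_cell: "stores M w \<Longrightarrow> a \<le> length w \<Longrightarrow> M a = cell_of w a"
  by (cases a) (auto simp: stores_def cell_of_def)

lemma result_word_stores: "stores M w \<Longrightarrow> result_word (R, M) = w"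
  by (auto simp: stores_def result_word_def intro: nth_equalityI)

lemma stores_initial: "stores (snd (initial_state w)) w"
  by (auto simp: stores_def initial_state_def)

lemma reach_comp:
  assumes "stores M w" "\<And>i. \<rho> i < k"
  shows "reach (compile e \<rho> k) (R, M) (\<lambda>(R', M'). M' = M \<and> R' k = ev e w (\<lambda>i. R (\<rho> i)) \<and> (\<forall>a<k. R' a = R a)) (etime e w (\<lambda>i. R (\<rho> i)))"
  using assms(2)
proof (induction e arbitrary: \<rho> k R)
  case (Num c)
  show ?case by (rule reach_straight) auto
next
  case (Var i)
  show ?case by (rule reach_straight) (use Var[of i] in auto)
next
  case (Mem a)
  show ?case unfolding compile.simps etime.simps
  proof (rule reach_Seq[OF Mem.IH], rule Mem.prems)
    fix s' assume s': "case s' of (R', M') \<Rightarrow> M' = M \<and> R' k = ev a w (\<lambda>i. R (\<rho> i)) \<and> (\<forall>a<k. R' a = R a)"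
    show "reach (block [Const (k + 1) 0, Load (k + 1) (k + 1), Sub (k + 1) k (k + 1), If_nz (k + 1) (Const k 0) (Load k k)]) s'
      (\<lambda>(R', M'). M' = M \<and> R' k = ev (Mem a) w (\<lambda>i. R (\<rho> i)) \<and> (\<forall>a<k. R' a = R a)) 6"
      by (rule reach_straight)
        (use s' assms(1) stores_cell[OF assms(1)] in \<open>auto simp: stores_def cell_of_def\<close>)
  qed
next
  case (Plus a b)
  show ?case unfolding compile.simps etime.simps add.assoc
  proof (rule reach_Seq[OF Plus.IH(1)], rule Plus.prems)
    fix s' assume s': "case s' of (R', M') \<Rightarrow> M' = M \<and> R' k = ev a w (\<lambda>i. R (\<rho> i)) \<and> (\<forall>a<k. R' a = R a)"
    then obtain R1 where R1: "s' = (R1, M)" "R1 k = ev a w (\<lambda>i. R (\<rho> i))" "\<forall>a<k. R1 a = R a" by auto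
    have e: "(\<lambda>i. R1 (\<rho> i)) = (\<lambda>i. R (\<rho> i))" using R1(3) Plus.prems by auto
    show "reach (Seq (compile b \<rho> (k + 1)) (Add k k (k + 1))) s'
      (\<lambda>(R', M'). M' = M \<and> R' k = ev (Plus a b) w (\<lambda>i. R (\<rho> i)) \<and> (\<forall>a<k. R' a = R a)) (etime b w (\<lambda>i. R (\<rho> i)) + 1)"
      unfolding R1(1)
    proof (rule reach_Seq[OF Plus.IH(2)[of \<rho> "k + 1" R1, unfolded e]])
      show "\<rho> i < k + 1" for i using Plus.prems[of i] by simp
    qed (use R1 in \<open>auto intro!: reach_straight\<close>)
  qed
next
  case (Monus a b)
  show ?case unfolding compile.simps etime.simps add.assoc
  proof (rule reach_Seq[OF Monus.IH(1)], rule Monus.prems)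
    fix s' assume s': "case s' of (R', M') \<Rightarrow> M' = M \<and> R' k = ev a w (\<lambda>i. R (\<rho> i)) \<and> (\<forall>a<k. R' a = R a)"
    then obtain R1 where R1: "s' = (R1, M)" "R1 k = ev a w (\<lambda>i. R (\<rho> i))" "\<forall>a<k. R1 a = R a" by auto
    have e: "(\<lambda>i. R1 (\<rho> i)) = (\<lambda>i. R (\<rho> i))" using R1(3) Monus.prems by auto
    show "reach (Seq (compile b \<rho> (k + 1)) (Sub k k (k + 1))) s'
      (\<lambda>(R', M'). M' = M \<and> R' k = ev (Monus a b) w (\<lambda>i. R (\<rho> i)) \<and> (\<forall>a<k. R' a = R a)) (etime b w (\<lambda>i. R (\<rho> i)) + 1)"
      unfolding R1(1)
    proof (rule reach_Seq[OF Monus.IH(2)[of \<rho> "k + 1" R1, unfolded e]])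
      show "\<rho> i < k + 1" for i using Monus.prems[of i] by simp
    qed (use R1 in \<open>auto intro!: reach_straight\<close>)
  qed
next
  case (Bind a e)
  show ?case unfolding compile.simps etime.simps add.assoc
  proof (rule reach_Seq[OF Bind.IH(1)], rule Bind.prems)
    fix s' assume s': "case s' of (R', M') \<Rightarrow> M' = M \<and> R' k = ev a w (\<lambda>i. R (\<rho> i)) \<and> (\<forall>a<k. R' a = R a)"
    then obtain R1 where R1: "s' = (R1, M)" "R1 k = ev a w (\<lambda>i. R (\<rho> i))" "\<forall>a<k. R1 a = R a" by auto
    have e: "(\<lambda>i. R1 (scons k \<rho> i)) = scons (ev a w (\<lambda>i. R (\<rho> i))) (\<lambda>i. R (\<rho> i))"
      using R1(2,3) Bind.prems by (auto simp: scons_def split: nat.split)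
    show "reach (Seq (compile e (scons k \<rho>) (k + 1)) (Seq (Const k 0) (Add k k (k + 1)))) s'
      (\<lambda>(R', M'). M' = M \<and> R' k = ev (Bind a e) w (\<lambda>i. R (\<rho> i)) \<and> (\<forall>a<k. R' a = R a))
      (etime e w (scons (ev a w (\<lambda>i. R (\<rho> i))) (\<lambda>i. R (\<rho> i))) + 2)"
      unfolding R1(1)
    proof (rule reach_Seq[OF Bind.IH(2)[of "scons k \<rho>" "k + 1" R1, unfolded e]])
      show "scons k \<rho> i < k + 1" for i using Bind.prems by (auto simp: scons_def less_SucI split: nat.split)
    qed (use R1 in \<open>auto intro!: reach_straight\<close>)
  qed
next
  case (Ren f e)
  show ?case unfolding compile.simps etime.simps ev.simps by (rule Ren.IH) (rule Ren.prems)
next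
  case (Rec b n s)
  define E where "E = (\<lambda>i. R (\<rho> i))"
  define N where "N = ev n w E"
  define v where "v = (\<lambda>i. ev (Rec b (Num i) s) w E)"
  define T where "T = (\<lambda>i. etime s w (scons (v i) (scons i E)) + 7)"
  \<comment> \<open>Registers \<open>k\<close>, \<open>k + 1\<close> and \<open>k + 2\<close> hold
    the value so far, the number of the round and the number of rounds left; the step is evaluated
    from \<open>k + 3\<close> on.\<close>
  define body where "body = Seq (compile s (scons k (scons (k + 1) \<rho>)) (k + 3))
        (block [Const k 0, Add k k (k + 3), Const (k + 3) 1, Add (k + 1) (k + 1) (k + 3), Sub (k + 2) (k + 2) (k + 3)])"
  have E: "(\<lambda>i. R1 (\<rho> i)) = E" if "\<forall>a<k. R1 a = R a" for R1 using that Rec.prems by (auto simp: E_def)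
  have body: "\<exists>t R'. exec body (R1, M) t (R', M) \<and> t + 1 \<le> T i \<and> R' k = v (Suc i) \<and> R' (k + 1) = Suc i \<and> R' (k + 2) = R1 (k + 2) - 1 \<and> (\<forall>a<k. R' a = R a)"
    if R1: "R1 k = v i" "R1 (k + 1) = i" "\<forall>a<k. R1 a = R a" for R1 i
  proof -
    have e: "(\<lambda>j. R1 (scons k (scons (k + 1) \<rho>) j)) = scons (v i) (scons i E)"
    proof
      fix j show "R1 (scons k (scons (k + 1) \<rho>) j) = scons (v i) (scons i E) j"
        using R1 E[OF R1(3)] by (auto simp: scons_def fun_eq_iff split: nat.split)
    qed
    have "scons k (scons (k + 1) \<rho>) j < k + 3" for j
      using Rec.prems[of "j - 2"] by (auto simp: scons_def split: nat.split)
    from Rec.IH(3)[of "scons k (scons (k + 1) \<rho>)" "k + 3" R1, OF this, unfolded e]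
    obtain t R2 where 2: "exec (compile s (scons k (scons (k + 1) \<rho>)) (k + 3)) (R1, M) t (R2, M)" "t \<le> etime s w (scons (v i) (scons i E))"
       "R2 (k + 3) = ev s w (scons (v i) (scons i E))" "\<forall>a<k + 3. R2 a = R1 a" unfolding reach_def by auto
    let ?B = "block [Const k 0, Add k k (k + 3), Const (k + 3) 1, Add (k + 1) (k + 1) (k + 3), Sub (k + 2) (k + 2) (k + 3)]"
    obtain t' where 3: "t' \<le> cost ?B" "exec ?B (R2, M) t' (sem ?B (R2, M))" using exec_straight[of ?B "(R2, M)"] by auto
    obtain R' where R': "sem ?B (R2, M) = (R', M)" "R' k = R2 (k + 3)" "R' (k + 1) = R2 (k + 1) + 1" "R' (k + 2) = R2 (k + 2) - 1" "\<forall>a<k. R' a = R2 a"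
      by auto
    have "exec body (R1, M) (t + t') (R', M)" unfolding body_def by (rule exec.Seq[OF 2(1)]) (use 3 R' in simp)
    moreover have "t + t' + 1 \<le> T i" using 2(2) 3(1) by (simp add: T_def)
    moreover have "v (Suc i) = ev s w (scons (v i) (scons i E))" by (simp add: v_def)
    ultimately show ?thesis using R' 2 R1 by (intro exI[of _ "t + t'"] exI[of _ R']) auto
  qed
  have loop: "\<exists>t R'. exec (While_nz (k + 2) body) (R1, M) t (R', M) \<and> t \<le> (\<Sum>j\<in>{i..<N}. T j) + 1 \<and> R' k = v N \<and> (\<forall>a<k. R' a = R a)"
    if "i \<le> N" "R1 k = v i" "R1 (k + 1) = i" "R1 (k + 2) = N - i" "\<forall>a<k. R1 a = R a" for i R1
    using that
  proof (induction "N - i" arbitrary: i R1)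
    case 0
    then show ?case using exec.While_false[of "(R1, M)" "k + 2" body] by (intro exI[of _ 1] exI[of _ R1]) auto
  next
    case (Suc d)
    obtain t R2 where 1: "exec body (R1, M) t (R2, M)" "t + 1 \<le> T i" "R2 k = v (Suc i)" "R2 (k + 1) = Suc i" "R2 (k + 2) = R1 (k + 2) - 1" "\<forall>a<k. R2 a = R a"
      using body[OF Suc.prems(2,3,5)] by blast
    have "d = N - Suc i" "Suc i \<le> N" using Suc.hyps(2) by auto
    note ih = Suc.hyps(1)[OF this]
    obtain t' R' where 2: "exec (While_nz (k + 2) body) (R2, M) t' (R', M)" "t' \<le> (\<Sum>j\<in>{Suc i..<N}. T j) + 1" "R' k = v N" "\<forall>a<k. R' a = R a"
      using ih[of R2] Suc.prems(4) 1 by auto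
    have "{i..<N} = insert i {Suc i..<N}" using Suc.hyps(2) by auto
    then have "(\<Sum>j\<in>{i..<N}. T j) = T i + (\<Sum>j\<in>{Suc i..<N}. T j)" by simp
    moreover have "exec (While_nz (k + 2) body) (R1, M) (t + t' + 1) (R', M)"
      by (rule exec.While_true[OF _ 1(1) 2(1)]) (use Suc in simp)
    ultimately show ?case using 1(2) 2 by (intro exI[of _ "t + t' + 1"] exI[of _ R']) auto
  qed
  obtain t1 R1 where 1: "exec (compile b \<rho> k) (R, M) t1 (R1, M)" "t1 \<le> etime b w E" "R1 k = ev b w E" "\<forall>a<k. R1 a = R a"
    using Rec.IH(1)[of \<rho> k R] Rec.prems unfolding reach_def E_def by auto
  have "\<rho> i < k + 2" for i using Rec.prems[of i] by simp
  from Rec.IH(2)[of \<rho> "k + 2" R1, OF this, unfolded E[OF 1(4)]]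
  obtain t2 R2 where 2: "exec (compile n \<rho> (k + 2)) (R1, M) t2 (R2, M)" "t2 \<le> etime n w E" "R2 (k + 2) = N" "\<forall>a<k + 2. R2 a = R1 a"
    unfolding reach_def by (auto simp: N_def)
  have 3: "exec (Const (k + 1) 0) (R2, M) 1 (R2(k + 1 := 0), M)" by (rule exec.Const)
  obtain t4 R4 where 4: "exec (While_nz (k + 2) body) (R2(k + 1 := 0), M) t4 (R4, M)" "t4 \<le> (\<Sum>j\<in>{0..<N}. T j) + 1" "R4 k = v N" "\<forall>a<k. R4 a = R a"
    using loop[of 0 "R2(k + 1 := 0)"] 1 2 by (auto simp: v_def)
  have "exec (compile (Rec b n s) \<rho> k) (R, M) (t1 + (t2 + (1 + t4))) (R4, M)"
    unfolding compile.simps body_def[symmetric] by (intro exec.Seq[OF 1(1)] exec.Seq[OF 2(1)] exec.Seq[OF 3] 4(1))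
  moreover have "t1 + (t2 + (1 + t4)) \<le> etime (Rec b n s) w E"
    using 1(2) 2(2) 4(2) by (simp add: T_def v_def N_def atLeast0LessThan)
  moreover have "v N = ev (Rec b n s) w E" by (simp add: v_def N_def)
  ultimately show ?case unfolding reach_def E_def[symmetric] using 4(3,4) by auto
qed

subsection \<open>Growth of expressions\<close>

text \<open>The levels of an Ackermann function bound values and running times of expressions, and they
  can themselves be computed by expressions.\<close>

fun grow :: "nat \<Rightarrow> nat \<Rightarrow> nat" where
  "grow 0 x = Suc x"
| "grow (Suc c) x = (grow c ^^ (x + 2)) x"

declare grow.simps(2) [simp del]

lemma funpow_less_add:
  fixes f :: "nat \<Rightarrow> nat"
  assumes "\<And>x. x < f x"
  shows "x + k \<le> (f ^^ k) x"
proof (induction k)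
  case (Suc k) then show ?case using assms[of "(f ^^ k) x"] by simp
qed simp

lemma funpow_increasing:
  fixes f :: "nat \<Rightarrow> nat"
  assumes "\<And>x. x < f x" "k \<le> l"
  shows "(f ^^ k) x \<le> (f ^^ l) x"
proof -
  have "(f ^^ l) x = (f ^^ (l - k)) ((f ^^ k) x)" using assms(2) funpow_add[of "l - k" k f] by simp
  then show ?thesis using funpow_less_add[of f "(f ^^ k) x" "l - k"] assms(1) by simp
qed

lemma grow_greater: "x < grow c x"
proof (induction c arbitrary: x)
  case (Suc c)
  have "x + (x + 2) \<le> (grow c ^^ (x + 2)) x" by (rule funpow_less_add) (rule Suc)
  then show ?case by (simp add: grow.simps)
qed simp

lemma grow_mono: "x \<le> y \<Longrightarrow> grow c x \<le> grow c y"
proof (induction c arbitrary: x y)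
  case (Suc c)
  have "mono (grow c)" using Suc.IH by (auto simp: mono_def)
  then have "(grow c ^^ (x + 2)) x \<le> (grow c ^^ (x + 2)) y" using Suc.prems by (rule funpow_mono)
  also have "\<dots> \<le> (grow c ^^ (y + 2)) y" by (rule funpow_increasing[OF grow_greater]) (use Suc.prems in simp)
  finally show ?case by (simp add: grow.simps)
qed simp

lemma grow_twice: "grow c (grow c x) \<le> grow (Suc c) x"
proof -
  have "(grow c ^^ 2) x \<le> (grow c ^^ (x + 2)) x" by (rule funpow_increasing) (auto simp: grow_greater)
  then show ?thesis by (simp add: numeral_2_eq_2 grow.simps)
qed

lemma grow_Suc: "grow c x < grow (Suc c) x"
  using grow_twice[of c x] grow_greater[of "grow c x" c] by simp

lemma grow_level: "c \<le> d \<Longrightarrow> grow c x \<le> grow d x"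
  using grow_Suc[of _ x] lift_Suc_mono_le[of "\<lambda>c. grow c x"] less_imp_le by blast

lemma grow_const: "c \<le> grow c x"
proof (induction c)
  case (Suc c) then show ?case using grow_Suc[of c x] by simp
qed simp

lemma grow_grow: "u \<le> grow d (grow c x) \<Longrightarrow> u \<le> grow (Suc (max c d)) x"
proof -
  have "grow d (grow c x) \<le> grow (max c d) (grow (max c d) x)"
    by (rule order_trans[OF grow_level grow_mono[OF grow_level]]) auto
  then show "u \<le> grow d (grow c x) \<Longrightarrow> u \<le> grow (Suc (max c d)) x" using grow_twice[of "max c d" x] by linarith
qed

lemma grow_1: "grow 1 x = 2 * x + 2"
proof -
  have "(grow 0 ^^ k) x = x + k" for k by (induction k) auto
  then show ?thesis by (simp add: grow.simps)
qed

lemma grow_2: "x * x \<le> grow 2 x"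
proof -
  have "2 ^ k * x \<le> (grow 1 ^^ k) x" for k
  proof (induction k)
    case (Suc k) then show ?case unfolding funpow.simps o_apply grow_1 by simp
  qed simp
  from this[of "x + 2"] have "2 ^ (x + 2) * x \<le> grow 2 x" by (simp add: numeral_2_eq_2 grow.simps)
  moreover have "x * x \<le> 2 ^ (x + 2) * x" using less_exp[of "x + 2"] by (intro mult_right_mono) linarith+
  ultimately show ?thesis by linarith
qed

definition below :: "nat \<Rightarrow> nat list \<Rightarrow> (nat \<Rightarrow> nat) \<Rightarrow> bool" where
  "below N w E \<longleftrightarrow> (\<forall>a. cell_of w a \<le> N) \<and> (\<forall>i. E i \<le> N)"

definition bounded_by :: "nat \<Rightarrow> (nat list \<Rightarrow> (nat \<Rightarrow> nat) \<Rightarrow> nat) \<Rightarrow> bool" where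
  "bounded_by c F \<longleftrightarrow> (\<forall>N w E. below N w E \<longrightarrow> F w E \<le> grow c N)"

lemma bounded_by_level: "bounded_by c F \<Longrightarrow> c \<le> d \<Longrightarrow> bounded_by d F"
  unfolding bounded_by_def using grow_level order_trans by blast

lemma bounded_by_const: "bounded_by c (\<lambda>w E. c)"
  by (simp add: bounded_by_def grow_const)

lemma bounded_by_add:
  assumes "bounded_by c F" "bounded_by d G"
  shows "\<exists>e. bounded_by e (\<lambda>w E. F w E + G w E)"
proof -
  have "F w E + G w E \<le> grow (Suc (max (max c d) 1)) N" if "below N w E" for N w E
  proof -
    have "F w E \<le> grow (max c d) N" "G w E \<le> grow (max c d) N"
      using assms that grow_level[of c "max c d" N] grow_level[of d "max c d" N] unfolding bounded_by_def by (meson max.cobounded1 max.cobounded2 order_trans)+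
    then have "F w E + G w E \<le> grow 1 (grow (max c d) N)" unfolding grow_1 by linarith
    then show ?thesis by (rule grow_grow)
  qed
  then show ?thesis unfolding bounded_by_def by blast
qed

lemma bounded_by_mult:
  assumes "bounded_by c F" "bounded_by d G"
  shows "\<exists>e. bounded_by e (\<lambda>w E. F w E * G w E)"
proof -
  have "F w E * G w E \<le> grow (Suc (max (max c d) 2)) N" if "below N w E" for N w E
  proof -
    have "F w E \<le> grow (max c d) N" "G w E \<le> grow (max c d) N"
      using assms that grow_level[of c "max c d" N] grow_level[of d "max c d" N] unfolding bounded_by_def by (meson max.cobounded1 max.cobounded2 order_trans)+
    then have "F w E * G w E \<le> grow 2 (grow (max c d) N)" using grow_2[of "grow (max c d) N"] by (meson mult_le_mono order_trans)
    then show ?thesis by (rule grow_grow)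
  qed
  then show ?thesis unfolding bounded_by_def by blast
qed

lemma below_scons: "below N w E \<Longrightarrow> x \<le> N \<Longrightarrow> below N w (scons x E)"
  by (auto simp: below_def scons_def split: nat.split)

lemma below_mono: "below N w E \<Longrightarrow> N \<le> N' \<Longrightarrow> below N' w E"
  by (auto simp: below_def intro: order_trans)

text \<open>Every round applies \<open>grow c\<close> once more, and the number of rounds is itself
  at most \<open>grow c N\<close>. Iterating that often is the next level at
  \<open>grow c N\<close>, and the inner \<open>grow c\<close> costs one more level.\<close>

lemma rec_bound:
  assumes b: "bounded_by c (ev b)" and n: "bounded_by c (ev n)" and s: "bounded_by c (ev s)"
    and N: "below N w E" and i: "i \<le> ev n w E"
  shows "ev (Rec b (Num i) s) w E \<le> grow (c + 2) N" "bounded_by c T \<Longrightarrow> i < ev n w E \<Longrightarrow> T w (scons (ev (Rec b (Num i) s) w E) (scons i E)) \<le> grow (c + 2) N"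
proof -
  define v where "v = (\<lambda>i. ev (Rec b (Num i) s) w E)"
  let ?X = "grow c N"
  have gr: "x < grow c x" for x by (rule grow_greater)
  have bl: "below ((grow c ^^ Suc j) N) w (scons (v j) (scons j E))" if "v j \<le> (grow c ^^ Suc j) N" for j
  proof -
    have "N + Suc j \<le> (grow c ^^ Suc j) N" by (rule funpow_less_add[OF gr])
    then show ?thesis by (intro below_scons that below_mono[OF N]) auto
  qed
  have v: "v j \<le> (grow c ^^ Suc j) N" for j
  proof (induction j)
    case 0 then show ?case using b N by (simp add: v_def bounded_by_def)
  next
    case (Suc j)
    have "v (Suc j) = ev s w (scons (v j) (scons j E))" by (simp add: v_def)
    then show ?case using s bl[OF Suc] by (simp add: bounded_by_def)
  qed
  have up: "(grow c ^^ j) N \<le> grow (c + 2) N" if "j \<le> ?X + 2" for j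
  proof -
    have m: "mono (grow c)" by (auto simp: mono_def grow_mono)
    have "(grow c ^^ j) N \<le> (grow c ^^ j) ?X" by (rule funpow_mono[OF m]) (use gr[of N] in simp)
    also have "\<dots> \<le> (grow c ^^ (?X + 2)) ?X" by (rule funpow_increasing[OF gr that])
    also have "\<dots> = grow (Suc c) ?X" by (simp add: grow.simps)
    finally show ?thesis using grow_grow[of _ "Suc c" c N] by simp
  qed
  have nX: "ev n w E \<le> ?X" using n N by (simp add: bounded_by_def)
  show "ev (Rec b (Num i) s) w E \<le> grow (c + 2) N" using v[of i] up[of "Suc i"] i nX unfolding v_def by linarith
  assume T: "bounded_by c T" and i': "i < ev n w E"
  have "T w (scons (v i) (scons i E)) \<le> (grow c ^^ Suc (Suc i)) N" using T bl[OF v[of i]] by (simp add: bounded_by_def)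
  then show "T w (scons (ev (Rec b (Num i) s) w E) (scons i E)) \<le> grow (c + 2) N"
    using up[of "Suc (Suc i)"] i' nX unfolding v_def by linarith
qed

definition tame :: "(nat list \<Rightarrow> (nat \<Rightarrow> nat) \<Rightarrow> nat) \<Rightarrow> bool" where
  "tame F \<longleftrightarrow> (\<exists>c. bounded_by c F)"

lemma tame_add: "tame F \<Longrightarrow> tame G \<Longrightarrow> tame (\<lambda>w E. F w E + G w E)"
  unfolding tame_def using bounded_by_add by blast

lemma tame_const: "tame (\<lambda>w E. c)"
  unfolding tame_def using bounded_by_const by blast

lemma tame_mult: "tame F \<Longrightarrow> tame G \<Longrightarrow> tame (\<lambda>w E. F w E * G w E)"
  unfolding tame_def using bounded_by_mult by blast

lemma tame_le: "tame G \<Longrightarrow> (\<And>w E. F w E \<le> G w E) \<Longrightarrow> tame F"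
  unfolding tame_def bounded_by_def by (meson order_trans)

text \<open>For values this is the classical fact that a primitive recursive function stays below
  some level of the Ackermann hierarchy. Running times obey recursions of the same kind.\<close>

lemma tame_ev_etime: "tame (ev e) \<and> tame (etime e)"
proof (induction e)
  case (Num k)
  have "tame (ev (Num k))" by (rule tame_le[OF tame_const[of k]]) simp
  moreover have "tame (etime (Num k))" by (rule tame_le[OF tame_const[of 1]]) simp
  ultimately show ?case ..
next
  case (Var i)
  have "bounded_by 0 (ev (Var i))" by (auto simp: bounded_by_def below_def le_SucI)
  then have "tame (ev (Var i))" unfolding tame_def by blast
  moreover have "tame (etime (Var i))" by (rule tame_le[OF tame_const[of 2]]) simp
  ultimately show ?case ..
next
  case (Mem a)
  have "bounded_by 0 (ev (Mem a))" by (auto simp: bounded_by_def below_def le_SucI)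
  then have "tame (ev (Mem a))" unfolding tame_def by blast
  moreover have "tame (etime (Mem a))" by (rule tame_le[OF tame_add[OF conjunct2[OF Mem] tame_const[of 6]]]) simp
  ultimately show ?case ..
next
  case (Plus a b)
  have "tame (ev (Plus a b))" by (rule tame_le[OF tame_add[of "ev a" "ev b"]]) (use Plus in auto)
  moreover have "tame (etime (Plus a b))"
    by (rule tame_le[OF tame_add[OF tame_add[of "etime a" "etime b"] tame_const[of 1]]]) (use Plus in auto)
  ultimately show ?case ..
next
  case (Monus a b)
  have "tame (ev (Monus a b))" by (rule tame_le[of "ev a"]) (use Monus in auto)
  moreover have "tame (etime (Monus a b))"
    by (rule tame_le[OF tame_add[OF tame_add[of "etime a" "etime b"] tame_const[of 1]]]) (use Monus in auto)
  ultimately show ?case ..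
next
  case (Bind a e)
  obtain c where c: "bounded_by c (ev a)" using Bind by (auto simp: tame_def)
  have *: "tame (\<lambda>w E. F w (scons (ev a w E) E))" if F: "tame F" for F
  proof -
    obtain d where d: "bounded_by d F" using F unfolding tame_def by blast
    have "F w (scons (ev a w E) E) \<le> grow (Suc (max c d)) N" if N: "below N w E" for w E N
    proof -
      have "ev a w E \<le> grow c N" using c N by (auto simp: bounded_by_def)
      then have "below (grow c N) w (scons (ev a w E) E)" using grow_greater[of N c] by (intro below_scons below_mono[OF N]) auto
      then show ?thesis using d by (intro grow_grow) (simp add: bounded_by_def)
    qed
    then have "bounded_by (Suc (max c d)) (\<lambda>w E. F w (scons (ev a w E) E))" unfolding bounded_by_def by blast
    then show ?thesis unfolding tame_def by blast
  qed
  have "tame (ev (Bind a e))" by (rule tame_le[OF *[of "ev e"]]) (use Bind in auto)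
  moreover have "tame (etime (Bind a e))" by (rule tame_le[OF tame_add[OF tame_add[OF _ *[of "etime e"]] tame_const[of 2]], of "etime a"]) (use Bind in auto)
  ultimately show ?case ..
next
  case (Ren f e)
  then obtain c d where cd: "bounded_by c (ev e)" "bounded_by d (etime e)" by (auto simp: tame_def)
  have "bounded_by c (ev (Ren f e))" "bounded_by d (etime (Ren f e))" using cd by (auto simp: bounded_by_def below_def)
  then show ?case unfolding tame_def by blast
next
  case (Rec b n s)
  then obtain cb cn cs ct where *: "bounded_by cb (ev b)" "bounded_by cn (ev n)" "bounded_by cs (ev s)" "bounded_by ct (etime s)" by (auto simp: tame_def)
  define c where "c = max (max cb ct) (max cn cs)"
  have c: "bounded_by c (ev b)" "bounded_by c (ev n)" "bounded_by c (ev s)" "bounded_by c (etime s)"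
    using bounded_by_level[OF *(1), of c] bounded_by_level[OF *(2), of c] bounded_by_level[OF *(3), of c] bounded_by_level[OF *(4), of c]
    by (auto simp: c_def)
  have "bounded_by (c + 2) (ev (Rec b n s))"
    using rec_bound(1)[OF c(1-3) _ order_refl] unfolding bounded_by_def ev.simps by blast
  then have v: "tame (ev (Rec b n s))" unfolding tame_def by blast
  \<comment> \<open>The largest cost of a round. It bounds the sum over all rounds by a product, for
    which \<open>tame_mult\<close> is available.\<close>
  define Z where "Z = (\<lambda>w E. Max (insert 0 ((\<lambda>i. etime s w (scons (ev (Rec b (Num i) s) w E) (scons i E))) ` {..<ev n w E})))"
  have "bounded_by (c + 2) Z"
    unfolding bounded_by_def
  proof (intro allI impI)
    fix N w E assume "below N w E"
    from rec_bound(2)[OF c(1-3) this less_imp_le c(4)] show "Z w E \<le> grow (c + 2) N" unfolding Z_def by simp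
  qed
  then have "tame Z" unfolding tame_def by blast
  then have "tame (\<lambda>w E. etime b w E + etime n w E + 2 + ev n w E * (Z w E + 7))" using Rec by (intro tame_add tame_mult tame_const) auto
  moreover have "etime (Rec b n s) w E \<le> etime b w E + etime n w E + 2 + ev n w E * (Z w E + 7)" for w E
  proof -
    have "(\<Sum>i<ev n w E. etime s w (scons (ev (Rec b (Num i) s) w E) (scons i E)) + 7) \<le> (\<Sum>i<ev n w E. Z w E + 7)"
      unfolding Z_def by (intro sum_mono add_right_mono Max_ge) auto
    then show ?thesis by simp
  qed
  ultimately have "tame (etime (Rec b n s))" by (rule tame_le)
  with v show ?case ..
qed

subsection \<open>Definable functions\<close>

definition expr :: "(nat list \<Rightarrow> (nat \<Rightarrow> nat) \<Rightarrow> nat) \<Rightarrow> bool" where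
  "expr F \<longleftrightarrow> (\<exists>e. \<forall>w E. ev e w E = F w E)"

named_theorems exprs

lemma exprI: "(\<And>w E. ev e w E = F w E) \<Longrightarrow> expr F"
  unfolding expr_def by blast

lemma expr_const [exprs]: "expr (\<lambda>w E. c)" by (rule exprI[of "Num c"]) simp
lemma expr_var [exprs]: "expr (\<lambda>w E. E i)" by (rule exprI[of "Var i"]) simp

lemma expr_cell [exprs]: "expr a \<Longrightarrow> expr (\<lambda>w E. cell_of w (a w E))"
  unfolding expr_def by (metis ev.simps(3))

lemma expr_add [exprs]: "expr a \<Longrightarrow> expr b \<Longrightarrow> expr (\<lambda>w E. a w E + b w E)"
  unfolding expr_def by (metis ev.simps(4))

lemma expr_diff [exprs]: "expr a \<Longrightarrow> expr b \<Longrightarrow> expr (\<lambda>w E. a w E - b w E)"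
  unfolding expr_def by (metis ev.simps(5))

lemma expr_Suc [exprs]: "expr a \<Longrightarrow> expr (\<lambda>w E. Suc (a w E))"
  using expr_add[OF _ expr_const[of 1], of a] by simp

lemma expr_shift: "expr a \<Longrightarrow> expr (\<lambda>w E. a w (\<lambda>i. E (f i)))"
  unfolding expr_def by (metis ev.simps(7))

lemma expr_let: "expr F \<Longrightarrow> expr a \<Longrightarrow> expr (\<lambda>w E. F w (scons (a w E) E))"
  unfolding expr_def by (metis ev.simps(6))

lemma expr_app1: "expr (\<lambda>w E. f w (E 0)) \<Longrightarrow> expr a \<Longrightarrow> expr (\<lambda>w E. f w (a w E))"
  using expr_let[of "\<lambda>w E. f w (E 0)" a] by simp

lemma expr_app2: "expr (\<lambda>w E. f w (E 0) (E 1)) \<Longrightarrow> expr a \<Longrightarrow> expr b \<Longrightarrow> expr (\<lambda>w E. f w (a w E) (b w E))"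
  using expr_let[OF expr_let[of "\<lambda>w E. f w (E 0) (E 1)" "\<lambda>w E. a w (\<lambda>i. E (Suc i))"], of b] expr_shift[of a Suc] by simp

lemma expr_rec:
  assumes "expr b" "expr n" "expr (\<lambda>w E. s w (E 0) (E 1) (\<lambda>i. E (Suc (Suc i))))"
  shows "expr (\<lambda>w E. rec_nat (b w E) (\<lambda>i x. s w x i E) (n w E))"
proof -
  obtain eb en es where e: "\<And>w E. ev eb w E = b w E" "\<And>w E. ev en w E = n w E" "\<And>w E. ev es w E = s w (E 0) (E 1) (\<lambda>i. E (Suc (Suc i)))"
    using assms unfolding expr_def by blast
  show ?thesis by (rule exprI[of "Rec eb en es"]) (simp add: e)
qed

lemma expr_sum [exprs]:
  assumes "expr n" "expr (\<lambda>w E. f w (E 0) (\<lambda>i. E (Suc i)))"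
  shows "expr (\<lambda>w E. \<Sum>i<n w E. f w i E)"
proof -
  have *: "(\<Sum>i<k. g i) = rec_nat 0 (\<lambda>i x. x + g i) k" for k and g :: "nat \<Rightarrow> nat" by (induction k) auto
  show ?thesis unfolding *
    by (rule expr_rec) (use assms expr_shift[OF assms(2), of Suc] in \<open>auto intro!: exprs\<close>)
qed

lemma expr_mult [exprs]: "expr a \<Longrightarrow> expr b \<Longrightarrow> expr (\<lambda>w E. a w E * b w E)"
  using expr_sum[of b "\<lambda>w i E. a w E"] expr_shift[of a Suc] by (simp add: mult.commute)

lemma expr_power [exprs]: "expr a \<Longrightarrow> expr b \<Longrightarrow> expr (\<lambda>w E. a w E ^ b w E)"
proof -
  have *: "x ^ k = rec_nat 1 (\<lambda>i y. y * x) k" for x k :: nat by (induction k) auto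
  show "expr a \<Longrightarrow> expr b \<Longrightarrow> ?thesis" unfolding *
    by (rule expr_rec) (auto intro!: exprs intro: expr_shift)
qed

lemma expr_grow [exprs]: "expr a \<Longrightarrow> expr (\<lambda>w E. grow c (a w E))"
proof (induction c arbitrary: a)
  case 0 then show ?case by (auto intro!: exprs)
next
  case (Suc c)
  have *: "(f ^^ k) x = rec_nat x (\<lambda>i y. f y) k" for f :: "nat \<Rightarrow> nat" and x k by (induction k) auto
  show ?case unfolding grow.simps(2) * by (rule expr_rec) (use Suc in \<open>auto intro!: exprs\<close>)
qed

lemma dec_not [exprs]: "expr (\<lambda>w E. of_bool (P w E)) \<Longrightarrow> expr (\<lambda>w E. of_bool (\<not> P w E))"
proof -
  have *: "of_bool (\<not> X) = 1 - (of_bool X :: nat)" for X by simp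
  show "expr (\<lambda>w E. of_bool (P w E)) \<Longrightarrow> ?thesis" unfolding * by (intro expr_diff expr_const)
qed

lemma dec_conj [exprs]: "expr (\<lambda>w E. of_bool (P w E)) \<Longrightarrow> expr (\<lambda>w E. of_bool (Q w E)) \<Longrightarrow> expr (\<lambda>w E. of_bool (P w E \<and> Q w E))"
  unfolding of_bool_conj by (rule expr_mult)

lemma dec_disj [exprs]: "expr (\<lambda>w E. of_bool (P w E)) \<Longrightarrow> expr (\<lambda>w E. of_bool (Q w E)) \<Longrightarrow> expr (\<lambda>w E. of_bool (P w E \<or> Q w E))"
  using dec_not[OF dec_conj[OF dec_not dec_not], of P Q] by simp

lemma dec_imp [exprs]: "expr (\<lambda>w E. of_bool (P w E)) \<Longrightarrow> expr (\<lambda>w E. of_bool (Q w E)) \<Longrightarrow> expr (\<lambda>w E. of_bool (P w E \<longrightarrow> Q w E))"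
  unfolding imp_conv_disj by (intro dec_disj dec_not)

lemma dec_le [exprs]:
  assumes "expr a" "expr b"
  shows "expr (\<lambda>w E. of_bool (a w E \<le> b w E))"
proof -
  have "of_bool (x \<le> y) = 1 - (x - y)" for x y :: nat by auto
  then show ?thesis using assms by (auto intro!: exprs)
qed

lemma dec_less [exprs]: "expr a \<Longrightarrow> expr b \<Longrightarrow> expr (\<lambda>w E. of_bool (a w E < b w E))"
  using dec_le[OF expr_Suc, of a b] by (simp add: Suc_le_eq)

lemma dec_eq [exprs]: "expr a \<Longrightarrow> expr b \<Longrightarrow> expr (\<lambda>w E. of_bool (a w E = b w E))"
  using dec_conj[OF dec_le dec_le, of a b b a] by (simp add: eq_iff[where 'a = nat])

lemma dec_ex [exprs]:
  assumes "expr n" "expr (\<lambda>w E. of_bool (P w (E 0) (\<lambda>i. E (Suc i))))"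
  shows "expr (\<lambda>w E. of_bool (\<exists>i<n w E. P w i E))"
proof -
  \<comment> \<open>Subtraction is truncated, so \<open>1 - (1 - x)\<close> tests whether
    \<open>x\<close> is positive.\<close>
  have *: "of_bool (\<exists>i<k. Q i) = 1 - (1 - (\<Sum>i<k. of_bool (Q i) :: nat))" for k :: nat and Q
  proof (cases "\<exists>i<k. Q i")
    case True
    then obtain i where "i < k" "Q i" by blast
    then have "1 \<le> (\<Sum>i<k. of_bool (Q i) :: nat)" using member_le_sum[of i "{..<k}" "\<lambda>i. of_bool (Q i) :: nat"] by simp
    with True show ?thesis by simp
  qed simp
  show ?thesis unfolding * by (intro exprs assms)
qed

lemma dec_all [exprs]:
  assumes "expr n" "expr (\<lambda>w E. of_bool (P w (E 0) (\<lambda>i. E (Suc i))))"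
  shows "expr (\<lambda>w E. of_bool (\<forall>i<n w E. P w i E))"
  using dec_not[OF dec_ex[OF assms(1) dec_not[OF assms(2)]]] by simp

lemma expr_div [exprs]:
  assumes "expr a" "expr b"
  shows "expr (\<lambda>w E. a w E div b w E)"
proof -
  have *: "x div y = of_bool (y \<noteq> 0) * (\<Sum>i<x. of_bool (Suc i * y \<le> x))" for x y :: nat
  proof (cases "y = 0")
    case False
    then have "Suc i * y \<le> x \<longleftrightarrow> i < x div y" for i by (simp add: less_eq_div_iff_mult_less_eq Suc_le_eq[symmetric])
    moreover have "i < x" if "i < x div y" for i using that div_le_dividend[of x y] by linarith
    ultimately have "{i. i < x \<and> Suc i * y \<le> x} = {..<x div y}" by auto
    then show ?thesis using False by (simp del: mult_Suc add: Int_def)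
  qed simp
  show ?thesis unfolding * by (intro exprs assms expr_shift[OF assms(1)] expr_shift[OF assms(2)])
qed

lemma expr_mod [exprs]: "expr a \<Longrightarrow> expr b \<Longrightarrow> expr (\<lambda>w E. a w E mod b w E)"
  unfolding modulo_nat_def by (intro exprs)

subsection \<open>Computable functions\<close>

lemma stores_result: "stores (snd s) (result_word s)"
  by (simp add: stores_def result_word_def)

text \<open>The word read by \<open>e\<close> is the one that \<open>c\<close> has left in the
  memory. All variables are mapped to register 0, which is reset to 0.\<close>

definition then_output :: "com \<Rightarrow> ex \<Rightarrow> com" where
  "then_output c e = Seq c (Seq (Const 0 0) (Seq (compile e (\<lambda>_. 0) 1) (block [Const 2 0, Const 3 1, Store 2 3, Store 3 1])))"

lemma run_then_output:
  assumes "run c w t w'"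
  shows "\<exists>t'. run (then_output c e) w t' [ev e w' (\<lambda>_. 0)] \<and> t' \<le> t + etime e w' (\<lambda>_. 0) + 5"
proof -
  obtain R M where s: "exec c (initial_state w) t (R, M)" "result_word (R, M) = w'" using assms unfolding run_def by auto
  have st: "stores M w'" using stores_result[of "(R, M)"] s(2) by simp
  have "reach (Seq (Const 0 0) (Seq (compile e (\<lambda>_. 0) 1) (block [Const 2 0, Const 3 1, Store 2 3, Store 3 1]))) (R, M)
    (\<lambda>s. result_word s = [ev e w' (\<lambda>_. 0)]) (1 + (etime e w' (\<lambda>_. 0) + 4))"
  proof (rule reach_Seq[OF reach_straight[of _ "\<lambda>s. s = (R(0 := 0), M)"]])
    fix s' assume "s' = (R(0 := 0), M)"
    then have s': "s' = (R(0 := 0), M)" .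
    have out: "reach (block [Const 2 0, Const 3 1, Store 2 3, Store 3 1]) s (\<lambda>s. result_word s = [ev e w' (\<lambda>_. 0)]) 4"
      if "case s of (R', M') \<Rightarrow> M' = M \<and> R' 1 = ev e w' (\<lambda>_. 0) \<and> (\<forall>a<1. R' a = (R(0 := 0)) a)" for s
      by (rule reach_straight) (use that in \<open>auto simp: result_word_def\<close>)
    show "reach (Seq (compile e (\<lambda>_. 0) 1) (block [Const 2 0, Const 3 1, Store 2 3, Store 3 1])) s'
       (\<lambda>s. result_word s = [ev e w' (\<lambda>_. 0)]) (etime e w' (\<lambda>_. 0) + 4)"
      unfolding s' using reach_comp[OF st, of "\<lambda>_. 0" 1 e "R(0 := 0)"] by (intro reach_Seq[OF _ out]) simp_all
  qed auto
  then obtain t' s' where "exec (Seq (Const 0 0) (Seq (compile e (\<lambda>_. 0) 1) (block [Const 2 0, Const 3 1, Store 2 3, Store 3 1]))) (R, M) t' s'"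
    "t' \<le> etime e w' (\<lambda>_. 0) + 5" "result_word s' = [ev e w' (\<lambda>_. 0)]" unfolding reach_def by auto
  then have "run (then_output c e) w (t + t') [ev e w' (\<lambda>_. 0)]" unfolding run_def then_output_def using exec.Seq[OF s(1)] by blast
  then show ?thesis using \<open>t' \<le> etime e w' (\<lambda>_. 0) + 5\<close> by (intro exI[of _ "t + t'"]) simp
qed

lemma computable_expr:
  assumes "computable g" "expr (\<lambda>w E. h (cell_of w 1))"
  shows "computable (\<lambda>k. h (g k))"
proof -
  obtain c where c: "\<And>k. \<exists>t. run c [k] t [g k]" using assms(1) unfolding computable_def by blast
  obtain e where e: "\<And>w E. ev e w E = h (cell_of w 1)" using assms(2) unfolding expr_def by blast
  have "\<exists>t. run (then_output c e) [k] t [h (g k)]" for k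
    using c[of k] run_then_output[of c "[k]" _ "[g k]" e] by (auto simp: e cell_of_def)
  then show ?thesis unfolding computable_def by blast
qed

lemma computable_id: "computable (\<lambda>k. k)"
proof -
  have "run Skip [k] 1 [k]" for k
    unfolding run_def using exec.Skip[of "initial_state [k]"] result_word_stores[OF stores_initial[of "[k]"], of "fst (initial_state [k])"]
    by (metis prod.collapse)
  then show ?thesis unfolding computable_def by blast
qed

text \<open>The kernel has bounded size, so any expression decides it within a time that depends on the
  parameter only.\<close>

lemma kernel_imp_fixed_parameter_tractable:
  assumes k: "kernel_within Q (\<lambda>s. a * s) B"
    and e: "expr (\<lambda>w E. D w)"
    and D: "\<And>I w. I \<in> instances Q \<Longrightarrow> encodes Q w I \<Longrightarrow> D w = of_bool (yes Q I)"
    and size: "\<And>I. I \<in> instances Q \<Longrightarrow> 1 \<le> inst_size Q I"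
    and word: "\<And>I w x. I \<in> instances Q \<Longrightarrow> encodes Q w I \<Longrightarrow> cell_of w x \<le> b * (inst_size Q I + param Q I)"
  shows "fixed_parameter_tractable Q"
proof -
  obtain c g where g: "computable g" and c: "\<And>I w. I \<in> instances Q \<Longrightarrow> encodes Q w I \<Longrightarrow>
        (\<exists>t w' I'. run c w t w' \<and> t \<le> a * inst_size Q I \<and> I' \<in> instances Q \<and> encodes Q w' I' \<and>
          (yes Q I' \<longleftrightarrow> yes Q I) \<and> inst_size Q I' \<le> g (param Q I) \<and> param Q I' \<le> g (param Q I) \<and> B I I')"
    using k unfolding kernel_within_def by blast
  obtain ex where ex: "\<And>w E. ev ex w E = D w" using e unfolding expr_def by blast
  obtain d where d: "bounded_by d (etime ex)" using tame_ev_etime unfolding tame_def by blast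
  define f where "f = (\<lambda>k. a + grow d (b * (g k + g k)) + 5)"
  have f: "computable f" unfolding f_def
    by (rule computable_expr[OF g, of "\<lambda>x. a + grow d (b * (x + x)) + 5"]) (intro exprs)
  have "\<exists>t. run (then_output c ex) w t [if yes Q I then 1 else 0] \<and> t \<le> f (param Q I) * inst_size Q I ^ 1"
    if I: "I \<in> instances Q" "encodes Q w I" for I w
  proof -
    obtain t w' I' where t: "run c w t w'" "t \<le> a * inst_size Q I" "I' \<in> instances Q" "encodes Q w' I'"
       "yes Q I' \<longleftrightarrow> yes Q I" "inst_size Q I' \<le> g (param Q I)" "param Q I' \<le> g (param Q I)"
      using c[OF I] by blast
    obtain t' where t': "run (then_output c ex) w t' [ev ex w' (\<lambda>_. 0)]" "t' \<le> t + etime ex w' (\<lambda>_. 0) + 5"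
      using run_then_output[OF t(1)] by blast
    let ?N = "b * (g (param Q I) + g (param Q I))"
    have "cell_of w' x \<le> ?N" for x
      using word[OF t(3,4), of x] mult_le_mono2[OF add_mono[OF t(6,7)], of b] by linarith
    then have "below ?N w' (\<lambda>_. 0)" by (simp add: below_def)
    then have "etime ex w' (\<lambda>_. 0) \<le> grow d ?N" using d unfolding bounded_by_def by blast
    then have "t' \<le> a * inst_size Q I + (grow d ?N + 5)" using t' t(2) by linarith
    \<comment> \<open>Instances have size at least 1, so the additive constant may be multiplied by
      the size.\<close>
    also have "\<dots> \<le> a * inst_size Q I + (grow d ?N + 5) * inst_size Q I" using size[OF I(1)] by simp
    finally have "t' \<le> f (param Q I) * inst_size Q I ^ 1" by (simp add: f_def algebra_simps)
    moreover have "ev ex w' (\<lambda>_. 0) = (if yes Q I then 1 else 0)" using ex D[OF t(3,4)] t(5) by simp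
    ultimately show ?thesis using t'(1) by auto
  qed
  then show ?thesis unfolding fixed_parameter_tractable_def using f by blast
qed

subsection \<open>The kernelization program\<close>

definition fixed :: "nat \<Rightarrow> nat \<Rightarrow> nat \<Rightarrow> nat \<Rightarrow> (nat \<Rightarrow> nat) \<Rightarrow> bool" where
  "fixed n m r l R \<longleftrightarrow> R 0 = 0 \<and> R 1 = 1 \<and> R 2 = n \<and> R 3 = m \<and> R 4 = r \<and> R 5 = l \<and>
     R 6 = l + 1 \<and> R 7 = l + 1 + n \<and> R 8 = l + 1 + n + n"

text \<open>Behind the input word of length \<open>l\<close> follow a table with \<open>n\<close> signatures, a table with \<open>n\<close> new
  vertex numbers, and counters indexed by signatures.\<close>

definition read_header :: com where
  "read_header = block [Const 0 0, Const 1 1, Load 5 0, Load 2 1, Const 11 2, Load 3 11, Const 11 3, Load 4 11,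
     Add 6 5 1, Add 7 6 2, Add 8 7 2]"

text \<open>Without multiplication the square is summed up from odd numbers: after \<open>i\<close>
  rounds register 11 holds \<open>5 * (m + 1) * i * i\<close>, register 12 the next difference, and
  register 13 the constant second difference. Register 14 ends the growth after \<open>r\<close>
  rounds, register 10 the loop after \<open>n\<close>.\<close>

definition square_loop :: com where
  "square_loop = Seq (block [Add 10 2 0, Const 11 0, Add 12 3 1, Add 13 12 12, Add 13 13 13, Add 12 13 12, Add 13 12 12, Add 14 4 0])
     (While_nz 10 (Seq (If_nz 14 (block [Add 11 11 12, Add 12 12 13, Sub 14 14 1]) Skip) (Sub 10 10 1)))"

definition power_loop :: "reg \<Rightarrow> reg \<Rightarrow> com" where
  "power_loop a b = Seq (block [Add 10 2 0, Const b 1])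
     (While_nz 10 (Seq (If_nz a (block [Add b b b, Sub a a 1]) Skip) (Sub 10 10 1)))"

lemma reach_read_header:
  assumes w: "w = [n, m, r] @ cells"
  shows "reach read_header (initial_state w) (\<lambda>(R, M). fixed n m r (length w) R \<and> M = snd (initial_state w)) 11"
  unfolding read_header_def initial_state_def
  by (rule reach_straight) (auto simp: fixed_def w)

lemma reach_square_loop:
  assumes "fixed n m r l R"
  shows "reach square_loop (R, M) (\<lambda>(R', M'). fixed n m r l R' \<and> M' = M \<and> R' 11 = 5 * (m + 1) * (min r n)\<^sup>2) (8 + (7 * n + 1))"
proof -
  define Inv where "Inv = (\<lambda>i (R', M'). fixed n m r l R' \<and> M' = M \<and> R' 10 = n - i \<and> R' 11 = 5 * (m + 1) * (min r i)\<^sup>2 \<and>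
     R' 12 = 5 * (m + 1) * (2 * min r i + 1) \<and> R' 13 = 10 * (m + 1) \<and> R' 14 = r - i)"
  let ?c = "Seq (If_nz 14 (block [Add 11 11 12, Add 12 12 13, Sub 14 14 1]) Skip) (Sub 10 10 1)"
  have loop: "reach (While_nz 10 ?c) s (Inv n) ((6 + 1) * n + 1)" if "Inv 0 s" for s
  proof (rule reach_While[where Inv = Inv, OF that])
    show "fst s 10 = n - i" if "Inv i s" for i s using that by (auto simp: Inv_def)
    fix i s assume i: "i < n" and s: "Inv i s"
    show "reach ?c s (Inv (Suc i)) 6"
    proof (rule reach_straight)
      obtain R' where R': "s = (R', M)" using s by (cases s) (auto simp: Inv_def)
      show "Inv (Suc i) (sem ?c s)"
      proof (cases "i < r")
        case True
        then have "min r i = i" "min r (Suc i) = Suc i" by auto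
        then show ?thesis using s i True by (auto simp: Inv_def R' fixed_def algebra_simps power2_eq_square)
      next
        case False
        then have "min r i = r" "min r (Suc i) = r" by auto
        then show ?thesis using s i False by (auto simp: Inv_def R' fixed_def)
      qed
    qed simp_all
  qed
  have "reach square_loop (R, M) (Inv n) (8 + ((6 + 1) * n + 1))"
    unfolding square_loop_def
    by (rule reach_Seq[OF reach_straight[of _ "Inv 0"] loop]) (use assms in \<open>auto simp: Inv_def fixed_def\<close>)
  then show ?thesis by (rule reach_mono) (auto simp: Inv_def)
qed

lemma reach_power_loop:
  assumes "fixed n m r l R" and ab: "9 \<le> a" "9 \<le> b" "a \<noteq> b" "a \<noteq> 10" "b \<noteq> 10"
  shows "reach (power_loop a b) (R, M) (\<lambda>(R', M'). fixed n m r l R' \<and> M' = M \<and> R' b = 2 ^ min (R a) n) (2 + (6 * n + 1))"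
proof -
  define Inv where "Inv = (\<lambda>i (R', M'). fixed n m r l R' \<and> M' = M \<and> R' 10 = n - i \<and> R' b = 2 ^ min (R a) i \<and> R' a = R a - i)"
  let ?c = "Seq (If_nz a (block [Add b b b, Sub a a 1]) Skip) (Sub 10 10 1)"
  have loop: "reach (While_nz 10 ?c) s (Inv n) ((5 + 1) * n + 1)" if "Inv 0 s" for s
  proof (rule reach_While[where Inv = Inv, OF that])
    show "fst s 10 = n - i" if "Inv i s" for i s using that by (auto simp: Inv_def)
    fix i s assume i: "i < n" and s: "Inv i s"
    show "reach ?c s (Inv (Suc i)) 5"
    proof (rule reach_straight)
      obtain R' where R': "s = (R', M)" using s by (cases s) (auto simp: Inv_def)
      show "Inv (Suc i) (sem ?c s)"
      proof (cases "i < R a")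
        case True
        then have "min (R a) i = i" "min (R a) (Suc i) = Suc i" by auto
        then show ?thesis using s i True ab by (auto simp: Inv_def R' fixed_def)
      next
        case False
        then have "min (R a) i = R a" "min (R a) (Suc i) = R a" by auto
        then show ?thesis using s i False ab by (auto simp: Inv_def R' fixed_def)
      qed
    qed simp_all
  qed
  have "reach (power_loop a b) (R, M) (Inv n) (2 + ((5 + 1) * n + 1))"
    unfolding power_loop_def
    by (rule reach_Seq[OF reach_straight[of _ "Inv 0"] loop]) (use assms in \<open>auto simp: Inv_def fixed_def\<close>)
  then show ?thesis by (rule reach_mono) (auto simp: Inv_def)
qed

text \<open>No class has more than \<open>n\<close> vertices, so powers may be cut off after \<open>n\<close> doublings, which keeps the
  running time linear.\<close>

definition threshold :: "nat \<Rightarrow> nat \<Rightarrow> nat \<Rightarrow> nat" where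
  "threshold n m r = 2 ^ min (2 ^ min (5 * (m + 1) * (min r n)\<^sup>2) n) n"

lemma reach_threshold:
  assumes "fixed n m r l R"
  shows "reach (Seq square_loop (Seq (power_loop 11 12) (power_loop 12 9))) (R, M)
    (\<lambda>(R', M'). fixed n m r l R' \<and> M' = M \<and> R' 9 = threshold n m r) (8 + (7 * n + 1) + ((2 + (6 * n + 1)) + (2 + (6 * n + 1))))"
proof (rule reach_Seq[OF reach_square_loop[OF assms]])
  fix s assume s: "case s of (R', M') \<Rightarrow> fixed n m r l R' \<and> M' = M \<and> R' 11 = 5 * (m + 1) * (min r n)\<^sup>2"
  then obtain R1 where R1: "s = (R1, M)" "fixed n m r l R1" "R1 11 = 5 * (m + 1) * (min r n)\<^sup>2" by auto
  show "reach (Seq (power_loop 11 12) (power_loop 12 9)) s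
    (\<lambda>(R', M'). fixed n m r l R' \<and> M' = M \<and> R' 9 = threshold n m r) ((2 + (6 * n + 1)) + (2 + (6 * n + 1)))"
    unfolding R1(1)
  proof (rule reach_Seq[OF reach_power_loop[OF R1(2)]])
    fix s assume "case s of (R', M') \<Rightarrow> fixed n m r l R' \<and> M' = M \<and> R' 12 = 2 ^ min (R1 11) n"
    then obtain R2 where R2: "s = (R2, M)" "fixed n m r l R2" "R2 12 = 2 ^ min (R1 11) n" by auto
    show "reach (power_loop 12 9) s (\<lambda>(R', M'). fixed n m r l R' \<and> M' = M \<and> R' 9 = threshold n m r) (2 + (6 * n + 1))"
      unfolding R2(1) by (rule reach_mono[OF reach_power_loop[OF R2(2)]]) (use R1(3) R2(3) in \<open>auto simp: threshold_def\<close>)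
  qed simp_all
qed

text \<open>Both scans of the hyperedges visit every cell once; the component \<open>rem\<close> tells how many elements of the
  current hyperedge are still to come, so a cell holds the size of the next hyperedge iff \<open>rem = 0\<close>.\<close>

fun sign_step :: "nat \<times> nat \<times> nat \<times> (nat \<Rightarrow> nat) \<Rightarrow> nat \<Rightarrow> nat \<times> nat \<times> nat \<times> (nat \<Rightarrow> nat)" where
  "sign_step (rem, cur, nxt, sg) c = (if rem \<noteq> 0 then (rem - 1, cur, nxt, sg(c := sg c + cur)) else (c, nxt, nxt + nxt, sg))"

text \<open>Hyperedge number \<open>i\<close> contributes \<open>2 ^ i\<close> to the signature of
  each of its vertices. The uniform cost measure allows numbers of this size in one cell. The table
  is not initialized, since the memory behind the input word starts with zeros.\<close>

definition sign_loop :: com where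
  "sign_loop = Seq (block [Const 11 3, Sub 10 5 11, Const 11 4, Const 12 0, Const 13 0, Const 14 1])
    (While_nz 10 (block [Load 15 11,
       If_nz 12 (block [Sub 12 12 1, Add 16 6 15, Load 17 16, Add 17 17 13, Store 16 17]) (block [Add 12 15 0, Add 13 14 0, Add 14 14 14]),
       Add 11 11 1, Sub 10 10 1]))"

lemma foldl_take_Suc: "i < length xs \<Longrightarrow> foldl f s (take (Suc i) xs) = f (foldl f s (take i xs)) (xs ! i)"
  by (simp add: take_Suc_conv_app_nth)

lemma reach_sign_loop:
  assumes f: "fixed n m r (length w) R" and w: "w = [n, m, r] @ cells" and M0: "M0 = snd (initial_state w)"
    and y: "R 9 = y" and fold: "foldl sign_step (0, 0, 1, \<lambda>_. 0) cells = (rem, cur, nxt, sg)"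
  shows "reach sign_loop (R, M0) (\<lambda>(R', M'). fixed n m r (length w) R' \<and> R' 9 = y \<and>
     M' = (\<lambda>q. if q \<le> length w then M0 q else sg (q - (length w + 1)))) (6 + (13 * length cells + 1))"
proof -
  define Inv where "Inv = (\<lambda>i (R', M'). fixed n m r (length w) R' \<and> R' 9 = y \<and> R' 10 = length cells - i \<and> R' 11 = 4 + i \<and>
     (\<exists>rem cur nxt sg. foldl sign_step (0, 0, 1, \<lambda>_. 0) (take i cells) = (rem, cur, nxt, sg) \<and> R' 12 = rem \<and> R' 13 = cur \<and> R' 14 = nxt \<and>
        M' = (\<lambda>q. if q \<le> length w then M0 q else sg (q - (length w + 1)))))"
  let ?c = "block [Load 15 11,
       If_nz 12 (block [Sub 12 12 1, Add 16 6 15, Load 17 16, Add 17 17 13, Store 16 17]) (block [Add 12 15 0, Add 13 14 0, Add 14 14 14]),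
       Add 11 11 1, Sub 10 10 1]"
  have loop: "reach (While_nz 10 ?c) s (Inv (length cells)) ((12 + 1) * length cells + 1)" if "Inv 0 s" for s
  proof (rule reach_While[where Inv = Inv, OF that])
    show "fst s 10 = length cells - i" if "Inv i s" for i s using that by (auto simp: Inv_def)
    fix i s assume i: "i < length cells" and s: "Inv i s"
    show "reach ?c s (Inv (Suc i)) 12"
    proof (rule reach_straight)
      obtain R' M' where R': "s = (R', M')" by (cases s)
      obtain rem cur nxt sg where S: "foldl sign_step (0, 0, 1, \<lambda>_. 0) (take i cells) = (rem, cur, nxt, sg)" "R' 12 = rem" "R' 13 = cur" "R' 14 = nxt"
        and M': "M' = (\<lambda>q. if q \<le> length w then M0 q else sg (q - (length w + 1)))"
        and R: "fixed n m r (length w) R'" "R' 9 = y" "R' 10 = length cells - i" "R' 11 = 4 + i"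
        using s unfolding R' Inv_def by auto
      have cell: "M' (4 + i) = cells ! i" using i by (simp add: M' M0 initial_state_def w)
      have upd: "M'(Suc (length w + c) := x) = (\<lambda>q. if q \<le> length w then M0 q else (sg(c := x)) (q - (length w + 1)))" for c x
        by (auto simp: M' fun_eq_iff)
      have rd: "M' (Suc (length w + c)) = sg c" for c by (simp add: M')
      show "Inv (Suc i) (sem ?c s)"
      proof (cases "rem = 0")
        case True
        then show ?thesis using R S i cell by (simp add: Inv_def R' foldl_take_Suc fixed_def M'[symmetric])
      next
        case False
        then show ?thesis using R S i cell by (simp add: Inv_def R' foldl_take_Suc fixed_def upd rd)
      qed
    qed simp_all
  qed
  have "reach sign_loop (R, M0) (Inv (length cells)) (6 + ((12 + 1) * length cells + 1))"
    unfolding sign_loop_def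
    by (rule reach_Seq[OF reach_straight[of _ "Inv 0"] loop]) (use f y in \<open>auto simp: Inv_def fixed_def w M0 initial_state_def fun_eq_iff\<close>)
  then show ?thesis by (rule reach_mono) (use fold in \<open>auto simp: Inv_def\<close>)
qed

text \<open>New numbers are stored as successors, so 0 marks a vertex that is dropped;
  \<open>y\<close> is the largest number of vertices kept per signature.\<close>

fun number_step :: "(nat \<Rightarrow> nat) \<Rightarrow> nat \<Rightarrow> nat \<times> (nat \<Rightarrow> nat) \<times> (nat \<Rightarrow> nat) \<Rightarrow> nat \<Rightarrow> nat \<times> (nat \<Rightarrow> nat) \<times> (nat \<Rightarrow> nat)" where
  "number_step sg y (k, nid, cnt) v =
     (if cnt (sg v) < y then (Suc k, nid(v := Suc k), cnt(sg v := Suc (cnt (sg v)))) else (k, nid, cnt))"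

text \<open>The counters are addressed by the signatures themselves, which may be exponential in
  \<open>m\<close>. So there is neither sorting nor searching, and only counters of signatures that
  occur are touched.\<close>

definition number_loop :: com where
  "number_loop = Seq (block [Add 10 2 0, Const 11 0, Const 12 0])
    (While_nz 10 (block [Add 13 6 11, Load 13 13, Add 13 8 13, Load 14 13, Sub 15 9 14,
       If_nz 15 (block [Add 12 12 1, Add 14 14 1, Store 13 14, Add 16 7 11, Store 16 12]) Skip,
       Add 11 11 1, Sub 10 10 1]))"

definition tables :: "nat \<Rightarrow> nat \<Rightarrow> (nat \<Rightarrow> nat) \<Rightarrow> (nat \<Rightarrow> nat) \<Rightarrow> (nat \<Rightarrow> nat) \<Rightarrow> (nat \<Rightarrow> nat) \<Rightarrow> nat \<Rightarrow> nat" where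
  "tables l n M0 sg nid cnt q = (if q \<le> l then M0 q else if q \<le> l + n then sg (q - (l + 1))
     else if q \<le> l + n + n then nid (q - (l + 1 + n)) else cnt (q - (l + 1 + n + n)))"

lemma tables_read:
  "v < n \<Longrightarrow> tables l n M0 sg nid cnt (Suc (l + v)) = sg v"
  "tables l n M0 sg nid cnt (Suc (l + n + v)) = (if v < n then nid v else cnt (v - n))"
  "tables l n M0 sg nid cnt (Suc (l + n + n + v)) = cnt v"
  by (auto simp: tables_def)

lemma tables_write:
  "v < n \<Longrightarrow> (tables l n M0 sg nid cnt)(Suc (l + n + v) := x) = tables l n M0 sg (nid(v := x)) cnt"
  "(tables l n M0 sg nid cnt)(Suc (l + n + n + v) := x) = tables l n M0 sg nid (cnt(v := x))"
  by (auto simp: tables_def fun_eq_iff)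

lemma reach_number_loop:
  assumes f: "fixed n m r l R" and y: "R 9 = y" and sg: "\<And>v. n \<le> v \<Longrightarrow> sg v = 0"
    and M: "M = (\<lambda>q. if q \<le> l then M0 q else sg (q - (l + 1)))"
    and fold: "foldl (number_step sg y) (0, \<lambda>_. 0, \<lambda>_. 0) [0..<n] = (k, nid, cnt)"
  shows "reach number_loop (R, M) (\<lambda>(R', M'). fixed n m r l R' \<and> R' 12 = k \<and> M' = tables l n M0 sg nid cnt) (3 + (15 * n + 1))"
proof -
  define Inv where "Inv = (\<lambda>i (R', M'). fixed n m r l R' \<and> R' 9 = y \<and> R' 10 = n - i \<and> R' 11 = i \<and>
     (\<exists>k nid cnt. foldl (number_step sg y) (0, \<lambda>_. 0, \<lambda>_. 0) [0..<i] = (k, nid, cnt) \<and> R' 12 = k \<and> M' = tables l n M0 sg nid cnt))"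
  let ?c = "block [Add 13 6 11, Load 13 13, Add 13 8 13, Load 14 13, Sub 15 9 14,
       If_nz 15 (block [Add 12 12 1, Add 14 14 1, Store 13 14, Add 16 7 11, Store 16 12]) Skip,
       Add 11 11 1, Sub 10 10 1]"
  have loop: "reach (While_nz 10 ?c) s (Inv n) ((14 + 1) * n + 1)" if "Inv 0 s" for s
  proof (rule reach_While[where Inv = Inv, OF that])
    show "fst s 10 = n - i" if "Inv i s" for i s using that by (auto simp: Inv_def)
    fix i s assume i: "i < n" and s: "Inv i s"
    show "reach ?c s (Inv (Suc i)) 14"
    proof (rule reach_straight)
      obtain R' M' where R': "s = (R', M')" by (cases s)
      obtain k nid cnt where S: "foldl (number_step sg y) (0, \<lambda>_. 0, \<lambda>_. 0) [0..<i] = (k, nid, cnt)" "R' 12 = k"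
        and M': "M' = tables l n M0 sg nid cnt"
        and R: "fixed n m r l R'" "R' 9 = y" "R' 10 = n - i" "R' 11 = i"
        using s unfolding R' Inv_def by auto
      show "Inv (Suc i) (sem ?c s)"
        using R S i M' by (cases "cnt (sg i) < y") (simp_all add: Inv_def R' fixed_def tables_read tables_write)
    qed simp_all
  qed
  have M1: "M = tables l n M0 sg (\<lambda>_. 0) (\<lambda>_. 0)" using sg by (auto simp: M tables_def fun_eq_iff)
  have "reach number_loop (R, M) (Inv n) (3 + ((14 + 1) * n + 1))"
    unfolding number_loop_def
    by (rule reach_Seq[OF reach_straight[of _ "Inv 0"] loop]) (use f y M1 in \<open>auto simp: Inv_def fixed_def\<close>)
  then show ?thesis by (rule reach_mono) (use fold in \<open>auto simp: Inv_def\<close>)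
qed

text \<open>\<open>hp\<close> is the place in the output where the size of the current hyperedge
  stands; it is counted up with every element that is kept.\<close>

fun copy_step :: "(nat \<Rightarrow> nat) \<Rightarrow> nat \<times> nat \<times> nat list \<Rightarrow> nat \<Rightarrow> nat \<times> nat \<times> nat list" where
  "copy_step nid (rem, hp, os) c =
     (if rem = 0 then (c, length os, os @ [0])
      else (rem - 1, hp, if nid c \<noteq> 0 then os[hp := Suc (os ! hp)] @ [nid c - 1] else os))"

definition copy_loop :: com where
  "copy_loop = Seq (block [Const 11 3, Sub 10 5 11, Const 11 4, Const 13 0, Const 14 4, Const 15 4])
    (While_nz 10 (block [Load 16 11,
       If_nz 13 (block [Sub 13 13 1, Add 17 7 16, Load 17 17,
           If_nz 17 (block [Sub 17 17 1, Store 14 17, Add 14 14 1, Load 18 15, Add 18 18 1, Store 15 18]) Skip])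
         (block [Add 13 16 0, Add 15 14 0, Store 14 0, Add 14 14 1]),
       Add 11 11 1, Sub 10 10 1]))"

definition overlay :: "nat list \<Rightarrow> (nat \<Rightarrow> nat) \<Rightarrow> nat \<Rightarrow> nat" where
  "overlay os M q = (if 4 \<le> q \<and> q < 4 + length os then os ! (q - 4) else M q)"

lemma overlay_append: "(overlay os M)(4 + length os := x) = overlay (os @ [x]) M"
  by (auto simp: overlay_def fun_eq_iff nth_append)

lemma overlay_update: "h < length os \<Longrightarrow> (overlay os M)(4 + h := x) = overlay (os[h := x]) M"
  by (auto simp: overlay_def fun_eq_iff nth_list_update)

lemma reach_copy_loop:
  assumes f: "fixed n m r l R" and k: "R 12 = k" and l: "l = 3 + length cells"
    and M: "\<And>i. i < length cells \<Longrightarrow> M (4 + i) = cells ! i" "\<And>v. M (l + 1 + n + v) = nid v"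
    and fold: "foldl (copy_step nid) (0, 0, []) cells = (rem, hp, os)"
  shows "reach copy_loop (R, M) (\<lambda>(R', M'). fixed n m r l R' \<and> R' 12 = k \<and> R' 14 = 4 + length os \<and> M' = overlay os M) (6 + (20 * length cells + 1))"
proof -
  \<comment> \<open>The output is written over the input. By \<open>length os \<le> i\<close> it is
    never longer than the part already read, so no cell is overwritten before it has been
    read.\<close>
  define Inv where "Inv = (\<lambda>i (R', M'). fixed n m r l R' \<and> R' 12 = k \<and> R' 10 = length cells - i \<and> R' 11 = 4 + i \<and>
     (\<exists>rem hp os. foldl (copy_step nid) (0, 0, []) (take i cells) = (rem, hp, os) \<and> R' 13 = rem \<and> R' 15 = 4 + hp \<and> R' 14 = 4 + length os \<and>
        length os \<le> i \<and> (rem \<noteq> 0 \<longrightarrow> hp < length os) \<and> M' = overlay os M))"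
  let ?c = "block [Load 16 11,
       If_nz 13 (block [Sub 13 13 1, Add 17 7 16, Load 17 17,
           If_nz 17 (block [Sub 17 17 1, Store 14 17, Add 14 14 1, Load 18 15, Add 18 18 1, Store 15 18]) Skip])
         (block [Add 13 16 0, Add 15 14 0, Store 14 0, Add 14 14 1]),
       Add 11 11 1, Sub 10 10 1]"
  have loop: "reach (While_nz 10 ?c) s (Inv (length cells)) ((19 + 1) * length cells + 1)" if "Inv 0 s" for s
  proof (rule reach_While[where Inv = Inv, OF that])
    show "fst s 10 = length cells - i" if "Inv i s" for i s using that by (auto simp: Inv_def)
    fix i s assume i: "i < length cells" and s: "Inv i s"
    show "reach ?c s (Inv (Suc i)) 19"
    proof (rule reach_straight)
      obtain R' M' where R': "s = (R', M')" by (cases s)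
      obtain rem hp os where S: "foldl (copy_step nid) (0, 0, []) (take i cells) = (rem, hp, os)" "R' 13 = rem" "R' 15 = 4 + hp" "R' 14 = 4 + length os"
        "length os \<le> i" "rem \<noteq> 0 \<longrightarrow> hp < length os"
        and M': "M' = overlay os M"
        and R: "fixed n m r l R'" "R' 12 = k" "R' 10 = length cells - i" "R' 11 = 4 + i"
        using s unfolding R' Inv_def by auto
      have cell: "overlay os M (4 + i) = cells ! i" using i S(5) M(1)[OF i] by (simp add: overlay_def)
      have idr: "overlay os M (Suc (l + n + v)) = nid v" for v
        using M(2)[of v] i S(5) by (simp add: overlay_def l add.assoc)
      have app: "(overlay os M)(4 + length os := x) = overlay (os @ [x]) M" for x by (rule overlay_append)
      have hdr: "overlay (os @ [x]) M (4 + hp) = os ! hp" "(overlay (os @ [x]) M)(4 + hp := z) = overlay (os[hp := z] @ [x]) M" if "rem \<noteq> 0" for x z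
        using S(6) that overlay_update[of hp "os @ [x]" M z] by (auto simp: overlay_def nth_append list_update_append)
      show "Inv (Suc i) (sem ?c s)"
      proof (cases "rem = 0")
        case True
        then show ?thesis using R S i cell app by (simp add: Inv_def R' M' foldl_take_Suc fixed_def)
      next
        case False
        then show ?thesis using R S i cell app idr hdr[OF False] by (simp add: Inv_def R' M' foldl_take_Suc fixed_def)
      qed
    qed simp_all
  qed
  have "reach copy_loop (R, M) (Inv (length cells)) (6 + ((19 + 1) * length cells + 1))"
    unfolding copy_loop_def
    by (rule reach_Seq[OF reach_straight[of _ "Inv 0"] loop]) (use f k l in \<open>auto simp: Inv_def fixed_def overlay_def fun_eq_iff\<close>)
  then show ?thesis by (rule reach_mono) (use fold in \<open>auto simp: Inv_def\<close>)
qed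

definition kernel_program :: com where
  "kernel_program = Seq read_header (Seq (Seq square_loop (Seq (power_loop 11 12) (power_loop 12 9)))
     (Seq sign_loop (Seq number_loop (Seq copy_loop (block [Sub 14 14 1, Store 0 14, Store 1 12])))))"

text \<open>The table of new numbers is read without a check of the index, and the counters follow
  it in the memory; this explains the function in \<open>fold3\<close>.\<close>

lemma run_kernel_program:
  assumes w: "w = [n, m, r] @ cells"
    and fold1: "foldl sign_step (0, 0, 1, \<lambda>_. 0) cells = (rem, cur, nxt, sg)" and sg: "\<And>v. n \<le> v \<Longrightarrow> sg v = 0"
    and fold2: "foldl (number_step sg (threshold n m r)) (0, \<lambda>_. 0, \<lambda>_. 0) [0..<n] = (k, nid, cnt)"
    and fold3: "foldl (copy_step (\<lambda>v. if v < n then nid v else cnt (v - n))) (0, 0, []) cells = (rem', hp, os)"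
  shows "\<exists>t. run kernel_program w t ([k, m, r] @ os) \<and> t \<le> 50 * (n + length cells + 1)"
proof -
  let ?l = "length w"
  define M0 where "M0 = snd (initial_state w)"
  define M3 where "M3 = tables ?l n M0 sg nid cnt"
  have M3: "M3 (4 + i) = cells ! i" if "i < length cells" for i
    using that by (simp add: M3_def M0_def tables_def w initial_state_def)
  have M3': "M3 (?l + 1 + n + v) = (if v < n then nid v else cnt (v - n))" for v
    using tables_read(2)[of ?l n M0 sg nid cnt v] by (simp add: M3_def)
  have l: "?l = 3 + length cells" by (simp add: w)
  have fin: "reach (block [Sub 14 14 1, Store 0 14, Store 1 12]) s (\<lambda>s. result_word s = [k, m, r] @ os) 3"
    if s: "case s of (R', M') \<Rightarrow> fixed n m r ?l R' \<and> R' 12 = k \<and> R' 14 = 4 + length os \<and> M' = overlay os M3" for s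
  proof (rule reach_straight)
    obtain R' where R': "s = (R', overlay os M3)" "fixed n m r ?l R'" "R' 12 = k" "R' 14 = 4 + length os" using s by auto
    have e: "sem (block [Sub 14 14 1, Store 0 14, Store 1 12]) s = (R'(14 := 3 + length os), (overlay os M3)(0 := 3 + length os, 1 := k))"
      using R' by (simp add: fixed_def)
    have "stores ((overlay os M3)(0 := 3 + length os, 1 := k)) ([k, m, r] @ os)"
      unfolding stores_def
    proof (intro conjI allI impI)
      fix i assume i: "i < length ([k, m, r] @ os)"
      have "M3 2 = m" "M3 3 = r" by (simp_all add: M3_def M0_def tables_def w initial_state_def)
      then show "((overlay os M3)(0 := 3 + length os, 1 := k)) (Suc i) = ([k, m, r] @ os) ! i"
        using i by (auto simp: overlay_def nth_append nth_Cons numeral_eq_Suc split: nat.split)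
    qed simp
    then show "result_word (sem (block [Sub 14 14 1, Store 0 14, Store 1 12]) s) = [k, m, r] @ os"
      unfolding e by (rule result_word_stores)
  qed simp_all
  have 5: "reach (Seq copy_loop (block [Sub 14 14 1, Store 0 14, Store 1 12])) s (\<lambda>s. result_word s = [k, m, r] @ os) ((6 + (20 * length cells + 1)) + 3)"
    if s: "case s of (R', M') \<Rightarrow> fixed n m r ?l R' \<and> R' 12 = k \<and> M' = M3" for s
  proof -
    obtain R' where R': "s = (R', M3)" "fixed n m r ?l R'" "R' 12 = k" using s by auto
    show ?thesis unfolding R'(1) by (rule reach_Seq[OF reach_copy_loop[OF R'(2,3) l M3 M3' fold3] fin])
  qed
  have 4: "reach (Seq number_loop (Seq copy_loop (block [Sub 14 14 1, Store 0 14, Store 1 12]))) s (\<lambda>s. result_word s = [k, m, r] @ os)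
     ((3 + (15 * n + 1)) + ((6 + (20 * length cells + 1)) + 3))"
    if s: "case s of (R', M') \<Rightarrow> fixed n m r ?l R' \<and> R' 9 = threshold n m r \<and> M' = (\<lambda>q. if q \<le> ?l then M0 q else sg (q - (?l + 1)))" for s
  proof -
    obtain R' where R': "s = (R', \<lambda>q. if q \<le> ?l then M0 q else sg (q - (?l + 1)))" "fixed n m r ?l R'" "R' 9 = threshold n m r" using s by auto
    show ?thesis unfolding R'(1)
      by (rule reach_Seq[OF reach_number_loop[OF R'(2,3) sg refl fold2] 5[unfolded M3_def]])
  qed
  have 3: "reach (Seq sign_loop (Seq number_loop (Seq copy_loop (block [Sub 14 14 1, Store 0 14, Store 1 12])))) s (\<lambda>s. result_word s = [k, m, r] @ os)
     ((6 + (13 * length cells + 1)) + ((3 + (15 * n + 1)) + ((6 + (20 * length cells + 1)) + 3)))"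
    if s: "case s of (R', M') \<Rightarrow> fixed n m r ?l R' \<and> M' = M0 \<and> R' 9 = threshold n m r" for s
  proof -
    obtain R' where R': "s = (R', M0)" "fixed n m r ?l R'" "R' 9 = threshold n m r" using s by auto
    show ?thesis unfolding R'(1)
      by (rule reach_Seq[OF reach_sign_loop[OF R'(2) w M0_def R'(3) fold1] 4])
  qed
  have 2: "reach (Seq (Seq square_loop (Seq (power_loop 11 12) (power_loop 12 9)))
     (Seq sign_loop (Seq number_loop (Seq copy_loop (block [Sub 14 14 1, Store 0 14, Store 1 12]))))) s (\<lambda>s. result_word s = [k, m, r] @ os)
     ((8 + (7 * n + 1) + ((2 + (6 * n + 1)) + (2 + (6 * n + 1)))) + ((6 + (13 * length cells + 1)) + ((3 + (15 * n + 1)) + ((6 + (20 * length cells + 1)) + 3))))"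
    if s: "case s of (R', M') \<Rightarrow> fixed n m r ?l R' \<and> M' = M0" for s
  proof -
    obtain R' where R': "s = (R', M0)" "fixed n m r ?l R'" using s by auto
    show ?thesis unfolding R'(1) by (rule reach_Seq[OF reach_threshold[OF R'(2)] 3])
  qed
  have "reach kernel_program (initial_state w) (\<lambda>s. result_word s = [k, m, r] @ os)
     (11 + ((8 + (7 * n + 1) + ((2 + (6 * n + 1)) + (2 + (6 * n + 1)))) + ((6 + (13 * length cells + 1)) + ((3 + (15 * n + 1)) + ((6 + (20 * length cells + 1)) + 3)))))"
    unfolding kernel_program_def by (rule reach_Seq[OF reach_read_header[OF w] 2[unfolded M0_def]])
  then obtain t s where "exec kernel_program (initial_state w) t s" "result_word s = [k, m, r] @ os" "t \<le> 50 * (n + length cells + 1)"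
    unfolding reach_def by (elim exE conjE) (rule that, assumption, assumption, simp)
  then show ?thesis unfolding run_def by blast
qed

subsection \<open>Correctness of the kernel\<close>

definition cells_of :: "nat list list \<Rightarrow> nat list" where
  "cells_of es = concat (map (\<lambda>e. length e # e) es)"

lemma cells_of_simps [simp]: "cells_of [] = []" "cells_of (e # es) = length e # e @ cells_of es"
  by (simp_all add: cells_of_def)

lemma sign_fold_edge:
  "distinct e \<Longrightarrow> foldl sign_step (length e, cur, nxt, sg) e = (0, cur, nxt, \<lambda>v. sg v + (if v \<in> set e then cur else 0))"
  by (induction e arbitrary: sg) auto

lemma sign_fold:
  "\<forall>e\<in>set es. distinct e \<Longrightarrow> \<exists>cur'. foldl sign_step (0, cur, nxt, sg) (cells_of es) =
     (0, cur', nxt * 2 ^ length es, \<lambda>v. sg v + nxt * (\<Sum>i<length es. if v \<in> set (es ! i) then 2 ^ i else 0))"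
proof (induction es arbitrary: cur nxt sg)
  case (Cons e es)
  obtain cur' where *: "foldl sign_step (0, nxt, nxt + nxt, \<lambda>v. sg v + (if v \<in> set e then nxt else 0)) (cells_of es) =
     (0, cur', (nxt + nxt) * 2 ^ length es, \<lambda>v. sg v + (if v \<in> set e then nxt else 0) + (nxt + nxt) * (\<Sum>i<length es. if v \<in> set (es ! i) then 2 ^ i else 0))"
    using Cons.IH[of nxt "nxt + nxt" "\<lambda>v. sg v + (if v \<in> set e then nxt else 0)"] Cons.prems by auto
  have "(nxt + nxt) * (\<Sum>i<length es. if v \<in> set (es ! i) then 2 ^ i else 0) = nxt * (\<Sum>i<length es. if v \<in> set (es ! i) then 2 ^ Suc i else 0)" for v
    unfolding sum_distrib_left by (intro sum.cong) auto
  moreover have "(\<Sum>i<length (e # es). if v \<in> set ((e # es) ! i) then 2 ^ i else 0) =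
      (if v \<in> set e then 1 else 0) + (\<Sum>i<length es. if v \<in> set (es ! i) then 2 ^ Suc i else 0 :: nat)" for v
    by (simp add: sum.lessThan_Suc_shift del: sum.lessThan_Suc power_Suc)
  ultimately show ?case using * Cons.prems
    by (intro exI[of _ cur']) (simp add: sign_fold_edge fun_eq_iff distrib_left del: sum.lessThan_Suc power_Suc list.size, simp)
qed simp

lemma number_fold:
  "\<exists>k nid cnt. foldl (number_step sg y) (0, \<lambda>_. 0, \<lambda>_. 0) [0..<i] = (k, nid, cnt) \<and> (\<forall>v\<ge>i. nid v = 0) \<and>
     bij_betw nid {v. nid v \<noteq> 0} {1..k} \<and> (\<forall>s. cnt s = card {v. nid v \<noteq> 0 \<and> sg v = s}) \<and>
     (\<forall>s. cnt s = min (card {v. v < i \<and> sg v = s}) y)"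
proof (induction i)
  case 0 show ?case by (simp add: bij_betw_def)
next
  case (Suc i)
  obtain k nid cnt where IH: "foldl (number_step sg y) (0, \<lambda>_. 0, \<lambda>_. 0) [0..<i] = (k, nid, cnt)" "\<forall>v\<ge>i. nid v = 0"
    "bij_betw nid {v. nid v \<noteq> 0} {1..k}" and cnt: "\<forall>s. cnt s = card {v. nid v \<noteq> 0 \<and> sg v = s}" "\<forall>s. cnt s = min (card {v. v < i \<and> sg v = s}) y"
    using Suc by (elim exE conjE)
  note IH = IH spec[OF cnt(1)] spec[OF cnt(2)]
  have less: "card {v. v < Suc i \<and> sg v = s} = card {v. v < i \<and> sg v = s} + (if sg i = s then 1 else 0)" for s
  proof -
    have "{v. v < Suc i \<and> sg v = s} = (if sg i = s then insert i {v. v < i \<and> sg v = s} else {v. v < i \<and> sg v = s})" by (auto simp: less_Suc_eq)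
    then show ?thesis by simp
  qed
  have sub: "{v. nid v \<noteq> 0} \<subseteq> {..<i}"
  proof
    fix v assume "v \<in> {v. nid v \<noteq> 0}"
    then have "\<not> i \<le> v" using spec[OF IH(2), of v] by simp
    then show "v \<in> {..<i}" by simp
  qed
  show ?case
  proof (cases "cnt (sg i) < y")
    case False
    have d: "cnt s = min (card {v. v < Suc i \<and> sg v = s}) y" for s using IH(5)[of s] False unfolding less by auto
    have fo: "foldl (number_step sg y) (0, \<lambda>_. 0, \<lambda>_. 0) [0..<Suc i] = (k, nid, cnt)" using IH(1) False by simp
    have z: "\<forall>v\<ge>Suc i. nid v = 0" using IH(2) by simp
    show ?thesis
      by (rule exI[of _ k], rule exI[of _ nid], rule exI[of _ cnt]) (intro conjI allI fo z IH(3,4) d)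
  next
    case True
    let ?nid = "nid(i := Suc k)" and ?cnt = "cnt(sg i := Suc (cnt (sg i)))"
    have K: "{v. ?nid v \<noteq> 0} = insert i {v. nid v \<noteq> 0}" by auto
    have i: "i \<notin> {v. nid v \<noteq> 0}" using IH(2) by simp
    have "bij_betw ?nid {v. nid v \<noteq> 0} {1..k}" by (rule bij_betw_cong[THEN iffD1, OF _ IH(3)]) (use i in auto)
    then have "bij_betw ?nid (insert i {v. nid v \<noteq> 0}) ({1..k} \<union> {Suc k})" using i by (intro bij_betw_combine[of _ _ _ "{i}", unfolded Un_insert_right Un_empty_right]) auto
    moreover have "{1..k} \<union> {Suc k} = {1..Suc k}" by auto
    ultimately have b: "bij_betw ?nid {v. ?nid v \<noteq> 0} {1..Suc k}" unfolding K by simp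
    have c: "?cnt s = card {v. ?nid v \<noteq> 0 \<and> sg v = s}" for s
    proof -
      have "{v. ?nid v \<noteq> 0 \<and> sg v = s} = (if sg i = s then insert i {v. nid v \<noteq> 0 \<and> sg v = s} else {v. nid v \<noteq> 0 \<and> sg v = s})" by auto
      moreover have "finite {v. nid v \<noteq> 0 \<and> sg v = s}" by (rule finite_subset[of _ "{..<i}"]) (use sub in auto)
      ultimately show ?thesis using i IH(4)[of s] by auto
    qed
    have d: "?cnt s = min (card {v. v < Suc i \<and> sg v = s}) y" for s using IH(5)[of s] True unfolding less by auto
    have fo: "foldl (number_step sg y) (0, \<lambda>_. 0, \<lambda>_. 0) [0..<Suc i] = (Suc k, ?nid, ?cnt)" using IH(1) True by simp
    have z: "\<forall>v\<ge>Suc i. ?nid v = 0" using IH(2) by simp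
    show ?thesis
      by (rule exI[of _ "Suc k"], rule exI[of _ ?nid], rule exI[of _ ?cnt]) (intro conjI allI fo z b c d)
  qed
qed

definition kept :: "(nat \<Rightarrow> nat) \<Rightarrow> nat list \<Rightarrow> nat list" where
  "kept nid e = map (\<lambda>x. nid x - 1) (filter (\<lambda>x. nid x \<noteq> 0) e)"

lemma copy_fold_edge:
  "foldl (copy_step nid) (length e, length os, os @ c # acc) e = (0, length os, os @ (c + length (kept nid e)) # acc @ kept nid e)"
proof (induction e arbitrary: c acc)
  case (Cons x e)
  show ?case using Cons.IH[of c acc] Cons.IH[of "Suc c" "acc @ [nid x - 1]"] by (auto simp: kept_def)
qed (simp add: kept_def)

lemma copy_fold:
  "\<exists>hp'. foldl (copy_step nid) (0, hp, os) (cells_of es) = (0, hp', os @ cells_of (map (kept nid) es))"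
proof (induction es arbitrary: hp os)
  case (Cons e es)
  show ?case using Cons.IH[of "length os" "os @ length (kept nid e) # kept nid e"] copy_fold_edge[of nid e os 0 "[]"] by simp
qed simp

lemma threshold_le: "threshold n m r \<le> 2 ^ (2 ^ (5 * r\<^sup>2 * (m + 1)))"
proof -
  have "5 * (m + 1) * (min r n)\<^sup>2 \<le> 5 * (m + 1) * r\<^sup>2" by (intro mult_le_mono power_mono) auto
  also have "\<dots> = 5 * r\<^sup>2 * (m + 1)" by (simp only: mult_ac)
  finally have "5 * (m + 1) * (min r n)\<^sup>2 \<le> 5 * r\<^sup>2 * (m + 1)" .
  then have "min (5 * (m + 1) * (min r n)\<^sup>2) n \<le> 5 * r\<^sup>2 * (m + 1)" by linarith
  then have "(2::nat) ^ min (5 * (m + 1) * (min r n)\<^sup>2) n \<le> 2 ^ (5 * r\<^sup>2 * (m + 1))" by (rule power_increasing) simp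
  then have "min ((2::nat) ^ min (5 * (m + 1) * (min r n)\<^sup>2) n) n \<le> 2 ^ (5 * r\<^sup>2 * (m + 1))" by linarith
  then show ?thesis unfolding threshold_def by (rule power_increasing) simp
qed

text \<open>A power of two that has been cut off is \<open>2 ^ n\<close> and exceeds
  \<open>n\<close>, more than any class can have. Replacing \<open>r\<close> by
  \<open>min r n\<close> is covered too: for \<open>r \<ge> n\<close> the inner exponent already
  reaches \<open>n\<close>.\<close>

lemma threshold_ge: "threshold n m r \<ge> n \<or> threshold n m r = 2 ^ (2 ^ (5 * r\<^sup>2 * (m + 1)))"
proof (cases "n \<le> 2 ^ min (5 * (m + 1) * (min r n)\<^sup>2) n")
  case True
  then have "threshold n m r = 2 ^ n" unfolding threshold_def by (simp add: min_absorb2)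
  then show ?thesis using less_exp[of n] by simp
next
  case False
  then have "\<not> n \<le> 5 * (m + 1) * (min r n)\<^sup>2" using less_exp[of n] by (auto simp: min_absorb2)
  moreover have "r < n"
  proof (rule ccontr)
    assume "\<not> r < n"
    then have "min r n = n" by simp
    moreover have "1 * n \<le> 5 * (m + 1) * n\<^sup>2" by (intro mult_le_mono) (auto simp: power2_eq_square)
    ultimately show False using \<open>\<not> n \<le> 5 * (m + 1) * (min r n)\<^sup>2\<close> by simp
  qed
  ultimately have "min (5 * (m + 1) * (min r n)\<^sup>2) n = 5 * r\<^sup>2 * (m + 1)" by (simp add: min_def algebra_simps)
  then show ?thesis using False unfolding threshold_def by (simp add: min_def)
qed

text \<open>The exponent is split into \<open>5 * r\<^sup>2 * m\<close> and
  \<open>5 * r\<^sup>2\<close>. The first part is covered by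
  \<open>5 * r \<le> 2 * (r\<^sup>2 + r + 1)\<close>, the second by 2 ^ 5 = 32 and 6 ^ 2 =
  36.\<close>

lemma bound_le:
  "(2::nat) ^ (2 ^ (5 * r\<^sup>2 * (m + 1))) \<le> 2 ^ (2 ^ (2 * r * (m * (r\<^sup>2 + r + 1))) * 6 ^ (2 * r\<^sup>2))"
proof -
  have "(2::nat) ^ (5 * r\<^sup>2) = 32 ^ (r\<^sup>2)" by (simp add: power_mult)
  also have "\<dots> \<le> 36 ^ (r\<^sup>2)" by (rule power_mono) auto
  also have "\<dots> = 6 ^ (2 * r\<^sup>2)" by (simp add: power_mult)
  finally have 1: "(2::nat) ^ (5 * r\<^sup>2) \<le> 6 ^ (2 * r\<^sup>2)" .
  have "5 * r \<le> 2 * (r\<^sup>2 + r + 1)"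
  proof (cases "r \<le> 1")
    case True then show ?thesis by (cases r) auto
  next
    case False
    then have "2 * r \<le> r\<^sup>2" unfolding power2_eq_square by (intro mult_right_mono) auto
    moreover have "5 * r \<le> 2 * (q + r + 1)" if "2 * r \<le> q" for q using that by simp
    ultimately show ?thesis by blast
  qed
  then have "r * m * (5 * r) \<le> r * m * (2 * (r\<^sup>2 + r + 1))" by (rule mult_le_mono2)
  moreover have "5 * r\<^sup>2 * m = r * m * (5 * r)" by (simp only: power2_eq_square mult_ac)
  moreover have "2 * r * (m * (r\<^sup>2 + r + 1)) = r * m * (2 * (r\<^sup>2 + r + 1))" by (simp only: mult_ac)
  ultimately have "5 * r\<^sup>2 * m \<le> 2 * r * (m * (r\<^sup>2 + r + 1))" by (simp only:)
  then have 2: "(2::nat) ^ (5 * r\<^sup>2 * m) \<le> 2 ^ (2 * r * (m * (r\<^sup>2 + r + 1)))" by (rule power_increasing) simp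
  have "(2::nat) ^ (5 * r\<^sup>2 * (m + 1)) = 2 ^ (5 * r\<^sup>2 * m) * 2 ^ (5 * r\<^sup>2)" by (simp add: algebra_simps power_add)
  also have "\<dots> \<le> 2 ^ (2 * r * (m * (r\<^sup>2 + r + 1))) * 6 ^ (2 * r\<^sup>2)" using 1 2 by (rule mult_le_mono[rotated])
  finally show ?thesis by (rule power_increasing) simp
qed

section \<open>The truncated instance\<close>

locale instance_word =
  fixes V :: "nat set" and E :: "nat set set" and r n :: nat and es :: "nat list list"
  assumes hyp: "hypergraph V E" and V: "V = {..<n}"
    and es: "distinct (map set es)" "\<And>e. e \<in> set es \<Longrightarrow> distinct e" "set ` set es = E"
begin

definition "m = length es"
definition "sg v = (\<Sum>i<m. if v \<in> set (es ! i) then 2 ^ i else 0 :: nat)"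
definition "cl = class_of (map set es)"
abbreviation "Y \<equiv> 2 ^ (2 ^ (5 * r\<^sup>2 * (m + 1))) :: nat"

lemma card_E: "card E = m"
  using distinct_card[OF es(1)] by (simp add: m_def es(3)[symmetric])

lemma cl_eq: "cl v = {j. j < m \<and> v \<in> set (es ! j)}"
  by (auto simp: cl_def class_of_def m_def)

lemma edge: "j < m \<Longrightarrow> set (es ! j) \<subseteq> V \<and> 2 \<le> card (set (es ! j))"
  using hyp es(3) by (auto simp: hypergraph_def m_def)

text \<open>The signature is the binary code of the class.\<close>

lemma sg_eq: "sg v = sg u \<longleftrightarrow> cl v = cl u"
proof -
  have "sg v = set_encode (cl v)" for v
    unfolding sg_def set_encode_def cl_eq by (simp add: sum.If_cases Int_def lessThan_def[symmetric])
  moreover have "finite (cl v)" for v by (rule finite_subset[of _ "{..<m}"]) (auto simp: cl_eq)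
  ultimately show ?thesis by (simp add: set_encode_eq)
qed

lemma sg_0: "n \<le> v \<Longrightarrow> sg v = 0"
  unfolding sg_def by (intro sum.neutral) (use edge V in fastforce)

lemma size_E: "(\<Sum>e\<in>E. card e) = sum_list (map length es)"
proof -
  have "(\<Sum>e\<in>E. card e) = sum_list (map card (map set es))"
    using sum_list_distinct_conv_sum_set[OF es(1), of card] by (simp add: es(3)[symmetric])
  also have "map card (map set es) = map length es" using es(2) by (auto simp: distinct_card)
  finally show ?thesis .
qed

lemma length_cells: "length (cells_of es) \<le> 2 * (\<Sum>e\<in>E. card e)"
proof -
  have l: "length (cells_of es') = length es' + sum_list (map length es')" for es' by (induction es') auto
  have "length es \<le> sum_list (map length es)"
  proof -
    have "1 \<le> length e" if "e \<in> set es" for e using that hyp es(3) by (force simp: hypergraph_def distinct_card[OF es(2)])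
    then have "sum_list (map (\<lambda>e. 1) es) \<le> sum_list (map length es)" by (intro sum_list_mono) auto
    then show ?thesis by (simp add: sum_list_triv)
  qed
  then show ?thesis using l[of es] size_E by simp
qed

lemma kernel_instance:
  obtains k nid cnt where
    "foldl (number_step sg (threshold n m r)) (0, \<lambda>_. 0, \<lambda>_. 0) [0..<n] = (k, nid, cnt)"
    "\<And>v. n \<le> v \<Longrightarrow> nid v = 0" "bij_betw (\<lambda>v. nid v - 1) {v. nid v \<noteq> 0} {..<k}"
    "\<And>c. card {v \<in> {v. nid v \<noteq> 0}. cl v = c} \<le> Y"
    "\<And>c. card {v \<in> {v. nid v \<noteq> 0}. cl v = c} \<ge> min (card {v \<in> V. cl v = c}) Y"
proof -
  obtain k nid cnt where f: "foldl (number_step sg (threshold n m r)) (0, \<lambda>_. 0, \<lambda>_. 0) [0..<n] = (k, nid, cnt)" "\<forall>v\<ge>n. nid v = 0"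
     "bij_betw nid {v. nid v \<noteq> 0} {1..k}" and cnt: "\<forall>s. cnt s = card {v. nid v \<noteq> 0 \<and> sg v = s}"
     "\<forall>s. cnt s = min (card {v. v < n \<and> sg v = s}) (threshold n m r)"
    using number_fold[of sg "threshold n m r" n] by (elim exE conjE)
  note f = f spec[OF cnt(1)] spec[OF cnt(2)]
  have "bij_betw (\<lambda>x. x - 1) {1..k} {..<k}" by (rule bij_betw_byWitness[of _ Suc]) auto
  from bij_betw_trans[OF f(3) this] have b: "bij_betw (\<lambda>v. nid v - 1) {v. nid v \<noteq> 0} {..<k}" by (simp add: comp_def)
  have e: "card {v \<in> {v. nid v \<noteq> 0}. cl v = c} = min (card {v \<in> V. cl v = c}) (threshold n m r)" for c
  proof (cases "\<exists>u\<in>V. cl u = c")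
    case True
    then obtain u where u: "u \<in> V" "cl u = c" by blast
    have "{v \<in> {v. nid v \<noteq> 0}. cl v = c} = {v. nid v \<noteq> 0 \<and> sg v = sg u}" "{v \<in> V. cl v = c} = {v. v < n \<and> sg v = sg u}"
      using u by (auto simp: sg_eq V)
    then show ?thesis using f(4)[of "sg u"] f(5)[of "sg u"] by simp
  next
    case False
    have "v \<in> V" if "nid v \<noteq> 0" for v
    proof -
      have "\<not> n \<le> v" using spec[OF f(2), of v] that by auto
      then show ?thesis by (simp add: V)
    qed
    then have "{v \<in> {v. nid v \<noteq> 0}. cl v = c} = {}" "{v \<in> V. cl v = c} = {}" using False by blast+
    then show ?thesis by (simp only: card.empty)
  qed
  have cn: "card {v \<in> V. cl v = c} \<le> n" for c
  proof -
    have "{v \<in> V. cl v = c} \<subseteq> {..<n}" by (auto simp: V)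
    from card_mono[OF _ this] show ?thesis by simp
  qed
  show thesis
  proof (rule that[OF f(1) _ b])
    show "nid v = 0" if "n \<le> v" for v using f(2) that by blast
    show "card {v \<in> {v. nid v \<noteq> 0}. cl v = c} \<le> Y" for c unfolding e using threshold_le[of n m r] by linarith
    show "card {v \<in> {v. nid v \<noteq> 0}. cl v = c} \<ge> min (card {v \<in> V. cl v = c}) Y" for c
      unfolding e using threshold_ge[of n m r] cn[of c] by (elim disjE) linarith+
  qed
qed

context
  fixes k :: nat and nid :: "nat \<Rightarrow> nat"
  assumes nid: "\<And>v. n \<le> v \<Longrightarrow> nid v = 0" "bij_betw (\<lambda>v. nid v - 1) {v. nid v \<noteq> 0} {..<k}"
    and up: "\<And>c. card {v \<in> {v. nid v \<noteq> 0}. cl v = c} \<le> Y"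
    and low: "\<And>c. card {v \<in> {v. nid v \<noteq> 0}. cl v = c} \<ge> min (card {v \<in> V. cl v = c}) Y"
begin

definition "K = {v. nid v \<noteq> 0}"
definition "ren v = nid v - 1"
definition "es' = map (kept nid) es"

lemma K_V: "K \<subseteq> V"
proof
  fix v assume "v \<in> K"
  then have "\<not> n \<le> v" using nid(1)[of v] by (auto simp: K_def)
  then show "v \<in> V" by (simp add: V)
qed

lemma finV: "finite V" by (simp add: V)

lemma ren: "bij_betw ren K {..<k}" using nid(2) by (simp add: K_def ren_def[abs_def])

lemma Y_ge: "2 \<le> Y" using power_increasing[of 1 "2 ^ (5 * r\<^sup>2 * (m + 1))" "2::nat"] by simp

lemma es'_nth: "j < m \<Longrightarrow> set (es' ! j) = ren ` (set (es ! j) \<inter> K)"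
  by (auto simp: es'_def m_def kept_def K_def ren_def)

lemma es'_distinct: "e \<in> set es' \<Longrightarrow> distinct e"
  using es(2) bij_betw_imp_inj_on[OF ren]
  by (auto simp: es'_def kept_def distinct_map K_def ren_def[abs_def] intro: inj_on_subset)

lemma twin: "v \<in> V \<Longrightarrow> \<exists>u\<in>K. cl u = cl v"
proof -
  assume v: "v \<in> V"
  have "{u \<in> V. cl u = cl v} \<noteq> {}" using v by blast
  then have "1 \<le> card {u \<in> V. cl u = cl v}" using finV by (simp add: Suc_le_eq card_gt_0_iff)
  then have "card {u \<in> K. cl u = cl v} \<ge> 1" using low[of "cl v"] Y_ge unfolding K_def[symmetric] by linarith
  then have "{u \<in> K. cl u = cl v} \<noteq> {}" by (metis card.empty not_one_le_zero)
  then show ?thesis by blast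
qed

lemma cl_mem: "cl u = cl v \<Longrightarrow> j < m \<Longrightarrow> u \<in> set (es ! j) \<longleftrightarrow> v \<in> set (es ! j)"
  by (auto simp: cl_eq)

text \<open>Every hyperedge is a union of classes, and every class keeps a vertex; so a hyperedge is
  determined by what is kept of it.\<close>

lemma es'_sets_distinct: "distinct (map set es')"
proof -
  have sub: "set (es ! i) \<subseteq> set (es ! j)" if ij: "i < m" "j < m" "set (es' ! i) = set (es' ! j)" for i j
  proof
    fix v assume v: "v \<in> set (es ! i)"
    then obtain u where u: "u \<in> K" "cl u = cl v" using twin edge[OF ij(1)] by blast
    then have "ren u \<in> set (es' ! i)" unfolding es'_nth[OF ij(1)] using cl_mem[OF u(2) ij(1)] v by (intro imageI) simp
    then obtain x where x: "x \<in> set (es ! j)" "x \<in> K" "ren u = ren x" unfolding ij(3) es'_nth[OF ij(2)] by auto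
    then have "u \<in> set (es ! j)" using inj_onD[OF bij_betw_imp_inj_on[OF ren] x(3) u(1) x(2)] by simp
    then show "v \<in> set (es ! j)" using cl_mem[OF u(2) ij(2)] by simp
  qed
  have "i = j" if ij: "i < m" "j < m" "set (es' ! i) = set (es' ! j)" for i j
  proof -
    have "set (es ! i) = set (es ! j)" by (rule subset_antisym[OF sub[OF ij] sub[OF ij(2,1) ij(3)[symmetric]]])
    then show ?thesis using ij nth_eq_iff_index_eq[OF es(1), of i j] by (simp add: m_def)
  qed
  then show ?thesis unfolding distinct_conv_nth by (auto simp: es'_def m_def)
qed

text \<open>Either the hyperedge meets two classes, and each of them keeps a vertex; or it lies in a
  single class with at least two vertices, of which two are kept because
  \<open>Y \<ge> 2\<close>.\<close>

lemma es'_card: "j < m \<Longrightarrow> 2 \<le> card (set (es' ! j))"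
proof -
  assume j: "j < m"
  have inj: "inj_on ren (set (es ! j) \<inter> K)" using bij_betw_imp_inj_on[OF ren] by (rule inj_on_subset) simp
  have "2 \<le> card (set (es ! j) \<inter> K)"
  proof (rule ccontr)
    assume less: "\<not> 2 \<le> card (set (es ! j) \<inter> K)"
    obtain x where x: "x \<in> set (es ! j)" using edge[OF j] by fastforce
    have same: "cl y = cl x" if y: "y \<in> set (es ! j)" for y
    proof (rule ccontr)
      assume ne: "cl y \<noteq> cl x"
      obtain u v where uv: "u \<in> K" "cl u = cl x" "v \<in> K" "cl v = cl y" using twin[of x] twin[of y] x y edge[OF j] by blast
      then have "{u, v} \<subseteq> set (es ! j) \<inter> K" using cl_mem j x y by blast
      moreover have "u \<noteq> v" using uv ne by auto
      ultimately show False using less card_mono[of "set (es ! j) \<inter> K" "{u, v}"] by simp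
    qed
    have "set (es ! j) \<subseteq> {v \<in> V. cl v = cl x}" using same edge[OF j] by blast
    then have "2 \<le> card {v \<in> V. cl v = cl x}" using edge[OF j] card_mono[of "{v \<in> V. cl v = cl x}" "set (es ! j)"] finV by fastforce
    then have "2 \<le> card {v \<in> K. cl v = cl x}" using low[of "cl x"] Y_ge unfolding K_def[symmetric] by linarith
    moreover have "{v \<in> K. cl v = cl x} \<subseteq> set (es ! j) \<inter> K" using cl_mem j x by blast
    ultimately show False using less card_mono[of "set (es ! j) \<inter> K" "{v \<in> K. cl v = cl x}"] by simp
  qed
  then show ?thesis unfolding es'_nth[OF j] card_image[OF inj] .
qed

lemma hypergraph': "hypergraph {..<k} (set ` set es')"
proof -
  have "e \<subseteq> {..<k} \<and> 2 \<le> card e" if "e \<in> set ` set es'" for e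
  proof -
    obtain j where j: "j < length es'" "e = set (es' ! j)" using \<open>e \<in> set ` set es'\<close> by (auto simp: in_set_conv_nth)
    then have "j < m" by (simp add: es'_def m_def)
    then show ?thesis using es'_card es'_nth[of j] j(2) bij_betw_imp_surj_on[OF ren] by blast
  qed
  then show ?thesis unfolding hypergraph_def by blast
qed

lemma class_ren: "v \<in> K \<Longrightarrow> class_of (map set es') (ren v) = cl v"
proof -
  assume v: "v \<in> K"
  have "ren v \<in> set (es' ! j) \<longleftrightarrow> v \<in> set (es ! j)" if "j < m" for j
    unfolding es'_nth[OF that] using v bij_betw_imp_inj_on[OF ren] by (auto dest: inj_onD)
  moreover have "length es' = m" by (simp add: es'_def m_def)
  ultimately show ?thesis by (auto simp: class_of_def cl_eq)
qed

lemma yes_iff: "yes Planar_Support ({..<k}, set ` set es', r) \<longleftrightarrow> yes Planar_Support (V, E, r)"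
proof -
  have m': "length (map set es') = m" "length (map set es) = m" by (simp_all add: es'_def m_def)
  have "yes Planar_Support (V, E, r) \<longleftrightarrow> (\<exists>t. realizes r m cl V t)"
    using support_iff_realizes[of V "map set es" r] hyp es(3) by (simp add: Planar_Support_def cl_def m_def)
  also have "\<dots> \<longleftrightarrow> (\<exists>t. realizes r m cl K t)"
  proof (rule truncation[OF finV K_V])
    show "cl ` K = cl ` V" using twin K_V by (auto simp: image_iff) metis
    show "cl v \<subseteq> {..<m}" for v by (auto simp: cl_eq)
  qed (use low in \<open>simp add: K_def\<close>)
  also have "\<dots> \<longleftrightarrow> (\<exists>t. realizes r m (class_of (map set es')) {..<k} t)"
  proof
    assume "\<exists>t. realizes r m cl K t"
    then obtain t where "realizes r m cl K t" by blast
    from realizes_rename[OF this bij_betw_imp_inj_on[OF ren] class_ren]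
    show "\<exists>t. realizes r m (class_of (map set es')) {..<k} t" unfolding bij_betw_imp_surj_on[OF ren] by blast
  next
    assume "\<exists>t. realizes r m (class_of (map set es')) {..<k} t"
    then obtain t where t: "realizes r m (class_of (map set es')) {..<k} t" by blast
    have b: "bij_betw (the_inv_into K ren) {..<k} K" by (rule bij_betw_the_inv_into[OF ren])
    have "cl (the_inv_into K ren u) = class_of (map set es') u" if "u \<in> {..<k}" for u
      using class_ren[of "the_inv_into K ren u"] bij_betwE[OF b] f_the_inv_into_f_bij_betw[OF ren] that by auto
    from realizes_rename[OF t bij_betw_imp_inj_on[OF b] this]
    show "\<exists>t. realizes r m cl K t" unfolding bij_betw_imp_surj_on[OF b] by blast
  qed
  also have "\<dots> \<longleftrightarrow> yes Planar_Support ({..<k}, set ` set es', r)"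
    using support_iff_realizes[of "{..<k}" "map set es'" r] hypergraph' m' by (simp add: Planar_Support_def)
  finally show ?thesis by blast
qed

lemma k_le: "k \<le> 2 ^ m * Y"
proof -
  have "K = (\<Union>c\<in>Pow {..<m}. {v \<in> K. cl v = c})" by (auto simp: cl_eq)
  from arg_cong[OF this, of card] have "k = card (\<Union>c\<in>Pow {..<m}. {v \<in> K. cl v = c})" using bij_betw_same_card[OF ren] by simp
  also have "\<dots> \<le> (\<Sum>c\<in>Pow {..<m}. card {v \<in> K. cl v = c})" by (rule card_UN_le) simp
  also have "\<dots> \<le> (\<Sum>c\<in>Pow {..<m}. Y)" using up by (intro sum_mono) (simp add: K_def)
  also have "\<dots> = 2 ^ m * Y" by (simp add: card_Pow)
  finally show ?thesis .
qed

lemma card_E': "card (set ` set es') = m"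
  using distinct_card[OF es'_sets_distinct] by (simp add: es'_def m_def image_image)

lemma size': "k + (\<Sum>e\<in>set ` set es'. card e) + 1 \<le> 2 ^ m * Y * (m + 1) + 1"
proof -
  have "(\<Sum>e\<in>set ` set es'. card e) \<le> (\<Sum>e\<in>set ` set es'. k)"
    using hypergraph' card_mono[of "{..<k}"] by (intro sum_mono) (auto simp: hypergraph_def)
  then have "k + (\<Sum>e\<in>set ` set es'. card e) \<le> k * (m + 1)" using card_E' by (simp add: mult.commute)
  also have "\<dots> \<le> 2 ^ m * Y * (m + 1)" using k_le by (rule mult_le_mono1)
  finally show ?thesis by simp
qed

end

lemma kernel_run:
  obtains t k fs where "run kernel_program ([n, m, r] @ cells_of es) t ([k, m, r] @ cells_of fs)"
    "t \<le> 100 * (n + (\<Sum>e\<in>E. card e) + 1)" "hypergraph {..<k} (set ` set fs)" "distinct (map set fs)" "\<And>e. e \<in> set fs \<Longrightarrow> distinct e"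
    "length fs = m" "card (set ` set fs) = m"
    "yes Planar_Support ({..<k}, set ` set fs, r) \<longleftrightarrow> yes Planar_Support (V, E, r)"
    "k \<le> 2 ^ m * Y" "k + (\<Sum>e\<in>set ` set fs. card e) + 1 \<le> 2 ^ m * Y * (m + 1) + 1"
proof -
  obtain k nid cnt where f: "foldl (number_step sg (threshold n m r)) (0, \<lambda>_. 0, \<lambda>_. 0) [0..<n] = (k, nid, cnt)"
    and nid: "\<And>v. n \<le> v \<Longrightarrow> nid v = 0" "bij_betw (\<lambda>v. nid v - 1) {v. nid v \<noteq> 0} {..<k}"
    "\<And>c. card {v \<in> {v. nid v \<noteq> 0}. cl v = c} \<le> Y"
    "\<And>c. card {v \<in> {v. nid v \<noteq> 0}. cl v = c} \<ge> min (card {v \<in> V. cl v = c}) Y"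
    by (rule kernel_instance) blast
  obtain cur where f1: "foldl sign_step (0, 0, 1, \<lambda>_. 0) (cells_of es) = (0, cur, 2 ^ length es, sg)"
    using sign_fold[of es 0 1 "\<lambda>_. 0"] es(2) by (auto simp: sg_def[abs_def] m_def)
  let ?nd = "\<lambda>v. if v < n then nid v else cnt (v - n)"
  obtain hp where f3: "foldl (copy_step ?nd) (0, 0, []) (cells_of es) = (0, hp, cells_of (map (kept ?nd) es))"
    using copy_fold[of ?nd 0 "[]" es] by auto
  have "kept ?nd e = kept nid e" if "e \<in> set es" for e
  proof -
    have "v < n" if "v \<in> set e" for v using that \<open>e \<in> set es\<close> hyp es(3) V by (auto simp: hypergraph_def)
    then show ?thesis unfolding kept_def by (auto cong: filter_cong map_cong)
  qed
  then have fs: "map (kept ?nd) es = es' nid" by (simp add: es'_def[OF nid])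
  obtain t where t: "run kernel_program ([n, m, r] @ cells_of es) t ([k, m, r] @ cells_of (es' nid))" "t \<le> 50 * (n + length (cells_of es) + 1)"
    using run_kernel_program[OF refl f1 sg_0 f f3] unfolding fs by blast
  have "t \<le> 100 * (n + (\<Sum>e\<in>E. card e) + 1)" using t(2) length_cells by simp
  moreover have "length (es' nid) = m" by (simp add: es'_def[OF nid] m_def)
  ultimately show thesis
    using that[OF t(1) _ hypergraph'[OF nid] es'_sets_distinct[OF nid] es'_distinct[OF nid] _ card_E'[OF nid] yes_iff[OF nid] k_le[OF nid] size'[OF nid]] by blast
qed

end

lemma planar_support_kernel:
  "kernel_within Planar_Support (\<lambda>s. 100 * s)
    (\<lambda>(V, E, r) (V', E', r').
      let m = card E in
      card V' \<le> 2 ^ m * 2 ^ (2 ^ (2 * r * (m * (r\<^sup>2 + r + 1))) * 6 ^ (2 * r\<^sup>2)))"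
proof -
  \<comment> \<open>The size bound in \<open>m\<close> and \<open>r\<close> with both replaced by
    the parameter \<open>p = m + r\<close>. The last summand bounds the new parameter, which equals
    the old one.\<close>
  define g where "g = (\<lambda>p::nat. 2 ^ p * 2 ^ (2 ^ (5 * p ^ 2 * (p + 1))) * (p + 1) + 1 + p)"
  have "computable g" unfolding g_def
    by (rule computable_expr[OF computable_id, of "\<lambda>p. 2 ^ p * 2 ^ (2 ^ (5 * p ^ 2 * (p + 1))) * (p + 1) + 1 + p"]) (intro exprs)
  have "\<exists>t w' I'. run kernel_program w t w' \<and> t \<le> 100 * inst_size Planar_Support I \<and>
      I' \<in> instances Planar_Support \<and> encodes Planar_Support w' I' \<and> yes Planar_Support I' = yes Planar_Support I \<and>
      inst_size Planar_Support I' \<le> g (param Planar_Support I) \<and> param Planar_Support I' \<le> g (param Planar_Support I) \<and>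
      (case I of (V, E, r) \<Rightarrow> \<lambda>(V', E', r'). let m = card E in card V' \<le> 2 ^ m * 2 ^ (2 ^ (2 * r * (m * (r\<^sup>2 + r + 1))) * 6 ^ (2 * r\<^sup>2))) I'"
    if I: "I \<in> instances Planar_Support" "encodes Planar_Support w I" for I w
  proof -
    obtain V E r where I_eq: "I = (V, E, r)" by (cases I)
    obtain n es where h: "hypergraph V E" "V = {..<n}"
      and es: "distinct (map set es)" "\<And>e. e \<in> set es \<Longrightarrow> distinct e" "set ` set es = E" and w: "w = [card V, length es, r] @ cells_of es"
      using I unfolding I_eq Planar_Support_def by (auto simp: encodes_hypergraph_def cells_of_def)
    interpret instance_word V E r n es by unfold_locales (use h es in auto)
    obtain t k fs where k: "run kernel_program ([n, m, r] @ cells_of es) t ([k, m, r] @ cells_of fs)"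
      "t \<le> 100 * (n + (\<Sum>e\<in>E. card e) + 1)" "hypergraph {..<k} (set ` set fs)" "distinct (map set fs)" "\<And>e. e \<in> set fs \<Longrightarrow> distinct e"
      "length fs = m" "card (set ` set fs) = m"
      "yes Planar_Support ({..<k}, set ` set fs, r) \<longleftrightarrow> yes Planar_Support (V, E, r)"
      "k \<le> 2 ^ m * Y" "k + (\<Sum>e\<in>set ` set fs. card e) + 1 \<le> 2 ^ m * Y * (m + 1) + 1"
      by (rule kernel_run) blast
    have run: "run kernel_program w t ([k, m, r] @ cells_of fs)" using k(1) by (simp add: w V m_def)
    have enc: "encodes Planar_Support ([k, m, r] @ cells_of fs) ({..<k}, set ` set fs, r)"
      using k(4-6) by (auto simp: Planar_Support_def encodes_hypergraph_def cells_of_def intro!: exI[of _ fs])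
    have "Y \<le> 2 ^ (2 ^ (5 * (m + r)\<^sup>2 * (m + r + 1)))"
      by (intro power_increasing mult_le_mono power_mono) auto
    then have "2 ^ m * Y * (m + 1) \<le> 2 ^ (m + r) * 2 ^ (2 ^ (5 * (m + r)\<^sup>2 * (m + r + 1))) * (m + r + 1)"
      by (intro mult_le_mono power_increasing) auto
    then have g: "2 ^ m * Y * (m + 1) + 1 \<le> g (m + r)" "m + r \<le> g (m + r)" by (auto simp: g_def)
    have "k \<le> 2 ^ m * 2 ^ (2 ^ (2 * r * (m * (r\<^sup>2 + r + 1))) * 6 ^ (2 * r\<^sup>2))"
      using k(9) mult_le_mono2[OF bound_le[of r m], of "2 ^ m"] by linarith
    then show ?thesis
      using run k(2,3,7,8,10) enc g
      by (intro exI[of _ t] exI[of _ "[k, m, r] @ cells_of fs"] exI[of _ "({..<k}, set ` set fs, r)"])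
         (auto simp: I_eq Planar_Support_def V card_E)
  qed
  then show ?thesis unfolding kernel_within_def using \<open>computable g\<close> by (intro exI[of _ kernel_program] exI[of _ g]) blast
qed

subsection \<open>Deciding Planar Support by exhaustive search\<close>

text \<open>A stack over \<open>{..<n}\<close> is coded as a number in base \<open>n + 1\<close> without digit 0, the top being the
  last digit.\<close>

fun stack_code :: "nat \<Rightarrow> nat list \<Rightarrow> nat" where
  "stack_code n [] = 0"
| "stack_code n (v # P) = stack_code n P * Suc n + Suc v"

lemma stack_code_Cons:
  assumes "v < n"
  shows "stack_code n (v # P) mod Suc n = Suc v" "stack_code n (v # P) div Suc n = stack_code n P"
proof -
  have e: "stack_code n (v # P) = Suc v + Suc n * stack_code n P" by (simp only: stack_code.simps mult.commute add.commute)
  show "stack_code n (v # P) mod Suc n = Suc v" unfolding e mod_mult_self2 using assms by simp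
  show "stack_code n (v # P) div Suc n = stack_code n P" unfolding e using assms by (subst div_mult_self2) auto
qed

lemma stack_code_inj:
  "set P \<subseteq> {..<n} \<Longrightarrow> set Q \<subseteq> {..<n} \<Longrightarrow> stack_code n P = stack_code n Q \<Longrightarrow> P = Q"
proof (induction P arbitrary: Q)
  case Nil then show ?case by (cases Q) auto
next
  case (Cons v P)
  then obtain u Q' where Q: "Q = u # Q'" by (cases Q) auto
  have vu: "v < n" "u < n" using Cons.prems Q by auto
  have "Suc v = Suc u" "stack_code n P = stack_code n Q'"
    using stack_code_Cons[OF vu(1), of P] stack_code_Cons[OF vu(2), of Q'] Cons.prems(3) unfolding Q by auto
  then show ?case using Cons.IH[of Q'] Cons.prems Q by auto
qed

lemma stack_code_length: "set P \<subseteq> {..<n} \<Longrightarrow> stack_code n P < Suc n ^ length P"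
proof (induction P)
  case (Cons v P)
  then have v: "stack_code n P + 1 \<le> Suc n ^ length P" "Suc v < Suc n" by auto
  have "(stack_code n P + 1) * Suc n \<le> Suc n ^ length P * Suc n" by (rule mult_le_mono1[OF v(1)])
  with v(2) have "stack_code n P * Suc n + Suc v < Suc n ^ length P * Suc n" by simp
  then show ?case by (simp add: algebra_simps)
qed simp

lemma stack_code_length_ge: "P \<noteq> [] \<Longrightarrow> Suc n ^ (length P - 1) \<le> stack_code n P"
proof (induction P)
  case (Cons v P)
  show ?case
  proof (cases "P = []")
    case False
    then have "Suc n ^ (length P - 1) * Suc n \<le> stack_code n P * Suc n" using Cons.IH by (intro mult_le_mono1)
    moreover have "Suc n ^ (length P - 1) * Suc n = Suc n ^ length P" using False by (cases P) auto
    ultimately show ?thesis by simp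
  qed simp
qed simp

lemma stack_code_top: "set P \<subseteq> {..<n} \<Longrightarrow> v < n \<Longrightarrow> stack_code n P mod Suc n = Suc v \<longleftrightarrow> P \<noteq> [] \<and> hd P = v"
  by (cases P) (simp_all add: stack_code_Cons del: stack_code.simps(2))

text \<open>\<open>L\<close> will be \<open>2 * n\<close>, since every vertex is pushed once and
  popped once in a closed tour.\<close>

definition walk :: "nat \<Rightarrow> nat \<Rightarrow> (nat \<Rightarrow> nat) \<Rightarrow> bool" where
  "walk n L S \<longleftrightarrow> S 0 = 0 \<and>
     (\<forall>k<L. (\<exists>v<n. S (Suc k) = S k * Suc n + Suc v) \<or> S k \<noteq> 0 \<and> S (Suc k) = S k div Suc n) \<and>
     (\<forall>v<n. \<exists>k<L. S (Suc k) = S k * Suc n + Suc v) \<and>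
     (\<forall>v<n. \<forall>k<L. \<forall>l<L. S (Suc k) = S k * Suc n + Suc v \<and> S (Suc l) = S l * Suc n + Suc v \<longrightarrow> k = l)"

definition noncrossing :: "nat \<Rightarrow> (nat \<Rightarrow> nat \<Rightarrow> bool) \<Rightarrow> bool" where
  "noncrossing L ch \<longleftrightarrow> (\<forall>a<Suc L. \<forall>b<Suc L. ch a b \<longrightarrow> a \<le> b \<and>
     (\<forall>c<Suc L. \<forall>d<Suc L. ch c d \<longrightarrow> \<not> (a < c \<and> c < b \<and> b < d)))"

definition linked :: "nat \<Rightarrow> nat \<Rightarrow> (nat \<Rightarrow> nat) \<Rightarrow> (nat \<Rightarrow> nat \<Rightarrow> bool) \<Rightarrow> nat \<Rightarrow> nat \<Rightarrow> bool" where
  "linked n L S ch u v \<longleftrightarrow> (\<exists>a<Suc L. \<exists>b<Suc L. ch a b \<and>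
     (S a mod Suc n = Suc u \<and> S b mod Suc n = Suc v \<or> S a mod Suc n = Suc v \<and> S b mod Suc n = Suc u))"

text \<open>Connectedness is tested by cuts because subsets of the vertices have numerical codes.\<close>

definition uncut :: "nat \<Rightarrow> (nat \<Rightarrow> nat \<Rightarrow> bool) \<Rightarrow> (nat \<Rightarrow> bool) \<Rightarrow> (nat \<Rightarrow> bool) \<Rightarrow> bool" where
  "uncut n lk e z \<longleftrightarrow> (\<forall>x<n. \<forall>y<n. e x \<and> e y \<and> z x \<and> \<not> z y \<longrightarrow>
     (\<exists>u<n. \<exists>v<n. e u \<and> e v \<and> z u \<and> \<not> z v \<and> lk u v))"

text \<open>For the direction from cuts to connectedness, the relevant cut is the set of all
  vertices that are joined to \<open>x\<close>.\<close>

lemma joined_iff_uncut: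
  assumes e: "e \<subseteq> {..<n}" and F: "\<And>u v. u \<in> e \<Longrightarrow> v \<in> e \<Longrightarrow> u \<noteq> v \<Longrightarrow> (u, v) \<in> F \<longleftrightarrow> lk u v"
  shows "(\<forall>x\<in>e. \<forall>y\<in>e. (x, y) \<in> joined F e) \<longleftrightarrow> (\<forall>z. uncut n lk (\<lambda>x. x \<in> e) z)"
proof
  assume J: "\<forall>x\<in>e. \<forall>y\<in>e. (x, y) \<in> joined F e"
  show "\<forall>z. uncut n lk (\<lambda>x. x \<in> e) z"
    unfolding uncut_def
  proof (intro allI impI, elim conjE)
    fix z x y assume x: "x \<in> e" "z x" and y: "y \<in> e" "\<not> z y"
    show "\<exists>u<n. \<exists>v<n. u \<in> e \<and> v \<in> e \<and> z u \<and> \<not> z v \<and> lk u v"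
    proof (rule ccontr)
      assume no: "\<not> (\<exists>u<n. \<exists>v<n. u \<in> e \<and> v \<in> e \<and> z u \<and> \<not> z v \<and> lk u v)"
      have "(x, y) \<in> joined F e" using J x y by blast
      then have "z y"
      proof (induction rule: joined_induct)
        case (step u v)
        show "z v"
        proof (rule ccontr)
          assume "\<not> z v"
          then have "u \<noteq> v" using step by auto
          then have "lk u v" using F step by blast
          then show False using no step \<open>\<not> z v\<close> e by (meson lessThan_iff subsetD)
        qed
      qed (rule x(2))
      then show False using y by simp
    qed
  qed
next
  assume U: "\<forall>z. uncut n lk (\<lambda>x. x \<in> e) z"
  show "\<forall>x\<in>e. \<forall>y\<in>e. (x, y) \<in> joined F e"
  proof (intro ballI, rule ccontr)
    fix x y assume x: "x \<in> e" and y: "y \<in> e" and no: "(x, y) \<notin> joined F e"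
    have lt: "x < n" "y < n" using x y e by auto
    have "uncut n lk (\<lambda>x. x \<in> e) (\<lambda>v. (x, v) \<in> joined F e)" using U by blast
    then obtain u v where uv: "u \<in> e" "v \<in> e" "(x, u) \<in> joined F e" "(x, v) \<notin> joined F e" "lk u v"
      unfolding uncut_def using x y no lt joined_refl[of x F e] by blast
    have "u \<noteq> v" using uv by auto
    then have "(u, v) \<in> F" using F uv by blast
    then have "(x, v) \<in> joined F e" using joined_trans[OF uv(3) joined_step] uv by blast
    then show False using uv by simp
  qed
qed

text \<open>A push raises the stack by one and a pop lowers it by one; this fixes the length of the
  tours to be searched.\<close>

lemma steps_pushed: "ok r P t \<Longrightarrow> steps t + length (out P t) = length P + 2 * length (pushed t)"
proof (induction t arbitrary: P)
  case (Push v t) then show ?case using Push.IH[of "v # P"] by simp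
next
  case (Pop t) then show ?case using Pop.IH[of "tl P"] by (cases P) auto
next
  case (Arc t u) from Arc.IH(1)[of P] Arc.IH(2)[of "out P t"] Arc.prems show ?case by simp
qed simp

lemma link_code:
  assumes "set P \<subseteq> {..<n}" "set Q \<subseteq> {..<n}" "u < n" "v < n"
  shows "(u, v) \<in> link P Q \<longleftrightarrow> stack_code n P mod Suc n = Suc u \<and> stack_code n Q mod Suc n = Suc v \<or>
     stack_code n P mod Suc n = Suc v \<and> stack_code n Q mod Suc n = Suc u"
  using assms by (auto simp: stack_code_top link_def)

lemma realizes_imp_codes:
  assumes R: "realizes r m cl {..<n} t" and mem: "\<forall>j<m. members cl j \<subseteq> {..<n}"
  shows "\<exists>S ch. (\<forall>k<Suc (2 * n). S k < Suc n ^ r) \<and> walk n (2 * n) S \<and> noncrossing (2 * n) ch \<and>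
     (\<forall>j<m. \<forall>z. uncut n (linked n (2 * n) S ch) (\<lambda>x. x \<in> members cl j) z)"
proof -
  have t: "ok r [] t" "out [] t = []" "distinct (pushed t)" "set (pushed t) = {..<n}"
    and conn: "\<And>j x y. j < m \<Longrightarrow> x \<in> {..<n} \<inter> members cl j \<Longrightarrow> y \<in> {..<n} \<inter> members cl j \<Longrightarrow> (x, y) \<in> joined (links [] t) (members cl j)"
    using R unfolding realizes_def by blast+
  have "length (pushed t) = n" using distinct_card[OF t(3)] t(4) by simp
  then have L: "steps t = 2 * n" using steps_pushed[OF t(1)] t(2) by simp
  interpret tour "stack_at [] t" "2 * n" r "chords t" using term_tour(1)[OF t(1,3)] unfolding L .
  have V: "V = {..<n}" using term_tour(2)[OF t(1,3)] t(4) unfolding L by simp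
  let ?S = "stack_at [] t"
  define S where "S = (\<lambda>k. stack_code n (?S k))"
  define ch where "ch = (\<lambda>a b. (a, b) \<in> chords t)"
  have st: "set (?S k) \<subseteq> {..<n}" if "k \<le> 2 * n" for k using on_stack[OF that] V by blast
  have push: "S (Suc k) = S k * Suc n + Suc v \<longleftrightarrow> ?S (Suc k) = v # ?S k" if "k < 2 * n" "v < n" for k v
  proof
    assume "S (Suc k) = S k * Suc n + Suc v"
    then have "stack_code n (?S (Suc k)) = stack_code n (v # ?S k)" by (simp add: S_def)
    then show "?S (Suc k) = v # ?S k" by (rule stack_code_inj[rotated 2]) (use st that in auto)
  qed (simp add: S_def)
  have "walk n (2 * n) S" unfolding walk_def
  proof (intro conjI allI impI)
    show "S 0 = 0" by (simp add: S_def S0)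
    fix k assume k: "k < 2 * n"
    from step[OF k] consider v where "?S (Suc k) = v # ?S k" | "?S k \<noteq> []" "?S (Suc k) = tl (?S k)" by blast
    then show "(\<exists>v<n. S (Suc k) = S k * Suc n + Suc v) \<or> S k \<noteq> 0 \<and> S (Suc k) = S k div Suc n"
    proof cases
      case 1
      then have "v < n" using st[of "Suc k"] k by auto
      then show ?thesis using push[OF k, of v] 1 by blast
    next
      case 2
      then obtain x P where P: "?S k = x # P" by (cases "?S k") auto
      then have "x < n" using st[of k] k by auto
      then have "S k \<noteq> 0" "S (Suc k) = S k div Suc n"
        unfolding S_def 2(2) P list.sel by (simp, metis stack_code_Cons(2))
      then show ?thesis by blast
    qed
  next
    fix v assume v: "v < n"
    then obtain k where "k < 2 * n" "?S (Suc k) = v # ?S k" using V unfolding V_def by blast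
    then show "\<exists>k<2 * n. S (Suc k) = S k * Suc n + Suc v" using push[of k v] v by blast
  next
    fix v k l assume "v < n" "k < 2 * n" "l < 2 * n" "S (Suc k) = S k * Suc n + Suc v \<and> S (Suc l) = S l * Suc n + Suc v"
    then show "k = l" using push[of k v] push[of l v] once[of k l v] by blast
  qed
  moreover have "S k < Suc n ^ r" if "k < Suc (2 * n)" for k
  proof -
    have k: "k \<le> 2 * n" using that by simp
    have "S k < Suc n ^ length (?S k)" unfolding S_def by (rule stack_code_length[OF st[OF k]])
    also have "\<dots> \<le> Suc n ^ r" using len[OF k] by (intro power_increasing) auto
    finally show ?thesis .
  qed
  moreover have "noncrossing (2 * n) ch" unfolding noncrossing_def ch_def using C nocross by blast
  moreover have "uncut n (linked n (2 * n) S ch) (\<lambda>x. x \<in> members cl j) z" if j: "j < m" for j z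
  proof -
    have lk: "linked n (2 * n) S ch u v" if uv: "(u, v) \<in> links [] t" "u < n" "v < n" for u v
    proof -
      obtain a b where ab: "(a, b) \<in> chords t" "(u, v) \<in> link (?S a) (?S b)" using links_chords[OF uv(1)] by blast
      have le: "a \<le> 2 * n" "b \<le> 2 * n" using C[OF ab(1)] by auto
      show ?thesis unfolding linked_def ch_def S_def
        using ab link_code[OF st[OF le(1)] st[OF le(2)] uv(2,3)] le by (meson le_imp_less_Suc)
    qed
    have e: "members cl j \<subseteq> {..<n}" using mem j by blast
    have "(\<forall>x\<in>members cl j. \<forall>y\<in>members cl j. (x, y) \<in> joined {(u, v). linked n (2 * n) S ch u v} (members cl j)) \<longleftrightarrow>
      (\<forall>z. uncut n (linked n (2 * n) S ch) (\<lambda>x. x \<in> members cl j) z)"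
      by (rule joined_iff_uncut[OF e]) simp
    moreover have "(x, y) \<in> joined {(u, v). linked n (2 * n) S ch u v} (members cl j)"
      if "(x, y) \<in> joined (links [] t) (members cl j)" for x y
      using that
    proof (induction rule: joined_induct)
      case (step y z)
      then have "linked n (2 * n) S ch y z" using lk[of y z] e by auto
      then have "(y, z) \<in> joined {(u, v). linked n (2 * n) S ch u v} (members cl j)" using step by (intro joined_step) auto
      with step.IH show ?case by (rule joined_trans)
    qed simp
    ultimately show ?thesis using conn[OF j] e by blast
  qed
  ultimately show ?thesis by blast
qed

text \<open>The codes are decoded to a tour, which can be drawn directly; no term has to be
  recovered.\<close>

lemma codes_imp_support:
  assumes h: "hypergraph {..<n} (set es)" and bd: "\<And>k. k \<le> 2 * n \<Longrightarrow> S k < Suc n ^ r"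
    and walk: "walk n (2 * n) S" and ch: "noncrossing (2 * n) ch"
    and cut: "\<And>j z. j < length es \<Longrightarrow> uncut n (linked n (2 * n) S ch) (\<lambda>x. x \<in> es ! j) z"
  shows "\<exists>G. support G {..<n} (set es) \<and> outerplanar r G"
proof -
  note w = walk[unfolded walk_def]
  have w0: "S 0 = 0" by (rule conjunct1[OF w])
  have w1: "(\<exists>v<n. S (Suc k) = S k * Suc n + Suc v) \<or> S k \<noteq> 0 \<and> S (Suc k) = S k div Suc n" if "k < 2 * n" for k
    by (rule mp[OF spec[OF conjunct1[OF conjunct2[OF w]]] that])
  have w2: "\<exists>k<2 * n. S (Suc k) = S k * Suc n + Suc v" if "v < n" for v
    by (rule mp[OF spec[OF conjunct1[OF conjunct2[OF conjunct2[OF w]]]] that])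
  have w3: "k = l" if "v < n" "k < 2 * n" "l < 2 * n" "S (Suc k) = S k * Suc n + Suc v" "S (Suc l) = S l * Suc n + Suc v" for v k l
    using mp[OF spec[OF conjunct2[OF conjunct2[OF conjunct2[OF w]]]] that(1), THEN spec, THEN mp, OF that(2), THEN spec, THEN mp, OF that(3)] that(4,5)
    by iprover
  have ex: "\<exists>P. set P \<subseteq> {..<n} \<and> S k = stack_code n P" if "k \<le> 2 * n" for k
    using that
  proof (induction k)
    case 0 show ?case using w0 by (intro exI[of _ "[]"]) simp
  next
    case (Suc k)
    then obtain P where P: "set P \<subseteq> {..<n}" "S k = stack_code n P" by auto
    from w1[OF Suc_le_lessD[OF Suc.prems]] consider v where "v < n" "S (Suc k) = S k * Suc n + Suc v" | "S k \<noteq> 0" "S (Suc k) = S k div Suc n"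
      by (elim disjE exE conjE)
    then show ?case
    proof cases
      case 1
      then show ?thesis using P by (intro exI[of _ "v # P"]) simp
    next
      case 2
      then obtain x Q where Q: "P = x # Q" using P by (cases P) auto
      then have "S (Suc k) = stack_code n Q" using 2(2) P stack_code_Cons(2)[of x n Q] by auto
      then show ?thesis using P Q by (intro exI[of _ Q]) auto
    qed
  qed
  define T where "T = (\<lambda>k. SOME P. set P \<subseteq> {..<n} \<and> S k = stack_code n P)"
  have T: "set (T k) \<subseteq> {..<n}" "S k = stack_code n (T k)" if "k \<le> 2 * n" for k
    using someI_ex[OF ex[OF that]] unfolding T_def by blast+
  have push: "S (Suc k) = S k * Suc n + Suc v \<longleftrightarrow> T (Suc k) = v # T k" if "k < 2 * n" "v < n" for k v
  proof -
    have k: "k \<le> 2 * n" "Suc k \<le> 2 * n" using that by auto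
    have "S (Suc k) = S k * Suc n + Suc v \<longleftrightarrow> stack_code n (T (Suc k)) = stack_code n (v # T k)"
      using T(2)[OF k(1)] T(2)[OF k(2)] by simp
    also have "\<dots> \<longleftrightarrow> T (Suc k) = v # T k" using stack_code_inj[of "T (Suc k)" n "v # T k"] T(1)[OF k(1)] T(1)[OF k(2)] that by auto
    finally show ?thesis .
  qed
  define C where "C = {(a, b). a \<le> 2 * n \<and> b \<le> 2 * n \<and> ch a b}"
  have tr: "tour T (2 * n) r C"
  proof
    show "T 0 = []" using T(2)[of 0] w0 by (cases "T 0") auto
    fix k assume k: "k < 2 * n"
    then have k': "k \<le> 2 * n" "Suc k \<le> 2 * n" by auto
    from w1[OF k] consider v where "v < n" "S (Suc k) = S k * Suc n + Suc v" | "S k \<noteq> 0" "S (Suc k) = S k div Suc n"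
      by (elim disjE exE conjE)
    then show "(\<exists>v. T (Suc k) = v # T k) \<or> T k \<noteq> [] \<and> T (Suc k) = tl (T k)"
    proof cases
      case 1 then show ?thesis using push[OF k] by blast
    next
      case 2
      then obtain x Q where Q: "T k = x # Q" using T(2)[OF k'(1)] by (cases "T k") auto
      then have "x < n" using T(1)[OF k'(1)] by auto
      then have "stack_code n (T (Suc k)) = stack_code n Q" using 2(2) T(2)[OF k'(1)] T(2)[OF k'(2)] stack_code_Cons(2)[of x n Q] Q by simp
      then have "T (Suc k) = Q" using stack_code_inj[of "T (Suc k)" n Q] T(1)[OF k'(1)] T(1)[OF k'(2)] Q by auto
      then show ?thesis using Q by simp
    qed
  next
    fix k assume k: "k \<le> 2 * n"
    show "length (T k) \<le> r"
    proof (rule ccontr)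
      assume "\<not> length (T k) \<le> r"
      then have "T k \<noteq> []" "r \<le> length (T k) - 1" by auto
      then have "Suc n ^ r \<le> stack_code n (T k)" using stack_code_length_ge[of "T k" n] power_increasing[of r "length (T k) - 1" "Suc n"] by linarith
      then show False using bd[OF k] T(2)[OF k] by simp
    qed
  next
    fix k l v assume kl: "k < 2 * n" "l < 2 * n" and v: "T (Suc k) = v # T k" "T (Suc l) = v # T l"
    have "v < n" using T(1)[of "Suc k"] kl v by auto
    then show "k = l" by (rule w3[OF _ kl]) (use push[of k v] push[of l v] kl v \<open>v < n\<close> in blast)+
  next
    show "a \<le> b \<and> b \<le> 2 * n" if "(a, b) \<in> C" for a b using that ch unfolding C_def noncrossing_def by (auto simp: less_Suc_eq_le)
    show "\<not> (a < c \<and> c < b \<and> b < d)" if "(a, b) \<in> C" "(c, d) \<in> C" for a b c d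
    proof -
      have "a < Suc (2 * n)" "b < Suc (2 * n)" "c < Suc (2 * n)" "d < Suc (2 * n)" "ch a b" "ch c d" using that by (auto simp: C_def)
      then show ?thesis using ch unfolding noncrossing_def by blast
    qed
  qed
  interpret tour T "2 * n" r C by (rule tr)
  have V: "V = {..<n}"
  proof
    show "V \<subseteq> {..<n}"
    proof
      fix v assume "v \<in> V"
      then obtain k where "k < 2 * n" "T (Suc k) = v # T k" unfolding V_def by blast
      then show "v \<in> {..<n}" using T(1)[of "Suc k"] by auto
    qed
    show "{..<n} \<subseteq> V"
    proof
      fix v assume v: "v \<in> {..<n}"
      then obtain k where "k < 2 * n" "S (Suc k) = S k * Suc n + Suc v" using w2[of v] by (auto simp del: mult_Suc_right)
      then show "v \<in> V" unfolding V_def using push[of k v] v by blast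
    qed
  qed
  obtain G where G: "pair_graph G" "pverts G = {..<n}" "outerplanar r G"
     "\<forall>(a, b)\<in>C. \<forall>(u, w)\<in>link (T a) (T b). u \<noteq> w \<longrightarrow> (u, w) \<in> parcs G"
    using tour_graph[unfolded V] by (elim exE conjE)
  have lk: "(u, v) \<in> parcs G" if uv: "linked n (2 * n) S ch u v" "u < n" "v < n" "u \<noteq> v" for u v
  proof -
    obtain a b where ab: "a \<le> 2 * n" "b \<le> 2 * n" "ch a b"
      "S a mod Suc n = Suc u \<and> S b mod Suc n = Suc v \<or> S a mod Suc n = Suc v \<and> S b mod Suc n = Suc u"
      using uv(1) unfolding linked_def by (auto simp: less_Suc_eq_le)
    have l: "(u, v) \<in> link (T a) (T b)"
      by (rule iffD2[OF link_code[OF T(1)[OF ab(1)] T(1)[OF ab(2)] uv(2,3)]]) (rule ab(4)[unfolded T(2)[OF ab(1)] T(2)[OF ab(2)]])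
    have "(a, b) \<in> C" using ab by (simp add: C_def)
    from bspec[OF bspec[OF G(4) this, unfolded split_conv] l] uv(4) show ?thesis by simp
  qed
  have "Digraph_Component.connected (with_proj G \<restriction> e)" if e: "e \<in> set es" for e
  proof -
    have eV: "e \<subseteq> {..<n}" "e \<noteq> {}" using h e by (auto simp: hypergraph_def)
    obtain j where j: "j < length es" "es ! j = e" using e by (auto simp: in_set_conv_nth)
    have "(\<forall>x\<in>e. \<forall>y\<in>e. (x, y) \<in> joined {(u, v). linked n (2 * n) S ch u v} e) \<longleftrightarrow> (\<forall>z. uncut n (linked n (2 * n) S ch) (\<lambda>x. x \<in> e) z)"
      by (rule joined_iff_uncut[OF eV(1)]) simp
    moreover have "\<forall>z. uncut n (linked n (2 * n) S ch) (\<lambda>x. x \<in> e) z" using cut[OF j(1)] j(2) by blast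
    moreover have "(x, y) \<in> joined (parcs G) e" if "(x, y) \<in> joined {(u, v). linked n (2 * n) S ch u v} e" for x y
      using that
    proof (induction rule: joined_induct)
      case (step y z)
      show ?case
      proof (cases "y = z")
        case False
        then have "(y, z) \<in> parcs G" using lk[of y z] step eV(1) by auto
        then have "(y, z) \<in> joined (parcs G) e" using step by (intro joined_step) auto
        with step.IH show ?thesis by (rule joined_trans)
      qed (use step in simp)
    qed simp
    ultimately have "\<forall>x\<in>e. \<forall>y\<in>e. (x, y) \<in> joined (parcs G) e" by blast
    then show ?thesis unfolding connected_induced[OF G(1)] using eV(2) by blast
  qed
  then show ?thesis using G by (auto simp: support_def)
qed

section \<open>Search over numerical codes\<close>

definition dig :: "nat \<Rightarrow> nat \<Rightarrow> nat \<Rightarrow> nat" where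
  "dig b x i = x div b ^ i mod b"

lemma digits_exist:
  assumes "0 < b" "\<And>i. i < L \<Longrightarrow> f i < b"
  shows "\<exists>x<b ^ L. \<forall>i<L. dig b x i = f i"
  using assms(2)
proof (induction L arbitrary: f)
  case (Suc L)
  obtain x where x: "x < b ^ L" "\<forall>i<L. dig b x i = f (Suc i)" using Suc.IH[of "\<lambda>i. f (Suc i)"] Suc.prems by auto
  have f0: "f 0 < b" using Suc.prems by simp
  have "f 0 + b * x < b * (x + 1)" using f0 by simp
  also have "\<dots> \<le> b * b ^ L" using x(1) by (intro mult_le_mono2) simp
  finally have lt: "f 0 + b * x < b ^ Suc L" by simp
  have "dig b (f 0 + b * x) i = f i" if "i < Suc L" for i
  proof (cases i)
    case 0 then show ?thesis using f0 by (simp add: dig_def)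
  next
    case (Suc j)
    have "(f 0 + b * x) div (b * b ^ j) = x div b ^ j" unfolding div_mult2_eq using f0 assms(1) by simp
    then show ?thesis using x(2) that Suc by (simp add: dig_def)
  qed
  with lt show ?case by blast
qed simp

text \<open>Hyperedges have different sizes, so the place of the \<open>j\<close>-th one is found by
  skipping from size to size. The first size is in cell 4, behind the length of the word and the
  three numbers of the head.\<close>

definition start_cell :: "nat list \<Rightarrow> nat \<Rightarrow> nat" where
  "start_cell w j = rec_nat 4 (\<lambda>i a. Suc (a + cell_of w a)) j"

definition in_edge :: "nat list \<Rightarrow> nat \<Rightarrow> nat \<Rightarrow> bool" where
  "in_edge w j x \<longleftrightarrow> (\<exists>i<cell_of w (start_cell w j). cell_of w (Suc (start_cell w j + i)) = x)"

definition accepts :: "nat list \<Rightarrow> nat \<Rightarrow> nat \<Rightarrow> nat \<Rightarrow> nat \<Rightarrow> nat \<Rightarrow> bool" where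
  "accepts w n m r s c \<longleftrightarrow>
     walk n (2 * n) (dig (Suc n ^ r) s) \<and> noncrossing (2 * n) (\<lambda>a b. dig 2 c (a * Suc (2 * n) + b) = 1) \<and>
     (\<forall>j<m. \<forall>z<2 ^ n. uncut n (linked n (2 * n) (dig (Suc n ^ r) s) (\<lambda>a b. dig 2 c (a * Suc (2 * n) + b) = 1)) (in_edge w j) (\<lambda>x. dig 2 z x = 1))"

lemma of_bool_less_2: "(of_bool P :: nat) < 2"
  by simp

lemma accepts_iff:
  assumes h: "hypergraph {..<n} (set es)" and w: "\<And>j x. j < length es \<Longrightarrow> in_edge w j x \<longleftrightarrow> x \<in> es ! j"
  shows "(\<exists>G. support G {..<n} (set es) \<and> outerplanar r G) \<longleftrightarrow>
    (\<exists>s<(Suc n ^ r) ^ Suc (2 * n). \<exists>c<2 ^ (Suc (2 * n) * Suc (2 * n)). accepts w n (length es) r s c)"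
proof
  assume "\<exists>G. support G {..<n} (set es) \<and> outerplanar r G"
  then obtain t where t: "realizes r (length es) (class_of es) {..<n} t" using support_iff_realizes[OF h] by blast
  have mem: "\<forall>j<length es. members (class_of es) j \<subseteq> {..<n}"
    using h by (auto simp: members_class_of hypergraph_def)
  obtain S ch where S: "\<forall>k<Suc (2 * n). S k < Suc n ^ r" "walk n (2 * n) S" "noncrossing (2 * n) ch"
     "\<forall>j<length es. \<forall>z. uncut n (linked n (2 * n) S ch) (\<lambda>x. x \<in> members (class_of es) j) z"
    using realizes_imp_codes[OF t mem] by (elim exE conjE)
  let ?L = "2 * n"
  obtain s where s: "s < (Suc n ^ r) ^ Suc ?L" "\<forall>k<Suc ?L. dig (Suc n ^ r) s k = S k"
    using digits_exist[of "Suc n ^ r" "Suc ?L" S] S(1) by auto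
  obtain c where c: "c < 2 ^ (Suc ?L * Suc ?L)" "\<forall>i<Suc ?L * Suc ?L. dig 2 c i = of_bool (ch (i div Suc ?L) (i mod Suc ?L))"
    \<comment> \<open>The chord from \<open>a\<close> to \<open>b\<close> is the binary digit number
      \<open>a * Suc ?L + b\<close>, so the pair is recovered by division with remainder.\<close>
    using digits_exist[of 2 "Suc ?L * Suc ?L" "\<lambda>i. of_bool (ch (i div Suc ?L) (i mod Suc ?L))", OF _ of_bool_less_2] by auto
  define ch' where "ch' = (\<lambda>a b. dig 2 c (a * Suc ?L + b) = 1)"
  have ch': "ch' a b \<longleftrightarrow> ch a b" if "a < Suc ?L" "b < Suc ?L" for a b
  proof -
    have "a * Suc ?L + b < Suc a * Suc ?L" using that by simp
    also have "\<dots> \<le> Suc ?L * Suc ?L" using that by (intro mult_le_mono1) simp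
    finally have "dig 2 c (a * Suc ?L + b) = of_bool (ch ((a * Suc ?L + b) div Suc ?L) ((a * Suc ?L + b) mod Suc ?L))" using c(2) by blast
    moreover have "(a * Suc ?L + b) div Suc ?L = a" by (subst div_mult_self3) (use that(2) in simp_all)
    moreover have "(a * Suc ?L + b) mod Suc ?L = b" unfolding mod_mult_self3 using that(2) by simp
    ultimately show ?thesis by (simp add: ch'_def)
  qed
  have dS: "dig (Suc n ^ r) s k = S k" if "k < Suc ?L" for k using s(2) that by blast
  have "walk n ?L (dig (Suc n ^ r) s)" using S(2) unfolding walk_def by (simp add: dS cong: conj_cong)
  moreover have "noncrossing ?L ch'" using S(3) ch' unfolding noncrossing_def by blast
  moreover have lk: "linked n ?L (dig (Suc n ^ r) s) ch' = linked n ?L S ch"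
    unfolding linked_def fun_eq_iff using dS ch' by (metis (no_types, lifting))
  moreover have "uncut n (linked n ?L S ch) (in_edge w j) (\<lambda>x. dig 2 z x = 1)" if j: "j < length es" for j z
  proof -
    have "in_edge w j = (\<lambda>x. x \<in> members (class_of es) j)" using w[OF j] by (simp add: fun_eq_iff members_class_of[OF j])
    then show ?thesis using S(4) j by simp
  qed
  ultimately have "accepts w n (length es) r s c" unfolding accepts_def ch'_def[symmetric] by simp
  then show "\<exists>s<(Suc n ^ r) ^ Suc ?L. \<exists>c<2 ^ (Suc ?L * Suc ?L). accepts w n (length es) r s c" using s(1) c(1) by blast
next
  assume "\<exists>s<(Suc n ^ r) ^ Suc (2 * n). \<exists>c<2 ^ (Suc (2 * n) * Suc (2 * n)). accepts w n (length es) r s c"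
  then obtain s c where a: "accepts w n (length es) r s c" by blast
  define ch where "ch = (\<lambda>a b. dig 2 c (a * Suc (2 * n) + b) = 1)"
  note a = a[unfolded accepts_def ch_def[symmetric]]
  show "\<exists>G. support G {..<n} (set es) \<and> outerplanar r G"
  proof (rule codes_imp_support[OF h])
    show "dig (Suc n ^ r) s k < Suc n ^ r" for k by (simp add: dig_def)
    show "walk n (2 * n) (dig (Suc n ^ r) s)" "noncrossing (2 * n) ch" using a by blast+
    fix j z assume j: "j < length es"
    \<comment> \<open>Whether a cut is crossed depends only on its values below \<open>n\<close>,
      and these have a code.\<close>
    obtain x where x: "x < 2 ^ n" "\<forall>i<n. dig 2 x i = of_bool (z i)" using digits_exist[of 2 n "\<lambda>i. of_bool (z i)", OF _ of_bool_less_2] by auto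
    have "uncut n (linked n (2 * n) (dig (Suc n ^ r) s) ch) (in_edge w j) (\<lambda>i. dig 2 x i = 1)" using a j x(1) by blast
    moreover have "in_edge w j = (\<lambda>x. x \<in> es ! j)" using w[OF j] by (simp add: fun_eq_iff)
    ultimately have u: "uncut n (linked n (2 * n) (dig (Suc n ^ r) s) ch) (\<lambda>x. x \<in> es ! j) (\<lambda>i. dig 2 x i = 1)" by simp
    have "(dig 2 x i = 1) = z i" if "i < n" for i using x(2) that by simp
    with u show "uncut n (linked n (2 * n) (dig (Suc n ^ r) s) ch) (\<lambda>x. x \<in> es ! j) z"
      unfolding uncut_def by (simp cong: conj_cong)
  qed
qed

lemma expr_dig [exprs]: "expr a \<Longrightarrow> expr b \<Longrightarrow> expr c \<Longrightarrow> expr (\<lambda>w E. dig (a w E) (b w E) (c w E))"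
  unfolding dig_def by (intro exprs)

lemma expr_start_cell: "expr (\<lambda>w E. start_cell w (E 0))"
  unfolding start_cell_def by (rule expr_rec) (intro exprs)+

lemmas expr_start_cell' [exprs] = expr_app1[of start_cell, OF expr_start_cell]

lemma dec_in_edge: "expr (\<lambda>w E. of_bool (in_edge w (E 0) (E 1)))"
  unfolding in_edge_def by (intro exprs)

lemmas dec_in_edge' [exprs] = expr_app2[of "\<lambda>w j x. of_bool (in_edge w j x)", OF dec_in_edge]

definition decision :: "nat list \<Rightarrow> nat" where
  "decision w = of_bool (\<exists>s<(Suc (cell_of w 1) ^ cell_of w 3) ^ Suc (2 * cell_of w 1).
     \<exists>c<2 ^ (Suc (2 * cell_of w 1) * Suc (2 * cell_of w 1)). accepts w (cell_of w 1) (cell_of w 2) (cell_of w 3) s c)"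

lemma expr_decision: "expr (\<lambda>w E. decision w)"
  unfolding decision_def accepts_def walk_def noncrossing_def uncut_def linked_def
  by (intro exprs)

lemma cell_of_append: "cell_of (xs @ x # ys) (Suc (length xs)) = x"
  by (simp add: cell_of_def)

lemma cell_of_append_block: "i < length ys \<Longrightarrow> cell_of (xs @ x # ys @ zs) (Suc (Suc (length xs) + i)) = ys ! i"
  by (simp add: cell_of_def nth_append)

lemma start_cell_word:
  assumes "w = [n, m, r] @ cells_of es" "j \<le> length es"
  shows "start_cell w j = 4 + length (cells_of (take j es))"
  using assms(2)
proof (induction j)
  case 0 show ?case by (simp add: start_cell_def)
next
  case (Suc j)
  have j: "j < length es" using Suc by simp
  have "cells_of es = cells_of (take j es) @ length (es ! j) # es ! j @ cells_of (drop (Suc j) es)"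
    using id_take_nth_drop[OF j] by (metis (no_types, lifting) append.assoc append_Cons cells_of_def concat_append list.simps(9) map_append cells_of_simps(2))
  then have w: "w = ([n, m, r] @ cells_of (take j es)) @ length (es ! j) # es ! j @ cells_of (drop (Suc j) es)" using assms(1) by simp
  have "4 + length (cells_of (take j es)) = Suc (length ([n, m, r] @ cells_of (take j es)))" by simp
  then have "cell_of w (4 + length (cells_of (take j es))) = length (es ! j)" unfolding w by (simp only: cell_of_append)
  moreover have "length (cells_of (take (Suc j) es)) = length (cells_of (take j es)) + Suc (length (es ! j))"
    using j by (simp add: take_Suc_conv_app_nth cells_of_def)
  moreover have "start_cell w (Suc j) = Suc (start_cell w j + cell_of w (start_cell w j))" by (simp add: start_cell_def)
  ultimately show ?case using Suc by simp
qed

lemma in_edge_word: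
  assumes w: "w = [n, m, r] @ cells_of es" and j: "j < length es"
  shows "in_edge w j x \<longleftrightarrow> x \<in> set (es ! j)"
proof -
  let ?p = "[n, m, r] @ cells_of (take j es)"
  have st: "start_cell w j = Suc (length ?p)" using start_cell_word[OF w, of j] j by simp
  have "cells_of es = cells_of (take j es) @ length (es ! j) # es ! j @ cells_of (drop (Suc j) es)"
    using id_take_nth_drop[OF j] by (metis (no_types, lifting) append.assoc append_Cons cells_of_def concat_append list.simps(9) map_append cells_of_simps(2))
  then have w': "w = ?p @ length (es ! j) # es ! j @ cells_of (drop (Suc j) es)" using w by simp
  then have len: "cell_of w (start_cell w j) = length (es ! j)" unfolding st using cell_of_append by metis
  have el: "cell_of w (Suc (start_cell w j + i)) = es ! j ! i" if "i < length (es ! j)" for i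
    unfolding st using cell_of_append_block[OF that, of ?p "length (es ! j)" "cells_of (drop (Suc j) es)"] unfolding w'[symmetric] .
  show ?thesis unfolding in_edge_def len using el by (auto simp: in_set_conv_nth)
qed

lemma planar_support_fpt: "fixed_parameter_tractable Planar_Support"
proof (rule kernel_imp_fixed_parameter_tractable[OF planar_support_kernel expr_decision, where b = 4])
  fix I w assume I: "I \<in> instances Planar_Support" "encodes Planar_Support w I"
  obtain V E r where I_eq: "I = (V, E, r)" by (cases I)
  obtain n es where h: "hypergraph V E" "V = {..<n}"
    and es: "distinct (map set es)" "\<And>e. e \<in> set es \<Longrightarrow> distinct e" "set ` set es = E" and w: "w = [card V, length es, r] @ cells_of es"
    using I unfolding I_eq Planar_Support_def by (auto simp: encodes_hypergraph_def cells_of_def)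
  have w': "w = [n, length es, r] @ cells_of es" using w h(2) by simp
  have c: "cell_of w 1 = n" "cell_of w 2 = length es" "cell_of w 3 = r" by (simp_all add: w' cell_of_def numeral_eq_Suc)
  have "in_edge w j x \<longleftrightarrow> x \<in> map set es ! j" if "j < length (map set es)" for j x
    using in_edge_word[OF w', of j x] that by simp
  moreover have "hypergraph {..<n} (set (map set es))" using h es(3) by simp
  ultimately have ac: "(\<exists>G. support G {..<n} (set (map set es)) \<and> outerplanar r G) \<longleftrightarrow>
    (\<exists>s<(Suc n ^ r) ^ Suc (2 * n). \<exists>c<2 ^ (Suc (2 * n) * Suc (2 * n)). accepts w n (length (map set es)) r s c)"
    by (rule accepts_iff[rotated])
  have y: "yes Planar_Support I \<longleftrightarrow> (\<exists>G. support G {..<n} (set (map set es)) \<and> outerplanar r G)"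
    by (simp add: I_eq Planar_Support_def h(2) es(3))
  show "decision w = of_bool (yes Planar_Support I)"
    unfolding decision_def c y ac length_map by (rule refl)
  interpret instance_word V E r n es by unfold_locales (use h es in auto)
  \<comment> \<open>Cell 0 holds the length of the word, at most 3 plus twice the total size of the
    hyperedges. Every other cell is 0 or holds a vertex, the size of a hyperedge or one of the
    numbers of the head.\<close>
  show "cell_of w x \<le> 4 * (inst_size Planar_Support I + param Planar_Support I)" for x
  proof -
    have s: "inst_size Planar_Support I = n + (\<Sum>e\<in>E. card e) + 1" "param Planar_Support I = length es + r"
      by (simp_all add: I_eq Planar_Support_def h(2) card_E m_def)
    have "length w = 3 + length (cells_of es)" by (simp add: w')
    then have "length w \<le> 3 + 2 * (\<Sum>e\<in>E. card e)" using length_cells by simp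
    moreover have "y \<le> n + length es + r" if "y \<in> set w" for y
    proof -
      have "y \<le> n" if y: "y \<in> set (cells_of es)"
      proof -
        obtain e where e: "e \<in> set es" "y = length e \<or> y \<in> set e" using y by (auto simp: cells_of_def)
        have eV: "set e \<subseteq> {..<n}" using e(1) h es(3) by (auto simp: hypergraph_def)
        then have "length e \<le> n" using card_mono[OF _ eV] distinct_card[OF es(2)[OF e(1)]] by simp
        then show ?thesis using e(2) eV by auto
      qed
      then show ?thesis using that by (auto simp: w')
    qed
    then have "w ! (x - 1) \<le> n + length es + r" if "x \<noteq> 0" "x \<le> length w" using that nth_mem[of "x - 1" w] by auto
    ultimately show ?thesis unfolding s cell_of_def by (cases "x = 0"; cases "x \<le> length w") auto
  qed
next
  show "1 \<le> inst_size Planar_Support I" for I by (cases I) (simp add: Planar_Support_def)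
qed

theorem theorem2:
  shows "(\<exists>a. kernel_within Planar_Support (\<lambda>s. a * s)
            (\<lambda>(V, E, r) (V', E', r').
              let m = card E in
              card V' \<le> 2 ^ m * 2 ^ (2 ^ (2 * r * (m * (r\<^sup>2 + r + 1))) * 6 ^ (2 * r\<^sup>2))))
         \<and> fixed_parameter_tractable Planar_Support"
  using planar_support_kernel planar_support_fpt by blast

end
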